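(* For every strict partition $\lambda=(\lambda_1>\dots>\lambda_r>0)$, define \[ \ket{\lambda}_p=(\Phi^{[\beta]}_{\lambda_1}-\tfrac12(-\tfrac{\beta}{2})^{\lambda_1})e^{-\theta}(\Phi^{[\beta]}_{\lambda_2}-\tfrac12(-\tfrac{\beta}{2})^{\lambda_2})e^{-\theta}\cdots(\Phi^{[\beta]}_{\lambda_r}-\tfrac12(-\tfrac{\beta}{2})^{\lambda_r})(\phi_0+1)\ket{0}. \] Then $gp_\lambda(x)=\bra{0}e^{\mathcal{H}^{[\beta]}(x)}\ket{\lambda}_p$.
   Context: Let $\beta$ be an indeterminate and $x=(x_1,\dots)$, $y=(y_1,\dots)$ variables. Let $\mathcal{A}$ be the associative $\mathbb{Q}(\beta)$-algebra generated by $\phi_n$ ($n\in\mathbb{Z}$) with $\phi_m\phi_n+\phi_n\phi_m=2(-1)^m\delta_{m+n,0}$ (infinite linear combinations allowed in a suitable completion); constants act as scalars. Vacuum vectors: $\phi_{-n}\ket{0}=0$, $\bra{0}\phi_n=0$ for $n>0$; vacuum expectation value with $\langle0|0\rangle=1$, $\bra{0}\phi_0\ket{0}=0$, $(\bra{u}\phi_n)\ket{v}=\bra{u}(\phi_n\ket{v})$. Anti-involution $\phi_n^\ast=(-1)^n\phi_{-n}$, $(XY)^\ast=Y^\ast X^\ast$. $\sum_{n\ge1}\phi^{[\beta]}_nz^n=\sum_{n\ge1}\phi_n\big(\tfrac{z}{1+\frac{\beta}{2}z}\big)^n$, $\sum_{n\ge0}\phi^{[\beta]}_{-n}z^{-n}=\sum_{n\ge0}\phi_{-n}(z^{-1}+\tfrac{\beta}{2})^n$,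 and $\Phi^{[\beta]}_n=\sum_{k\ge0}\tfrac12(-\tfrac{\beta}{2})^k\phi^{[\beta]}_{n-k}$ (i.e. $\sum_n\Phi^{[\beta]}_nz^n=\frac{1}{2+\beta z}\sum_n\phi^{[\beta]}_nz^n$). For odd $m$, $b_m=\frac14\sum_{i\in\mathbb{Z}}(-1)^i\phi_{-i-m}\phi_i$; for $m\ne0$, $b^{(\beta)}_m$ is obtained from $\frac{(X-\frac{\beta}{2})^m-(-X-\frac{\beta}{2})^m}{2}$ (polynomial in $X$ if $m>0$, series in $X^{-1}$ if $m<0$) by $X^k\mapsto b_k$; $b^{[\beta]}_m=(b^{(\beta)}_{-m})^\ast$; $\mathcal{H}^{[\beta]}(x)=2\sum_{n=1,3,5,\dots}\frac{p_n(x)}{n}b^{[\beta]}_n$ with $p_n(x)=\sum_ix_i^n$; $\theta=2\sum_{n=1,3,5,\dots}(\tfrac{\beta}{2})^n\frac{b_n}{n}$. With $a\oplus b=a+b+\beta ab$, $a\ominus b=\frac{a-b}{1+\beta b}$, $\overline{t}=\frac{-t}{1+\beta t}$: for strict $\lambda$ of length $r$, $GP_\lambda(x)=[u_1^{-\lambda_1}\cdots u_r^{-\lambda_r}]\prod_{i}\frac{1}{(2+\beta u_i)(1+\beta u_i)}\prod_{i,j}\frac{u_i\oplus x_j}{u_i\ominus x_j}\prod_{i<j}\frac{u_j\ominus u_i}{u_j\oplus u_i}$ and $GQ_\lambda(x)$ is the same with $\prod_i\frac{1}{(2+\beta u_i)(1+\beta u_i)}$ replaced by $\prod_i\frac{1}{1+\beta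 u_i}$ (expansions in $\mathbb{Q}(\beta)((u_r))\cdots((u_1))[[x_1,x_2,\dots]]$). The dual functions $gp_\lambda,gq_\lambda$ are the unique symmetric functions with $\sum_{\lambda\text{ strict}}GQ_\lambda(x)gp_\lambda(y)=\sum_{\lambda\text{ strict}}GP_\lambda(x)gq_\lambda(y)=\prod_{i,j}\frac{1-\overline{x_i}y_j}{1-x_iy_j}$.
   Formalization: The Hamiltonian H^[β](x) = 2 Σ (p_n(x)/n) b^[β]_n is summed over all n ≥ 1 instead of only odd n; with odd n only the identity fails, e.g. for λ=(3), where the one-variable result differs from gp_(3) by (β/2)y². *)

theory Defs
  imports
    "HOL-Library.Poly_Mapping"
    "HOL-Library.FuncSet"
    "HOL-Library.FSet"
    "HOL-Computational_Algebra.Computational_Algebra"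
begin

section \<open>Convolution of functions on a commutative monoid\<close>

definition conv :: "('m::cancel_comm_monoid_add \<Rightarrow> 'a::comm_ring_1) \<Rightarrow> ('m \<Rightarrow> 'a) \<Rightarrow> 'm \<Rightarrow> 'a" where
  "conv f g m = (\<Sum>(a, b) | a + b = m \<and> f a \<noteq> 0 \<and> g b \<noteq> 0. f a * g b)"

lemma conv_superset:
  assumes "finite P" "P \<subseteq> {(a, b). a + b = m}" "{(a, b). a + b = m \<and> f a \<noteq> 0 \<and> g b \<noteq> 0} \<subseteq> P"
  shows "conv f g m = (\<Sum>(a, b)\<in>P. f a * g b)"
  unfolding conv_def
proof (rule sum.mono_neutral_left)
  show "\<forall>i\<in>P - {(a, b). a + b = m \<and> f a \<noteq> 0 \<and> g b \<noteq> 0}. (case i of (a, b) \<Rightarrow> f a * g b) = 0"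
    using assms(2) by auto
qed (use assms in auto)

lemma conv_nonzeroD:
  assumes "conv f g m \<noteq> 0"
  obtains a b where "a + b = m" "f a \<noteq> 0" "g b \<noteq> 0"
proof -
  have "{(a, b). a + b = m \<and> f a \<noteq> 0 \<and> g b \<noteq> 0} \<noteq> {}"
    using assms unfolding conv_def by (metis (no_types, lifting) sum.empty)
  then show thesis using that by auto
qed

lemma conv_commute: "conv f g = conv g f"
proof
  fix m
  show "conv f g m = conv g f m"
    unfolding conv_def
    by (rule sum.reindex_bij_witness[of _ "\<lambda>(a, b). (b, a)" "\<lambda>(a, b). (b, a)"])
      (auto simp: add.commute mult.commute)
qed

lemma conv_add_left:
  assumes "\<And>m. finite {(a, b). a + b = m \<and> f a \<noteq> 0 \<and> h b \<noteq> 0}"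
    and "\<And>m. finite {(a, b). a + b = m \<and> g a \<noteq> 0 \<and> h b \<noteq> 0}"
  shows "conv (\<lambda>a. f a + g a) h = (\<lambda>m. conv f h m + conv g h m)"
proof
  fix m
  let ?P = "{(a, b). a + b = m \<and> f a \<noteq> 0 \<and> h b \<noteq> 0} \<union> {(a, b). a + b = m \<and> g a \<noteq> 0 \<and> h b \<noteq> 0}"
  have fin: "finite ?P" using assms by simp
  have "conv (\<lambda>a. f a + g a) h m = (\<Sum>(a, b)\<in>?P. (f a + g a) * h b)"
    by (rule conv_superset[OF fin]) auto
  moreover have "conv f h m = (\<Sum>(a, b)\<in>?P. f a * h b)"
    by (rule conv_superset[OF fin]) auto
  moreover have "conv g h m = (\<Sum>(a, b)\<in>?P. g a * h b)"
    by (rule conv_superset[OF fin]) auto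
  ultimately show "conv (\<lambda>a. f a + g a) h m = conv f h m + conv g h m"
    by (simp add: sum.distrib[symmetric] algebra_simps split_def)
qed

lemma conv_one_left: "conv (\<lambda>a. if a = 0 then 1 else 0) f = f"
proof
  fix m
  show "conv (\<lambda>a. if a = 0 then 1 else 0) f m = f m"
    by (subst conv_superset[where P = "{(0, m)}"]) (auto split: if_splits)
qed

lemma conv_conv:
  assumes fin: "finite {(a, b, c). a + b + c = m \<and> f a \<noteq> 0 \<and> g b \<noteq> 0 \<and> h c \<noteq> 0}" (is "finite ?T")
  shows "conv (conv f g) h m = (\<Sum>(a, b, c) | a + b + c = m \<and> f a \<noteq> 0 \<and> g b \<noteq> 0 \<and> h c \<noteq> 0. f a * g b * h c)"
proof -
  let ?D = "(\<lambda>(a, b, c). (a + b, c)) ` ?T"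
  let ?S = "\<lambda>s. {(a, b). a + b = s \<and> f a \<noteq> 0 \<and> g b \<noteq> 0}"
  have finD: "finite ?D" using fin by simp
  have finS: "finite (?S s)" if "(s, c) \<in> ?D" for s c
  proof -
    have "h c \<noteq> 0" "s + c = m" using that by auto
    then have "(\<lambda>(a, b). (a, b, c)) ` ?S s \<subseteq> ?T" by auto
    moreover have "inj_on (\<lambda>(a, b). (a, b, c)) (?S s)" by (auto simp: inj_on_def)
    ultimately show ?thesis using fin by (meson finite_imageD finite_subset)
  qed
  have "conv (conv f g) h m = (\<Sum>(s, c)\<in>?D. conv f g s * h c)"
  proof (rule conv_superset[OF finD])
    show "{(a, b). a + b = m \<and> conv f g a \<noteq> 0 \<and> h b \<noteq> 0} \<subseteq> ?D"
    proof clarify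
      fix s c assume "conv f g s \<noteq> 0" "h c \<noteq> 0" "m = s + c"
      then obtain a b where "a + b = s" "f a \<noteq> 0" "g b \<noteq> 0" by (auto elim: conv_nonzeroD)
      then show "(s, c) \<in> (\<lambda>(a, b, c). (a + b, c)) ` {(a, b, ca). a + b + ca = s + c \<and> f a \<noteq> 0 \<and> g b \<noteq> 0 \<and> h ca \<noteq> 0}"
        using \<open>h c \<noteq> 0\<close> by (intro image_eqI[of _ _ "(a, b, c)"]) auto
    qed
  qed auto
  also have "\<dots> = (\<Sum>sc\<in>?D. \<Sum>ab\<in>?S (fst sc). f (fst ab) * g (snd ab) * h (snd sc))"
    unfolding conv_def by (rule sum.cong) (auto simp: sum_distrib_right split_def)
  also have "\<dots> = (\<Sum>(sc, ab)\<in>Sigma ?D (\<lambda>sc. ?S (fst sc)). f (fst ab) * g (snd ab) * h (snd sc))"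
  proof (rule sum.Sigma[OF finD], rule ballI)
    fix sc assume "sc \<in> ?D"
    then have "(fst sc, snd sc) \<in> ?D" by simp
    then show "finite (?S (fst sc))" by (rule finS)
  qed
  also have "\<dots> = (\<Sum>(a, b, c)\<in>?T. f a * g b * h c)"
    by (rule sum.reindex_bij_witness[of _ "\<lambda>(a, b, c). ((a + b, c), (a, b))" "\<lambda>((s, c), (a, b)). (a, b, c)"])
      (auto simp: image_iff, blast)
  finally show ?thesis .
qed

lemma conv_assoc:
  assumes fin: "\<And>m. finite {(a, b, c). a + b + c = m \<and> f a \<noteq> 0 \<and> g b \<noteq> 0 \<and> h c \<noteq> 0}"
  shows "conv (conv f g) h = conv f (conv g h)"
proof
  fix m
  let ?T = "{(a, b, c). a + b + c = m \<and> f a \<noteq> 0 \<and> g b \<noteq> 0 \<and> h c \<noteq> 0}"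
  let ?T' = "{(b, c, a). b + c + a = m \<and> g b \<noteq> 0 \<and> h c \<noteq> 0 \<and> f a \<noteq> 0}"
  have img: "?T' = (\<lambda>(a, b, c). (b, c, a)) ` ?T"
    by (auto simp: image_iff add_ac) 
  then have fin': "finite ?T'" using fin by simp
  have "conv f (conv g h) m = conv (conv g h) f m" by (simp add: conv_commute)
  also have "\<dots> = (\<Sum>(b, c, a)\<in>?T'. g b * h c * f a)" by (rule conv_conv[OF fin'])
  also have "\<dots> = (\<Sum>(a, b, c)\<in>?T. f a * g b * h c)"
    by (rule sum.reindex_bij_witness[of _ "\<lambda>(a, b, c). (b, c, a)" "\<lambda>(b, c, a). (a, b, c)"])
      (auto simp: algebra_simps)
  also have "\<dots> = conv (conv f g) h m" by (rule conv_conv[OF fin, symmetric])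
  finally show "conv (conv f g) h m = conv f (conv g h) m" by simp
qed

section \<open>Formal power series in arbitrarily many variables\<close>

typedef ('v, 'a) mps = "UNIV :: (('v \<Rightarrow>\<^sub>0 nat) \<Rightarrow> 'a) set"
  morphisms mps_coeff Abs_mps ..

setup_lifting type_definition_mps

lemma finite_monomial_divisors: "finite {a :: 'v \<Rightarrow>\<^sub>0 nat. \<exists>b. a + b = m}"
proof -
  let ?A = "{a :: 'v \<Rightarrow>\<^sub>0 nat. \<exists>b. a + b = m}"
  let ?M = "Max (insert 0 (Poly_Mapping.lookup m ` Poly_Mapping.keys m))"
  let ?F = "{f. \<forall>x. (x \<in> Poly_Mapping.keys m \<longrightarrow> f x \<in> {..?M}) \<and> (x \<notin> Poly_Mapping.keys m \<longrightarrow> f x = (0::nat))}"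
  have "finite ?F" by (rule finite_set_of_finite_funs) auto
  moreover have "Poly_Mapping.lookup ` ?A \<subseteq> ?F"
  proof clarify
    fix a b :: "'v \<Rightarrow>\<^sub>0 nat" and x
    assume m: "m = a + b"
    show "(x \<in> Poly_Mapping.keys (a + b) \<longrightarrow> Poly_Mapping.lookup a x \<in> {..Max (insert 0 (Poly_Mapping.lookup (a + b) ` Poly_Mapping.keys (a + b)))}) \<and>
          (x \<notin> Poly_Mapping.keys (a + b) \<longrightarrow> Poly_Mapping.lookup a x = 0)"
    proof (intro conjI impI)
      assume "x \<in> Poly_Mapping.keys (a + b)"
      then have "Poly_Mapping.lookup (a + b) x \<le> Max (insert 0 (Poly_Mapping.lookup (a + b) ` Poly_Mapping.keys (a + b)))"
        by (intro Max_ge) auto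
      then show "Poly_Mapping.lookup a x \<in> {..Max (insert 0 (Poly_Mapping.lookup (a + b) ` Poly_Mapping.keys (a + b)))}"
        by (simp add: lookup_add)
    next
      assume "x \<notin> Poly_Mapping.keys (a + b)"
      then show "Poly_Mapping.lookup a x = 0"
        by (simp add: in_keys_iff lookup_add)
    qed
  qed
  ultimately have "finite (Poly_Mapping.lookup ` ?A)" by (rule finite_subset[rotated])
  then show ?thesis by (rule finite_imageD) (auto simp: inj_on_def intro: poly_mapping_eqI)
qed

lemma finite_monomial_pairs: "finite {(a, b :: 'v \<Rightarrow>\<^sub>0 nat). a + b = m \<and> P a b}"
proof (rule finite_subset)
  let ?A = "{a :: 'v \<Rightarrow>\<^sub>0 nat. \<exists>b. a + b = m}"
  show "{(a, b). a + b = m \<and> P a b} \<subseteq> ?A \<times> ?A" by auto (metis add.commute)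
  show "finite (?A \<times> ?A)" by (simp add: finite_monomial_divisors)
qed

lemma finite_monomial_triples: "finite {(a, b, c :: 'v \<Rightarrow>\<^sub>0 nat). a + b + c = m \<and> P a b c}"
proof (rule finite_subset)
  let ?A = "{a :: 'v \<Rightarrow>\<^sub>0 nat. \<exists>b. a + b = m}"
  show "{(a, b, c). a + b + c = m \<and> P a b c} \<subseteq> ?A \<times> ?A \<times> ?A"
    by (auto simp: add_ac) (metis add.commute add.left_commute)+
  show "finite (?A \<times> ?A \<times> ?A)" by (simp add: finite_monomial_divisors)
qed

instantiation mps :: (type, comm_ring_1) comm_ring_1
begin

lift_definition zero_mps :: "('a, 'b) mps" is "\<lambda>_. 0" .
lift_definition one_mps :: "('a, 'b) mps" is "\<lambda>m. if m = 0 then 1 else 0" .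
lift_definition plus_mps :: "('a, 'b) mps \<Rightarrow> ('a, 'b) mps \<Rightarrow> ('a, 'b) mps" is "\<lambda>f g m. f m + g m" .
lift_definition minus_mps :: "('a, 'b) mps \<Rightarrow> ('a, 'b) mps \<Rightarrow> ('a, 'b) mps" is "\<lambda>f g m. f m - g m" .
lift_definition uminus_mps :: "('a, 'b) mps \<Rightarrow> ('a, 'b) mps" is "\<lambda>f m. - f m" .
lift_definition times_mps :: "('a, 'b) mps \<Rightarrow> ('a, 'b) mps \<Rightarrow> ('a, 'b) mps" is conv .

instance
proof
  fix a b c :: "('a, 'b) mps"
  show "a * b * c = a * (b * c)"
    by transfer (rule conv_assoc, rule finite_monomial_triples)
  show "a * b = b * a" by transfer (rule conv_commute)
  show "1 * a = a" by transfer (rule conv_one_left)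
  show "(a + b) * c = a * c + b * c"
    by transfer (rule conv_add_left; rule finite_monomial_pairs)
  show "(0 :: ('a, 'b) mps) \<noteq> 1" by transfer (auto simp: fun_eq_iff)
qed (transfer; simp add: fun_eq_iff algebra_simps)+

end

section \<open>Iterated Laurent series\<close>

definition well_ordered_set :: "'m::linorder set \<Rightarrow> bool" where
  "well_ordered_set S \<longleftrightarrow> wfp_on S (<)"

lemma well_ordered_set_iff:
  "well_ordered_set S \<longleftrightarrow> (\<forall>A\<subseteq>S. A \<noteq> {} \<longrightarrow> (\<exists>m\<in>A. \<forall>x\<in>A. m \<le> x))"
  unfolding well_ordered_set_def wfp_on_iff_ex_minimal by (metis not_le)

lemma well_ordered_set_subset: "well_ordered_set S \<Longrightarrow> T \<subseteq> S \<Longrightarrow> well_ordered_set T"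
  unfolding well_ordered_set_iff by blast

lemma well_ordered_set_singleton: "well_ordered_set {a}"
  unfolding well_ordered_set_iff by auto

lemma well_ordered_set_empty: "well_ordered_set {}"
  unfolding well_ordered_set_iff by auto

lemma well_ordered_set_Un:
  assumes "well_ordered_set S" "well_ordered_set T"
  shows "well_ordered_set (S \<union> T)"
  unfolding well_ordered_set_iff
proof (intro allI impI)
  fix A assume A: "A \<subseteq> S \<union> T" "A \<noteq> {}"
  show "\<exists>m\<in>A. \<forall>x\<in>A. m \<le> x"
  proof (cases "A \<inter> S = {} \<or> A \<inter> T = {}")
    case True
    then have "A \<subseteq> S \<or> A \<subseteq> T" using A by blast
    then show ?thesis using A(2) assms unfolding well_ordered_set_iff by meson
  next
    case False
    then obtain m n where "m \<in> A \<inter> S" "\<forall>x\<in>A \<inter> S. m \<le> x" "n \<in> A \<inter> T" "\<forall>x\<in>A \<inter> T. n \<le> x"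
      using assms unfolding well_ordered_set_iff by (meson inf_le2)
    then have "min m n \<in> A" "\<forall>x\<in>A. min m n \<le> x"
      using A(1) by (auto simp: min_def) (meson IntI UnE nle_le order_trans subsetD)+
    then show ?thesis by blast
  qed
qed

lemma no_decreasing_seq:
  assumes "well_ordered_set S" "\<And>n. s n \<in> S" "\<And>n::nat. s (Suc n) < s n"
  shows False
proof -
  have "range s \<subseteq> S" "range s \<noteq> {}" using assms(2) by auto
  then obtain m where "m \<in> range s" "\<forall>x\<in>range s. m \<le> x"
    using assms(1) unfolding well_ordered_set_iff by meson
  then obtain n where "\<And>k. s n \<le> s k" by auto
  then show False using assms(3)[of n] by (simp add: leD)
qed

lemma well_ordered_setI_seq:
  assumes "\<And>s. (\<And>n::nat. s n \<in> S) \<Longrightarrow> (\<And>n. s (Suc n) < s n) \<Longrightarrow> False"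
  shows "well_ordered_set S"
  unfolding well_ordered_set_iff
proof (intro allI impI, rule ccontr)
  fix A assume A: "A \<subseteq> S" "A \<noteq> {}" and no: "\<not> (\<exists>m\<in>A. \<forall>x\<in>A. m \<le> x)"
  then obtain g where g: "\<And>m. m \<in> A \<Longrightarrow> g m \<in> A \<and> g m < m"
    by (metis not_le)
  obtain a where a: "a \<in> A" using A by blast
  define s where "s n = (g ^^ n) a" for n
  have "s n \<in> A" for n by (induction n) (auto simp: s_def a g)
  then show False using assms[of s] g A by (auto simp: s_def)
qed

lemma finite_well_ordered_converse:
  fixes A :: "'m::linorder set"
  assumes "well_ordered_set A" and max: "\<And>B. B \<subseteq> A \<Longrightarrow> B \<noteq> {} \<Longrightarrow> \<exists>m\<in>B. \<forall>x\<in>B. x \<le> m"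
  shows "finite A"
proof (rule ccontr)
  assume inf: "infinite A"
  have fin: "finite {x \<in> A. x < a}" if "a \<in> A" for a
  proof (rule ccontr)
    assume a: "infinite {x \<in> A. x < a}"
    let ?B = "{a \<in> A. infinite {x \<in> A. x < a}}"
    have "?B \<subseteq> A" "?B \<noteq> {}" using that a by auto
    then obtain a0 where a0: "a0 \<in> ?B" "\<forall>x\<in>?B. a0 \<le> x"
      using assms(1) unfolding well_ordered_set_iff by meson
    then have "{x \<in> A. x < a0} \<noteq> {}" by (metis (no_types, lifting) finite.emptyI mem_Collect_eq)
    then obtain m where m: "m \<in> {x \<in> A. x < a0}" "\<forall>x\<in>{x \<in> A. x < a0}. x \<le> m"
      using max[of "{x \<in> A. x < a0}"] by blast
    then have "finite {x \<in> A. x < m}" using a0 by (auto simp: not_le[symmetric])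
    moreover have "{x \<in> A. x < a0} \<subseteq> insert m {x \<in> A. x < m}" using m by fastforce
    ultimately have "finite {x \<in> A. x < a0}" by (meson finite.insertI finite_subset)
    then show False using a0(1) by simp
  qed
  have "A \<noteq> {}" using inf by auto
  then obtain m where m: "m \<in> A" "\<forall>x\<in>A. x \<le> m" using max[of A] by auto
  then have "A \<subseteq> insert m {x \<in> A. x < m}" by fastforce
  then show False using fin[OF m(1)] inf by (meson finite.insertI finite_subset)
qed

lemma finite_well_ordered_pairs:
  fixes S T :: "'m::linordered_ab_group_add set"
  assumes S: "well_ordered_set S" and T: "well_ordered_set T"
  shows "finite {(a, b). a + b = m \<and> a \<in> S \<and> b \<in> T}"
proof -
  let ?A = "{a \<in> S. m - a \<in> T}"
  have "finite ?A"
  proof (rule finite_well_ordered_converse)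
    show "well_ordered_set ?A" using S by (rule well_ordered_set_subset) auto
    fix B assume B: "B \<subseteq> ?A" "B \<noteq> {}"
    then have "(\<lambda>a. m - a) ` B \<subseteq> T" "(\<lambda>a. m - a) ` B \<noteq> {}" by auto
    then obtain n where "n \<in> (\<lambda>a. m - a) ` B" "\<forall>x\<in>(\<lambda>a. m - a) ` B. n \<le> x"
      using T unfolding well_ordered_set_iff by meson
    then obtain a where "a \<in> B" "\<forall>x\<in>B. x \<le> a" by auto
    then show "\<exists>m\<in>B. \<forall>x\<in>B. x \<le> m" by blast
  qed
  then have "finite ((\<lambda>a. (a, m - a)) ` ?A)" by simp
  moreover have "{(a, b). a + b = m \<and> a \<in> S \<and> b \<in> T} \<subseteq> (\<lambda>a. (a, m - a)) ` ?A"
    by (auto simp: image_iff)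
  ultimately show ?thesis by (rule finite_subset[rotated])
qed

lemma well_ordered_set_plus:
  fixes S T :: "'m::linordered_ab_group_add set"
  assumes S: "well_ordered_set S" and T: "well_ordered_set T"
  shows "well_ordered_set {a + b |a b. a \<in> S \<and> b \<in> T}"
proof (rule well_ordered_setI_seq)
  fix s :: "nat \<Rightarrow> 'm"
  assume "\<And>n. s n \<in> {a + b |a b. a \<in> S \<and> b \<in> T}" and dec: "\<And>n. s (Suc n) < s n"
  then have "\<forall>n. \<exists>a b. a \<in> S \<and> b \<in> T \<and> s n = a + b" by blast
  then obtain a b where ab: "\<And>n. a n \<in> S" "\<And>n. b n \<in> T" "\<And>n. s n = a n + b n"
    by metis
  have sdec: "s m < s n" if "n < m" for m n
    using that dec by (induction rule: strict_inc_induct) (auto intro: less_trans lift_Suc_antimono_le)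
  obtain f :: "nat \<Rightarrow> nat" where f: "strict_mono f" "monoseq (\<lambda>n. a (f n))"
    using seq_monosub by blast
  obtain k where k: "\<And>n. n \<ge> k \<Longrightarrow> a (f n) \<le> a (f (Suc n))"
  proof (cases "\<forall>n. a (f n) \<le> a (f (Suc n))")
    case True then show ?thesis using that by blast
  next
    case False
    then have anti: "\<And>m n. m \<le> n \<Longrightarrow> a (f n) \<le> a (f m)"
      using f(2) unfolding monoseq_def by (meson le_SucI order_refl)
    have "range (\<lambda>n. a (f n)) \<subseteq> S" "range (\<lambda>n. a (f n)) \<noteq> {}" using ab by auto
    then obtain m where "m \<in> range (\<lambda>n. a (f n))" "\<forall>x\<in>range (\<lambda>n. a (f n)). m \<le> x"
      using S unfolding well_ordered_set_iff by meson
    then obtain k where "\<And>n. a (f k) \<le> a (f n)" by auto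
    then have "a (f n) \<le> a (f (Suc n))" if "n \<ge> k" for n
      using anti[OF that] order_trans by blast
    then show ?thesis using that by blast
  qed
  have "b (f (Suc (n + k))) < b (f (n + k))" for n
  proof -
    have "s (f (Suc (n + k))) < s (f (n + k))" by (rule sdec) (use f in \<open>auto simp: strict_mono_def\<close>)
    then have "a (f (Suc (n + k))) + b (f (Suc (n + k))) < a (f (n + k)) + b (f (n + k))" by (simp add: ab)
    moreover have "a (f (n + k)) \<le> a (f (Suc (n + k)))" by (rule k) simp
    ultimately show ?thesis
      using add_mono[of "a (f (n + k))" "a (f (Suc (n + k)))" "b (f (n + k))" "b (f (Suc (n + k)))"]
      by (metis not_le)
  qed
  then show False using no_decreasing_seq[OF T, of "\<lambda>n. b (f (n + k))"] ab by auto
qed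

lemma finite_well_ordered_triples:
  fixes S T U :: "'m::linordered_ab_group_add set"
  assumes S: "well_ordered_set S" and T: "well_ordered_set T" and U: "well_ordered_set U"
  shows "finite {(a, b, c). a + b + c = m \<and> a \<in> S \<and> b \<in> T \<and> c \<in> U}"
proof -
  let ?ST = "{a + b |a b. a \<in> S \<and> b \<in> T}"
  let ?P = "{(s, c). s + c = m \<and> s \<in> ?ST \<and> c \<in> U}"
  let ?Q = "\<lambda>s. {(a, b). a + b = s \<and> a \<in> S \<and> b \<in> T}"
  have "finite (Sigma ?P (\<lambda>(s, c). ?Q s))"
    by (rule finite_SigmaI)
      (use finite_well_ordered_pairs[OF well_ordered_set_plus[OF S T] U] finite_well_ordered_pairs[OF S T] in auto)
  moreover have "{(a, b, c). a + b + c = m \<and> a \<in> S \<and> b \<in> T \<and> c \<in> U}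
      \<subseteq> (\<lambda>((s, c), (a, b)). (a, b, c)) ` Sigma ?P (\<lambda>(s, c). ?Q s)"
  proof clarify
    fix a b c assume "a \<in> S" "b \<in> T" "c \<in> U" "m = a + b + c"
    then show "(a, b, c) \<in> (\<lambda>((s, c), (a, b)). (a, b, c)) ` Sigma {(s, ca). s + ca = a + b + c \<and> s \<in> ?ST \<and> ca \<in> U} (\<lambda>(s, c). ?Q s)"
      by (intro image_eqI[of _ _ "((a + b, c), (a, b))"]) auto
  qed
  ultimately show ?thesis by (meson finite_imageI finite_subset)
qed

text \<open>
  An iterated Laurent series is a function on the exponents of the monomials
  $u_0^{e_0} u_1^{e_1} \cdots$ that involves only finitely many of the variables and whose support
  is well-ordered lexicographically, $e_0$ being the most significant exponent (this is the order
  of \<^type>\<open>poly_mapping\<close>).  For $r$ variables these are exactly the elements of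
  $K((u_{r-1}))\cdots((u_1))((u_0))$; the type is the union of these rings over all $r$.
\<close>

definition il_support :: "(nat \<Rightarrow>\<^sub>0 int) set \<Rightarrow> bool" where
  "il_support S \<longleftrightarrow> well_ordered_set S \<and> (\<exists>r. \<forall>e\<in>S. Poly_Mapping.keys e \<subseteq> {..<r})"

typedef (overloaded) 'a ilaurent = "{f :: (nat \<Rightarrow>\<^sub>0 int) \<Rightarrow> 'a::zero. il_support {e. f e \<noteq> 0}}"
  morphisms il_coeff Abs_ilaurent
  by (rule exI[of _ "\<lambda>_. 0"]) (simp add: il_support_def well_ordered_set_empty)

setup_lifting type_definition_ilaurent

lemma il_support_subset: "il_support S \<Longrightarrow> T \<subseteq> S \<Longrightarrow> il_support T"
proof -
  assume S: "il_support S" and T: "T \<subseteq> S"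
  obtain r where "\<forall>e\<in>S. Poly_Mapping.keys e \<subseteq> {..<r}" using S by (auto simp: il_support_def)
  then have "\<forall>e\<in>T. Poly_Mapping.keys e \<subseteq> {..<r}" using T by blast
  moreover have "well_ordered_set T"
    using S T by (intro well_ordered_set_subset[of S T]) (simp_all add: il_support_def)
  ultimately show ?thesis unfolding il_support_def by (intro conjI exI)
qed

lemma il_support_singleton: "il_support {e}"
proof -
  have "Poly_Mapping.keys e \<subseteq> {..<Suc (Max (insert 0 (Poly_Mapping.keys e)))}"
    by (intro subsetI) (simp add: less_Suc_eq_le)
  then have "\<forall>e'\<in>{e}. Poly_Mapping.keys e' \<subseteq> {..<Suc (Max (insert 0 (Poly_Mapping.keys e)))}" by simp
  with well_ordered_set_singleton show ?thesis unfolding il_support_def by (intro conjI exI)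
qed

lemma il_support_Un: "il_support S \<Longrightarrow> il_support T \<Longrightarrow> il_support (S \<union> T)"
proof -
  assume S: "il_support S" and T: "il_support T"
  obtain r where r: "\<forall>e\<in>S. Poly_Mapping.keys e \<subseteq> {..<r}" using S by (auto simp: il_support_def)
  obtain q where q: "\<forall>e\<in>T. Poly_Mapping.keys e \<subseteq> {..<q}" using T by (auto simp: il_support_def)
  have "\<forall>e\<in>S \<union> T. Poly_Mapping.keys e \<subseteq> {..<max r q}"
  proof
    fix e assume "e \<in> S \<union> T"
    then have "Poly_Mapping.keys e \<subseteq> {..<r} \<or> Poly_Mapping.keys e \<subseteq> {..<q}" using r q by blast
    then show "Poly_Mapping.keys e \<subseteq> {..<max r q}" by auto
  qed
  moreover have "well_ordered_set (S \<union> T)"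
    using S T by (intro well_ordered_set_Un) (simp_all add: il_support_def)
  ultimately show ?thesis unfolding il_support_def by (intro conjI exI)
qed

lemma il_support_plus:
  assumes S: "il_support S" and T: "il_support T"
  shows "il_support {a + b |a b. a \<in> S \<and> b \<in> T}"
proof -
  obtain r where r: "\<forall>e\<in>S. Poly_Mapping.keys e \<subseteq> {..<r}" using S by (auto simp: il_support_def)
  obtain q where q: "\<forall>e\<in>T. Poly_Mapping.keys e \<subseteq> {..<q}" using T by (auto simp: il_support_def)
  have "\<forall>e\<in>{a + b |a b. a \<in> S \<and> b \<in> T}. Poly_Mapping.keys e \<subseteq> {..<max r q}"
  proof
    fix e assume "e \<in> {a + b |a b. a \<in> S \<and> b \<in> T}"
    then obtain a b where e: "e = a + b" and a: "a \<in> S" and b: "b \<in> T" by auto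
    have "Poly_Mapping.keys e \<subseteq> Poly_Mapping.keys a \<union> Poly_Mapping.keys b"
      unfolding e by (rule Poly_Mapping.keys_add)
    also have "\<dots> \<subseteq> {..<r} \<union> {..<q}"
      by (rule Un_mono) (use r q a b in simp_all)
    also have "\<dots> \<subseteq> {..<max r q}" by auto
    finally show "Poly_Mapping.keys e \<subseteq> {..<max r q}" .
  qed
  moreover have "well_ordered_set {a + b |a b. a \<in> S \<and> b \<in> T}"
    using S T by (intro well_ordered_set_plus) (simp_all add: il_support_def)
  ultimately show ?thesis unfolding il_support_def by (intro conjI exI)
qed

lemma il_support_pairs:
  assumes "il_support {e. f e \<noteq> 0}" "il_support {e. g e \<noteq> 0}"
  shows "finite {(a, b). a + b = m \<and> f a \<noteq> 0 \<and> g b \<noteq> 0}"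
proof -
  have "well_ordered_set {e. f e \<noteq> 0}" "well_ordered_set {e. g e \<noteq> 0}"
    using assms by (auto simp: il_support_def)
  from finite_well_ordered_pairs[OF this, of m] show ?thesis by simp
qed

lemma il_support_triples:
  assumes "il_support {e. f e \<noteq> 0}" "il_support {e. g e \<noteq> 0}" "il_support {e. h e \<noteq> 0}"
  shows "finite {(a, b, c). a + b + c = m \<and> f a \<noteq> 0 \<and> g b \<noteq> 0 \<and> h c \<noteq> 0}"
proof -
  have "well_ordered_set {e. f e \<noteq> 0}" "well_ordered_set {e. g e \<noteq> 0}" "well_ordered_set {e. h e \<noteq> 0}"
    using assms by (auto simp: il_support_def)
  from finite_well_ordered_triples[OF this, of m] show ?thesis by simp
qed

instantiation ilaurent :: (comm_ring_1) comm_ring_1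
begin

lift_definition zero_ilaurent :: "'a ilaurent" is "\<lambda>_. 0"
  by (simp add: il_support_def well_ordered_set_empty)
lift_definition one_ilaurent :: "'a ilaurent" is "\<lambda>e. if e = 0 then 1 else 0"
  by (rule il_support_subset[OF il_support_singleton[of 0]]) auto
lift_definition plus_ilaurent :: "'a ilaurent \<Rightarrow> 'a ilaurent \<Rightarrow> 'a ilaurent" is "\<lambda>f g e. f e + g e"
  by (erule (1) il_support_subset[OF il_support_Un]) auto
lift_definition minus_ilaurent :: "'a ilaurent \<Rightarrow> 'a ilaurent \<Rightarrow> 'a ilaurent" is "\<lambda>f g e. f e - g e"
  by (erule (1) il_support_subset[OF il_support_Un]) auto
lift_definition uminus_ilaurent :: "'a ilaurent \<Rightarrow> 'a ilaurent" is "\<lambda>f e. - f e"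
  by simp
lift_definition times_ilaurent :: "'a ilaurent \<Rightarrow> 'a ilaurent \<Rightarrow> 'a ilaurent" is conv
  by (erule (1) il_support_subset[OF il_support_plus]) (auto elim!: conv_nonzeroD)

instance
proof
  fix a b c :: "'a ilaurent"
  show "a * b * c = a * (b * c)"
    by transfer (rule conv_assoc, rule il_support_triples)
  show "a * b = b * a" by transfer (rule conv_commute)
  show "1 * a = a" by transfer (rule conv_one_left)
  show "(a + b) * c = a * c + b * c"
    by transfer (rule conv_add_left; rule il_support_pairs)
  show "(0 :: 'a ilaurent) \<noteq> 1" by transfer (auto simp: fun_eq_iff)
qed (transfer; simp add: fun_eq_iff algebra_simps)+

end

text \<open>
  In both rings a unit has a unique inverse; \<open>inverse\<close> and \<open>/\<close> are meaningful for units only.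
  Writing a rational function with \<open>/\<close> therefore denotes its expansion in the ring at hand.
\<close>

instantiation mps :: (type, comm_ring_1) inverse
begin
definition inverse_mps :: "('a, 'b) mps \<Rightarrow> ('a, 'b) mps" where
  "inverse_mps f = (THE g. f * g = 1)"
definition divide_mps :: "('a, 'b) mps \<Rightarrow> ('a, 'b) mps \<Rightarrow> ('a, 'b) mps" where
  "divide_mps f g = f * inverse g"
instance ..
end

instantiation ilaurent :: (comm_ring_1) inverse
begin
definition inverse_ilaurent :: "'a ilaurent \<Rightarrow> 'a ilaurent" where
  "inverse_ilaurent f = (THE g. f * g = 1)"
definition divide_ilaurent :: "'a ilaurent \<Rightarrow> 'a ilaurent \<Rightarrow> 'a ilaurent" where
  "divide_ilaurent f g = f * inverse g"
instance ..
end

lift_definition mps_const :: "'a::zero \<Rightarrow> ('v, 'a) mps" is "\<lambda>c m. if m = 0 then c else 0" .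

lift_definition mps_var :: "'v \<Rightarrow> ('v, 'a::zero_neq_one) mps"
  is "\<lambda>v m. if m = Poly_Mapping.single v 1 then 1 else 0" .

lift_definition mps_map :: "('a \<Rightarrow> 'b) \<Rightarrow> ('v, 'a) mps \<Rightarrow> ('v, 'b) mps" is "\<lambda>h f m. h (f m)" .

text \<open>Substitution of the variable \<open>\<iota> v\<close> for \<open>v\<close>, for injective \<open>\<iota>\<close>.\<close>

lift_definition mps_rename :: "('v \<Rightarrow> 'w) \<Rightarrow> ('v, 'a::zero) mps \<Rightarrow> ('w, 'a) mps"
  is "\<lambda>\<iota> f m. if Poly_Mapping.keys m \<subseteq> range \<iota> then f (Poly_Mapping.map_key \<iota> m) else 0" .

definition il_monom :: "(nat \<Rightarrow>\<^sub>0 int) \<Rightarrow> 'a::zero \<Rightarrow> 'a ilaurent" where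
  "il_monom e c = Abs_ilaurent (\<lambda>e'. if e' = e then c else 0)"

lemma il_coeff_il_monom: "il_coeff (il_monom e c) e' = (if e' = e then c else 0)"
proof -
  have "il_support {e'. (if e' = e then c else 0) \<noteq> 0}"
    by (rule il_support_subset[OF il_support_singleton[of e]]) auto
  then show ?thesis by (simp add: il_monom_def Abs_ilaurent_inverse)
qed

definition il_const :: "'a::zero \<Rightarrow> 'a ilaurent" where
  "il_const c = il_monom 0 c"

definition il_var :: "nat \<Rightarrow> 'a::zero_neq_one ilaurent" where
  "il_var i = il_monom (Poly_Mapping.single i 1) 1"

text \<open>Unconditional, coefficientwise (discrete) convergence of infinite sums and products.\<close>

definition mps_has_sum :: "('i \<Rightarrow> ('v, 'a::comm_ring_1) mps) \<Rightarrow> 'i set \<Rightarrow> ('v, 'a) mps \<Rightarrow> bool" where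
  "mps_has_sum f I s \<longleftrightarrow>
    (\<forall>m. \<forall>\<^sub>F J in finite_subsets_at_top I. mps_coeff (\<Sum>i\<in>J. f i) m = mps_coeff s m)"

definition mps_has_prod :: "('i \<Rightarrow> ('v, 'a::comm_ring_1) mps) \<Rightarrow> 'i set \<Rightarrow> ('v, 'a) mps \<Rightarrow> bool" where
  "mps_has_prod f I p \<longleftrightarrow>
    (\<forall>m. \<forall>\<^sub>F J in finite_subsets_at_top I. mps_coeff (\<Prod>i\<in>J. f i) m = mps_coeff p m)"

definition mps_infsum :: "('i \<Rightarrow> ('v, 'a::comm_ring_1) mps) \<Rightarrow> 'i set \<Rightarrow> ('v, 'a) mps" where
  "mps_infsum f I = (THE s. mps_has_sum f I s)"

definition mps_infprod :: "('i \<Rightarrow> ('v, 'a::comm_ring_1) mps) \<Rightarrow> 'i set \<Rightarrow> ('v, 'a) mps" where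
  "mps_infprod f I = (THE p. mps_has_prod f I p)"

lemma mps_eqI: "(\<And>m. mps_coeff f m = mps_coeff g m) \<Longrightarrow> f = g"
  by transfer auto

lemma mps_has_sum_unique: "mps_has_sum f I s \<Longrightarrow> mps_has_sum f I t \<Longrightarrow> s = t"
proof (rule mps_eqI)
  fix m assume "mps_has_sum f I s" "mps_has_sum f I t"
  then have "\<forall>\<^sub>F J in finite_subsets_at_top I. mps_coeff (sum f J) m = mps_coeff s m"
    and "\<forall>\<^sub>F J in finite_subsets_at_top I. mps_coeff (sum f J) m = mps_coeff t m"
    unfolding mps_has_sum_def by simp_all
  then have "\<forall>\<^sub>F J in finite_subsets_at_top I. mps_coeff s m = mps_coeff t m"
    by eventually_elim simp
  then show "mps_coeff s m = mps_coeff t m" by simp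
qed

lemma mps_has_prod_unique: "mps_has_prod f I p \<Longrightarrow> mps_has_prod f I q \<Longrightarrow> p = q"
proof (rule mps_eqI)
  fix m assume "mps_has_prod f I p" "mps_has_prod f I q"
  then have "\<forall>\<^sub>F J in finite_subsets_at_top I. mps_coeff (prod f J) m = mps_coeff p m"
    and "\<forall>\<^sub>F J in finite_subsets_at_top I. mps_coeff (prod f J) m = mps_coeff q m"
    unfolding mps_has_prod_def by simp_all
  then have "\<forall>\<^sub>F J in finite_subsets_at_top I. mps_coeff p m = mps_coeff q m"
    by eventually_elim simp
  then show "mps_coeff p m = mps_coeff q m" by simp
qed

section \<open>Dual $K$-theoretic $P$-functions\<close>

type_synonym qbeta = "rat poly fract"

definition beta :: qbeta where
  "beta = Fract [:0, 1:] 1"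

definition fgl_plus :: "'a::{comm_ring_1,inverse} \<Rightarrow> 'a \<Rightarrow> 'a \<Rightarrow> 'a" where
  "fgl_plus \<beta> a b = a + b + \<beta> * a * b"

definition fgl_minus :: "'a::{comm_ring_1,inverse} \<Rightarrow> 'a \<Rightarrow> 'a \<Rightarrow> 'a" where
  "fgl_minus \<beta> a b = (a - b) / (1 + \<beta> * b)"

definition fgl_neg :: "'a::{comm_ring_1,inverse} \<Rightarrow> 'a \<Rightarrow> 'a" where
  "fgl_neg \<beta> t = - t / (1 + \<beta> * t)"

definition strict_partitions :: "nat list set" where
  "strict_partitions = {lam. sorted_wrt (>) lam \<and> 0 \<notin> set lam}"

text \<open>Indices start at 0: \<open>U i\<close> is $u_{i+1}$, \<open>X j\<close> is $x_{j+1}$ and \<open>lam ! i\<close> is $\lambda_{i+1}$.\<close>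

definition GQ_gen :: "nat \<Rightarrow> (nat, qbeta ilaurent) mps" where
  "GQ_gen r =
    (let \<beta> = mps_const (il_const beta);
         U = (\<lambda>i. mps_const (il_var i));
         X = mps_var
     in (\<Prod>i<r. 1 / (1 + \<beta> * U i))
        * mps_infprod (\<lambda>(i, j). fgl_plus \<beta> (U i) (X j) / fgl_minus \<beta> (U i) (X j)) ({..<r} \<times> UNIV)
        * (\<Prod>(i, j) | i < j \<and> j < r. fgl_minus \<beta> (U j) (U i) / fgl_plus \<beta> (U j) (U i)))"

definition GQ :: "nat list \<Rightarrow> (nat, qbeta) mps" where
  "GQ lam = mps_map
    (\<lambda>c. il_coeff c (\<Sum>i<length lam. Poly_Mapping.single i (- int (lam ! i))))
    (GQ_gen (length lam))"

definition symmetric_functions :: "(nat, 'a::zero) mps set" where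
  "symmetric_functions = {f. (\<forall>\<pi>. bij \<pi> \<longrightarrow> mps_rename \<pi> f = f) \<and>
    (\<exists>d. \<forall>m. mps_coeff f m \<noteq> 0 \<longrightarrow> (\<Sum>i\<in>Poly_Mapping.keys m. Poly_Mapping.lookup m i) \<le> d)}"

text \<open>In the Cauchy identity $x_i$ and $y_j$ are the variables \<open>Inl i\<close> and \<open>Inr j\<close>.\<close>

definition cauchy_kernel :: "(nat + nat, qbeta) mps" where
  "cauchy_kernel =
    (let x = (\<lambda>i. mps_var (Inl i)); y = (\<lambda>j. mps_var (Inr j))
     in mps_infprod (\<lambda>(i, j). (1 - fgl_neg (mps_const beta) (x i) * y j) / (1 - x i * y j)) UNIV)"

definition gp_family :: "(nat list \<Rightarrow> (nat, qbeta) mps) \<Rightarrow> bool" where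
  "gp_family g \<longleftrightarrow> g \<in> strict_partitions \<rightarrow>\<^sub>E symmetric_functions \<and>
    mps_has_sum (\<lambda>lam. mps_rename Inl (GQ lam) * mps_rename Inr (g lam)) strict_partitions cauchy_kernel"

definition gp :: "nat list \<Rightarrow> (nat, qbeta) mps" where
  "gp = (THE g. gp_family g)"

section \<open>Neutral fermions\<close>

text \<open>
  The scalars are extended from $\mathbb{Q}(\beta)$ to $\mathbb{Q}(\beta)[[x_1, x_2, \ldots]]$, so
  that $\mathcal{H}^{[\beta]}(x)$ is an element of the algebra.  An element of the completed algebra
  is written as a formal, possibly infinite, linear combination of words
  $\phi_{n_1} \cdots \phi_{n_k}$, represented by the lists \<open>[n\<^sub>1, ..., n\<^sub>k]\<close>.
\<close>

type_synonym scalars = "(nat, qbeta) mps"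
type_synonym fermion_series = "int list \<Rightarrow> scalars"

definition neg_one_pow :: "int \<Rightarrow> 'a::ring_1" where
  "neg_one_pow n = (if even n then 1 else - 1)"

definition fs_word :: "int list \<Rightarrow> fermion_series" where
  "fs_word w = (\<lambda>w'. if w' = w then 1 else 0)"

text \<open>All families below are locally finite: a given word occurs in finitely many members.\<close>

definition fs_lincomb :: "'i set \<Rightarrow> ('i \<Rightarrow> scalars) \<Rightarrow> ('i \<Rightarrow> fermion_series) \<Rightarrow> fermion_series" where
  "fs_lincomb I c X = (\<lambda>w. \<Sum>i | i \<in> I \<and> c i * X i w \<noteq> 0. c i * X i w)"

text \<open>
  The anti-involution: $(\phi_{n_1} \cdots \phi_{n_k})^\ast
  = (-1)^{n_1 + \cdots + n_k} \phi_{-n_k} \cdots \phi_{-n_1}$.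
\<close>

definition fs_star :: "fermion_series \<Rightarrow> fermion_series" where
  "fs_star X = (\<lambda>w. neg_one_pow (sum_list w) * X (map uminus (rev w)))"

definition phi_bracket :: "int \<Rightarrow> fermion_series" where
  "phi_bracket n =
    (if n \<ge> 1
     then fs_lincomb {1..}
       (\<lambda>k. mps_const (fps_nth ((fps_X / (1 + fps_const (beta / 2) * fps_X)) ^ k) (nat n)))
       (\<lambda>k::nat. fs_word [int k])
     else fs_lincomb UNIV
       (\<lambda>k. mps_const (coeff ([:beta / 2, 1:] ^ k) (nat (- n))))
       (\<lambda>k::nat. fs_word [- int k]))"

definition Phi_bracket :: "int \<Rightarrow> fermion_series" where
  "Phi_bracket n =
    fs_lincomb UNIV (\<lambda>k::nat. mps_const (1 / 2 * (- beta / 2) ^ k)) (\<lambda>k. phi_bracket (n - int k))"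

definition b_op :: "int \<Rightarrow> fermion_series" where
  "b_op m = fs_lincomb UNIV (\<lambda>i. mps_const (1 / 4 * neg_one_pow i)) (\<lambda>i. fs_word [- i - m, i])"

text \<open>A Laurent series in $X^{-1}$: the variable of the type \<open>fls\<close> is $X^{-1}$.\<close>

definition b_round_series :: "int \<Rightarrow> qbeta fls" where
  "b_round_series m =
    ((fls_X_inv - fls_const (beta / 2)) powi m - (- fls_X_inv - fls_const (beta / 2)) powi m) / 2"

text \<open>\<open>b_round_series m\<close> is odd in $X$, so only odd powers $X^k$ occur.\<close>

definition b_round :: "int \<Rightarrow> fermion_series" where
  "b_round m = fs_lincomb {k. odd k} (\<lambda>k. mps_const (fls_nth (b_round_series m) (- k))) b_op"

definition b_bracket :: "int \<Rightarrow> fermion_series" where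
  "b_bracket m = fs_star (b_round (- m))"

definition power_sum :: "nat \<Rightarrow> scalars" where
  "power_sum n = mps_infsum (\<lambda>i. mps_var i ^ n) UNIV"

text \<open>
  The sum ranges over all $n \ge 1$, not only over the odd $n$.  For $\beta \ne 0$ the even-indexed $b^{[\beta]}_n$ do not
  vanish (for $\beta = 0$ they do), and they are needed: conjugation by $e^{\mathcal{H}^{[\beta]}(x)}$
  multiplies $\sum_n \phi^{[\beta]}_n z^n$ by
  $\exp \sum_{n \ge 1} \frac{p_n(x)}{n} (z^n - \overline{z}^n)
  = \prod_i \frac{1 - \overline{z} x_i}{1 - z x_i}$, the factor of the Cauchy kernel.
\<close>

definition H_bracket :: fermion_series where
  "H_bracket = fs_lincomb {1..} (\<lambda>n::nat. 2 * power_sum n * mps_const (1 / of_nat n)) (\<lambda>n. b_bracket (int n))"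

definition theta :: fermion_series where
  "theta = fs_lincomb {n. odd n} (\<lambda>n::nat. mps_const (2 * (beta / 2) ^ n / of_nat n)) (\<lambda>n. b_op (int n))"

text \<open>
  \<open>'f\<close> is the Fock space $\mathcal{A} |0\rangle$, \<open>phi n\<close> the action of $\phi_n$, \<open>ket\<close> the vacuum
  and \<open>bra\<close> the functional $v \mapsto \langle 0 | v$.  By \<open>cyclic\<close> the remaining axioms
  determine \<open>bra\<close> on all of \<open>'f\<close>.
\<close>

locale neutral_fermions = module scale
  for scale :: "'a::comm_ring_1 \<Rightarrow> 'f::ab_group_add \<Rightarrow> 'f" +
  fixes phi :: "int \<Rightarrow> 'f \<Rightarrow> 'f" and ket :: 'f and bra :: "'f \<Rightarrow> 'a"
  assumes phi_linear: "module_hom scale scale (phi n)"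
    and bra_linear: "module_hom scale (*) bra"
    and anticommute: "phi m (phi n v) + phi n (phi m v) = (if m + n = 0 then scale (2 * neg_one_pow m) v else 0)"
    and phi_ket: "n > 0 \<Longrightarrow> phi (- n) ket = 0"
    and bra_phi: "n > 0 \<Longrightarrow> bra (phi n v) = 0"
    and bra_ket: "bra ket = 1"
    and bra_phi0_ket: "bra (phi 0 ket) = 0"
    and cyclic: "module.span scale (range (\<lambda>w. foldr phi w ket)) = UNIV"

text \<open>
  The sums in the action of a fermion series and in the exponential are over the indices with
  non-zero terms.  These are finitely many for all series used here, because a vector of the Fock
  space is annihilated by \<open>phi (- n)\<close> for large \<open>n\<close>.
\<close>

definition fs_act :: "(scalars \<Rightarrow> 'f::ab_group_add \<Rightarrow> 'f) \<Rightarrow> (int \<Rightarrow> 'f \<Rightarrow> 'f) \<Rightarrow> fermion_series \<Rightarrow> 'f \<Rightarrow> 'f" where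
  "fs_act scale phi X v = Sum_any (\<lambda>w. scale (X w) (foldr phi w v))"

definition op_exp :: "(scalars \<Rightarrow> 'f::ab_group_add \<Rightarrow> 'f) \<Rightarrow> ('f \<Rightarrow> 'f) \<Rightarrow> 'f \<Rightarrow> 'f" where
  "op_exp scale T v = Sum_any (\<lambda>k::nat. scale (mps_const (1 / of_nat (fact k))) ((T ^^ k) v))"

fun ket_p :: "(scalars \<Rightarrow> 'f::ab_group_add \<Rightarrow> 'f) \<Rightarrow> (int \<Rightarrow> 'f \<Rightarrow> 'f) \<Rightarrow> 'f \<Rightarrow> nat list \<Rightarrow> 'f" where
  "ket_p scale phi ket [] = phi 0 ket + ket"
| "ket_p scale phi ket (l # ls) =
    (let v = (if ls = [] then ket_p scale phi ket ls
              else op_exp scale (\<lambda>u. - fs_act scale phi theta u) (ket_p scale phi ket ls))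
     in fs_act scale phi (Phi_bracket (int l)) v - scale (mps_const (1 / 2 * (- beta / 2) ^ l)) v)"

text \<open>
  Such Fock spaces exist: the free module on the finite subsets \<open>{n\<^sub>1 > ... > n\<^sub>k}\<close> of the natural
  numbers, which stand for the vectors $\phi_{n_1} \cdots \phi_{n_k} |0\rangle$.
\<close>

definition fock_toggle :: "nat \<Rightarrow> nat fset \<Rightarrow> nat fset" where
  "fock_toggle n S = (if n |\<in>| S then S |-| {|n|} else finsert n S)"

definition fock_sign :: "nat \<Rightarrow> nat fset \<Rightarrow> 'a::comm_ring_1" where
  "fock_sign n S = (- 1) ^ card {s. s |\<in>| S \<and> n < s}"

definition fock_coeff :: "int \<Rightarrow> nat fset \<Rightarrow> 'a::comm_ring_1" where
  "fock_coeff n S =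
    (if n > 0 then (if nat n |\<in>| S then fock_sign (nat n) S else 0)
     else if n < 0 then (if nat (- n) |\<in>| S then 0 else 2 * neg_one_pow n * fock_sign (nat (- n)) S)
     else fock_sign 0 S)"

definition fock_phi :: "int \<Rightarrow> (nat fset \<Rightarrow>\<^sub>0 'a::comm_ring_1) \<Rightarrow> nat fset \<Rightarrow>\<^sub>0 'a" where
  "fock_phi n f =
    Abs_poly_mapping (\<lambda>S. fock_coeff n S * Poly_Mapping.lookup f (fock_toggle (nat \<bar>n\<bar>) S))"

definition fock_scale :: "'a::comm_ring_1 \<Rightarrow> (nat fset \<Rightarrow>\<^sub>0 'a) \<Rightarrow> nat fset \<Rightarrow>\<^sub>0 'a" where
  "fock_scale c f = Abs_poly_mapping (\<lambda>S. c * Poly_Mapping.lookup f S)"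

lemma fock_toggle_toggle [simp]: "fock_toggle n (fock_toggle n S) = S"
  by (auto simp: fock_toggle_def)

lemma fock_toggle_commute: "fock_toggle m (fock_toggle n S) = fock_toggle n (fock_toggle m S)"
  by (auto simp: fock_toggle_def)

lemma in_fock_toggle: "k |\<in>| fock_toggle n S \<longleftrightarrow> (if k = n then k |\<notin>| S else k |\<in>| S)"
  by (auto simp: fock_toggle_def)

lemma fock_sign_toggle:
  "fock_sign m (fock_toggle n S) = (if m < n then - fock_sign m S else fock_sign m S)"
proof -
  have fin: "finite {s. s |\<in>| S \<and> m < s}"
    by (rule finite_subset[of _ "fset S"]) auto
  consider "\<not> m < n" | "m < n" "n |\<in>| S" | "m < n" "n |\<notin>| S" by blast
  then show ?thesis
  proof cases
    case 1
    then have "{s. s |\<in>| fock_toggle n S \<and> m < s} = {s. s |\<in>| S \<and> m < s}"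
      by (auto simp: in_fock_toggle split: if_splits)
    then show ?thesis using 1 by (simp add: fock_sign_def)
  next
    case 2
    then have "{s. s |\<in>| S \<and> m < s} = insert n {s. s |\<in>| fock_toggle n S \<and> m < s}"
      and "n \<notin> {s. s |\<in>| fock_toggle n S \<and> m < s}"
      by (auto simp: in_fock_toggle split: if_splits)
    then have "card {s. s |\<in>| S \<and> m < s} = Suc (card {s. s |\<in>| fock_toggle n S \<and> m < s})"
      using fin by (metis card_insert_disjoint finite_insert)
    then show ?thesis using 2 by (simp add: fock_sign_def)
  next
    case 3
    then have "{s. s |\<in>| fock_toggle n S \<and> m < s} = insert n {s. s |\<in>| S \<and> m < s}"
      by (auto simp: in_fock_toggle split: if_splits)
    then have "card {s. s |\<in>| fock_toggle n S \<and> m < s} = Suc (card {s. s |\<in>| S \<and> m < s})"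
      using fin 3 by simp
    then show ?thesis using 3 by (simp add: fock_sign_def)
  qed
qed

lemma fock_sign_square [simp]: "fock_sign n S * fock_sign n S = 1"
  by (simp add: fock_sign_def flip: power_mult_distrib)

lemma fock_sign_cancel:
  "fock_sign n S * (x * fock_sign n S) = x" "x * fock_sign n S * fock_sign n S = x"
proof -
  have "fock_sign n S * (x * fock_sign n S) = x * (fock_sign n S * fock_sign n S)"
    by (simp only: ac_simps)
  then show "fock_sign n S * (x * fock_sign n S) = x" by simp
  show "x * fock_sign n S * fock_sign n S = x" by (simp only: mult.assoc fock_sign_square mult_1_right)
qed

lemma lookup_fock_phi:
  "Poly_Mapping.lookup (fock_phi n f) S = fock_coeff n S * Poly_Mapping.lookup f (fock_toggle (nat \<bar>n\<bar>) S)"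
proof -
  have "{S. fock_coeff n S * Poly_Mapping.lookup f (fock_toggle (nat \<bar>n\<bar>) S) \<noteq> 0}
      \<subseteq> fock_toggle (nat \<bar>n\<bar>) ` Poly_Mapping.keys f"
  proof
    fix S assume "S \<in> {S. fock_coeff n S * Poly_Mapping.lookup f (fock_toggle (nat \<bar>n\<bar>) S) \<noteq> 0}"
    then have "fock_toggle (nat \<bar>n\<bar>) S \<in> Poly_Mapping.keys f" by (auto simp: in_keys_iff)
    then show "S \<in> fock_toggle (nat \<bar>n\<bar>) ` Poly_Mapping.keys f"
      by (intro image_eqI[of _ _ "fock_toggle (nat \<bar>n\<bar>) S"]) simp_all
  qed
  then have "finite {S. fock_coeff n S * Poly_Mapping.lookup f (fock_toggle (nat \<bar>n\<bar>) S) \<noteq> 0}"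
    by (rule finite_subset) simp
  then show ?thesis by (simp add: fock_phi_def)
qed

lemma lookup_fock_scale: "Poly_Mapping.lookup (fock_scale c f) S = c * Poly_Mapping.lookup f S"
proof -
  have "finite {S. c * Poly_Mapping.lookup f S \<noteq> 0}"
    by (rule finite_subset[of _ "Poly_Mapping.keys f"]) (auto simp: in_keys_iff)
  then show ?thesis by (simp add: fock_scale_def)
qed

lemma fock_coeff_anticommute:
  "fock_coeff m S * fock_coeff n (fock_toggle (nat \<bar>m\<bar>) S)
    + fock_coeff n S * fock_coeff m (fock_toggle (nat \<bar>n\<bar>) S)
    = (if m + n = 0 then 2 * neg_one_pow m else (0 :: 'a::comm_ring_1))"
proof -
  have "\<bar>m\<bar> \<noteq> \<bar>n\<bar> \<or> (m = n \<and> n \<noteq> 0) \<or> (m = - n \<and> n > 0) \<or> (m = - n \<and> n < 0) \<or> (m = 0 \<and> n = 0)"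
    by (cases n "0 :: int" rule: linorder_cases) (auto simp: abs_eq_iff)
  then consider "\<bar>m\<bar> \<noteq> \<bar>n\<bar>" | "m = n" "n \<noteq> 0" | "m = - n" "n > 0" | "m = - n" "n < 0" | "m = 0" "n = 0"
    by blast
  then show ?thesis
  proof cases
    case 1
    then have ne: "nat \<bar>n\<bar> \<noteq> nat \<bar>m\<bar>" and mn: "m + n \<noteq> 0" by auto
    have eq: "fock_coeff k (fock_toggle c S) =
      (if nat \<bar>k\<bar> < c then - fock_coeff k S else (fock_coeff k S :: 'a))" if "nat \<bar>k\<bar> \<noteq> c" for k c
      using that
      by (cases k "0 :: int" rule: linorder_cases) (simp_all add: fock_coeff_def in_fock_toggle fock_sign_toggle)
    have "fock_coeff m S * fock_coeff n (fock_toggle (nat \<bar>m\<bar>) S)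
      + fock_coeff n S * fock_coeff m (fock_toggle (nat \<bar>n\<bar>) S) = (0 :: 'a)"
      unfolding eq[OF ne] eq[OF ne[symmetric]]
    proof (cases "nat \<bar>n\<bar> < nat \<bar>m\<bar>")
      case True
      then have "\<not> nat \<bar>m\<bar> < nat \<bar>n\<bar>" by simp
      with True show "fock_coeff m S * (if nat \<bar>n\<bar> < nat \<bar>m\<bar> then - fock_coeff n S else fock_coeff n S)
        + fock_coeff n S * (if nat \<bar>m\<bar> < nat \<bar>n\<bar> then - fock_coeff m S else fock_coeff m S) = (0 :: 'a)"
        by (simp only: if_True if_False mult_minus_right) (simp add: mult.commute)
    next
      case False
      then have "nat \<bar>m\<bar> \<le> nat \<bar>n\<bar>" by (simp only: not_less)
      then have "nat \<bar>m\<bar> < nat \<bar>n\<bar>" using ne[symmetric] by (rule le_neq_implies_less)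
      with False show "fock_coeff m S * (if nat \<bar>n\<bar> < nat \<bar>m\<bar> then - fock_coeff n S else fock_coeff n S)
        + fock_coeff n S * (if nat \<bar>m\<bar> < nat \<bar>n\<bar> then - fock_coeff m S else fock_coeff m S) = (0 :: 'a)"
        by (simp only: if_True if_False mult_minus_right) (simp add: mult.commute)
    qed
    then show ?thesis using mn by (simp only: if_False)
  next
    case 2
    then have "fock_coeff m S * fock_coeff m (fock_toggle (nat \<bar>m\<bar>) S) = (0 :: 'a)"
      by (cases m "0 :: int" rule: linorder_cases) (simp_all add: fock_coeff_def in_fock_toggle)
    then show ?thesis using 2 by simp
  next
    case 3
    define k where "k = nat n"
    have n: "n = int k" and k: "k > 0" and m: "m = - int k" using 3 by (simp_all add: k_def)
    show ?thesis unfolding n m using k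
      by (cases "k |\<in>| S")
        (simp_all add: fock_coeff_def in_fock_toggle fock_sign_toggle fock_sign_cancel neg_one_pow_def)
  next
    case 4
    define k where "k = nat m"
    have m: "m = int k" and k: "k > 0" and n: "n = - int k" using 4 by (simp_all add: k_def)
    show ?thesis unfolding n m using k
      by (cases "k |\<in>| S")
        (simp_all add: fock_coeff_def in_fock_toggle fock_sign_toggle fock_sign_cancel neg_one_pow_def)
  next
    case 5
    then show ?thesis by (simp add: fock_coeff_def fock_sign_toggle neg_one_pow_def)
  qed
qed

lemma fock_module: "module fock_scale"
  by unfold_locales (rule poly_mapping_eqI, simp add: lookup_fock_scale lookup_add algebra_simps)+

lemma fock_word: "\<exists>w e. e * e = (1 :: 'a::comm_ring_1) \<and>
  foldr fock_phi w (Poly_Mapping.single {||} 1) = Poly_Mapping.single S e"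
proof (induction S)
  case empty
  show ?case by (intro exI[of _ "[]"] exI[of _ 1]) simp
next
  case (insert n S)
  then obtain w and e :: 'a where IH: "e * e = 1"
    "foldr fock_phi w (Poly_Mapping.single {||} 1) = Poly_Mapping.single S e" by blast
  have "fock_phi (int n) (Poly_Mapping.single S e)
      = Poly_Mapping.single (finsert n S) (fock_sign n (finsert n S) * e)"
  proof (rule poly_mapping_eqI)
    fix T
    have "S = fock_toggle n T \<longleftrightarrow> T = finsert n S"
      using insert.hyps by (metis fock_toggle_def fock_toggle_toggle)
    then show "Poly_Mapping.lookup (fock_phi (int n) (Poly_Mapping.single S e)) T
        = Poly_Mapping.lookup (Poly_Mapping.single (finsert n S) (fock_sign n (finsert n S) * e)) T"
      by (auto simp: lookup_fock_phi lookup_single when_def fock_coeff_def)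
  qed
  moreover have "(fock_sign n (finsert n S) * e) * (fock_sign n (finsert n S) * e) = 1"
    using IH(1) fock_sign_square[of n "finsert n S"] by (metis mult.assoc mult.left_commute mult_1)
  ultimately show ?case using IH(2)
    by (intro exI[of _ "int n # w"] exI[of _ "fock_sign n (finsert n S) * e"]) simp
qed

lemma neutral_fermions_fock:
  "neutral_fermions fock_scale fock_phi (Poly_Mapping.single {||} 1)
    (\<lambda>f :: nat fset \<Rightarrow>\<^sub>0 'a::comm_ring_1. Poly_Mapping.lookup f {||})"
proof -
  interpret module "fock_scale :: 'a \<Rightarrow> _" by (rule fock_module)
  let ?k = "Poly_Mapping.single {||} 1 :: nat fset \<Rightarrow>\<^sub>0 'a"
  have single: "Poly_Mapping.single S c \<in> span (range (\<lambda>w. foldr fock_phi w ?k))" for S c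
  proof -
    obtain w and e :: 'a where w: "e * e = 1" "foldr fock_phi w ?k = Poly_Mapping.single S e"
      using fock_word by blast
    have "Poly_Mapping.single S c = fock_scale (c * e) (foldr fock_phi w ?k)"
      by (rule poly_mapping_eqI)
        (simp add: w(2) lookup_fock_scale lookup_single when_def mult.assoc w(1))
    then show ?thesis by (auto intro: span_scale span_base)
  qed
  have span: "f \<in> span (range (\<lambda>w. foldr fock_phi w ?k))" for f
  proof -
    have "f = (\<Sum>S\<in>Poly_Mapping.keys f. Poly_Mapping.single S (Poly_Mapping.lookup f S))"
      by (rule poly_mapping_eqI) (simp add: lookup_sum lookup_single when_def in_keys_iff)
    also have "\<dots> \<in> span (range (\<lambda>w. foldr fock_phi w ?k))"
      by (rule span_sum) (rule single)
    finally show ?thesis .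
  qed
  have toggle_empty: "fock_toggle n S = {||} \<longleftrightarrow> S = {|n|}" for n S
  proof
    assume "fock_toggle n S = {||}"
    then have "fock_toggle n (fock_toggle n S) = fock_toggle n {||}" by simp
    then show "S = {|n|}" by (simp add: fock_toggle_def[of n "{||}"])
  qed (simp add: fock_toggle_def)
  have empty_toggle: "{||} = fock_toggle n S \<longleftrightarrow> S = {|n|}" for n S
    by (rule trans[OF eq_commute toggle_empty])
  show ?thesis
  proof unfold_locales
    fix m n :: int and c :: 'a and v v' :: "nat fset \<Rightarrow>\<^sub>0 'a"
    show "fock_phi n (v + v') = fock_phi n v + fock_phi n v'"
      by (rule poly_mapping_eqI) (simp add: lookup_fock_phi lookup_add algebra_simps)
    show "fock_phi n (fock_scale c v) = fock_scale c (fock_phi n v)"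
      by (rule poly_mapping_eqI) (simp add: lookup_fock_phi lookup_fock_scale algebra_simps)
    show "Poly_Mapping.lookup (v + v') {||} = Poly_Mapping.lookup v {||} + Poly_Mapping.lookup v' {||}"
      by (simp add: lookup_add)
    show "Poly_Mapping.lookup (fock_scale c v) {||} = c * Poly_Mapping.lookup v {||}"
      by (simp add: lookup_fock_scale)
    show "fock_phi m (fock_phi n v) + fock_phi n (fock_phi m v)
        = (if m + n = 0 then fock_scale (2 * neg_one_pow m) v else 0)"
    proof (rule poly_mapping_eqI)
      fix S
      have comm: "fock_toggle (nat \<bar>m\<bar>) (fock_toggle (nat \<bar>n\<bar>) S)
          = fock_toggle (nat \<bar>n\<bar>) (fock_toggle (nat \<bar>m\<bar>) S)"
        by (rule fock_toggle_commute)
      have "Poly_Mapping.lookup (fock_phi m (fock_phi n v) + fock_phi n (fock_phi m v)) S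
          = (fock_coeff m S * fock_coeff n (fock_toggle (nat \<bar>m\<bar>) S)
            + fock_coeff n S * fock_coeff m (fock_toggle (nat \<bar>n\<bar>) S))
            * Poly_Mapping.lookup v (fock_toggle (nat \<bar>n\<bar>) (fock_toggle (nat \<bar>m\<bar>) S))"
        by (simp add: lookup_add lookup_fock_phi comm distrib_right mult.assoc)
      also have "\<dots> = Poly_Mapping.lookup (if m + n = 0 then fock_scale (2 * neg_one_pow m) v else 0) S"
      proof (cases "m + n = 0")
        case True
        then have "\<bar>n\<bar> = \<bar>m\<bar>" by linarith
        then have "fock_toggle (nat \<bar>n\<bar>) (fock_toggle (nat \<bar>m\<bar>) S) = S" by simp
        then show ?thesis
          unfolding fock_coeff_anticommute using True by (simp add: lookup_fock_scale)
      next
        case False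
        then show ?thesis unfolding fock_coeff_anticommute by simp
      qed
      finally show "Poly_Mapping.lookup (fock_phi m (fock_phi n v) + fock_phi n (fock_phi m v)) S
          = Poly_Mapping.lookup (if m + n = 0 then fock_scale (2 * neg_one_pow m) v else 0) S" .
    qed
    show "fock_phi (- n) ?k = 0" if "n > 0"
      by (rule poly_mapping_eqI)
        (use that in \<open>auto simp: lookup_fock_phi lookup_single when_def fock_coeff_def empty_toggle\<close>)
    show "Poly_Mapping.lookup (fock_phi n v) {||} = 0" if "n > 0"
      using that by (simp add: lookup_fock_phi fock_coeff_def)
    show "Poly_Mapping.lookup ?k {||} = 1" by simp
    show "Poly_Mapping.lookup (fock_phi 0 ?k) {||} = 0"
      by (auto simp: lookup_fock_phi lookup_single when_def empty_toggle)
    show "span (range (\<lambda>w. foldr fock_phi w ?k)) = UNIV" using span by auto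
  qed (simp_all add: algebra_simps)
qed

end

theory Submission
  imports Defs
begin

text \<open>
  On the module \<open>Fplus\<close> generated from $\Omega = (\phi_0 + 1) |0\rangle$, the functional
  $\langle 0 | \phi_{-l}$ agrees with $(-1)^l \langle 0 | M_l$, where
  $M(W) = \exp (2 \sum_{j\ \mathrm{odd}} \frac{W^j}{j} b_j)$.  The vectors $|\lambda\rangle_p$ form a basis
  of \<open>Fplus\<close>, and anticommuting $e^\theta \phi^{[\beta]}(\overline z)$ through the factors of
  $|\lambda\rangle_p$ gives the dual basis $D_\lambda$ of functionals.  With $X(w) = \phi(w) M(1/w)$ and $\hat X$ its modes
  in the variable $x$, $w = x / (1 + \frac{\beta}{2} x)$, moving all annihilation operators to the
  left shows that $D_\lambda (\hat X_{q_1} \cdots \hat X_{q_s} \Omega)$ is the coefficient of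
  $x_1^{q_1} \cdots x_s^{q_s}$ in $GQ_\lambda$.

  Conjugation by $e^{\mathcal H}$ multiplies $\hat X(x)$ by
  $\prod_j \frac{1 - \overline x y_j}{1 - x y_j}$.  Expanding $\hat X_{q_1} \cdots \hat X_{q_s} \Omega$ in the basis
  $|\lambda\rangle_p$ and applying $\langle 0 | e^{\mathcal H}$ therefore yields the Cauchy identity for
  $\langle 0 | e^{\mathcal H} |\lambda\rangle_p$.  Conversely the $|\lambda\rangle_p$ are
  $\mathbb{Q}(\beta)$-combinations of the vectors $\hat X_{q_1} \cdots \hat X_{q_s} \Omega$, which gives both the symmetry of
  $\langle 0 | e^{\mathcal H} |\lambda\rangle_p$ and the uniqueness of the dual family.
\<close>

subsection \<open>Expansion coefficients of the fields\<close>

text \<open>Write g = beta/2 and W(u) = 1/w(u) = 1/u + g. The map w sends the formal inverse of z to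
  -w(z), which is the origin of the signs (-1)^j below. Also W(u) + W(v) = (u \<oplus> v)/(uv) and
  W(u) - W(v) = (v - u)/(uv), so the factors produced by moving fields past the operators M are
  those of GQ. The operator e^theta is M(g); it multiplies phi(w(z)) by (1 + g w)/(1 - g w) = 1 +
  beta z, the source of the factors 1 + beta u. The same factor also mixes neighbouring modes, and
  strictness of the partition absorbs this shift in the duality proof. The factor 1/(2 + beta z) in
  Phi normalises an anticommutator to a Kronecker delta; the subtracted constant is the vacuum value
  of the mode, because \<open>phi 0\<close> acts to the left as 1 on \<open>Fplus\<close>. One
  obstacle shapes the second half: the scalars of the module contain the variables of gp, whereas
  the generating series of GQ has coefficients over Q(beta). Series-valued functionals therefore see
  only constant coefficients of scalars, and this loses nothing on a Q(beta)-form of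
  \<open>Fplus\<close>.\<close>

definition gam :: qbeta where "gam = beta / 2"

definition wfps :: "qbeta fps" where "wfps = fps_X / (1 + fps_const gam * fps_X)"

definition wser :: "qbeta fls" where "wser = fps_to_fls wfps"

text \<open>The power k may be any integer. Since 1/w = 1/z + gam, this single array describes both
  halves of the definition of the deformed fermions, as \<open>phi_bracket_apply\<close>
  confirms.\<close>

definition cw :: "int \<Rightarrow> int \<Rightarrow> qbeta" where "cw n k = fls_nth (wser powi k) n"

lemma beta_eq_gam: "beta = 2 * gam"
  by (simp add: gam_def)

lemma wfps_times: "wfps * (1 + fps_const gam * fps_X) = fps_X"
  unfolding wfps_def by (simp add: fps_divide_unit mult.assoc inverse_mult_eq_1)

lemma wfps_nth_0 [simp]: "wfps $ 0 = 0"
  using arg_cong[OF wfps_times, of "\<lambda>f. f $ 0"] by simp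

lemma wfps_nth_1 [simp]: "wfps $ Suc 0 = 1"
  using arg_cong[OF wfps_times, of "\<lambda>f. f $ Suc 0"] by (simp add: fps_mult_nth)

lemma wser_times: "wser * (fls_X_inv + fls_const gam) = 1"
proof -
  have XX: "(fls_X_inv :: qbeta fls) * fls_X = 1" by (simp add: fls_X_inv_times_conv_shift)
  have "wser * (fls_X_inv + fls_const gam) * fls_X = wser * (1 + fls_const gam * fls_X)"
    by (simp only: mult.assoc distrib_right XX)
  also have "\<dots> = fps_to_fls (wfps * (1 + fps_const gam * fps_X))"
    by (simp add: wser_def fls_times_fps_to_fls)
  also have "\<dots> = 1 * fls_X" by (simp add: wfps_times)
  finally show ?thesis by (metis mult_right_cancel fls_X_nonzero)
qed

lemma wser_nz: "wser \<noteq> 0" using wser_times by auto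

lemma wser_powi_Suc: "wser powi k = wser powi (k + 1) * (fls_X_inv + fls_const gam)"
  by (simp add: power_int_add wser_nz mult.assoc wser_times)

text \<open>Multiplication of w^k by 1/w = 1/z + gam. Most later coefficient identities follow from
  this recursion and the vanishing for n < k; the binomial formula enters only with the
  Hamiltonian.\<close>

lemma cw_rec: "cw n (k - 1) = cw (n + 1) k + gam * cw n k"
  unfolding cw_def
  by (subst wser_powi_Suc) (simp add: algebra_simps fls_X_inv_times_conv_shift)

lemma cw_rec_minus: "cw n (- 1 - int l) = cw (n + 1) (- int l) + gam * cw n (- int l)"
proof -
  have "- 1 - int l = - int l - 1" by simp
  then show ?thesis by (simp only: cw_rec)
qed

lemma cw_nat: "cw n (int k) = (if n < 0 then 0 else (wfps ^ k) $ nat n)"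
  by (simp add: cw_def wser_def flip: fps_to_fls_power)

lemma cw_0: "cw n 0 = (if n = 0 then 1 else 0)"
  by (simp add: cw_def)

lemma cw_less: "n < k \<Longrightarrow> cw n k = 0"
proof (cases "k \<ge> 0")
  case True
  assume "n < k"
  with True show ?thesis using cw_nat[of n "nat k"] startsby_zero_power_prefix[of wfps "nat k"]
    by (auto simp: nat_less_iff)
next
  case False
  have "n < - int l \<Longrightarrow> cw n (- int l) = 0" for l
  proof (induction l arbitrary: n)
    case (Suc l)
    then show ?case using cw_rec_minus[of n l] by simp
  qed (simp add: cw_0)
  from this[of "nat (- k)"] False show "n < k \<Longrightarrow> cw n k = 0" by simp
qed

lemma cw_self: "cw n n = 1"
proof (cases "n \<ge> 0")
  case True
  then show ?thesis using cw_nat[of n "nat n"] startsby_zero_power_nth_same[of wfps "nat n"] by auto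
next
  case False
  have "cw (- int l) (- int l) = 1" for l
  proof (induction l)
    case (Suc l)
    have "cw (- int (Suc l)) (- int (Suc l)) = cw (- int l) (- int l) + gam * cw (- int (Suc l)) (- int l)"
      using cw_rec_minus[of "- int (Suc l)" l] by simp
    then show ?case using Suc by (simp add: cw_less)
  qed (simp add: cw_0)
  from this[of "nat (- n)"] False show ?thesis by simp
qed

text \<open>Nonpositive powers of w are polynomials in 1/z. This is why the deformed modes of
  positive index involve only positive modes.\<close>

lemma cw_pos_nonpos: "n > 0 \<Longrightarrow> k \<le> 0 \<Longrightarrow> cw n k = 0"
proof -
  have "n > 0 \<Longrightarrow> cw n (- int l) = 0" for l
    by (induction l arbitrary: n) (auto simp: cw_0 cw_rec_minus)
  from this[of "nat (- k)"] show "n > 0 \<Longrightarrow> k \<le> 0 \<Longrightarrow> cw n k = 0" by simp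
qed

lemma cw_neg_nat: "cw (- int n) (- int k) = coeff ([:gam, 1:] ^ k) n"
proof (induction k arbitrary: n)
  case 0
  show ?case by (cases n) (auto simp: cw_0)
next
  case (Suc k)
  have "cw (- int n) (- int (Suc k)) = cw (- int n + 1) (- int k) + gam * cw (- int n) (- int k)"
    using cw_rec_minus[of "- int n" k] by simp
  also have "cw (- int n + 1) (- int k) = (case n of 0 \<Rightarrow> 0 | Suc m \<Rightarrow> cw (- int m) (- int k))"
    by (cases n) (simp_all add: cw_pos_nonpos algebra_simps)
  finally show ?case using Suc by (simp add: coeff_pCons split: nat.splits)
qed

text \<open>\<open>cPhi n j\<close> is the coefficient of $z^n$ in $w(z)^j / (2 + \beta z)$, $w(z) = z / (1 + \frac{\beta}{2} z)$.\<close>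

definition kap :: "int \<Rightarrow> qbeta" where
  "kap n = (if n < 0 then 0 else 1 / 2 * (- gam) ^ nat n)"

definition cPhi :: "int \<Rightarrow> int \<Rightarrow> qbeta" where
  "cPhi n j = (\<Sum>k | k \<le> nat (n - j). kap (int k) * cw (n - int k) j)"

lemma kap_rec: "2 * kap n + beta * kap (n - 1) = (if n = 0 then 1 else 0)"
proof -
  have "kap (int (Suc m)) = - gam * kap (int m)" for m by (simp add: kap_def nat_add_distrib)
  moreover have "n < 0 \<or> n = 0 \<or> (\<exists>m. n = int (Suc m))" by presburger
  ultimately show ?thesis by (auto simp: kap_def beta_eq_gam)
qed

lemma kap_Suc: "kap (int (Suc m)) = - gam * kap (int m)" by (simp add: kap_def nat_add_distrib)

lemma cPhi_less: "n < j \<Longrightarrow> cPhi n j = 0"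
  unfolding cPhi_def by (rule sum.neutral) (auto simp: cw_less)

lemma cPhi_rec: "2 * cPhi n j + beta * cPhi (n - 1) j = cw n j"
proof (cases "n < j")
  case True
  then show ?thesis by (simp add: cPhi_less cw_less)
next
  case False
  define m where "m = nat (n - j)"
  have n: "n = j + int m" using False by (simp add: m_def)
  have "cPhi n j = kap 0 * cw n j + (\<Sum>k<m. kap (int (Suc k)) * cw (n - int (Suc k)) j)"
    unfolding cPhi_def n
    by (simp add: atMost_def[symmetric] lessThan_Suc_atMost[symmetric] sum.lessThan_Suc_shift del: sum.lessThan_Suc of_nat_Suc)
  also have "(\<Sum>k<m. kap (int (Suc k)) * cw (n - int (Suc k)) j) = - gam * (\<Sum>k<m. kap (int k) * cw (n - 1 - int k) j)"
    unfolding kap_Suc sum_distrib_left by (simp add: algebra_simps)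
  also have "(\<Sum>k<m. kap (int k) * cw (n - 1 - int k) j) = cPhi (n - 1) j"
  proof (cases m)
    case 0
    then show ?thesis by (simp add: cPhi_less n)
  next
    case (Suc m')
    then have "{..<m} = {k. k \<le> nat (n - 1 - j)}" by (auto simp: n)
    then show ?thesis by (simp add: cPhi_def)
  qed
  finally show ?thesis by (simp add: kap_def beta_eq_gam)
qed

text \<open>A Laurent series bounded below that is killed by 2 + beta z is zero. Identities for
  \<open>cPhi\<close> are checked after multiplication by 2 + beta z, where \<open>cPhi_rec\<close>
  turns them into identities for \<open>cw\<close>.\<close>

lemma qbeta_rec_zero:
  fixes x :: "int \<Rightarrow> qbeta"
  assumes "\<And>n. n < N \<Longrightarrow> x n = 0" "\<And>n. 2 * x n + beta * x (n - 1) = 0"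
  shows "x n = 0"
proof (cases "n < N")
  case False
  then have "N - 1 \<le> n" by simp
  then show ?thesis
    by (induction n rule: int_ge_induct) (use assms in \<open>auto, metis add_diff_cancel_right' add_cancel_left_right mult_eq_0_iff mult_zero_right zero_neq_numeral\<close>)
qed (use assms in auto)

lemma cPhi_self: "cPhi n n = 1 / 2"
  using cPhi_rec[of n n] by (simp add: cPhi_less cw_self field_simps)

lemma cPhi_0: "cPhi n 0 = kap n"
proof -
  have "cPhi n 0 - kap n = 0"
  proof (rule qbeta_rec_zero[of 0 "\<lambda>n. cPhi n 0 - kap n"])
    fix n
    have "2 * (cPhi n 0 - kap n) + beta * (cPhi (n - 1) 0 - kap (n - 1))
      = (2 * cPhi n 0 + beta * cPhi (n - 1) 0) - (2 * kap n + beta * kap (n - 1))"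
      by (simp add: algebra_simps)
    then show "2 * (cPhi n 0 - kap n) + beta * (cPhi (n - 1) 0 - kap (n - 1)) = 0"
      unfolding cPhi_rec kap_rec by (simp add: cw_0)
  qed (simp add: cPhi_less kap_def)
  then show ?thesis by simp
qed

lemma cPhi_rec2: "cPhi n (k - 1) = cPhi (n + 1) k + gam * cPhi n k"
proof -
  have "cPhi n (k - 1) - cPhi (n + 1) k - gam * cPhi n k = 0"
  proof (rule qbeta_rec_zero[of "k - 1" "\<lambda>n. cPhi n (k - 1) - cPhi (n + 1) k - gam * cPhi n k"])
    fix n
    have "2 * (cPhi n (k - 1) - cPhi (n + 1) k - gam * cPhi n k) +
      beta * (cPhi (n - 1) (k - 1) - cPhi (n - 1 + 1) k - gam * cPhi (n - 1) k)
      = (2 * cPhi n (k - 1) + beta * cPhi (n - 1) (k - 1))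
       - (2 * cPhi (n + 1) k + beta * cPhi (n + 1 - 1) k) - gam * (2 * cPhi n k + beta * cPhi (n - 1) k)"
      by (simp add: algebra_simps)
    then show "2 * (cPhi n (k - 1) - cPhi (n + 1) k - gam * cPhi n k) +
      beta * (cPhi (n - 1) (k - 1) - cPhi (n - 1 + 1) k - gam * cPhi (n - 1) k) = 0"
      unfolding cPhi_rec by (simp add: cw_rec)
  qed (simp add: cPhi_less)
  then show ?thesis by (simp add: algebra_simps)
qed

text \<open>Since 1/w = (2 + beta z)/(2z), the quotient w^(-1)/(2 + beta z) is just 1/(2z); further
  factors 1/w = 1/z + gam create no nonnegative powers of z.\<close>

lemma cPhi_neg: "n \<ge> 0 \<Longrightarrow> k < 0 \<Longrightarrow> cPhi n k = 0"
proof -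
  have base: "cPhi n (- 1) = (if n = - 1 then 1 / 2 else 0)" for n
  proof -
    have "cPhi n (-1) - (if n = - 1 then 1 / 2 else 0) = 0"
    proof (rule qbeta_rec_zero[of "-1" "\<lambda>n. cPhi n (-1) - (if n = - 1 then 1 / 2 else 0)"])
      fix n
      have "cw n (-1) = (if n = -1 then 1 else 0) + (if n = 0 then gam else 0)"
        using cw_rec[of n 0] by (simp add: cw_0)
      then show "2 * (cPhi n (-1) - (if n = - 1 then 1 / 2 else 0))
          + beta * (cPhi (n - 1) (-1) - (if n - 1 = - 1 then 1 / 2 else 0)) = 0"
        using cPhi_rec[of n "-1"] by (simp add: algebra_simps beta_eq_gam)
    qed (simp add: cPhi_less)
    then show ?thesis by (simp only: right_minus_eq)
  qed
  have "n \<ge> 0 \<Longrightarrow> cPhi n (- 1 - int l) = 0" for l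
  proof (induction l arbitrary: n)
    case (Suc l)
    then show ?case using cPhi_rec2[of n "- 1 - int l"] by (simp add: algebra_simps)
  qed (simp add: base)
  from this[of "nat (- 1 - k)"] show "n \<ge> 0 \<Longrightarrow> k < 0 \<Longrightarrow> cPhi n k = 0" by simp
qed

text \<open>
  In the variables \<open>u\<close>, \<open>z\<close> the sum over \<open>l\<close> is $\sum_l w(u)^l w(z)^{-l}$, and the shift of \<open>l\<close>
  by one shows that it is invariant under moving a factor \<open>u / z\<close>.
\<close>

lemma cw_delta:
  assumes "N \<ge> \<bar>j\<bar>" "N \<ge> \<bar>m\<bar>"
  shows "(\<Sum>l = - N..N. cw j l * cw m (- l)) = (if m + j = 0 then 1 else 0) + (if m + j = 1 then gam else 0)"
proof -
  define S where "S j m = (\<Sum>l = - m..j. cw j l * cw m (- l))" for j m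
  have S_eq: "(\<Sum>l = a..b. cw j l * cw m (- l)) = S j m" if "a \<le> - m" "b \<ge> j" for a b j m
    unfolding S_def by (rule sum.mono_neutral_right) (use that in \<open>auto simp: cw_less\<close>)
  have shift: "S (j + 1) m = S j (m + 1)" for j m
  proof -
    let ?A = "- m - 1" and ?B = "j + 1"
    have a: "S (j + 1) m = (\<Sum>l = ?A..?B. cw (j + 1) l * cw m (- l))" by (rule S_eq[symmetric]) auto
    also have "\<dots> = (\<Sum>l = ?A..?B. cw j (l - 1) * cw m (- l)) - gam * (\<Sum>l = ?A..?B. cw j l * cw m (- l))"
      unfolding cw_rec by (simp add: sum_distrib_left algebra_simps flip: sum.distrib)
    also have "(\<Sum>l = ?A..?B. cw j (l - 1) * cw m (- l)) = (\<Sum>l = ?A - 1..?B - 1. cw j l * cw m (- l - 1))"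
      by (rule sum.reindex_bij_witness[of _ "\<lambda>l. l + 1" "\<lambda>l. l - 1"]) (auto simp: algebra_simps)
    also have "\<dots> = (\<Sum>l = ?A - 1..?B - 1. cw j l * cw (m + 1) (- l)) + gam * (\<Sum>l = ?A - 1..?B - 1. cw j l * cw m (- l))"
      unfolding cw_rec by (simp add: sum_distrib_left algebra_simps flip: sum.distrib)
    also have "(\<Sum>l = ?A - 1..?B - 1. cw j l * cw (m + 1) (- l)) = S j (m + 1)" by (rule S_eq) auto
    also have "(\<Sum>l = ?A - 1..?B - 1. cw j l * cw m (- l)) = S j m" by (rule S_eq) auto
    also have "(\<Sum>l = ?A..?B. cw j l * cw m (- l)) = S j m" by (rule S_eq) auto
    finally show ?thesis by simp
  qed
  have S0: "S j m = S 0 (j + m)"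
  proof -
    have p: "S (int k) m = S 0 (int k + m)" for k m
    proof (induction k arbitrary: m)
      case (Suc k)
      then show ?case using shift[of "int k" m] by (simp add: algebra_simps)
    qed simp
    have q: "S (- int k) m = S 0 (- int k + m)" for k m
    proof (induction k arbitrary: m)
      case (Suc k)
      have "S (- int (Suc k)) m = S (- int k) (m - 1)" using shift[of "- int (Suc k)" "m - 1"] by simp
      then show ?case using Suc[of "m - 1"] by (simp add: algebra_simps)
    qed simp
    show ?thesis using p[of "nat j" m] q[of "nat (-j)" m] by (cases "j \<ge> 0") auto
  qed
  have c0: "cw 0 (- int l) = gam ^ l" for l
    using cw_neg_nat[of 0 l] by (simp add: coeff_0_power)
  have cneg: "m < 0 \<Longrightarrow> S 0 m = 0" for m unfolding S_def by simp
  have S0_nat: "S 0 (int m) = (\<Sum>l\<le>m. gam ^ l * cw (int m) (int l))" for m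
  proof -
    have "S 0 (int m) = (\<Sum>l = - int m..0. cw 0 l * cw (int m) (- l))" by (simp add: S_def)
    also have "\<dots> = (\<Sum>l\<le>m. cw 0 (- int l) * cw (int m) (int l))"
      by (rule sum.reindex_bij_witness[of _ "\<lambda>l. - int l" "\<lambda>l. nat (- l)"]) auto
    finally show ?thesis by (simp add: c0)
  qed
  \<comment> \<open>Only j + m matters by now, and the row j = 0 is the coefficient of z^n in the
    sum of gam^l w^l, that is 1/(1 - gam w) = 1 + gam z. This is the Jacobian factor w/(z w') of the
    delta function in w.\<close>
  have tot: "S 0 n = (if n = 0 then 1 else 0) + (if n = 1 then gam else 0)" for n
  proof -
    have r: "S 0 (int (Suc m)) = gam * (\<Sum>l\<le>m. gam ^ l * cw (int (Suc m)) (int (Suc l)))" for m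
      unfolding S0_nat by (subst sum.atMost_Suc_shift) (simp add: cw_0 sum_distrib_left mult_ac del: of_nat_Suc)
    have rr: "cw (int (Suc m)) (int (Suc l)) = cw (int m) (int l) - gam * cw (int m) (int (Suc l))" for m l
      using cw_rec[of "int m" "int (Suc l)"] by (simp add: algebra_simps)
    have r1: "S 0 (int (Suc m)) = gam * S 0 (int m) - gam * (S 0 (int m) - cw (int m) 0)" for m
    proof -
      have "(\<Sum>l\<le>m. gam ^ l * cw (int (Suc m)) (int (Suc l))) = S 0 (int m) - (\<Sum>l\<le>m. gam ^ Suc l * cw (int m) (int (Suc l)))"
        unfolding rr S0_nat by (simp add: algebra_simps sum_subtractf)
      also have "(\<Sum>l\<le>m. gam ^ Suc l * cw (int m) (int (Suc l))) = (\<Sum>l\<le>Suc m. gam ^ l * cw (int m) (int l)) - cw (int m) 0"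
        by (subst sum.atMost_Suc_shift) simp
      also have "(\<Sum>l\<le>Suc m. gam ^ l * cw (int m) (int l)) = S 0 (int m)" unfolding S0_nat by (simp add: cw_less)
      finally show ?thesis unfolding r by (simp add: algebra_simps)
    qed
    have "n < 0 \<or> n = 0 \<or> (\<exists>m. n = int (Suc m))" by presburger
    then consider "n < 0" | "n = 0" | m where "n = int (Suc m)" by blast
    then show ?thesis
    proof cases
      case 1 then show ?thesis by (simp add: cneg)
    next
      case 2 then show ?thesis using S0_nat[of 0] by (simp add: cw_0)
    next
      case 3 then show ?thesis using r1[of m] S0_nat[of 0] by (simp add: cw_0 algebra_simps)
    qed
  qed
  have "(\<Sum>l = - N..N. cw j l * cw m (- l)) = S j m" by (rule S_eq) (use assms in auto)
  then show ?thesis using S0 tot by (simp add: add.commute)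
qed

section \<open>Constant power series and signs\<close>

lemma mps_coeff_const: "mps_coeff (mps_const c) m = (if m = 0 then c else 0)"
  by (simp add: mps_const.rep_eq)

lemma mps_coeff_simps:
  "mps_coeff 0 m = 0" "mps_coeff 1 m = (if m = 0 then 1 else 0)"
  "mps_coeff (f + g) m = mps_coeff f m + mps_coeff g m"
  "mps_coeff (f - g) m = mps_coeff f m - mps_coeff g m"
  "mps_coeff (- f) m = - mps_coeff f m"
  "mps_coeff (f * g) m = conv (mps_coeff f) (mps_coeff g) m"
  by (simp_all add: zero_mps.rep_eq one_mps.rep_eq plus_mps.rep_eq minus_mps.rep_eq uminus_mps.rep_eq times_mps.rep_eq)

lemma mps_coeff_sum: "mps_coeff (sum f A) m = (\<Sum>a\<in>A. mps_coeff (f a) m)"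
  by (induction A rule: infinite_finite_induct) (simp_all add: mps_coeff_simps)

lemma mps_coeff_const_times: "mps_coeff (mps_const c * f) m = c * mps_coeff f m"
  unfolding mps_coeff_simps by (subst conv_superset[where P = "{(0, m)}"]) (auto simp: mps_coeff_const split: if_splits)

lemma mps_const_0 [simp]: "mps_const 0 = 0"
  and mps_const_1 [simp]: "mps_const 1 = 1"
  and mps_const_add: "mps_const (a + b) = mps_const a + mps_const b"
  and mps_const_diff: "mps_const (a - b) = mps_const a - mps_const b"
  and mps_const_minus: "mps_const (- a) = - mps_const a"
  for a b :: "'a::comm_ring_1"
  by (rule mps_eqI, simp add: mps_coeff_const mps_coeff_simps)+

lemma mps_const_mult: "mps_const (a * b) = mps_const a * mps_const b" for a b :: "'a::comm_ring_1"
  by (rule mps_eqI) (simp add: mps_coeff_const mps_coeff_const_times)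

lemma mps_const_sum: "mps_const (\<Sum>a\<in>A. f a) = (\<Sum>a\<in>A. mps_const (f a))" for f :: "_ \<Rightarrow> 'a::comm_ring_1"
  by (induction A rule: infinite_finite_induct) (simp_all add: mps_const_add)

lemma mps_const_prod: "mps_const (\<Prod>a\<in>A. f a) = (\<Prod>a\<in>A. mps_const (f a))" for f :: "_ \<Rightarrow> 'a::comm_ring_1"
  by (induction A rule: infinite_finite_induct) (simp_all add: mps_const_mult)

lemma mps_const_of_nat: "mps_const (of_nat n) = of_nat n" 
  by (induction n) (simp_all add: mps_const_add)

lemma mps_const_numeral [simp]: "mps_const (numeral n) = numeral n"
  using mps_const_of_nat[of "numeral n"] by simp

lemma mps_const_power: "mps_const (a ^ n) = mps_const a ^ n" for a :: "'a::comm_ring_1"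
  by (induction n) (simp_all add: mps_const_mult)

lemma neg_one_pow_mult: "neg_one_pow a * neg_one_pow a = (1 :: 'a::comm_ring_1)"
  by (simp add: neg_one_pow_def)

lemma neg_one_pow_minus [simp]: "neg_one_pow (- a) = (neg_one_pow a :: 'a::ring_1)"
  by (simp add: neg_one_pow_def)

lemma mps_const_neg_one_pow: "mps_const (neg_one_pow a) = (neg_one_pow a :: scalars)"
  by (simp add: neg_one_pow_def mps_const_minus)

subsection \<open>The Fock space\<close>

locale scalar_fermions = neutral_fermions scale phi ket bra
  for scale :: "scalars \<Rightarrow> 'f::ab_group_add \<Rightarrow> 'f" and phi ket bra
begin

abbreviation linop :: "('f \<Rightarrow> 'f) \<Rightarrow> bool" where "linop \<equiv> module_hom scale scale"

abbreviation csc :: "qbeta \<Rightarrow> 'f \<Rightarrow> 'f" where "csc c \<equiv> scale (mps_const c)"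

lemma linop_add: "linop T \<Longrightarrow> T (u + v) = T u + T v" by (rule module_hom.add)
lemma linop_scale: "linop T \<Longrightarrow> T (scale c v) = scale c (T v)" by (rule module_hom.scale)
lemma linop_0: "linop T \<Longrightarrow> T 0 = 0" by (rule module_hom.zero)
lemma linop_neg: "linop T \<Longrightarrow> T (- u) = - T u" by (rule module_hom.neg)
lemma linop_diff: "linop T \<Longrightarrow> T (u - v) = T u - T v" by (rule module_hom.diff)
lemma linop_sum: "linop T \<Longrightarrow> T (sum f A) = (\<Sum>a\<in>A. T (f a))" by (rule module_hom.sum)

lemma linopI: "(\<And>u v. T (u + v) = T u + T v) \<Longrightarrow> (\<And>c v. T (scale c v) = scale c (T v)) \<Longrightarrow> linop T"
  by unfold_locales auto

lemma linop_comp: "linop S \<Longrightarrow> linop T \<Longrightarrow> linop (\<lambda>v. S (T v))"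
  by (rule linopI) (simp_all add: linop_add linop_scale)
lemma linop_minus: "linop S \<Longrightarrow> linop T \<Longrightarrow> linop (\<lambda>v. S v - T v)"
  by (rule linopI) (simp_all add: linop_add linop_scale algebra_simps scale_right_diff_distrib)
lemma linop_scl: "linop T \<Longrightarrow> linop (\<lambda>v. scale c (T v))"
  by (rule linopI) (simp_all add: linop_add linop_scale scale_right_distrib mult.commute)
lemma linop_sums: "(\<And>a. a \<in> A \<Longrightarrow> linop (T a)) \<Longrightarrow> linop (\<lambda>v. \<Sum>a\<in>A. T a v)"
  by (rule linopI) (simp_all add: linop_add linop_scale sum.distrib scale_sum_right)
lemma linop_id: "linop (\<lambda>v. v)" by (rule linopI) auto

lemmas phi_add = linop_add[OF phi_linear]
  and phi_scale = linop_scale[OF phi_linear]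
  and phi_0 = linop_0[OF phi_linear]
  and phi_neg = linop_neg[OF phi_linear]
  and phi_diff = linop_diff[OF phi_linear]
  and phi_sum = linop_sum[OF phi_linear]

lemma bra_add: "bra (u + v) = bra u + bra v" by (rule module_hom.add[OF bra_linear])
lemma bra_scale: "bra (scale c v) = c * bra v" by (rule module_hom.scale[OF bra_linear])
lemma bra_0: "bra 0 = 0" by (rule module_hom.zero[OF bra_linear])
lemma bra_neg: "bra (- v) = - bra v" by (rule module_hom.neg[OF bra_linear])
lemma bra_diff: "bra (u - v) = bra u - bra v" by (rule module_hom.diff[OF bra_linear])
lemma bra_sum: "bra (sum f A) = (\<Sum>a\<in>A. bra (f a))" by (rule module_hom.sum[OF bra_linear])

lemma phi_swap: "phi m (phi n v) = - phi n (phi m v) + (if m + n = 0 then scale (2 * neg_one_pow m) v else 0)"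
  using anticommute[of m n v] by (simp add: algebra_simps)

lemma scale_half: "scale (mps_const (1 / 2)) (v + v) = v"
proof -
  have "scale (mps_const (1 / 2)) (v + v) = scale (mps_const (1 / 2) + mps_const (1 / 2)) v"
    by (simp only: scale_right_distrib scale_left_distrib)
  also have "mps_const (1 / 2) + mps_const (1 / 2) = (mps_const (1 / 2 + 1 / 2) :: scalars)"
    by (rule mps_const_add[symmetric])
  finally show ?thesis by simp
qed

lemma double_eq_0: "(v :: 'f) + v = 0 \<Longrightarrow> v = 0"
  using scale_half[of v] by simp

lemma phi_square: "n \<noteq> 0 \<Longrightarrow> phi n (phi n v) = 0"
proof -
  assume "n \<noteq> 0"
  then have "n + n \<noteq> 0" by simp
  with anticommute[of n n v] have "phi n (phi n v) + phi n (phi n v) = 0" by (simp only: if_False)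
  then show ?thesis by (rule double_eq_0)
qed

lemma phi_0_square: "phi 0 (phi 0 v) = v"
proof -
  have "phi 0 (phi 0 v) + phi 0 (phi 0 v) = v + v"
    using anticommute[of 0 0 v] scale_left_distrib[of 1 1 v] by (simp add: neg_one_pow_def)
  then show ?thesis by (metis scale_half)
qed

definition plus :: 'f where "plus = phi 0 ket + ket"

text \<open>The square of \<open>phi 0\<close> is 1, so adding \<open>ket\<close> to
  \<open>phi 0 ket\<close> projects onto the eigenvalue 1 up to a factor.\<close>

lemma phi_0_plus: "phi 0 plus = plus"
  by (simp add: plus_def phi_add phi_0_square add.commute)

lemma phi_plus: "n < 0 \<Longrightarrow> phi n plus = 0"
  using phi_ket[of "- n"] phi_swap[of n 0 ket] by (simp add: plus_def phi_add phi_0)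

lemma phi_ket_neg: "n < 0 \<Longrightarrow> phi n ket = 0"
  using phi_ket[of "- n"] by simp

lemma bra_plus: "bra plus = 1"
  by (simp add: plus_def bra_add bra_ket bra_phi0_ket)

text \<open>Satisfied by \<open>ket\<close> and by \<open>plus\<close>. Degree estimates are stated
  for both at once: with \<open>ket\<close> they control the whole module, with \<open>plus\<close>
  they keep vectors in \<open>Fplus\<close>.\<close>

definition vac :: "'f \<Rightarrow> bool" where "vac \<Omega> \<longleftrightarrow> (\<forall>n<0. phi n \<Omega> = 0)"

lemma vac_ket: "vac ket" and vac_plus: "vac plus"
  by (simp_all add: vac_def phi_ket_neg phi_plus)

text \<open>Degree bounds take the place of convergence. There is nothing below degree 0, so on a
  given vector almost all terms of an infinite series of modes vanish, and such series become finite
  sums with an explicit range.\<close>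

definition filt :: "'f \<Rightarrow> int \<Rightarrow> 'f set" where
  "filt \<Omega> d = span {foldr phi (map int a) \<Omega> | a. int (sum_list a) \<le> d}"

lemma filt_word: "int (sum_list a) \<le> d \<Longrightarrow> foldr phi (map int a) \<Omega> \<in> filt \<Omega> d"
  unfolding filt_def by (rule span_base) blast

lemma filt_vac: "d \<ge> 0 \<Longrightarrow> \<Omega> \<in> filt \<Omega> d"
  using filt_word[of "[]" d \<Omega>] by simp

lemma filt_mono: "v \<in> filt \<Omega> d \<Longrightarrow> d \<le> e \<Longrightarrow> v \<in> filt \<Omega> e"
  unfolding filt_def by (erule span_mono[THEN subsetD, rotated]) auto

lemma filt_add: "u \<in> filt \<Omega> d \<Longrightarrow> v \<in> filt \<Omega> d \<Longrightarrow> u + v \<in> filt \<Omega> d"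
  unfolding filt_def by (rule span_add)

lemma filt_diff: "u \<in> filt \<Omega> d \<Longrightarrow> v \<in> filt \<Omega> d \<Longrightarrow> u - v \<in> filt \<Omega> d"
  unfolding filt_def by (rule span_diff)

lemma filt_neg: "u \<in> filt \<Omega> d \<Longrightarrow> - u \<in> filt \<Omega> d"
  unfolding filt_def by (rule span_neg)

lemma filt_scale: "u \<in> filt \<Omega> d \<Longrightarrow> scale c u \<in> filt \<Omega> d"
  unfolding filt_def by (rule span_scale)

lemma filt_0: "0 \<in> filt \<Omega> d"
  unfolding filt_def by (rule span_zero)

lemma filt_sum: "(\<And>a. a \<in> A \<Longrightarrow> f a \<in> filt \<Omega> d) \<Longrightarrow> sum f A \<in> filt \<Omega> d"
  unfolding filt_def by (rule span_sum)

lemma filt_below_0: "v \<in> filt \<Omega> d \<Longrightarrow> d < 0 \<Longrightarrow> v = 0"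
proof -
  assume v: "v \<in> filt \<Omega> d" and "d < 0"
  then have "{foldr phi (map int a) \<Omega> | a. int (sum_list a) \<le> d} = {}" by auto
  with v show "v = 0" unfolding filt_def by simp
qed

lemma filt_induct [consumes 1, case_names word add scale zero]:
  assumes "v \<in> filt \<Omega> d"
    and "\<And>a. int (sum_list a) \<le> d \<Longrightarrow> P (foldr phi (map int a) \<Omega>)"
    and "\<And>u v. u \<in> filt \<Omega> d \<Longrightarrow> v \<in> filt \<Omega> d \<Longrightarrow> P u \<Longrightarrow> P v \<Longrightarrow> P (u + v)"
    and "\<And>c v. v \<in> filt \<Omega> d \<Longrightarrow> P v \<Longrightarrow> P (scale c v)"
    and zero: "P 0"
  shows "P v"
proof -
  have "v \<in> filt \<Omega> d \<and> P v"
    using assms(1) unfolding filt_def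
  proof (induction rule: span_induct_alt)
    case base
    then show ?case using assms(5) filt_0 unfolding filt_def by blast
  next
    case (step c x y)
    then have x: "x \<in> filt \<Omega> d" "P x" using assms(2) unfolding filt_def by (auto intro: span_base)
    then have "scale c x \<in> filt \<Omega> d" "P (scale c x)" using assms(4) by (auto intro: filt_scale)
    with step show ?case using assms(3) unfolding filt_def by (auto intro: span_add)
  qed
  then show ?thesis by simp
qed

text \<open>A negative mode is moved towards the vacuum, which it kills. A contraction on the way
  removes the letter b = -n, so the degree drops by the same amount as in the uncontracted
  terms.\<close>

lemma phi_filt:
  assumes \<Omega>: "vac \<Omega>" and v: "v \<in> filt \<Omega> d"
  shows "phi n v \<in> filt \<Omega> (d + n)"
proof -
  have nonneg: "u \<in> filt \<Omega> d \<Longrightarrow> phi (int b) u \<in> filt \<Omega> (d + int b)" for u b d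
  proof (induction rule: filt_induct)
    case (word a)
    then show ?case using filt_word[of "b # a" "d + int b" \<Omega>] by simp
  qed (simp_all add: phi_add phi_scale phi_0 filt_add filt_scale filt_0)
  have neg: "n < 0 \<Longrightarrow> phi n (foldr phi (map int a) \<Omega>) \<in> filt \<Omega> (int (sum_list a) + n)" for a
  proof (induction a)
    case Nil
    then show ?case using \<Omega> by (simp add: vac_def filt_0)
  next
    case (Cons b a)
    let ?v = "foldr phi (map int a) \<Omega>"
    have "phi (int b) (phi n ?v) \<in> filt \<Omega> (int (sum_list a) + n + int b)"
      using nonneg Cons by blast
    moreover have "n + int b = 0 \<Longrightarrow> scale (2 * neg_one_pow n) ?v \<in> filt \<Omega> (int (sum_list a) + n + int b)"
      by (rule filt_scale) (rule filt_word, simp)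
    ultimately have "- phi (int b) (phi n ?v) + (if n + int b = 0 then scale (2 * neg_one_pow n) ?v else 0)
        \<in> filt \<Omega> (int (sum_list a) + n + int b)"
      by (simp add: filt_add filt_neg filt_diff)
    moreover have "phi n (foldr phi (map int (b # a)) \<Omega>)
        = - phi (int b) (phi n ?v) + (if n + int b = 0 then scale (2 * neg_one_pow n) ?v else 0)"
      unfolding list.map foldr_Cons o_apply by (rule phi_swap)
    moreover have "int (sum_list (b # a)) + n = int (sum_list a) + n + int b" by simp
    ultimately show ?case by (simp only:)
  qed
  show ?thesis
  proof (cases "n \<ge> 0")
    case True
    then show ?thesis using nonneg[OF v, of "nat n"] by simp
  next
    case False
    show ?thesis using v
    proof (induction rule: filt_induct)
      case (word a)
      show ?case by (rule filt_mono[OF neg]) (use word False in auto)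
    qed (simp_all add: phi_add phi_scale phi_0 filt_add filt_scale filt_0)
  qed
qed

lemma phi_vanish: "vac \<Omega> \<Longrightarrow> v \<in> filt \<Omega> d \<Longrightarrow> n < - d \<Longrightarrow> phi n v = 0"
  by (rule filt_below_0[OF phi_filt]) auto

lemma F_induct [case_names ket add scale phi]:
  assumes "P ket" "\<And>u v. P u \<Longrightarrow> P v \<Longrightarrow> P (u + v)" "\<And>c v. P v \<Longrightarrow> P (scale c v)"
    and "\<And>n v. P v \<Longrightarrow> P (phi n v)"
  shows "P v"
proof -
  have "v \<in> span (range (\<lambda>w. foldr phi w ket))" using cyclic by simp
  then show ?thesis
  proof (induction rule: span_induct_alt)
    case base
    show ?case using assms(3)[OF assms(1), of 0] by simp
  next
    case (step c x y)
    have "P (foldr phi w ket)" for w by (induction w) (use assms in auto)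
    then show ?case using step assms by auto
  qed
qed

lemma ex_filt: obtains d where "d \<ge> 0" "v \<in> filt ket d"
proof -
  have "\<exists>d. d \<ge> 0 \<and> v \<in> filt ket d"
  proof (induction v rule: F_induct)
    case ket
    then show ?case by (intro exI[of _ 0]) (simp add: filt_vac)
  next
    case (add u v)
    then obtain d e where "d \<ge> 0" "u \<in> filt ket d" "e \<ge> 0" "v \<in> filt ket e" by blast
    then have "u + v \<in> filt ket (max d e)" by (intro filt_add) (auto elim: filt_mono)
    then show ?case using \<open>d \<ge> 0\<close> by (intro exI[of _ "max d e"]) auto
  next
    case (scale c v)
    then show ?case using filt_scale by blast
  next
    case (phi n v)
    then obtain d where "d \<ge> 0" "v \<in> filt ket d" by blast
    then have "phi n v \<in> filt ket (max 0 (d + n))" by (meson filt_mono max.cobounded2 phi_filt vac_ket)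
    then show ?case by (intro exI[of _ "max 0 (d + n)"]) auto
  qed
  then show thesis using that by blast
qed

text \<open>By cyclicity, two operators that agree on \<open>ket\<close> and pass through every mode
  by the same rule are equal. Commutation and inversion of exponentials are proved in this
  way.\<close>

lemma linop_eqI:
  assumes "linop A" "linop B" "A ket = B ket"
    and "\<And>n v. A v = B v \<Longrightarrow> A (phi n v) = B (phi n v)"
  shows "A v = B v"
  by (induction v rule: F_induct) (use assms in \<open>simp_all add: linop_add linop_scale\<close>)

definition Fplus :: "'f set" where "Fplus = {v. \<exists>d. v \<in> filt plus d}"

lemma FplusE: assumes "v \<in> Fplus" obtains d where "d \<ge> 0" "v \<in> filt plus d"
proof -
  obtain d where "v \<in> filt plus d" using assms by (auto simp: Fplus_def)
  then have "v \<in> filt plus (max 0 d)" by (rule filt_mono) auto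
  then show thesis by (intro that[of "max 0 d"]) auto
qed

lemma FplusI: "v \<in> filt plus d \<Longrightarrow> v \<in> Fplus" by (auto simp: Fplus_def)

lemma Fplus_plus: "plus \<in> Fplus" by (rule FplusI[of _ 0]) (rule filt_vac, simp)
lemma Fplus_add: "u \<in> Fplus \<Longrightarrow> v \<in> Fplus \<Longrightarrow> u + v \<in> Fplus"
proof -
  assume "u \<in> Fplus" "v \<in> Fplus"
  then obtain d e where "u \<in> filt plus d" "v \<in> filt plus e" by (auto simp: Fplus_def)
  then have "u + v \<in> filt plus (max d e)" by (intro filt_add) (auto elim: filt_mono)
  then show ?thesis by (rule FplusI)
qed
lemma Fplus_scale: "v \<in> Fplus \<Longrightarrow> scale c v \<in> Fplus"
  by (auto simp: Fplus_def intro: filt_scale)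
lemma Fplus_neg: "v \<in> Fplus \<Longrightarrow> - v \<in> Fplus" by (auto simp: Fplus_def intro: filt_neg)
lemma Fplus_diff: "u \<in> Fplus \<Longrightarrow> v \<in> Fplus \<Longrightarrow> u - v \<in> Fplus"
  using Fplus_add[of u "- v"] Fplus_neg by simp
lemma Fplus_phi: "v \<in> Fplus \<Longrightarrow> phi n v \<in> Fplus"
  by (auto simp: Fplus_def intro: phi_filt[OF vac_plus])

text \<open>Moved past a positive mode, \<open>phi 0\<close> only exposes that mode to
  \<open>bra\<close>, and both sides are 0; factors \<open>phi 0\<close> square to 1, and
  \<open>plus\<close> is fixed. On the whole module the claim fails, as \<open>bra ket = 1\<close>
  and \<open>bra (phi 0 ket) = 0\<close> show.\<close>

lemma bra_phi_0: "v \<in> Fplus \<Longrightarrow> bra (phi 0 v) = bra v"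
proof -
  have word: "bra (phi 0 (foldr phi (map int a) plus)) = bra (foldr phi (map int a) plus)" for a
  proof (induction a)
    case Nil
    then show ?case by (simp add: phi_0_plus)
  next
    case (Cons b a)
    show ?case
    proof (cases "b = 0")
      case True
      then show ?thesis using Cons by (simp add: phi_0_square)
    next
      case False
      then show ?thesis
        using phi_swap[of 0 "int b" "foldr phi (map int a) plus"] by (simp add: bra_neg bra_phi)
    qed
  qed
  assume "v \<in> Fplus"
  then obtain d where "v \<in> filt plus d" by (auto simp: Fplus_def)
  then show ?thesis
    by (induction rule: filt_induct) (simp_all add: word phi_add phi_scale phi_0 bra_add bra_scale)
qed

subsection \<open>Linear combinations of modes\<close>

definition lin :: "(int \<Rightarrow> scalars) \<Rightarrow> 'f \<Rightarrow> 'f" where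
  "lin c v = Sum_any (\<lambda>j. scale (c j) (phi j v))"

lemma lin_eq:
  assumes "vac \<Omega>" "v \<in> filt \<Omega> d" "\<And>j. j > n \<Longrightarrow> c j = 0" "a \<le> - d" "n \<le> b"
  shows "lin c v = (\<Sum>j = a..b. scale (c j) (phi j v))"
  unfolding lin_def
proof (rule Sum_any.expand_superset)
  show "{j. scale (c j) (phi j v) \<noteq> 0} \<subseteq> {a..b}"
  proof clarify
    fix j assume j: "scale (c j) (phi j v) \<noteq> 0"
    then have "\<not> j < - d" using phi_vanish[OF assms(1,2)] by auto
    moreover have "\<not> j > n" using assms(3) j by auto
    ultimately show "j \<in> {a..b}" using assms by auto
  qed
qed simp

lemma lin_linop:
  assumes "\<And>j. j > n \<Longrightarrow> c j = 0"
  shows "linop (lin c)"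
proof (rule linopI)
  fix u v :: 'f
  obtain d e where d: "d \<ge> 0" "u \<in> filt ket d" "e \<ge> 0" "v \<in> filt ket e" using ex_filt by metis
  then have "u \<in> filt ket (d + e)" "v \<in> filt ket (d + e)" by (auto elim: filt_mono)
  moreover from this have "u + v \<in> filt ket (d + e)" by (rule filt_add)
  ultimately show "lin c (u + v) = lin c u + lin c v"
    by (simp add: lin_eq[OF vac_ket _ assms order_refl order_refl] phi_add scale_right_distrib sum.distrib)
next
  fix s v
  obtain d where d: "d \<ge> 0" "v \<in> filt ket d" using ex_filt by metis
  then have "scale s v \<in> filt ket d" by (intro filt_scale)
  then show "lin c (scale s v) = scale s (lin c v)" using d
    by (simp add: lin_eq[OF vac_ket _ assms order_refl order_refl] phi_scale scale_sum_right mult.commute)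
qed

lemma lin_add:
  assumes "\<And>j. j > n \<Longrightarrow> c j = 0" "\<And>j. j > n \<Longrightarrow> e j = 0"
  shows "lin (\<lambda>j. c j + e j) v = lin c v + lin e v"
proof -
  obtain d where d: "d \<ge> 0" "v \<in> filt ket d" using ex_filt by metis
  show ?thesis
    by (subst (1 2 3) lin_eq[OF vac_ket d(2), of n _ "- d" n])
      (use assms in \<open>auto simp: scale_left_distrib sum.distrib\<close>)
qed

lemma lin_scale:
  assumes "\<And>j. j > n \<Longrightarrow> c j = 0"
  shows "lin (\<lambda>j. s * c j) v = scale s (lin c v)"
proof -
  obtain d where d: "d \<ge> 0" "v \<in> filt ket d" using ex_filt by metis
  show ?thesis
    by (subst (1 2) lin_eq[OF vac_ket d(2), of n _ "- d" n])
      (use assms in \<open>auto simp: scale_sum_right\<close>)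
qed

lemma lin_filt:
  assumes "vac \<Omega>" "v \<in> filt \<Omega> d" "\<And>j. j > n \<Longrightarrow> c j = 0"
  shows "lin c v \<in> filt \<Omega> (d + n)"
  by (subst lin_eq[OF assms order_refl order_refl])
    (auto intro!: filt_sum filt_scale filt_mono[OF phi_filt[OF assms(1,2)]])

lemma lin_single: "lin (\<lambda>j. if j = n then c else 0) v = scale c (phi n v)"
  unfolding lin_def
  by (subst Sum_any.expand_superset[of "{n}"]) auto

lemma lin_Fplus: "v \<in> Fplus \<Longrightarrow> (\<And>j. j > n \<Longrightarrow> c j = 0) \<Longrightarrow> lin c v \<in> Fplus"
  unfolding Fplus_def using lin_filt[OF vac_plus] by blast

text \<open>The coefficient of z^n in f(z) phi(z), where phi(z) is the generating series of the
  modes.\<close>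

definition act :: "scalars fps \<Rightarrow> int \<Rightarrow> 'f \<Rightarrow> 'f" where
  "act f n = lin (\<lambda>j. if j \<le> n then f $ nat (n - j) else 0)"

lemma act_eq:
  assumes "vac \<Omega>" "v \<in> filt \<Omega> d" "n + d \<le> int N"
  shows "act f n v = (\<Sum>k\<le>N. scale (f $ k) (phi (n - int k) v))"
proof -
  have "act f n v = (\<Sum>j = n - int N..n. scale (if j \<le> n then f $ nat (n - j) else 0) (phi j v))"
    unfolding act_def by (rule lin_eq[OF assms(1,2)]) (use assms in auto)
  also have "\<dots> = (\<Sum>k\<le>N. scale (f $ k) (phi (n - int k) v))"
    by (rule sum.reindex_bij_witness[of _ "\<lambda>k. n - int k" "\<lambda>j. nat (n - j)"]) auto
  finally show ?thesis .
qed

lemma act_linop: "linop (act f n)"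
  unfolding act_def by (rule lin_linop[of n]) auto

lemma act_1: "act 1 n v = phi n v"
proof -
  have "act 1 n v = lin (\<lambda>j. if j = n then 1 else 0) v"
    unfolding act_def by (rule arg_cong[of _ _ "\<lambda>c. lin c v"]) (auto simp: fun_eq_iff)
  then show ?thesis by (simp add: lin_single)
qed

lemma act_add: "act (f + g) n v = act f n v + act g n v"
  unfolding act_def
  by (subst lin_add[of n, symmetric]) (auto intro!: arg_cong[of _ _ "\<lambda>c. lin c v"])

lemma act_scale: "act (fps_const c * f) n v = scale c (act f n v)"
  unfolding act_def
  by (subst lin_scale[of n, symmetric]) (auto intro!: arg_cong[of _ _ "\<lambda>c. lin c v"])

lemma act_0: "act 0 n v = 0"
  using act_scale[of 0 0 n v] by simp

lemma act_sum: "act (\<Sum>a\<in>A. f a) n v = (\<Sum>a\<in>A. act (f a) n v)"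
  by (induction A rule: infinite_finite_induct) (simp_all add: act_0 act_add)

lemma act_mult:
  assumes "vac \<Omega>" "v \<in> filt \<Omega> d" "n + d \<le> int N"
  shows "act (f * g) n v = (\<Sum>k\<le>N. scale (f $ k) (act g (n - int k) v))"
proof -
  have "act (f * g) n v = (\<Sum>m\<le>N. \<Sum>k\<le>m. scale (f $ k * g $ (m - k)) (phi (n - int m) v))"
    by (subst act_eq[OF assms]) (simp add: fps_mult_nth scale_sum_left atMost_atLeast0)
  also have "\<dots> = (\<Sum>k\<le>N. \<Sum>m\<in>{k..N}. scale (f $ k * g $ (m - k)) (phi (n - int m) v))"
    unfolding sum.Sigma[OF finite_atMost ballI[OF finite_atMost]] sum.Sigma[OF finite_atMost ballI[OF finite_atLeastAtMost]]
    by (rule sum.reindex_bij_witness[of _ "\<lambda>(k, m). (m, k)" "\<lambda>(m, k). (k, m)"]) auto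
  also have "\<dots> = (\<Sum>k\<le>N. scale (f $ k) (act g (n - int k) v))"
  proof (rule sum.cong)
    fix k assume "k \<in> {..N}"
    then have k: "k \<le> N" by simp
    have "act g (n - int k) v = (\<Sum>i\<le>N - k. scale (g $ i) (phi (n - int k - int i) v))"
      by (rule act_eq[OF assms(1,2)]) (use k assms in \<open>auto simp: of_nat_diff\<close>)
    also have "\<dots> = (\<Sum>m\<in>{k..N}. scale (g $ (m - k)) (phi (n - int m) v))"
      by (rule sum.reindex_bij_witness[of _ "\<lambda>m. m - k" "\<lambda>i. i + k"]) (use k in \<open>auto simp: of_nat_diff algebra_simps\<close>)
    finally show "(\<Sum>m\<in>{k..N}. scale (f $ k * g $ (m - k)) (phi (n - int m) v)) = scale (f $ k) (act g (n - int k) v)"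
      by (simp add: scale_sum_right)
  qed simp
  finally show ?thesis .
qed

end

subsection \<open>Exponentials of power series\<close>

lemma scalars_of_nat_cancel: "mps_const (1 / of_nat (Suc n)) * (of_nat (Suc n) * a) = (a :: scalars)"
proof -
  have "mps_const (1 / of_nat (Suc n)) * of_nat (Suc n) = (mps_const (1 / of_nat (Suc n) * of_nat (Suc n)) :: scalars)"
    unfolding mps_const_mult mps_const_of_nat ..
  also have "\<dots> = 1" by (simp del: of_nat_Suc)
  finally show ?thesis by (simp only: mult.assoc[symmetric] mult_1_left)
qed

text \<open>The exponential is characterised by its differential equation, so that a rational
  function can be recognised as one; \<open>is_exp_unique\<close> then identifies it with the series
  \<open>efps\<close>.\<close>

definition is_exp :: "scalars fps \<Rightarrow> scalars fps \<Rightarrow> bool" where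
  "is_exp t f \<longleftrightarrow> f $ 0 = 1 \<and> fps_deriv f = fps_deriv t * f"

lemma is_exp_unique: assumes "is_exp t f" "is_exp t g" shows "f = g"
proof (rule fps_ext)
  fix n
  show "f $ n = g $ n"
  proof (induction n rule: less_induct)
    case (less n)
    show ?case
    proof (cases n)
      case 0
      then show ?thesis using assms by (simp add: is_exp_def)
    next
      case (Suc m)
      have r: "h $ Suc m = mps_const (1 / of_nat (Suc m)) * (\<Sum>i=0..m. fps_deriv t $ i * h $ (m - i))"
        if "is_exp t h" for h
      proof -
        have "fps_deriv h $ m = (fps_deriv t * h) $ m" using that by (simp add: is_exp_def)
        then have "of_nat (Suc m) * h $ Suc m = (\<Sum>i=0..m. fps_deriv t $ i * h $ (m - i))"
          by (simp add: fps_mult_nth)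
        then show ?thesis using scalars_of_nat_cancel[of m "h $ Suc m"] by simp
      qed
      have "(\<Sum>i=0..m. fps_deriv t $ i * f $ (m - i)) = (\<Sum>i=0..m. fps_deriv t $ i * g $ (m - i))"
        by (rule sum.cong) (use less Suc in auto)
      then show ?thesis using r[OF assms(1)] r[OF assms(2)] Suc by simp
    qed
  qed
qed

lemma is_exp_0: "is_exp 0 1" by (simp add: is_exp_def)

lemma is_exp_add: "is_exp t f \<Longrightarrow> is_exp s g \<Longrightarrow> is_exp (t + s) (f * g)"
  by (simp add: is_exp_def algebra_simps)

lemma is_exp_sum: "finite A \<Longrightarrow> (\<And>a. a \<in> A \<Longrightarrow> is_exp (t a) (f a)) \<Longrightarrow> is_exp (\<Sum>a\<in>A. t a) (\<Prod>a\<in>A. f a)"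
  by (induction A rule: finite_induct) (auto simp: is_exp_0 is_exp_add)

definition geo :: "'a::comm_ring_1 \<Rightarrow> 'a fps" where "geo s = Abs_fps (\<lambda>k. s ^ k)"

lemma geo_times: "geo s * (1 - fps_const s * fps_X) = 1"
proof -
  have "geo s - fps_const s * (fps_X * geo s) = 1"
    by (rule fps_ext) (auto simp: geo_def fps_X_mult_nth simp flip: power_Suc)
  then show ?thesis by (simp add: algebra_simps)
qed

text \<open>The expansion of (1 + s z)/(1 - s z), the factor by which the exponentials below
  multiply a field.\<close>

definition gser :: "'a::comm_ring_1 \<Rightarrow> 'a fps" where "gser s = Abs_fps (\<lambda>k. if k = 0 then 1 else 2 * s ^ k)"

lemma gser_eq: "gser s = geo s * (1 + fps_const s * fps_X)"
proof -
  have "gser s = geo s + fps_const s * (fps_X * geo s)"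
    by (rule fps_ext) (auto simp: gser_def geo_def fps_X_mult_nth simp flip: power_Suc)
  then show ?thesis by (simp add: algebra_simps)
qed

lemma gser_times: "gser s * (1 - fps_const s * fps_X) = 1 + fps_const s * fps_X"
  using geo_times[of s] unfolding gser_eq
  by (simp only: mult.assoc mult.commute[of "1 + _"]) (simp only: mult.assoc[symmetric] mult_1_left)

definition tser :: "scalars \<Rightarrow> scalars fps" where
  "tser s = Abs_fps (\<lambda>k. if odd k then 2 * mps_const (1 / of_nat k) * s ^ k else 0)"

text \<open>\<open>tser s\<close> is the logarithm of (1 + s z)/(1 - s z): its derivative is 2s/(1 -
  s^2 z^2). The proof first clears this denominator and then divides by means of the two geometric
  series.\<close>

lemma is_exp_tser: "is_exp (tser s) (gser s)"
proof -
  let ?c = "fps_const s"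
  let ?A = "1 - ?c * fps_X" and ?B = "1 + ?c * fps_X"
  let ?G = "geo s" and ?H = "geo (- s)"
  have G: "?G * ?A = 1" by (rule geo_times)
  have H: "?H * ?B = 1" using geo_times[of "- s"] by (simp flip: fps_const_neg)
  have dt: "fps_deriv (tser s) $ k = (if even k then 2 * s ^ Suc k else 0)" for k
  proof (cases "even k")
    case True
    then have "fps_deriv (tser s) $ k = of_nat (Suc k) * (2 * mps_const (1 / of_nat (Suc k)) * s ^ Suc k)"
      unfolding fps_deriv_nth tser_def by simp
    also have "\<dots> = mps_const (1 / of_nat (Suc k)) * (of_nat (Suc k) * (2 * s ^ Suc k))"
      by (simp only: ac_simps)
    also have "\<dots> = 2 * s ^ Suc k" by (rule scalars_of_nat_cancel)
    finally show ?thesis using True by simp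
  qed (simp add: tser_def)
  have "fps_deriv (tser s) - fps_const (s ^ 2) * (fps_X ^ 2 * fps_deriv (tser s)) = 2 * ?c"
  proof (rule fps_ext)
    fix k
    show "(fps_deriv (tser s) - fps_const (s ^ 2) * (fps_X ^ 2 * fps_deriv (tser s))) $ k = (2 * ?c) $ k"
    proof (cases "k < 2")
      case True
      then have "k = 0 \<or> k = 1" by auto
      then show ?thesis by (auto simp: dt fps_X_power_mult_nth numeral_fps_const simp del: fps_deriv_nth)
    next
      case False
      then obtain m where "k = m + 2" by (metis add.commute le_Suc_ex not_less)
      then show ?thesis
        by (simp add: dt fps_X_power_mult_nth numeral_fps_const power2_eq_square mult_ac del: fps_deriv_nth)
    qed
  qed
  then have "fps_deriv (tser s) * (?A * ?B) = 2 * ?c"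
    by (simp add: algebra_simps power2_eq_square flip: fps_const_mult)
  then have t: "fps_deriv (tser s) * ?A * ?B = 2 * ?c" by (simp add: mult.assoc)
  have t': "fps_deriv (tser s) = 2 * ?c * ?G * ?H"
  proof -
    have "2 * ?c * ?G * ?H = fps_deriv (tser s) * (?G * ?A) * (?H * ?B)"
      unfolding t[symmetric] by (simp only: mult_ac)
    then show ?thesis unfolding G H by simp
  qed
  have "fps_deriv (?G * ?A) = 0" unfolding G by simp
  then have "fps_deriv ?G * ?A = ?c * ?G"
    by (simp add: algebra_simps)
  moreover have "fps_deriv ?G = (fps_deriv ?G * ?A) * ?G"
    unfolding mult.assoc mult.commute[of ?A ?G] G by simp
  ultimately have G': "fps_deriv ?G = ?c * ?G * ?G" by simp
  have "fps_deriv (gser s) = ?c * ?G * ?G * ?B + ?G * ?c"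
    unfolding gser_eq by (simp add: G' algebra_simps)
  also have "?G * ?c = ?c * ?G * (?G * ?A)" unfolding G by simp
  also have "?c * ?G * ?G * ?B + ?c * ?G * (?G * ?A) = 2 * ?c * ?G * ?G" by (simp add: algebra_simps)
  also have "\<dots> = 2 * ?c * ?G * ?G * (?H * ?B)" unfolding H by simp
  also have "\<dots> = fps_deriv (tser s) * gser s" unfolding t' gser_eq by (simp only: mult_ac)
  finally show ?thesis by (simp add: is_exp_def gser_def)
qed

definition dpow :: "scalars fps \<Rightarrow> nat \<Rightarrow> scalars fps" where
  "dpow t i = fps_const (mps_const (1 / of_nat (fact i))) * t ^ i"

definition efps :: "scalars fps \<Rightarrow> scalars fps" where
  "efps t = Abs_fps (\<lambda>m. \<Sum>i\<le>m. dpow t i $ m)"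

lemma inv_fact_Suc: "(mps_const (1 / of_nat (fact i)) :: scalars)
    = of_nat (Suc i) * mps_const (1 / of_nat (fact (Suc i)))"
proof -
  have "(1 :: qbeta) / of_nat (fact i) = of_nat (Suc i) * (1 / of_nat (fact (Suc i)))"
  proof -
    have "(of_nat (fact (Suc i)) :: qbeta) = of_nat (Suc i) * of_nat (fact i)"
      by (simp only: fact_Suc of_nat_mult of_nat_id)
    then show ?thesis by (simp del: of_nat_Suc fact_Suc of_nat_fact)
  qed
  then have "(mps_const (1 / of_nat (fact i)) :: scalars) = mps_const (of_nat (Suc i) * (1 / of_nat (fact (Suc i))))"
    by (rule arg_cong)
  then show ?thesis unfolding mps_const_mult mps_const_of_nat .
qed

lemma dpow_times: "dpow t i * t = of_nat (Suc i) * dpow t (Suc i)"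
proof -
  have "dpow t i * t = of_nat (Suc i) * fps_const (mps_const (1 / of_nat (fact (Suc i)))) * (t ^ i * t)"
    unfolding dpow_def inv_fact_Suc[of i] by (simp only: fps_of_nat[symmetric] fps_const_mult[symmetric] mult_ac)
  then show ?thesis by (simp add: dpow_def mult_ac)
qed

lemma dpow_deriv: "fps_deriv (dpow t (Suc i)) = fps_deriv t * dpow t i"
proof -
  have "fps_deriv (dpow t (Suc i)) = fps_const (mps_const (1 / of_nat (fact (Suc i)))) * (fps_const (of_nat (Suc i)) * fps_deriv t * t ^ i)"
    unfolding dpow_def by (simp add: fps_deriv_power del: of_nat_Suc power_Suc fact_Suc of_nat_fact)
  also have "\<dots> = fps_deriv t * (fps_const (of_nat (Suc i) * mps_const (1 / of_nat (fact (Suc i)))) * t ^ i)"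
    by (simp only: fps_const_mult[symmetric] mult_ac)
  finally show ?thesis unfolding inv_fact_Suc[symmetric] dpow_def .
qed

lemma dpow_less: "t $ 0 = 0 \<Longrightarrow> m < i \<Longrightarrow> dpow t i $ m = 0"
  by (simp add: dpow_def startsby_zero_power_prefix)

lemma is_exp_efps: assumes t: "t $ 0 = 0" shows "is_exp t (efps t)"
proof -
  have "fps_deriv (efps t) = fps_deriv t * efps t"
  proof (rule fps_ext)
    fix m
    have e: "efps t $ k = (\<Sum>i\<le>m. dpow t i $ k)" if "k \<le> m" for k
      unfolding efps_def fps_nth_Abs_fps
      by (rule sum.mono_neutral_left) (use that t in \<open>auto simp: dpow_less\<close>)
    have "fps_deriv (efps t) $ m = (\<Sum>i\<le>Suc m. fps_deriv (dpow t i) $ m)"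
      by (simp add: efps_def sum_distrib_left del: sum.atMost_Suc)
    also have "\<dots> = (\<Sum>i\<le>m. (fps_deriv t * dpow t i) $ m)"
      by (subst sum.atMost_Suc_shift) (simp add: dpow_deriv dpow_def[of t 0] del: fps_deriv_nth)
    also have "\<dots> = (\<Sum>a=0..m. fps_deriv t $ a * (\<Sum>i\<le>m. dpow t i $ (m - a)))"
      unfolding fps_mult_nth sum_distrib_left by (rule sum.swap)
    also have "\<dots> = (fps_deriv t * efps t) $ m"
      unfolding fps_mult_nth by (rule sum.cong) (simp_all add: e)
    finally show "fps_deriv (efps t) $ m = (fps_deriv t * efps t) $ m" .
  qed
  then show ?thesis by (simp add: is_exp_def efps_def dpow_def)
qed

section \<open>Quadratic operators and their exponentials\<close>

definition odd_fps :: "scalars fps \<Rightarrow> bool" where "odd_fps t \<longleftrightarrow> (\<forall>k. even k \<longrightarrow> t $ k = 0)"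

lemma odd_fps_0: "odd_fps t \<Longrightarrow> t $ 0 = 0" by (simp add: odd_fps_def)

text \<open>For odd t this is the sum of t_k b_k over k > 0: the word [p, q] occurs in b_k exactly
  when p + q = -k, with coefficient (-1)^q / 4. Both theta and the Hamiltonian have this
  form.\<close>

definition quad :: "scalars fps \<Rightarrow> fermion_series" where
  "quad t w = (case w of [p, q] \<Rightarrow> if p + q < 0 then t $ nat (- (p + q)) * mps_const (1 / 4 * neg_one_pow q) else 0
    | _ \<Rightarrow> 0)"

lemma quad_simp: "quad t [p, q] = (if p + q < 0 then t $ nat (- (p + q)) * mps_const (1 / 4 * neg_one_pow q) else 0)"
  by (simp add: quad_def)

lemma quad_nonzeroD: "quad t w \<noteq> 0 \<Longrightarrow> \<exists>p q. w = [p, q] \<and> p + q < 0"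
  by (auto simp: quad_def split: list.splits if_splits)

context scalar_fermions begin

definition bos :: "scalars fps \<Rightarrow> 'f \<Rightarrow> 'f" where "bos t = fs_act scale phi (quad t)"

lemma bos_eq:
  assumes "vac \<Omega>" "v \<in> filt \<Omega> d" "d \<le> N"
  shows "bos t v = (\<Sum>p = -N..N. \<Sum>q = -N..N. scale (quad t [p, q]) (phi p (phi q v)))"
proof -
  let ?B = "{-N..N} \<times> {-N..N}"
  have "bos t v = (\<Sum>w\<in>(\<lambda>(p, q). [p, q]) ` ?B. scale (quad t w) (foldr phi w v))"
    unfolding bos_def fs_act_def
  proof (rule Sum_any.expand_superset)
    show "{w. scale (quad t w) (foldr phi w v) \<noteq> 0} \<subseteq> (\<lambda>(p, q). [p, q]) ` ?B"
    proof
      fix w assume w: "w \<in> {w. scale (quad t w) (foldr phi w v) \<noteq> 0}"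
      then have "quad t w \<noteq> 0" by auto
      then obtain p q where pq: "w = [p, q]" "p + q < 0" using quad_nonzeroD by blast
      then have nz: "phi p (phi q v) \<noteq> 0" using w by auto
      then have "\<not> q < - d" using phi_vanish[OF assms(1,2)] phi_0 by metis
      moreover have "\<not> p < - d"
        using nz phi_swap[of p q v] pq(2) phi_vanish[OF assms(1,2), of p] phi_0 by auto
      ultimately show "w \<in> (\<lambda>(p, q). [p, q]) ` ?B" using pq assms(3) by auto
    qed
  qed simp
  also have "\<dots> = (\<Sum>(p, q)\<in>?B. scale (quad t [p, q]) (phi p (phi q v)))"
    by (subst sum.reindex) (auto simp: inj_on_def split_def)
  finally show ?thesis by (simp add: sum.cartesian_product)
qed

lemma bos_linop: "linop (bos t)"
proof (rule linopI)
  fix u v :: 'f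
  obtain d e where d: "d \<ge> 0" "u \<in> filt ket d" "e \<ge> 0" "v \<in> filt ket e" using ex_filt by metis
  then have "u \<in> filt ket (d + e)" "v \<in> filt ket (d + e)" by (auto elim: filt_mono)
  moreover from this have "u + v \<in> filt ket (d + e)" by (rule filt_add)
  ultimately show "bos t (u + v) = bos t u + bos t v"
    by (simp add: bos_eq[OF vac_ket _ order_refl] phi_add scale_right_distrib sum.distrib)
next
  fix s v
  obtain d where d: "d \<ge> 0" "v \<in> filt ket d" using ex_filt by metis
  then have "scale s v \<in> filt ket d" by (intro filt_scale)
  then show "bos t (scale s v) = scale s (bos t v)" using d
    by (simp add: bos_eq[OF vac_ket _ order_refl] phi_scale scale_sum_right mult.commute)
qed

lemma bos_filt:
  assumes "vac \<Omega>" "v \<in> filt \<Omega> d" shows "bos t v \<in> filt \<Omega> (d - 1)"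
proof -
  have "scale (quad t [p, q]) (phi p (phi q v)) \<in> filt \<Omega> (d - 1)" for p q
  proof (cases "p + q < 0")
    case True
    have "phi p (phi q v) \<in> filt \<Omega> (d + q + p)" by (intro phi_filt assms)
    then show ?thesis using True by (intro filt_scale) (auto elim: filt_mono)
  qed (simp add: quad_simp filt_0)
  then show ?thesis by (subst bos_eq[OF assms order_refl]) (intro filt_sum)
qed

lemma bos_vac: "vac \<Omega> \<Longrightarrow> bos t \<Omega> = 0"
  by (rule filt_below_0[OF bos_filt[OF _ filt_vac[OF order_refl]]]) auto

lemma phi_pair_commute:
  "phi p (phi q (phi n v)) = phi n (phi p (phi q v))
    + (if q = - n then scale (2 * neg_one_pow n) (phi p v) else 0)
    - (if p = - n then scale (2 * neg_one_pow n) (phi q v) else 0)"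
proof -
  have "phi p (phi q (phi n v)) = - phi p (phi n (phi q v)) + (if q = - n then scale (2 * neg_one_pow n) (phi p v) else 0)"
    using arg_cong[OF phi_swap[of q n v], of "phi p"]
    by (cases "q = - n") (simp_all add: eq_neg_iff_add_eq_0[symmetric] phi_diff phi_neg phi_scale phi_add)
  moreover have "phi p (phi n (phi q v)) = - phi n (phi p (phi q v)) + (if p = - n then scale (2 * neg_one_pow n) (phi q v) else 0)"
    using phi_swap[of p n "phi q v"] by (cases "p = - n") (simp_all add: eq_neg_iff_add_eq_0[symmetric])
  ultimately show ?thesis by simp
qed

text \<open>For odd k the commutator of b_k with the mode n is the mode n - k, so the commutator
  with the field is multiplication by t(z).\<close>

lemma bos_phi:
  assumes t: "odd_fps t"
  shows "bos t (phi n v) = phi n (bos t v) + act t n v"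
proof -
  obtain d where d: "d \<ge> 0" "v \<in> filt ket d" using ex_filt by metis
  define N where "N = d + \<bar>n\<bar>"
  let ?S = "\<lambda>p q. scale (quad t [p, q])"
  let ?e = "2 * neg_one_pow n :: scalars"
  \<comment> \<open>The mode p arises from contracting q in the words [p, -n] and from contracting p
    in the words [-n, p], with opposite signs. For n - p odd the two contributions add up; for n - p
    even the coefficient of t is 0.\<close>
  have c: "(quad t [p, - n] - quad t [- n, p]) * ?e = (if p \<le> n then t $ nat (n - p) else 0)" for p
  proof (cases "p < n")
    case True
    show ?thesis
    proof (cases "even (n - p)")
      case True
      then have "even (nat (n - p))" using \<open>p < n\<close> by (simp add: even_nat_iff)
      then show ?thesis using True t \<open>p < n\<close> by (simp add: quad_simp odd_fps_def)
    next
      case False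
      then have "neg_one_pow p = (- neg_one_pow n :: qbeta)" by (auto simp: neg_one_pow_def)
      then have "(quad t [p, - n] - quad t [- n, p]) * ?e
          = t $ nat (n - p) * (mps_const (1 / 4 * neg_one_pow n - 1 / 4 * neg_one_pow p) * mps_const (2 * neg_one_pow n))"
        using True unfolding mps_const_diff by (simp add: quad_simp algebra_simps mps_const_mult mps_const_neg_one_pow)
      also have "mps_const (1 / 4 * neg_one_pow n - 1 / 4 * neg_one_pow p) * mps_const (2 * neg_one_pow n)
          = (mps_const (neg_one_pow n * neg_one_pow n) :: scalars)"
        unfolding mps_const_mult[symmetric] \<open>neg_one_pow p = _\<close> by (rule arg_cong[of _ _ mps_const]) (simp add: field_simps)
      finally show ?thesis using True by (simp add: neg_one_pow_mult)
    qed
  next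
    case False
    then show ?thesis using odd_fps_0[OF t] by (cases "p = n") (auto simp: quad_simp)
  qed
  have mn: "- n \<in> {-N..N}" using d(1) by (auto simp: N_def)
  have 1: "phi n v \<in> filt ket (d + n)" by (rule phi_filt[OF vac_ket d(2)])
  have "bos t (phi n v) = (\<Sum>p = -N..N. \<Sum>q = -N..N. ?S p q (phi p (phi q (phi n v))))"
    by (rule bos_eq[OF vac_ket 1]) (simp add: N_def)
  also have "\<dots> = (\<Sum>p = -N..N. \<Sum>q = -N..N. ?S p q (phi n (phi p (phi q v))))
      + (\<Sum>p = -N..N. \<Sum>q = -N..N. if q = - n then ?S p q (scale ?e (phi p v)) else 0)
      - (\<Sum>p = -N..N. \<Sum>q = -N..N. if p = - n then ?S p q (scale ?e (phi q v)) else 0)"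
    unfolding phi_pair_commute[of _ _ n v] sum.distrib[symmetric] sum_subtractf[symmetric]
    by (intro sum.cong refl) (simp add: scale_right_distrib scale_right_diff_distrib)
  also have "(\<Sum>p = -N..N. \<Sum>q = -N..N. ?S p q (phi n (phi p (phi q v)))) = phi n (bos t v)"
    by (subst bos_eq[OF vac_ket d(2), of N]) (simp_all add: N_def phi_sum phi_scale)
  also have "(\<Sum>p = -N..N. \<Sum>q = -N..N. if q = - n then ?S p q (scale ?e (phi p v)) else 0)
      = (\<Sum>p = -N..N. scale (quad t [p, - n] * ?e) (phi p v))"
    by (intro sum.cong refl) (subst sum.delta, use mn in auto)
  also have "(\<Sum>p = -N..N. \<Sum>q = -N..N. if p = - n then ?S p q (scale ?e (phi q v)) else 0)
      = (\<Sum>q = -N..N. scale (quad t [- n, q] * ?e) (phi q v))"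
    by (subst sum.swap, intro sum.cong refl) (subst sum.delta, use mn in auto)
  also have "phi n (bos t v) + (\<Sum>p = -N..N. scale (quad t [p, - n] * ?e) (phi p v))
      - (\<Sum>q = -N..N. scale (quad t [- n, q] * ?e) (phi q v))
      = phi n (bos t v) + (\<Sum>p = -N..N. scale ((quad t [p, - n] - quad t [- n, p]) * ?e) (phi p v))"
    by (simp only: left_diff_distrib scale_left_diff_distrib sum_subtractf add_diff_eq)
  also have "(\<Sum>p = -N..N. scale ((quad t [p, - n] - quad t [- n, p]) * ?e) (phi p v)) = act t n v"
    unfolding c act_def by (rule lin_eq[OF vac_ket d(2), of n, symmetric]) (use d(1) in \<open>auto simp: N_def\<close>)
  finally show ?thesis .
qed

lemma bos_act:
  assumes t: "odd_fps t"
  shows "bos t (act g n v) = act g n (bos t v) + act (g * t) n v"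
proof -
  obtain d where d: "d \<ge> 0" "v \<in> filt ket d" using ex_filt by metis
  define N where "N = nat (n + d)"
  have N: "n + d \<le> int N" by (simp add: N_def)
  have 1: "bos t v \<in> filt ket d" using bos_filt[OF vac_ket d(2)] by (rule filt_mono) simp
  have "bos t (act g n v) = (\<Sum>k\<le>N. scale (g $ k) (phi (n - int k) (bos t v))) + (\<Sum>k\<le>N. scale (g $ k) (act t (n - int k) v))"
    by (simp add: act_eq[OF vac_ket d(2) N] linop_sum[OF bos_linop] linop_scale[OF bos_linop]
        bos_phi[OF t] scale_right_distrib sum.distrib)
  then show ?thesis by (simp add: act_eq[OF vac_ket 1 N] act_mult[OF vac_ket d(2) N])
qed

text \<open>Both orders pick up the same multiplication by t s when passing a mode, and both kill
  \<open>ket\<close>; so no central term appears.\<close>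

lemma bos_commute:
  assumes "odd_fps t" "odd_fps s"
  shows "bos t (bos s v) = bos s (bos t v)"
proof (rule linop_eqI[of "\<lambda>v. bos t (bos s v)" "\<lambda>v. bos s (bos t v)"])
  fix n v assume "bos t (bos s v) = bos s (bos t v)"
  then show "bos t (bos s (phi n v)) = bos s (bos t (phi n v))"
    by (simp add: bos_phi assms linop_add[OF bos_linop] bos_act mult.commute)
qed (auto intro: linop_comp bos_linop simp: bos_vac vac_ket linop_0[OF bos_linop])

lemma bos_const: "bos (fps_const c * t) v = scale c (bos t v)"
proof -
  obtain d where d: "d \<ge> 0" "v \<in> filt ket d" using ex_filt by metis
  have "quad (fps_const c * t) w = c * quad t w" for w
    by (auto simp: quad_def algebra_simps split: list.splits)
  then show ?thesis by (simp add: bos_eq[OF vac_ket d(2) order_refl] scale_sum_right)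
qed

definition dbos :: "scalars fps \<Rightarrow> nat \<Rightarrow> 'f \<Rightarrow> 'f" where
  "dbos t k v = csc (1 / of_nat (fact k)) ((bos t ^^ k) v)"

lemma bos_pow_linop: "linop (bos t ^^ k)"
  by (induction k) (use linop_id in \<open>auto simp: o_def id_def intro: linop_comp bos_linop\<close>)

lemma dbos_linop: "linop (dbos t k)"
  using linop_scl[OF bos_pow_linop] unfolding dbos_def by simp

lemma dbos_filt: assumes "vac \<Omega>" "v \<in> filt \<Omega> d" shows "dbos t k v \<in> filt \<Omega> (d - int k)"
proof -
  have "(bos t ^^ k) v \<in> filt \<Omega> (d - int k)"
  proof (induction k)
    case (Suc k)
    then show ?case using bos_filt[OF assms(1) Suc] by (simp add: algebra_simps)
  qed (use assms in simp)
  then show ?thesis unfolding dbos_def by (rule filt_scale)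
qed

lemma dbos_0: "dbos t 0 v = v" by (simp add: dbos_def)

lemma bos_dbos: "bos t (dbos t k v) = scale (of_nat (Suc k)) (dbos t (Suc k) v)"
  unfolding dbos_def inv_fact_Suc[of k] by (simp add: linop_scale[OF bos_linop] mult.commute del: fact_Suc of_nat_Suc)

lemma scale_Suc_cancel: "scale (of_nat (Suc k)) u = scale (of_nat (Suc k)) v \<Longrightarrow> u = v"
proof -
  assume a: "scale (of_nat (Suc k)) u = scale (of_nat (Suc k)) v"
  have "csc (1 / of_nat (Suc k)) (scale (of_nat (Suc k)) w) = w" for w
    using scalars_of_nat_cancel[of k 1] by (simp only: scale_scale mult_1_right scale_one)
  then show "u = v" using a by metis
qed

text \<open>The Leibniz rule for divided powers. In the induction step the weights N + 1 - i, from
  the operators that stay, and i, from the power of t, add up to N + 1, which is then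
  cancelled.\<close>

lemma dbos_phi:
  assumes t: "odd_fps t"
  shows "dbos t N (phi n v) = (\<Sum>i\<le>N. act (dpow t i) n (dbos t (N - i) v))"
proof (induction N)
  case 0
  have "dpow t 0 = 1" by (simp add: dpow_def)
  then show ?case by (simp add: dbos_0 act_1)
next
  case (Suc N)
  let ?A = "\<lambda>i j. act (dpow t i) n (dbos t j v)"
  have cn: "act (of_nat k * g) n u = scale (of_nat k) (act g n u)" for k g u
    using act_scale[of "of_nat k"] by (simp add: fps_of_nat)
  have "scale (of_nat (Suc N)) (dbos t (Suc N) (phi n v)) = bos t (dbos t N (phi n v))"
    by (simp only: bos_dbos)
  also have "\<dots> = (\<Sum>i\<le>N. scale (of_nat (Suc N - i)) (?A i (Suc N - i))) + (\<Sum>i\<le>N. scale (of_nat (Suc i)) (?A (Suc i) (N - i)))"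
    unfolding Suc linop_sum[OF bos_linop] bos_act[OF t] bos_dbos dpow_times cn linop_scale[OF act_linop] sum.distrib
    by (intro arg_cong2[of _ _ _ _ "(+)"] sum.cong refl) (simp_all add: Suc_diff_le)
  also have "(\<Sum>i\<le>N. scale (of_nat (Suc N - i)) (?A i (Suc N - i))) = (\<Sum>i\<le>Suc N. scale (of_nat (Suc N - i)) (?A i (Suc N - i)))"
    by simp
  also have "(\<Sum>i\<le>N. scale (of_nat (Suc i)) (?A (Suc i) (N - i))) = (\<Sum>i\<le>Suc N. scale (of_nat i) (?A i (Suc N - i)))"
    by (subst sum.atMost_Suc_shift) simp
  also have "(\<Sum>i\<le>Suc N. scale (of_nat (Suc N - i)) (?A i (Suc N - i))) + (\<Sum>i\<le>Suc N. scale (of_nat i) (?A i (Suc N - i)))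
      = (\<Sum>i\<le>Suc N. scale (of_nat (Suc N)) (?A i (Suc N - i)))"
    unfolding sum.distrib[symmetric] scale_left_distrib[symmetric] of_nat_add[symmetric]
    by (intro sum.cong refl) simp
  finally have "scale (of_nat (Suc N)) (dbos t (Suc N) (phi n v)) = scale (of_nat (Suc N)) (\<Sum>i\<le>Suc N. ?A i (Suc N - i))"
    by (simp only: scale_sum_right)
  then show ?case by (rule scale_Suc_cancel)
qed

definition bexp :: "scalars fps \<Rightarrow> 'f \<Rightarrow> 'f" where "bexp t = op_exp scale (bos t)"

lemma bexp_eq:
  assumes "vac \<Omega>" "v \<in> filt \<Omega> d" "d \<le> int N"
  shows "bexp t v = (\<Sum>k\<le>N. dbos t k v)"
  unfolding bexp_def op_exp_def dbos_def[symmetric]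
proof (rule Sum_any.expand_superset)
  show "{k. dbos t k v \<noteq> 0} \<subseteq> {..N}"
  proof
    fix k assume "k \<in> {k. dbos t k v \<noteq> 0}"
    then have k: "dbos t k v \<noteq> 0" by simp
    show "k \<in> {..N}"
    proof (rule ccontr)
      assume "k \<notin> {..N}"
      then have "dbos t k v = 0" using assms by (intro filt_below_0[OF dbos_filt[OF assms(1,2)]]) auto
      with k show False by simp
    qed
  qed
qed simp

lemma bexp_linop: "linop (bexp t)"
proof (rule linopI)
  fix u v :: 'f
  obtain d e where d: "d \<ge> 0" "u \<in> filt ket d" "e \<ge> 0" "v \<in> filt ket e" using ex_filt by metis
  then have "u \<in> filt ket (d + e)" "v \<in> filt ket (d + e)" by (auto elim: filt_mono)
  moreover from this have "u + v \<in> filt ket (d + e)" by (rule filt_add)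
  moreover have "d + e \<le> int (nat (d + e))" by simp
  ultimately show "bexp t (u + v) = bexp t u + bexp t v"
    using bexp_eq[OF vac_ket, of _ "d + e" "nat (d + e)"] by (simp add: linop_add[OF dbos_linop] sum.distrib)
next
  fix s v
  obtain d where d: "d \<ge> 0" "v \<in> filt ket d" using ex_filt by metis
  then have "scale s v \<in> filt ket d" by (intro filt_scale)
  then show "bexp t (scale s v) = scale s (bexp t v)" using d bexp_eq[OF vac_ket, of _ "d" "nat d"]
    by (simp add: linop_scale[OF dbos_linop] scale_sum_right)
qed

lemma bexp_filt: assumes "vac \<Omega>" "v \<in> filt \<Omega> d" shows "bexp t v \<in> filt \<Omega> d"
proof -
  have "dbos t k v \<in> filt \<Omega> d" for k using dbos_filt[OF assms] by (rule filt_mono) simp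
  then show ?thesis by (subst bexp_eq[OF assms, of "nat d"]) (auto intro: filt_sum)
qed

lemma bexp_vac: "vac \<Omega> \<Longrightarrow> bexp t \<Omega> = \<Omega>"
  by (subst bexp_eq[OF _ filt_vac[OF order_refl], of \<Omega> 0]) (simp_all add: dbos_0)

lemma bexp_Fplus: "v \<in> Fplus \<Longrightarrow> bexp t v \<in> Fplus"
  unfolding Fplus_def using bexp_filt[OF vac_plus] by blast

lemma bexp_phi:
  assumes t: "odd_fps t" and f: "is_exp t f"
  shows "bexp t (phi n v) = act f n (bexp t v)"
proof -
  have f: "f = efps t" using is_exp_unique[OF f is_exp_efps] t by (simp add: odd_fps_0)
  obtain d where d: "d \<ge> 0" "v \<in> filt ket d" using ex_filt by metis
  define A where "A = nat (n + d)"
  define D where "D = nat d"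
  let ?a = "\<lambda>i j. act (dpow t i) n (dbos t j v)"
  have dz: "dbos t j v = 0" if "j > D" for j
    by (rule filt_below_0[OF dbos_filt[OF vac_ket d(2)]]) (use that d in \<open>auto simp: D_def\<close>)
  have dj: "dbos t j v \<in> filt ket d" for j
    using dbos_filt[OF vac_ket d(2)] by (rule filt_mono) simp
  have A: "n + d \<le> int A" by (simp add: A_def)
  have az: "?a i j = 0" if "i > A" for i j
    by (subst act_eq[OF vac_ket dj A]) (use that odd_fps_0[OF t] in \<open>auto simp: dpow_less\<close>)
  have "bexp t (phi n v) = (\<Sum>K\<le>A + D. dbos t K (phi n v))"
    by (rule bexp_eq[OF vac_ket phi_filt[OF vac_ket d(2)]]) (use d in \<open>auto simp: A_def D_def\<close>)
  also have "\<dots> = (\<Sum>(K, i)\<in>Sigma {..A + D} (\<lambda>K. {..K}). ?a i (K - i))"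
    by (simp add: dbos_phi[OF t] sum.Sigma)
  also have "\<dots> = (\<Sum>(i, j)\<in>{(i, j). i + j \<le> A + D}. ?a i j)"
    by (rule sum.reindex_bij_witness[of _ "\<lambda>(i, j). (i + j, i)" "\<lambda>(K, i). (i, K - i)"]) auto
  \<comment> \<open>The triangular range of summation is cut down to a rectangle: for i > A the
    power of t starts in too high a degree, and for j > D the divided power kills v.\<close>
  also have "\<dots> = (\<Sum>(i, j)\<in>{..A} \<times> {..D}. ?a i j)"
  proof (rule sum.mono_neutral_right)
    have "{(i, j). i + j \<le> A + D} \<subseteq> {..A + D} \<times> {..A + D}" by auto
    then show "finite {(i, j). i + j \<le> A + D}" by (rule finite_subset) simp
    have "?a i j = 0" if "i > A \<or> j > D" for i j
      using that az dz linop_0[OF act_linop] by metis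
    then show "\<forall>x\<in>{(i, j). i + j \<le> A + D} - {..A} \<times> {..D}. (case x of (i, j) \<Rightarrow> ?a i j) = 0"
      by (auto simp: not_le) (metis not_le)+
  qed auto
  also have "\<dots> = (\<Sum>j\<le>D. \<Sum>i\<le>A. ?a i j)"
    by (subst sum.swap) (simp add: sum.cartesian_product)
  also have "\<dots> = (\<Sum>j\<le>D. act f n (dbos t j v))"
  proof (rule sum.cong)
    fix j
    have "(\<Sum>i\<le>A. dpow t i) $ k = f $ k" if "k \<le> A" for k
      unfolding f efps_def fps_nth_Abs_fps fps_sum_nth
      by (rule sum.mono_neutral_right) (use that odd_fps_0[OF t] in \<open>auto simp: dpow_less\<close>)
    then have "act (\<Sum>i\<le>A. dpow t i) n (dbos t j v) = act f n (dbos t j v)"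
      by (subst (1 2) act_eq[OF vac_ket dj A]) (auto intro: sum.cong)
    then show "(\<Sum>i\<le>A. ?a i j) = act f n (dbos t j v)" by (simp add: act_sum)
  qed simp
  also have "\<dots> = act f n (bexp t v)"
    by (subst bexp_eq[OF vac_ket d(2), of D]) (use d in \<open>auto simp: D_def linop_sum[OF act_linop]\<close>)
  finally show ?thesis .
qed

lemma bexp_act:
  assumes t: "odd_fps t" "is_exp t f"
  shows "bexp t (act g n v) = act (g * f) n (bexp t v)"
proof -
  obtain d where d: "d \<ge> 0" "v \<in> filt ket d" using ex_filt by metis
  define N where "N = nat (n + d)"
  have N: "n + d \<le> int N" by (simp add: N_def)
  show ?thesis
    by (simp add: act_eq[OF vac_ket d(2) N] linop_sum[OF bexp_linop] linop_scale[OF bexp_linop]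
        bexp_phi[OF t] act_mult[OF vac_ket bexp_filt[OF vac_ket d(2)] N])
qed

lemma bexp_commute_bos:
  assumes "odd_fps t" "odd_fps s"
  shows "bexp t (bos s v) = bos s (bexp t v)"
proof -
  obtain d where d: "d \<ge> 0" "v \<in> filt ket d" using ex_filt by metis
  have 1: "bos s v \<in> filt ket d" using bos_filt[OF vac_ket d(2)] by (rule filt_mono) simp
  have "(bos t ^^ k) (bos s v) = bos s ((bos t ^^ k) v)" for k
    by (induction k) (simp_all add: bos_commute[OF assms])
  then show ?thesis
    using bexp_eq[OF vac_ket d(2), of "nat d"] bexp_eq[OF vac_ket 1, of "nat d"]
    by (simp add: dbos_def linop_sum[OF bos_linop] linop_scale[OF bos_linop])
qed

lemma bexp_inverse:
  assumes "odd_fps t" "odd_fps s" "is_exp t f" "is_exp s g" "f * g = 1"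
  shows "bexp t (bexp s v) = v"
proof (rule linop_eqI[of "\<lambda>v. bexp t (bexp s v)" "\<lambda>v. v"])
  fix n v assume "bexp t (bexp s v) = v"
  then show "bexp t (bexp s (phi n v)) = phi n v"
    using assms by (simp add: bexp_phi[OF assms(2,4)] bexp_act[OF assms(1,3)] act_1 mult.commute)
qed (auto intro: linop_comp bexp_linop linop_id simp: bexp_vac vac_ket)

end

section \<open>The operator theta and the bosonic modes\<close>

lemma sum_triangle:
  fixes f :: "nat \<Rightarrow> nat \<Rightarrow> 'a::comm_monoid_add"
  shows "(\<Sum>k\<le>n. \<Sum>i\<le>k. f k i) = (\<Sum>i\<le>n. \<Sum>j\<le>n - i. f (i + j) i)"
  unfolding sum.Sigma[OF finite_atMost ballI[OF finite_atMost]]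
  by (rule sum.reindex_bij_witness[of _ "\<lambda>(i, j). (i + j, i)" "\<lambda>(k, i). (i, k - i)"]) auto

lemma fs_lincomb_superset:
  assumes "finite J" "J \<subseteq> I" "\<And>i. i \<in> I - J \<Longrightarrow> c i * X i w = 0"
  shows "fs_lincomb I c X w = (\<Sum>i\<in>J. c i * X i w)"
  unfolding fs_lincomb_def
  by (rule sum.mono_neutral_left) (use assms in auto)

lemma b_op_apply: "b_op m w = (case w of [p, q] \<Rightarrow> if p + q = - m then mps_const (1 / 4 * neg_one_pow q) else 0 | _ \<Rightarrow> 0)"
proof -
  have z: "b_op m w = 0" if "\<And>i. w \<noteq> [- i - m, i]"
    unfolding b_op_def by (subst fs_lincomb_superset[of "{}"]) (use that in \<open>auto simp: fs_word_def\<close>)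
  consider p q where "w = [p, q]" "p + q = - m" | "\<And>i. w \<noteq> [- i - m, i]" by force
  then show ?thesis
  proof cases
    case 1
    then have "w = [- q - m, q]" by simp
    then show ?thesis unfolding b_op_def
      by (subst fs_lincomb_superset[of "{q}"]) (auto simp: fs_word_def)
  next
    case 2
    have "p + q \<noteq> - m" if "w = [p, q]" for p q using 2[of q] that by auto
    then show ?thesis unfolding z[OF 2] by (auto split: list.splits)
  qed
qed

definition tgam :: "scalars fps" where "tgam = tser (mps_const gam)"

lemma theta_eq_quad: "theta = quad tgam"
proof
  fix w
  consider p q k where "w = [p, q]" "p + q = - int k" "k > 0" | p q where "w = [p, q]" "p + q \<ge> 0" | "\<And>p q. w \<noteq> [p, q]"
  proof (cases "\<exists>p q. w = [p, q]")
    case True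
    then obtain p q where w: "w = [p, q]" by blast
    show thesis
    proof (cases "p + q < 0")
      case True
      then show ?thesis using that(1)[of p q "nat (- (p + q))"] w by simp
    qed (use that(2) w in auto)
  qed (use that(3) in auto)
  then show "theta w = quad tgam w"
  proof cases
    case 1
    show ?thesis
    proof (cases "odd k")
      case True
      have "theta w = (\<Sum>n\<in>{k}. mps_const (2 * (beta / 2) ^ n / of_nat n) * b_op (int n) w)"
        unfolding theta_def by (rule fs_lincomb_superset) (use True 1 in \<open>auto simp: b_op_apply\<close>)
      moreover have "mps_const (2 * (beta / 2) ^ k / of_nat k) = (2 * mps_const (1 / of_nat k) * mps_const gam ^ k :: scalars)"
      proof -
        have "(2 * (beta / 2) ^ k / of_nat k :: qbeta) = 2 * (1 / of_nat k) * gam ^ k" by (simp add: gam_def)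
        then show ?thesis by (simp only: mps_const_mult mps_const_power mps_const_numeral)
      qed
      ultimately show ?thesis using 1 True by (simp add: b_op_apply quad_simp tgam_def tser_def)
    next
      case False
      have "theta w = (\<Sum>n\<in>{}. mps_const (2 * (beta / 2) ^ n / of_nat n) * b_op (int n) w)"
        unfolding theta_def by (rule fs_lincomb_superset) (use False 1 in \<open>auto simp: b_op_apply\<close>)
      then show ?thesis using 1 False by (simp add: quad_simp tgam_def tser_def)
    qed
  next
    case 2
    have "theta w = (\<Sum>n\<in>{}. mps_const (2 * (beta / 2) ^ n / of_nat n) * b_op (int n) w)"
      unfolding theta_def by (rule fs_lincomb_superset) (use 2 in \<open>auto simp: b_op_apply dest: odd_pos\<close>)
    then show ?thesis using 2 by (simp add: quad_simp)
  next
    case 3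
    have "theta w = (\<Sum>n\<in>{}. mps_const (2 * (beta / 2) ^ n / of_nat n) * b_op (int n) w)"
      unfolding theta_def by (rule fs_lincomb_superset) (use 3 in \<open>auto simp: b_op_apply split: list.splits\<close>)
    moreover have "quad tgam w = 0" using 3 by (auto simp: quad_def split: list.splits)
    ultimately show ?thesis by simp
  qed
qed

lemma odd_tser: "odd_fps (tser s)" by (simp add: odd_fps_def tser_def)

lemma tser_minus: "tser (- s) = - tser s"
  by (rule fps_ext) (simp add: tser_def)

lemma gser_minus: "gser s * gser (- s) = 1" for s :: "'a::comm_ring_1"
proof -
  have "gser s * gser (- s) = (geo s * (1 - fps_const s * fps_X)) * (geo (- s) * (1 - fps_const (- s) * fps_X))"
    unfolding gser_eq by (simp add: mult_ac flip: fps_const_neg)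
  then show ?thesis by (simp only: geo_times mult_1)
qed

definition hcoeff :: "nat \<Rightarrow> scalars" where "hcoeff j = (if j = 0 then 1 else 2)"
definition ocoeff :: "nat \<Rightarrow> scalars" where "ocoeff j = (if odd j then 2 else 0)"

text \<open>For h(z) = (1 + z)/(1 - z) = exp t(z) this is z h' = (z t') h: \<open>hcoeff\<close>
  lists the coefficients of h, and \<open>ocoeff\<close> those of z t'.\<close>

lemma hcoeff_ocoeff: "(\<Sum>i\<le>l. ocoeff i * hcoeff (l - i)) = of_nat l * hcoeff l"
proof (cases l)
  case 0
  then show ?thesis by (simp add: ocoeff_def)
next
  case (Suc m)
  have g: "gser (1 :: scalars) $ i = hcoeff i" for i by (simp add: gser_def hcoeff_def)
  have t: "fps_deriv (tser 1) $ i = ocoeff (Suc i)" for i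
  proof (cases "even i")
    case True
    then have "fps_deriv (tser 1) $ i = of_nat (Suc i) * (2 * mps_const (1 / of_nat (Suc i)))"
      unfolding fps_deriv_nth tser_def by simp
    also have "\<dots> = mps_const (1 / of_nat (Suc i)) * (of_nat (Suc i) * 2)" by (simp only: ac_simps)
    also have "\<dots> = 2" by (rule scalars_of_nat_cancel)
    finally show ?thesis using True by (simp add: ocoeff_def)
  qed (simp add: tser_def ocoeff_def)
  have "fps_deriv (gser 1) $ m = (fps_deriv (tser 1) * gser 1) $ m"
    using is_exp_tser[of 1] by (simp add: is_exp_def)
  then have "of_nat (Suc m) * hcoeff (Suc m) = (\<Sum>i\<le>m. ocoeff (Suc i) * hcoeff (m - i))"
    by (simp add: fps_mult_nth t g atMost_atLeast0 del: fps_deriv_nth) (simp add: g)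
  also have "\<dots> = (\<Sum>i\<le>l. ocoeff i * hcoeff (l - i))"
    unfolding Suc by (subst sum.atMost_Suc_shift) (simp add: ocoeff_def)
  finally show ?thesis using Suc by simp
qed

context scalar_fermions begin

lemma odd_tgam: "odd_fps tgam" "odd_fps (- tgam)"
  using odd_tser[of "mps_const gam"] odd_tser[of "- mps_const gam"] unfolding tser_minus tgam_def by auto

lemma is_exp_tgam: "is_exp tgam (gser (mps_const gam))" "is_exp (- tgam) (gser (- mps_const gam))"
  using is_exp_tser[of "mps_const gam"] is_exp_tser[of "- mps_const gam"] unfolding tser_minus tgam_def by auto

definition E :: "'f \<Rightarrow> 'f" where "E = bexp tgam"
definition Ei :: "'f \<Rightarrow> 'f" where "Ei = bexp (- tgam)"

lemma E_Ei: "E (Ei v) = v"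
  unfolding E_def Ei_def using odd_tgam is_exp_tgam gser_minus by (intro bexp_inverse) auto

lemma Ei_E: "Ei (E v) = v"
  unfolding E_def Ei_def using odd_tgam is_exp_tgam gser_minus by (intro bexp_inverse) (auto simp: mult.commute)

lemma Ei_eq: "Ei = op_exp scale (\<lambda>u. - fs_act scale phi theta u)"
proof -
  have "bos (- tgam) = (\<lambda>u. - fs_act scale phi theta u)"
  proof
    fix u
    have "- tgam = fps_const (- 1) * tgam" by (simp flip: fps_const_neg)
    then have "bos (- tgam) u = scale (- 1) (bos tgam u)" using bos_const by metis
    then show "bos (- tgam) u = - fs_act scale phi theta u" by (simp add: bos_def theta_eq_quad)
  qed
  then show ?thesis by (simp add: Ei_def bexp_def)
qed

definition bj :: "nat \<Rightarrow> 'f \<Rightarrow> 'f" where "bj j v = bos (if odd j then fps_X ^ j else 0) v"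

lemma odd_bj: "odd_fps (if odd j then fps_X ^ j else 0)" by (auto simp: odd_fps_def fps_X_power_nth)

lemma bj_linop: "linop (bj j)" unfolding bj_def by (rule bos_linop)

lemma act_X_power: "act (fps_X ^ j) n v = phi (n - int j) v"
proof -
  have "(\<lambda>i. if i \<le> n then (fps_X ^ j :: scalars fps) $ nat (n - i) else 0) = (\<lambda>i. if i = n - int j then 1 else 0)"
    by (auto simp: fps_X_power_nth fun_eq_iff)
  then show ?thesis by (simp add: act_def lin_single)
qed

lemma bj_phi: "odd j \<Longrightarrow> bj j (phi n v) = phi n (bj j v) + phi (n - int j) v"
  using bos_phi[OF odd_bj, of j n v] by (simp add: bj_def act_X_power)

lemma bos_filt_odd: "vac \<Omega> \<Longrightarrow> v \<in> filt \<Omega> d \<Longrightarrow> bj j v \<in> filt \<Omega> (d - int j)"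
proof -
  assume v: "vac \<Omega>" "v \<in> filt \<Omega> d"
  have "scale (quad (if odd j then fps_X ^ j else 0) [p, q]) (phi p (phi q v)) \<in> filt \<Omega> (d - int j)" for p q
  proof (cases "p + q = - int j")
    case True
    have "phi p (phi q v) \<in> filt \<Omega> (d + q + p)" by (intro phi_filt v)
    then show ?thesis using True by (intro filt_scale) (auto elim: filt_mono)
  next
    case False
    then have "quad (if odd j then fps_X ^ j else 0) [p, q] = 0"
      by (auto simp: quad_simp fps_X_power_nth)
    then show ?thesis by (simp add: filt_0)
  qed
  then show ?thesis unfolding bj_def by (subst bos_eq[OF v order_refl]) (intro filt_sum)
qed

subsection \<open>The modes of a one-parameter vertex operator\<close>

text \<open>
  The operators \<open>Mop k\<close> are the coefficients of
  $M(W) = \exp \big(2 \sum_{j\ \mathrm{odd}} \frac{W^j}{j} b_j\big)$, which satisfies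
  $M(W) \phi(w) = \frac{1 + wW}{1 - wW} \phi(w) M(W)$; the recursion is $W M'(W) = 2 \sum_j W^j b_j M(W)$.
\<close>

fun Mop :: "nat \<Rightarrow> 'f \<Rightarrow> 'f" where
  "Mop 0 v = v"
| "Mop (Suc k) v = csc (1 / of_nat (Suc k)) (\<Sum>i\<le>k. scale (ocoeff (Suc i)) (bj (Suc i) (Mop (k - i) v)))"

lemma Mop_rec: "scale (of_nat k) (Mop k v) = (\<Sum>i\<le>k. scale (ocoeff i) (bj i (Mop (k - i) v)))"
proof (cases k)
  case (Suc m)
  have "scale (of_nat (Suc m)) (csc (1 / of_nat (Suc m)) w) = w" for w
    using scalars_of_nat_cancel[of m 1]
    by (simp only: scale_scale mult_1_right scale_one mult.commute[of "of_nat (Suc m)"])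
  then show ?thesis unfolding Suc by (subst sum.atMost_Suc_shift) (simp add: ocoeff_def del: of_nat_Suc)
qed (simp add: ocoeff_def)

lemma Mop_linop: "linop (Mop k)"
proof (induction k rule: less_induct)
  case (less k)
  show ?case
  proof (cases k)
    case 0
    then show ?thesis using linop_id by (simp add: Mop.simps(1)[abs_def])
  next
    case (Suc m)
    then have "linop (Mop (m - i))" for i using less by simp
    then show ?thesis unfolding Suc Mop.simps(2)[abs_def]
      by (intro linop_scl linop_sums linop_comp[OF bj_linop])
  qed
qed

lemma Mop_filt:
  assumes "vac \<Omega>" "v \<in> filt \<Omega> d"
  shows "Mop k v \<in> filt \<Omega> (d - int k)"
proof (induction k rule: less_induct)
  case (less k)
  show ?case
  proof (cases k)
    case (Suc m)
    have "bj (Suc i) (Mop (m - i) v) \<in> filt \<Omega> (d - int k)" if "i \<le> m" for i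
    proof -
      have "Mop (m - i) v \<in> filt \<Omega> (d - int (m - i))" by (rule less) (use Suc in auto)
      from bos_filt_odd[OF assms(1) this, of "Suc i"] show ?thesis
        by (rule filt_mono) (use that Suc in auto)
    qed
    then show ?thesis unfolding Suc Mop.simps(2) by (intro filt_scale filt_sum) auto
  qed (use assms in simp)
qed

lemma Mop_Fplus: "v \<in> Fplus \<Longrightarrow> Mop k v \<in> Fplus"
  unfolding Fplus_def using Mop_filt[OF vac_plus] by blast

lemma Mop_vac: "vac \<Omega> \<Longrightarrow> Mop k \<Omega> = (if k = 0 then \<Omega> else 0)"
  using filt_below_0[OF Mop_filt[OF _ filt_vac[OF order_refl], of \<Omega> k]] by auto

lemma Mop_vanish: "vac \<Omega> \<Longrightarrow> v \<in> filt \<Omega> d \<Longrightarrow> int k > d \<Longrightarrow> Mop k v = 0"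
  by (rule filt_below_0[OF Mop_filt]) auto

lemma Mop_commute_gen:
  assumes "linop T" "\<And>j v. T (bj j v) = bj j (T v)"
  shows "T (Mop k v) = Mop k (T v)"
proof (induction k arbitrary: v rule: less_induct)
  case (less k)
  show ?case
  proof (cases k)
    case (Suc m)
    then have "T (Mop (m - i) v) = Mop (m - i) (T v)" for i using less by simp
    then show ?thesis unfolding Suc Mop.simps(2) by (simp add: linop_scale linop_sum assms)
  qed simp
qed

lemma Mop_bos: "odd_fps t \<Longrightarrow> bos t (Mop k v) = Mop k (bos t v)"
  by (rule Mop_commute_gen[OF bos_linop]) (simp add: bj_def bos_commute odd_bj)

lemma Mop_bexp: "odd_fps t \<Longrightarrow> bexp t (Mop k v) = Mop k (bexp t v)"
  by (rule Mop_commute_gen[OF bexp_linop]) (simp add: bj_def bexp_commute_bos odd_bj)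

lemma Mop_bj: "bj j (Mop k v) = Mop k (bj j v)"
  unfolding bj_def by (rule Mop_bos[OF odd_bj])

lemma Mop_commute: "Mop l (Mop k v) = Mop k (Mop l v)"
  by (rule Mop_commute_gen[OF Mop_linop]) (simp add: Mop_bj)

lemma Mop_E: "E (Mop k v) = Mop k (E v)" unfolding E_def by (rule Mop_bexp[OF odd_tgam(1)])

text \<open>Multiplied by K, the recursion of \<open>Mop\<close> yields the weight K - l from the
  operators that pass the mode and, by \<open>hcoeff_ocoeff\<close>, the weight l from the modes
  they create. The total K is cancelled.\<close>

lemma Mop_phi: "Mop k (phi n v) = (\<Sum>j\<le>k. scale (hcoeff j) (phi (n - int j) (Mop (k - j) v)))"
proof (induction k rule: less_induct)
  case (less K)
  show ?case
  proof (cases K)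
    case 0
    then show ?thesis by (simp add: hcoeff_def)
  next
    case (Suc m)
    have bb: "scale (ocoeff i) (bj i (phi n u)) = scale (ocoeff i) (phi n (bj i u)) + scale (ocoeff i) (phi (n - int i) u)" for i n u
      using bj_phi[of i n u] by (auto simp: ocoeff_def scale_right_distrib)
    have IH: "scale (ocoeff i) (bj i (Mop (K - i) (phi n v)))
        = (\<Sum>j\<le>K - i. scale (hcoeff j * ocoeff i) (phi (n - int j) (bj i (Mop (K - i - j) v))))
        + (\<Sum>j\<le>K - i. scale (hcoeff j * ocoeff i) (phi (n - int j - int i) (Mop (K - i - j) v)))" if "i \<le> K" for i
    proof (cases "i = 0")
      case True
      then show ?thesis by (simp add: ocoeff_def)
    next
      case False
      have "Mop (K - i) (phi n v) = (\<Sum>j\<le>K - i. scale (hcoeff j) (phi (n - int j) (Mop (K - i - j) v)))"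
        by (rule less) (use False that in auto)
      then have "scale (ocoeff i) (bj i (Mop (K - i) (phi n v)))
          = (\<Sum>j\<le>K - i. scale (hcoeff j) (scale (ocoeff i) (bj i (phi (n - int j) (Mop (K - i - j) v)))))"
        by (simp add: linop_sum[OF bj_linop] linop_scale[OF bj_linop] scale_sum_right mult.commute)
      then show ?thesis unfolding bb by (simp add: scale_right_distrib sum.distrib)
    qed
    have "scale (of_nat K) (Mop K (phi n v)) = (\<Sum>i\<le>K. scale (ocoeff i) (bj i (Mop (K - i) (phi n v))))"
      by (rule Mop_rec)
    also have "\<dots> = (\<Sum>i\<le>K. \<Sum>j\<le>K - i. scale (hcoeff j * ocoeff i) (phi (n - int j) (bj i (Mop (K - i - j) v))))
        + (\<Sum>i\<le>K. \<Sum>j\<le>K - i. scale (hcoeff j * ocoeff i) (phi (n - int j - int i) (Mop (K - i - j) v)))"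
      by (simp add: IH sum.distrib)
    also have "(\<Sum>i\<le>K. \<Sum>j\<le>K - i. scale (hcoeff j * ocoeff i) (phi (n - int j) (bj i (Mop (K - i - j) v))))
        = (\<Sum>j\<le>K. \<Sum>i\<le>K - j. scale (hcoeff j * ocoeff i) (phi (n - int j) (bj i (Mop (K - j - i) v))))"
      unfolding sum.Sigma[OF finite_atMost ballI[OF finite_atMost]]
      by (rule sum.reindex_bij_witness[of _ "\<lambda>(j, i). (i, j)" "\<lambda>(i, j). (j, i)"]) (auto simp: add.commute)
    also have "\<dots> = (\<Sum>j\<le>K. scale (hcoeff j) (phi (n - int j) (\<Sum>i\<le>K - j. scale (ocoeff i) (bj i (Mop (K - j - i) v)))))"
      by (simp add: phi_sum phi_scale scale_sum_right)
    also have "\<dots> = (\<Sum>j\<le>K. scale (of_nat (K - j)) (scale (hcoeff j) (phi (n - int j) (Mop (K - j) v))))"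
      unfolding Mop_rec[symmetric] phi_scale by (simp add: mult.commute)
    also have "(\<Sum>i\<le>K. \<Sum>j\<le>K - i. scale (hcoeff j * ocoeff i) (phi (n - int j - int i) (Mop (K - i - j) v)))
        = (\<Sum>l\<le>K. \<Sum>i\<le>l. scale (hcoeff (l - i) * ocoeff i) (phi (n - int l) (Mop (K - l) v)))"
      unfolding sum_triangle by (intro sum.cong refl) (simp add: algebra_simps)
    also have "\<dots> = (\<Sum>l\<le>K. scale (of_nat l) (scale (hcoeff l) (phi (n - int l) (Mop (K - l) v))))"
      by (simp add: scale_sum_left[symmetric] mult.commute[of "hcoeff (_ - _)"] hcoeff_ocoeff)
    also have "(\<Sum>j\<le>K. scale (of_nat (K - j)) (scale (hcoeff j) (phi (n - int j) (Mop (K - j) v))))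
       + (\<Sum>l\<le>K. scale (of_nat l) (scale (hcoeff l) (phi (n - int l) (Mop (K - l) v))))
      = (\<Sum>l\<le>K. scale (of_nat K) (scale (hcoeff l) (phi (n - int l) (Mop (K - l) v))))"
      unfolding sum.distrib[symmetric] scale_left_distrib[symmetric] of_nat_add[symmetric]
      by (intro sum.cong refl) simp
    finally have "scale (of_nat K) (Mop K (phi n v)) = scale (of_nat K) (\<Sum>j\<le>K. scale (hcoeff j) (phi (n - int j) (Mop (K - j) v)))"
      by (simp only: scale_sum_right)
    then show ?thesis unfolding Suc by (rule scale_Suc_cancel)
  qed
qed

text \<open>The exchange relation with its denominator 1 - wW cleared. It then has two terms on each
  side and survives the evaluation of w at a Laurent series.\<close>

lemma Mop_phi_Suc: "Mop (Suc k) (phi n v) = Mop k (phi (n - 1) v) + phi n (Mop (Suc k) v) + phi (n - 1) (Mop k v)"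
proof -
  have "Mop (Suc k) (phi n v) = phi n (Mop (Suc k) v)
      + (\<Sum>j\<le>k. scale (hcoeff (Suc j)) (phi (n - 1 - int j) (Mop (k - j) v)))"
    unfolding Mop_phi by (subst sum.atMost_Suc_shift) (simp add: hcoeff_def algebra_simps)
  also have "(\<Sum>j\<le>k. scale (hcoeff (Suc j)) (phi (n - 1 - int j) (Mop (k - j) v)))
      = (\<Sum>j\<le>k. scale (hcoeff j) (phi (n - 1 - int j) (Mop (k - j) v)) + (if j = 0 then phi (n - 1) (Mop k v) else 0))"
    by (rule sum.cong) (auto simp: hcoeff_def scale_left_distrib[of 1 1, simplified])
  finally show ?thesis by (simp add: sum.distrib Mop_phi)
qed

text \<open>M(-W) M(W) = 1, because the exponent of M is odd in W. The sum is multiplied by k = i +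
  (k - i), and the recursion is applied to the inner or the outer operator accordingly.\<close>

lemma Mop_inverse: "(\<Sum>i\<le>k. scale ((-1) ^ i) (Mop i (Mop (k - i) v))) = (if k = 0 then v else 0)"
proof (induction k rule: less_induct)
  case (less k)
  show ?case
  proof (cases k)
    case (Suc m)
    have A: "(\<Sum>i\<le>k. scale ((-1) ^ i) (scale (of_nat i) (Mop i (Mop (k - i) v))))
        = (\<Sum>a\<le>k. scale ((-1) ^ a * ocoeff a) (bj a (\<Sum>i\<le>k - a. scale ((-1) ^ i) (Mop i (Mop (k - a - i) v)))))"
    proof -
      have "(\<Sum>i\<le>k. scale ((-1) ^ i) (scale (of_nat i) (Mop i (Mop (k - i) v))))
        = (\<Sum>i\<le>k. \<Sum>a\<le>i. scale ((-1) ^ i * ocoeff a) (bj a (Mop (i - a) (Mop (k - i) v))))"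
        unfolding Mop_rec by (simp add: scale_sum_right)
      also have "\<dots> = (\<Sum>a\<le>k. \<Sum>j\<le>k - a. scale ((-1) ^ a * ocoeff a) (bj a (scale ((-1) ^ j) (Mop j (Mop (k - a - j) v)))))"
        unfolding sum_triangle by (simp add: linop_scale[OF bj_linop] power_add mult_ac)
      finally show ?thesis by (simp add: linop_sum[OF bj_linop] scale_sum_right)
    qed
    have B: "(\<Sum>i\<le>k. scale ((-1) ^ i) (scale (of_nat (k - i)) (Mop i (Mop (k - i) v))))
        = (\<Sum>a\<le>k. scale (ocoeff a) (bj a (\<Sum>i\<le>k - a. scale ((-1) ^ i) (Mop i (Mop (k - a - i) v)))))"
    proof -
      have "(\<Sum>i\<le>k. scale ((-1) ^ i) (scale (of_nat (k - i)) (Mop i (Mop (k - i) v))))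
        = (\<Sum>i\<le>k. \<Sum>a\<le>k - i. scale ((-1) ^ i * ocoeff a) (bj a (Mop i (Mop (k - i - a) v))))"
      proof (rule sum.cong)
        fix i
        have "scale (of_nat (k - i)) (Mop i (Mop (k - i) v)) = Mop i (scale (of_nat (k - i)) (Mop (k - i) v))"
          by (simp only: linop_scale[OF Mop_linop])
        also have "\<dots> = (\<Sum>a\<le>k - i. scale (ocoeff a) (bj a (Mop i (Mop (k - i - a) v))))"
          unfolding Mop_rec by (simp add: linop_sum[OF Mop_linop] linop_scale[OF Mop_linop] Mop_bj)
        finally show "scale ((-1) ^ i) (scale (of_nat (k - i)) (Mop i (Mop (k - i) v)))
            = (\<Sum>a\<le>k - i. scale ((-1) ^ i * ocoeff a) (bj a (Mop i (Mop (k - i - a) v))))"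
          by (simp only: scale_sum_right scale_scale)
      qed simp
      also have "\<dots> = (\<Sum>a\<le>k. \<Sum>i\<le>k - a. scale ((-1) ^ i * ocoeff a) (bj a (Mop i (Mop (k - a - i) v))))"
        unfolding sum.Sigma[OF finite_atMost ballI[OF finite_atMost]]
        by (rule sum.reindex_bij_witness[of _ "\<lambda>(j, i). (i, j)" "\<lambda>(i, j). (j, i)"]) (auto simp: add.commute)
      finally show ?thesis by (simp add: linop_sum[OF bj_linop] linop_scale[OF bj_linop] scale_sum_right mult.commute)
    qed
    have "scale (of_nat k) (\<Sum>i\<le>k. scale ((-1) ^ i) (Mop i (Mop (k - i) v)))
        = (\<Sum>i\<le>k. scale ((-1) ^ i) (scale (of_nat i) (Mop i (Mop (k - i) v))))
          + (\<Sum>i\<le>k. scale ((-1) ^ i) (scale (of_nat (k - i)) (Mop i (Mop (k - i) v))))"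
      unfolding sum.distrib[symmetric] scale_right_distrib[symmetric] scale_left_distrib[symmetric] of_nat_add[symmetric] scale_sum_right
      by (intro sum.cong refl) (simp add: mult.commute)
    \<comment> \<open>The sum \<open>A\<close> carries the additional sign (-1)^a, and
      \<open>ocoeff a\<close> vanishes for even a, so the two sums cancel term by term.\<close>
    also have "\<dots> = 0"
      unfolding A B sum.distrib[symmetric] scale_left_distrib[symmetric]
      by (rule sum.neutral) (auto simp: ocoeff_def)
    finally have "scale (of_nat (Suc m)) (\<Sum>i\<le>k. scale ((-1) ^ i) (Mop i (Mop (k - i) v))) = scale (of_nat (Suc m)) 0"
      unfolding Suc by (simp only: scale_zero_right)
    from scale_Suc_cancel[OF this] show ?thesis using Suc by simp
  qed simp
qed

subsection \<open>The functional of a creation operator\<close>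

text \<open>
  On \<open>Fplus\<close> the functional $\langle 0 | \phi(w)$ coincides with $\langle 0 | M(-1/w)$: this replaces all
  Wick and Pfaffian computations.
\<close>

lemma bra_phi_Mop:
  assumes "v \<in> Fplus"
  shows "bra (phi (- int l) v) = (-1) ^ l * bra (Mop l v)"
proof -
  let ?w = "\<lambda>a. foldr phi (map int a) plus"
  define Q where "Q v \<longleftrightarrow> (\<forall>l. bra (phi (- int l) v) = (-1) ^ l * bra (Mop l v))" for v
  have filtQ: "Q v" if "v \<in> filt plus e" "\<And>a. int (sum_list a) \<le> e \<Longrightarrow> Q (?w a)" for v e
    using that(1)
  proof (induction rule: filt_induct)
    case (word a)
    then show ?case by (rule that(2))
  qed (simp_all add: Q_def phi_add phi_scale phi_0 bra_add bra_scale bra_0 linop_add[OF Mop_linop]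
      linop_scale[OF Mop_linop] linop_0[OF Mop_linop] algebra_simps)
  have sgn: "(-1) ^ l * ((-1) ^ l * x) = (x :: scalars)" for l x
    by (simp flip: mult.assoc power_mult_distrib)
  \<comment> \<open>Applying \<open>Mop k\<close> with k > 0, or dropping a positive letter, lowers
    the degree; dropping a letter 0 merely shortens the word. Hence the lexicographic order.\<close>
  have wf: "wf (inv_image (less_than <*lex*> less_than) (\<lambda>a :: nat list. (sum_list a, length a)))"
    by auto
  have word: "Q (?w a)" for a
  proof (induction a rule: wf_induct_rule[OF wf])
    case (1 a)
    note IH = 1
    show ?case
    proof (cases a)
      case Nil
      have "bra (phi (- int l) plus) = (-1) ^ l * bra (Mop l plus)" for l
        by (cases "l = 0") (simp_all add: Mop_vac[OF vac_plus] phi_plus phi_0_plus bra_0)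
      then show ?thesis by (simp add: Nil Q_def)
    next
      case (Cons b a')
      let ?v = "?w a'"
      have F: "?v \<in> Fplus" using filt_word[OF order_refl] FplusI by blast
      have QM: "Q (Mop k ?v)" if "b > 0 \<or> k > 0" for k
      proof (rule filtQ)
        show "Mop k ?v \<in> filt plus (int (sum_list a) - 1)"
          by (rule filt_mono[OF Mop_filt[OF vac_plus filt_word[OF order_refl]]]) (use Cons that in auto)
        fix c assume "int (sum_list c) \<le> int (sum_list a) - 1"
        then show "Q (?w c)" by (intro IH) auto
      qed
      have Qv: "Q ?v" by (rule IH) (auto simp: Cons)
      have QM': "Q (Mop k ?v)" for k using QM[of k] Qv by (cases "k = 0") auto
      have QM'': "bra (phi (- int i) (Mop k ?v)) = (-1) ^ i * bra (Mop i (Mop k ?v))" for i k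
        using QM' by (simp add: Q_def)
      have P: "(\<Sum>i\<le>l. (-1) ^ i * bra (Mop i (Mop (l - i) ?v))) = (if l = 0 then bra ?v else 0)" for l
        using arg_cong[OF Mop_inverse[of l ?v], of bra] by (simp add: bra_sum bra_scale bra_0 split: if_splits)
      have "bra (phi (- int l) (phi (int b) ?v)) = (-1) ^ l * bra (Mop l (phi (int b) ?v))" for l
      proof (cases "b = 0")
        case True
        have R: "bra (Mop l (phi 0 ?v)) = 2 * (\<Sum>j\<le>l. bra (phi (- int j) (Mop (l - j) ?v))) - bra (phi 0 (Mop l ?v))"
          unfolding Mop_phi bra_sum bra_scale
          by (cases l) (simp_all add: sum.atMost_Suc_shift hcoeff_def sum_distrib_left del: sum.atMost_Suc)
        show ?thesis
        proof (cases "l = 0")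
          case True
          then show ?thesis using \<open>b = 0\<close> by (simp add: bra_phi_0 Fplus_phi F)
        next
          case False
          \<comment> \<open>The letter 0 produces a minus sign on either side: here by
            anticommutation, and in \<open>R\<close> because its sum is the coefficient of W^l in
            M(-W) M(W), which is 0 for l > 0.\<close>
          have "bra (phi (- int l) (phi 0 ?v)) = - bra (phi (- int l) ?v)"
            using phi_swap[of "- int l" 0 ?v] False by (simp add: bra_neg bra_phi_0 Fplus_phi F)
          also have "bra (phi (- int l) ?v) = (-1) ^ l * bra (Mop l ?v)" using Qv by (simp add: Q_def)
          finally show ?thesis using True False unfolding R QM'' P
            by (simp add: R QM'' P bra_phi_0 Mop_Fplus F)
        qed
      next
        case False
        \<comment> \<open>For a positive letter both sides reduce to a single contraction, present
          only at l = b. On the side of \<open>Mop\<close> the remaining sum is once more a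
          coefficient of M(-W) M(W).\<close>
        have "bra (phi (- int l) (phi (int b) ?v)) = (if l = b then 2 * (-1) ^ l * bra ?v else 0)"
          using phi_swap[of "- int l" "int b" ?v] False
          by (auto simp: bra_neg bra_phi bra_scale bra_add bra_diff bra_0 neg_one_pow_def minus_one_power_iff)
        moreover have "bra (Mop l (phi (int b) ?v)) = (if l = b then 2 * bra ?v else 0)"
        proof (cases "l < b")
          case True
          then show ?thesis unfolding Mop_phi bra_sum bra_scale
            by (auto intro!: sum.neutral simp: bra_phi)
        next
          case bl: False
          have "bra (Mop l (phi (int b) ?v)) = (\<Sum>j\<le>l. hcoeff j * bra (phi (int b - int j) (Mop (l - j) ?v)))"
            unfolding Mop_phi bra_sum bra_scale ..
          also have "\<dots> = (\<Sum>j\<in>{b..l}. hcoeff j * bra (phi (int b - int j) (Mop (l - j) ?v)))"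
            by (rule sum.mono_neutral_right) (auto simp: bra_phi)
          also have "\<dots> = (\<Sum>i\<le>l - b. 2 * ((-1) ^ i * bra (Mop i (Mop (l - b - i) ?v))))"
          proof (rule sum.reindex_bij_witness[of _ "\<lambda>i. i + b" "\<lambda>j. j - b"])
            fix j assume j: "j \<in> {b..l}"
            then have e: "int b - int j = - int (j - b)" "l - j = l - b - (j - b)" "hcoeff j = 2"
              using False by (auto simp: of_nat_diff hcoeff_def)
            show "2 * ((-1) ^ (j - b) * bra (Mop (j - b) (Mop (l - b - (j - b)) ?v)))
                = hcoeff j * bra (phi (int b - int j) (Mop (l - j) ?v))"
              unfolding e(1,3) QM'' unfolding e(2) ..
          qed (use bl in auto)
          finally show ?thesis using bl unfolding sum_distrib_left[symmetric] P by auto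
        qed
        ultimately show ?thesis by simp
      qed
      then show ?thesis by (simp add: Cons Q_def)
    qed
  qed
  obtain d where "v \<in> filt plus d" using assms by (auto simp: Fplus_def)
  then have "Q v" by (rule filtQ) (rule word)
  then show ?thesis by (simp add: Q_def)
qed

subsection \<open>Creating coherent vectors\<close>

text \<open>$X(w) = \phi(w) M(1/w)$, the operator that adds a variable to the coherent vectors of the Fock space.\<close>

definition X :: "int \<Rightarrow> 'f \<Rightarrow> 'f" where
  "X n v = Sum_any (\<lambda>k::nat. phi (n + int k) (Mop k v))"

lemma X_eq:
  assumes "vac \<Omega>" "v \<in> filt \<Omega> d" "d \<le> int N"
  shows "X n v = (\<Sum>k\<le>N. phi (n + int k) (Mop k v))"
  unfolding X_def
proof (rule Sum_any.expand_superset)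
  have "k \<le> N" if "phi (n + int k) (Mop k v) \<noteq> 0" for k
  proof (rule ccontr)
    assume "\<not> k \<le> N"
    then have "Mop k v = 0" using assms by (intro Mop_vanish[OF assms(1,2)]) auto
    with that show False by (simp add: phi_0)
  qed
  then show "{k. phi (n + int k) (Mop k v) \<noteq> 0} \<subseteq> {..N}" by auto
qed simp

lemma X_linop: "linop (X n)"
proof (rule linopI)
  fix u v :: 'f
  obtain d e where d: "d \<ge> 0" "u \<in> filt ket d" "e \<ge> 0" "v \<in> filt ket e" using ex_filt by metis
  then have "u \<in> filt ket (d + e)" "v \<in> filt ket (d + e)" by (auto elim: filt_mono)
  moreover from this have "u + v \<in> filt ket (d + e)" by (rule filt_add)
  ultimately show "X n (u + v) = X n u + X n v"
    using X_eq[OF vac_ket, of _ "d + e" "nat (d + e)" n] d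
    by (simp add: linop_add[OF Mop_linop] phi_add sum.distrib)
next
  fix s v
  obtain d where d: "d \<ge> 0" "v \<in> filt ket d" using ex_filt by metis
  then have "scale s v \<in> filt ket d" by (intro filt_scale)
  then show "X n (scale s v) = scale s (X n v)" using d X_eq[OF vac_ket, of _ "d" "nat d" n]
    by (simp add: linop_scale[OF Mop_linop] phi_scale scale_sum_right)
qed

lemma X_filt: assumes "vac \<Omega>" "v \<in> filt \<Omega> d" shows "X n v \<in> filt \<Omega> (d + n)"
  by (subst X_eq[OF assms, of "nat d"])
    (auto intro!: filt_sum filt_mono[OF phi_filt[OF assms(1) Mop_filt[OF assms]]])

lemma X_Fplus: "v \<in> Fplus \<Longrightarrow> X n v \<in> Fplus"
  unfolding Fplus_def using X_filt[OF vac_plus] by blast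

text \<open>The exponential commutes with M, so X(w) acquires the same factor f(w) as
  phi(w).\<close>

lemma bexp_X:
  assumes t: "odd_fps t" "is_exp t f" and v: "vac \<Omega>" "v \<in> filt \<Omega> d" "n + d \<le> int N"
  shows "bexp t (X n v) = (\<Sum>k\<le>N. scale (f $ k) (X (n - int k) (bexp t v)))"
proof -
  define K where "K = nat d"
  have K: "d \<le> int K" by (simp add: K_def)
  let ?u = "bexp t v"
  have u: "?u \<in> filt \<Omega> d" by (rule bexp_filt[OF v(1,2)])
  have "bexp t (X n v) = (\<Sum>k\<le>K. act f (n + int k) (Mop k ?u))"
    by (simp add: X_eq[OF v(1,2) K] linop_sum[OF bexp_linop] bexp_phi[OF t] Mop_bexp[OF t(1)])
  also have "\<dots> = (\<Sum>k\<le>K. \<Sum>i\<le>N. scale (f $ i) (phi (n + int k - int i) (Mop k ?u)))"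
    by (intro sum.cong refl act_eq[OF v(1) Mop_filt[OF v(1) u]]) (use v in auto)
  also have "\<dots> = (\<Sum>i\<le>N. scale (f $ i) (X (n - int i) ?u))"
    by (subst sum.swap) (simp add: X_eq[OF v(1) u K] scale_sum_right algebra_simps)
  finally show ?thesis .
qed

lemma bos_X:
  assumes t: "odd_fps t" and v: "vac \<Omega>" "v \<in> filt \<Omega> d" "n + d \<le> int N"
  shows "bos t (X n v) = X n (bos t v) + (\<Sum>k\<le>N. scale (t $ k) (X (n - int k) v))"
proof -
  define K where "K = nat d"
  have K: "d \<le> int K" by (simp add: K_def)
  have b: "bos t v \<in> filt \<Omega> d" using bos_filt[OF v(1,2)] by (rule filt_mono) simp
  have "bos t (X n v) = (\<Sum>k\<le>K. phi (n + int k) (Mop k (bos t v))) + (\<Sum>k\<le>K. act t (n + int k) (Mop k v))"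
    by (simp add: X_eq[OF v(1,2) K] linop_sum[OF bos_linop] bos_phi[OF t] Mop_bos[OF t] sum.distrib)
  also have "(\<Sum>k\<le>K. phi (n + int k) (Mop k (bos t v))) = X n (bos t v)"
    by (simp add: X_eq[OF v(1) b K])
  also have "(\<Sum>k\<le>K. act t (n + int k) (Mop k v)) = (\<Sum>k\<le>K. \<Sum>i\<le>N. scale (t $ i) (phi (n + int k - int i) (Mop k v)))"
    by (intro sum.cong refl act_eq[OF v(1) Mop_filt[OF v(1,2)]]) (use v in auto)
  also have "\<dots> = (\<Sum>i\<le>N. scale (t $ i) (X (n - int i) v))"
    by (subst sum.swap) (simp add: X_eq[OF v(1,2) K] scale_sum_right algebra_simps)
  finally show ?thesis .
qed

lemma Mop_X: "Mop l (X n v) = (\<Sum>j\<le>l. scale (hcoeff j) (X (n - int j) (Mop (l - j) v)))"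
proof -
  obtain d where d: "d \<ge> 0" "v \<in> filt ket d" using ex_filt by metis
  define K where "K = nat d"
  have K: "d \<le> int K" by (simp add: K_def)
  have m: "Mop j v \<in> filt ket d" for j using Mop_filt[OF vac_ket d(2)] by (rule filt_mono) simp
  have "Mop l (X n v) = (\<Sum>k\<le>K. \<Sum>j\<le>l. scale (hcoeff j) (phi (n + int k - int j) (Mop (l - j) (Mop k v))))"
    by (simp add: X_eq[OF vac_ket d(2) K] linop_sum[OF Mop_linop] Mop_phi)
  also have "\<dots> = (\<Sum>j\<le>l. scale (hcoeff j) (X (n - int j) (Mop (l - j) v)))"
    by (subst sum.swap) (simp add: X_eq[OF vac_ket m K] scale_sum_right algebra_simps Mop_commute[of _ "l - _"])
  finally show ?thesis .
qed

text \<open>X(w) M(-1/w) = phi(w), since M(1/w) M(-1/w) = 1. In this form the modes are seen to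
  preserve any span stable under \<open>X\<close> and \<open>Mop\<close>.\<close>

lemma phi_eq_X:
  assumes "vac \<Omega>" "v \<in> filt \<Omega> d" "d \<le> int N"
  shows "phi n v = (\<Sum>k\<le>N. scale ((-1) ^ k) (X (n + int k) (Mop k v)))"
proof -
  have "(\<Sum>k\<le>N. scale ((-1) ^ k) (X (n + int k) (Mop k v)))
      = (\<Sum>k\<le>N. \<Sum>l\<le>N - k. scale ((-1) ^ k) (phi (n + int (k + l)) (Mop (k + l - k) (Mop k v))))"
  proof (rule sum.cong)
    fix k assume "k \<in> {..N}"
    then have "X (n + int k) (Mop k v) = (\<Sum>l\<le>N - k. phi (n + int k + int l) (Mop l (Mop k v)))"
      by (intro X_eq[OF assms(1) Mop_filt[OF assms(1,2)]]) (use assms(3) in \<open>auto simp: of_nat_diff\<close>)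
    then show "scale ((-1) ^ k) (X (n + int k) (Mop k v))
        = (\<Sum>l\<le>N - k. scale ((-1) ^ k) (phi (n + int (k + l)) (Mop (k + l - k) (Mop k v))))"
      by (simp add: scale_sum_right algebra_simps)
  qed simp
  also have "\<dots> = (\<Sum>m\<le>N. \<Sum>k\<le>m. scale ((-1) ^ k) (phi (n + int m) (Mop (m - k) (Mop k v))))"
    by (rule sum_triangle[symmetric])
  also have "\<dots> = (\<Sum>m\<le>N. phi (n + int m) (\<Sum>k\<le>m. scale ((-1) ^ k) (Mop k (Mop (m - k) v))))"
    by (simp add: phi_sum phi_scale Mop_commute[of "_ - _"])
  also have "\<dots> = phi n v"
    unfolding Mop_inverse by (simp add: if_distrib[of "phi _"] phi_0 cong: if_cong)
  finally show ?thesis ..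
qed

text \<open>On \<open>Fplus\<close>, \<open>bra\<close> composed with phi(w) is \<open>bra\<close>
  composed with M(-1/w), and M(-1/w) M(1/w) = 1. So \<open>bra\<close> absorbs X(w)
  altogether.\<close>

lemma bra_X:
  assumes v: "v \<in> Fplus"
  shows "bra (X n v) = (if n = 0 then bra v else 0)"
proof -
  obtain d where d: "d \<ge> 0" "v \<in> filt plus d" using FplusE[OF v] by metis
  define N where "N = max (nat d) (nat (- n))"
  have e: "bra (X n v) = (\<Sum>k\<le>N. bra (phi (n + int k) (Mop k v)))"
    by (subst X_eq[OF vac_plus d(2), of N]) (auto simp: N_def bra_sum)
  show ?thesis
  proof (cases "n > 0")
    case True
    then show ?thesis unfolding e by (auto intro!: sum.neutral simp: bra_phi)
  next
    case False
    define m where "m = nat (- n)"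
    have n: "n = - int m" using False by (simp add: m_def)
    have z: "bra (phi (n + int k) u) = 0" if "\<not> k \<le> m" for k u
      by (rule bra_phi) (use that in \<open>simp add: n\<close>)
    have "m \<le> N" by (simp add: N_def m_def)
    then have "bra (X n v) = (\<Sum>k\<le>m. bra (phi (n + int k) (Mop k v)))"
      unfolding e by (intro sum.mono_neutral_right) (auto intro: z)
    also have "\<dots> = (\<Sum>i\<le>m. (-1) ^ i * bra (Mop i (Mop (m - i) v)))"
    proof (rule sum.reindex_bij_witness[of _ "\<lambda>i. m - i" "\<lambda>k. m - k"])
      fix k assume k: "k \<in> {..m}"
      then have e: "n + int k = - int (m - k)" by (simp add: n of_nat_diff)
      have e2: "m - (m - k) = k" using k by simp
      show "(-1) ^ (m - k) * bra (Mop (m - k) (Mop (m - (m - k)) v)) = bra (phi (n + int k) (Mop k v))"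
        unfolding e e2 bra_phi_Mop[OF Mop_Fplus[OF v]] ..
    qed auto
    also have "\<dots> = (if m = 0 then bra v else 0)"
      using arg_cong[OF Mop_inverse[of m v], of bra] by (simp add: bra_sum bra_scale bra_0 split: if_splits)
    finally show ?thesis by (simp add: n)
  qed
qed

subsection \<open>Deformed fermions\<close>

definition clin :: "(int \<Rightarrow> qbeta) \<Rightarrow> 'f \<Rightarrow> 'f" where
  "clin c = lin (\<lambda>j. mps_const (c j))"

lemma clin_eq:
  assumes "vac \<Omega>" "v \<in> filt \<Omega> d" "\<And>j. j > n \<Longrightarrow> c j = 0" "a \<le> - d" "n \<le> b"
  shows "clin c v = (\<Sum>j = a..b. csc (c j) (phi j v))"
  unfolding clin_def by (rule lin_eq[OF assms(1,2) _ assms(4,5)]) (use assms(3) in auto)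

lemma csc_double: "csc (2 * c) w = csc c w + csc c w"
  unfolding mult_2 mps_const_add by (rule scale_left_distrib)

lemma clin_linop: "(\<And>j. j > n \<Longrightarrow> c j = 0) \<Longrightarrow> linop (clin c)"
  unfolding clin_def by (rule lin_linop[of n]) auto

lemma clin_filt: "vac \<Omega> \<Longrightarrow> v \<in> filt \<Omega> d \<Longrightarrow> (\<And>j. j > n \<Longrightarrow> c j = 0) \<Longrightarrow> clin c v \<in> filt \<Omega> (d + n)"
  unfolding clin_def by (rule lin_filt) auto

lemma clin_Fplus: "v \<in> Fplus \<Longrightarrow> (\<And>j. j > n \<Longrightarrow> c j = 0) \<Longrightarrow> clin c v \<in> Fplus"
  unfolding clin_def by (rule lin_Fplus[of _ n]) auto

lemma clin_add:
  assumes "\<And>j. j > n \<Longrightarrow> c j = 0" "\<And>j. j > n \<Longrightarrow> e j = 0"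
  shows "clin (\<lambda>j. c j + e j) v = clin c v + clin e v"
  unfolding clin_def mps_const_add by (rule lin_add[of n]) (use assms in auto)

lemma clin_scale:
  assumes "\<And>j. j > n \<Longrightarrow> c j = 0"
  shows "clin (\<lambda>j. s * c j) v = csc s (clin c v)"
  unfolding clin_def mps_const_mult by (rule lin_scale[of n]) (use assms in auto)

lemma clin_anticommute:
  assumes c: "\<And>j. j > n \<Longrightarrow> c j = 0" and e: "\<And>j. j > m \<Longrightarrow> e j = 0" and N: "N \<ge> \<bar>n\<bar>" "N \<ge> \<bar>m\<bar>"
  shows "clin c (clin e v) + clin e (clin c v) = csc (\<Sum>l = -N..N. 2 * neg_one_pow l * (c l * e (- l))) v"
proof -
  obtain d where d: "d \<ge> 0" "v \<in> filt ket d" using ex_filt by metis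
  define K where "K = d + N"
  have N0: "N \<ge> 0" using N by simp
  have K: "n \<le> K" "m \<le> K" "- K \<le> - d" "- K \<le> - (d + n)" "- K \<le> - (d + m)" using N N0 d by (auto simp: K_def)
  have ev: "clin e v \<in> filt ket (d + m)" by (rule clin_filt[OF vac_ket d(2) e])
  have cv: "clin c v \<in> filt ket (d + n)" by (rule clin_filt[OF vac_ket d(2) c])
  have C: "clin c u = (\<Sum>a = -K..K. csc (c a) (phi a u))" if "u \<in> filt ket d'" "- K \<le> - d'" for u d'
    by (rule clin_eq[OF vac_ket that(1) _ that(2) K(1)]) (use c in auto)
  have D: "clin e u = (\<Sum>a = -K..K. csc (e a) (phi a u))" if "u \<in> filt ket d'" "- K \<le> - d'" for u d'
    by (rule clin_eq[OF vac_ket that(1) _ that(2) K(2)]) (use e in auto)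
  have "clin c (clin e v) = (\<Sum>a = -K..K. \<Sum>b = -K..K. csc (c a * e b) (phi a (phi b v)))"
    by (subst C[OF ev K(5)], subst D[OF d(2) K(3)]) (simp add: phi_sum phi_scale scale_sum_right mps_const_mult)
  moreover have "clin e (clin c v) = (\<Sum>a = -K..K. \<Sum>b = -K..K. csc (c a * e b) (phi b (phi a v)))"
    by (subst D[OF cv K(4)], subst C[OF d(2) K(3)], subst sum.swap) (simp add: phi_sum phi_scale scale_sum_right mps_const_mult mult.commute)
  ultimately have "clin c (clin e v) + clin e (clin c v)
      = (\<Sum>a = -K..K. \<Sum>b = -K..K. csc (c a * e b) (phi a (phi b v) + phi b (phi a v)))"
    by (simp only: sum.distrib[symmetric] scale_right_distrib)
  also have "\<dots> = (\<Sum>a = -K..K. \<Sum>b = -K..K. if b = - a then csc (2 * neg_one_pow a * (c a * e b)) v else 0)"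
    unfolding anticommute
    by (intro sum.cong refl)
      (auto simp: add_eq_0_iff mps_const_mult mps_const_neg_one_pow mult_ac)
  also have "\<dots> = (\<Sum>a = -K..K. csc (2 * neg_one_pow a * (c a * e (- a))) v)"
    by (intro sum.cong refl) (subst sum.delta, auto)
  also have "\<dots> = (\<Sum>a = -N..N. csc (2 * neg_one_pow a * (c a * e (- a))) v)"
  proof (rule sum.mono_neutral_right)
    show "\<forall>a\<in>{-K..K} - {-N..N}. csc (2 * neg_one_pow a * (c a * e (- a))) v = 0"
    proof
      fix a assume "a \<in> {-K..K} - {-N..N}"
      then have "a > n \<or> - a > m" using N by auto
      then show "csc (2 * neg_one_pow a * (c a * e (- a))) v = 0" using c e by auto
    qed
  qed (use d in \<open>auto simp: K_def\<close>)
  finally show ?thesis by (simp only: mps_const_sum scale_sum_left)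
qed

lemma E_linop: "linop E" and Ei_linop: "linop Ei"
  unfolding E_def Ei_def by (rule bexp_linop)+

lemma E_filt: "vac \<Omega> \<Longrightarrow> v \<in> filt \<Omega> d \<Longrightarrow> E v \<in> filt \<Omega> d"
  and Ei_filt: "vac \<Omega> \<Longrightarrow> v \<in> filt \<Omega> d \<Longrightarrow> Ei v \<in> filt \<Omega> d"
  unfolding E_def Ei_def by (rule bexp_filt, assumption+)+

lemma E_vac: "vac \<Omega> \<Longrightarrow> E \<Omega> = \<Omega>" and Ei_vac: "vac \<Omega> \<Longrightarrow> Ei \<Omega> = \<Omega>"
  unfolding E_def Ei_def by (rule bexp_vac, assumption)+

lemma E_Fplus: "v \<in> Fplus \<Longrightarrow> E v \<in> Fplus" and Ei_Fplus: "v \<in> Fplus \<Longrightarrow> Ei v \<in> Fplus"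
  unfolding E_def Ei_def by (rule bexp_Fplus, assumption)+

lemma act_X_mult: "act (fps_X * f) n v = act f (n - 1) v"
proof -
  have "nat (n - j) - Suc 0 = nat (n - 1 - j)" for j by simp
  then show ?thesis
    unfolding act_def by (intro arg_cong[of _ _ "\<lambda>c. lin c v"]) (auto simp: fun_eq_iff fps_X_mult_nth)
qed

text \<open>The relation (1 - gam z) E phi(z) = (1 + gam z) phi(z) E in coefficients.\<close>

lemma E_phi: "E (phi n v) = csc gam (E (phi (n - 1) v)) + phi n (E v) + csc gam (phi (n - 1) (E v))"
proof -
  let ?s = "mps_const gam :: scalars"
  have b: "E (phi m v) = act (gser ?s) m (E v)" for m
    unfolding E_def by (rule bexp_phi[OF odd_tgam(1) is_exp_tgam(1)])
  have g: "gser ?s = fps_const ?s * (fps_X * gser ?s) + 1 + fps_const ?s * (fps_X * 1)"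
    using gser_times[of ?s] by (simp add: algebra_simps)
  have "E (phi n v) = act (fps_const ?s * (fps_X * gser ?s) + 1 + fps_const ?s * (fps_X * 1)) n (E v)"
    unfolding b using g by simp
  then show ?thesis unfolding act_add act_scale act_X_mult act_1 b .
qed

lemma E_clin:
  assumes c: "\<And>j. j > n \<Longrightarrow> c j = 0"
  shows "E (clin c v) = csc gam (E (clin (\<lambda>j. c (j + 1)) v)) + clin c (E v) + csc gam (clin (\<lambda>j. c (j + 1)) (E v))"
proof -
  obtain d where d: "d \<ge> 0" "v \<in> filt ket d" using ex_filt by metis
  have Ev: "E v \<in> filt ket d" by (rule E_filt[OF vac_ket d(2)])
  have c': "\<And>j. j > n \<Longrightarrow> c (j + 1) = 0" using c by simp
  have s: "clin (\<lambda>j. c (j + 1)) u = (\<Sum>j = -d..n. csc (c j) (phi (j - 1) u))" if "u \<in> filt ket d" for u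
  proof -
    have "clin (\<lambda>j. c (j + 1)) u = (\<Sum>j = - d - 1..n - 1. csc (c (j + 1)) (phi j u))"
    proof -
      have "clin (\<lambda>j. c (j + 1)) u = (\<Sum>j = - d - 1..n. csc (c (j + 1)) (phi j u))"
        by (rule clin_eq[OF vac_ket that, of n]) (use c' in auto)
      also have "\<dots> = (\<Sum>j = - d - 1..n - 1. csc (c (j + 1)) (phi j u))"
        by (rule sum.mono_neutral_right) (auto simp: c)
      finally show ?thesis .
    qed
    also have "\<dots> = (\<Sum>j = -d..n. csc (c j) (phi (j - 1) u))"
      by (rule sum.reindex_bij_witness[of _ "\<lambda>j. j - 1" "\<lambda>j. j + 1"]) auto
    finally show ?thesis .
  qed
  have cl: "clin c u = (\<Sum>j = -d..n. csc (c j) (phi j u))" if "u \<in> filt ket d" for u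
    by (rule clin_eq[OF vac_ket that c]) auto
  have "E (clin c v) = (\<Sum>j = -d..n. csc (c j) (csc gam (E (phi (j - 1) v)) + phi j (E v) + csc gam (phi (j - 1) (E v))))"
    by (simp add: cl[OF d(2)] linop_sum[OF E_linop] linop_scale[OF E_linop] flip: E_phi)
  also have "\<dots> = csc gam (\<Sum>j = -d..n. csc (c j) (E (phi (j - 1) v))) + (\<Sum>j = -d..n. csc (c j) (phi j (E v)))
      + csc gam (\<Sum>j = -d..n. csc (c j) (phi (j - 1) (E v)))"
    by (simp add: scale_right_distrib sum.distrib scale_sum_right mult.commute)
  also have "(\<Sum>j = -d..n. csc (c j) (E (phi (j - 1) v))) = E (clin (\<lambda>j. c (j + 1)) v)"
    by (simp add: s[OF d(2)] linop_sum[OF E_linop] linop_scale[OF E_linop])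
  finally show ?thesis by (simp add: s[OF Ev] cl[OF Ev])
qed

text \<open>
  \<open>pc n\<close>, \<open>Ph n\<close> and \<open>am n\<close> are the coefficients of $z^n$ in $\phi^{[\beta]}(\overline z)$,
  $\Phi^{[\beta]}(z)$ and $(\phi^{[\beta]}(z) - 1) / (2 + \beta z)$, where $\phi^{[\beta]}(z) = \sum_n \phi^{[\beta]}_n z^n$.
\<close>

definition pc :: "int \<Rightarrow> 'f \<Rightarrow> 'f" where "pc n = clin (\<lambda>j. neg_one_pow j * cw n j)"
definition Ph :: "int \<Rightarrow> 'f \<Rightarrow> 'f" where "Ph n = clin (cPhi n)"
definition am :: "int \<Rightarrow> 'f \<Rightarrow> 'f" where "am n v = Ph n v - csc (kap n) v"

lemma pc_linop: "linop (pc n)" unfolding pc_def by (rule clin_linop[of n]) (simp add: cw_less)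
lemma Ph_linop: "linop (Ph n)" unfolding Ph_def by (rule clin_linop[of n]) (simp add: cPhi_less)
lemma am_linop: "linop (am n)"
  unfolding am_def by (rule linop_minus[OF Ph_linop linop_scl[OF linop_id]])

lemma pc_Fplus: "v \<in> Fplus \<Longrightarrow> pc n v \<in> Fplus"
  unfolding pc_def by (rule clin_Fplus[of _ n]) (auto simp: cw_less)
lemma am_Fplus: "v \<in> Fplus \<Longrightarrow> am n v \<in> Fplus"
  unfolding am_def Ph_def by (intro Fplus_diff Fplus_scale clin_Fplus[of _ n]) (auto simp: cPhi_less)

lemma pc_filt: "vac \<Omega> \<Longrightarrow> v \<in> filt \<Omega> d \<Longrightarrow> pc n v \<in> filt \<Omega> (d + n)"
  unfolding pc_def by (rule clin_filt) (auto simp: cw_less)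

text \<open>The field is evaluated at -w with w = w(z), where the factor of E is (1 - gam w)/(1 +
  gam w) = 1/(1 + beta z). Thus pc(z) E = (1 + beta z) E pc(z).\<close>

lemma pc_E: "pc n (E v) = E (pc n v) + csc beta (E (pc (n - 1) v))"
proof -
  let ?c = "\<lambda>n j. neg_one_pow j * cw n j :: qbeta"
  let ?S = "\<lambda>n. clin (\<lambda>j. ?c n (j + 1))"
  \<comment> \<open>\<open>?S\<close> is the field multiplied by its argument -w(z) = -z/(1 + gam
    z); the recursion clears this denominator.\<close>
  have rec: "?S n u = - csc gam (?S (n - 1) u) - pc (n - 1) u" for n u
  proof -
    have "?c n (j + 1) = - gam * ?c (n - 1) (j + 1) + (- 1) * ?c (n - 1) j" for j
      using cw_rec[of "n - 1" "j + 1"] by (simp add: neg_one_pow_def algebra_simps)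
    then have "?S n u = clin (\<lambda>j. - gam * ?c (n - 1) (j + 1) + (- 1) * ?c (n - 1) j) u" by simp
    also have "\<dots> = clin (\<lambda>j. - gam * ?c (n - 1) (j + 1)) u + clin (\<lambda>j. (- 1) * ?c (n - 1) j) u"
      by (rule clin_add[of n]) (auto simp: cw_less)
    also have "clin (\<lambda>j. - gam * ?c (n - 1) (j + 1)) u = csc (- gam) (?S (n - 1) u)"
      by (rule clin_scale[of n]) (auto simp: cw_less)
    also have "clin (\<lambda>j. (- 1) * ?c (n - 1) j) u = csc (- 1) (pc (n - 1) u)"
      unfolding pc_def by (rule clin_scale[of n]) (auto simp: cw_less)
    finally show ?thesis by (simp add: mps_const_minus)
  qed
  have e: "E (pc n v) = csc gam (E (?S n v)) + pc n (E v) + csc gam (?S n (E v))" for n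
    unfolding pc_def by (rule E_clin[of n]) (auto simp: cw_less)
  have "pc n (E v) = E (pc n v) - csc gam (E (?S n v)) - csc gam (?S n (E v))"
    using e[of n] by (simp add: algebra_simps)
  also have "E (?S n v) = - csc gam (E (?S (n - 1) v)) - E (pc (n - 1) v)"
    unfolding rec[of n] by (simp add: linop_diff[OF E_linop] linop_neg[OF E_linop] linop_scale[OF E_linop])
  also have "?S n (E v) = - csc gam (?S (n - 1) (E v)) - pc (n - 1) (E v)" by (rule rec)
  also have "pc (n - 1) (E v) = E (pc (n - 1) v) - csc gam (E (?S (n - 1) v)) - csc gam (?S (n - 1) (E v))"
    using e[of "n - 1"] by (simp add: algebra_simps)
  also have "E (pc n v) - csc gam (- csc gam (E (?S (n - 1) v)) - E (pc (n - 1) v))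
      - csc gam (- csc gam (?S (n - 1) (E v)) - (E (pc (n - 1) v) - csc gam (E (?S (n - 1) v)) - csc gam (?S (n - 1) (E v))))
      = E (pc n v) + (csc gam (E (pc (n - 1) v)) + csc gam (E (pc (n - 1) v)))"
    by (simp add: scale_right_diff_distrib scale_right_distrib)
  also have "csc gam (E (pc (n - 1) v)) + csc gam (E (pc (n - 1) v)) = csc beta (E (pc (n - 1) v))"
    by (rule csc_double[symmetric, of gam, folded beta_eq_gam])
  finally show ?thesis .
qed

text \<open>Evaluated at w = w(z), the factor of E is (1 + gam w)/(1 - gam w) = 1 + beta z, the
  inverse of the one in \<open>pc_E\<close>.\<close>

lemma E_Ph: "E (Ph n v) = Ph n (E v) + csc beta (Ph (n - 1) (E v))"
proof -
  let ?S = "\<lambda>n. clin (\<lambda>j. cPhi n (j + 1))"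
  have rec: "?S n u = - csc gam (?S (n - 1) u) + Ph (n - 1) u" for n u
  proof -
    have "cPhi n (j + 1) = - gam * cPhi (n - 1) (j + 1) + 1 * cPhi (n - 1) j" for j
      using cPhi_rec2[of "n - 1" "j + 1"] by (simp add: algebra_simps)
    then have "?S n u = clin (\<lambda>j. - gam * cPhi (n - 1) (j + 1) + 1 * cPhi (n - 1) j) u" by simp
    also have "\<dots> = clin (\<lambda>j. - gam * cPhi (n - 1) (j + 1)) u + clin (\<lambda>j. 1 * cPhi (n - 1) j) u"
      by (rule clin_add[of n]) (auto simp: cPhi_less)
    also have "clin (\<lambda>j. - gam * cPhi (n - 1) (j + 1)) u = csc (- gam) (?S (n - 1) u)"
      by (rule clin_scale[of n]) (auto simp: cPhi_less)
    finally show ?thesis by (simp add: mps_const_minus Ph_def)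
  qed
  have e: "E (Ph n v) = csc gam (E (?S n v)) + Ph n (E v) + csc gam (?S n (E v))" for n
    unfolding Ph_def by (rule E_clin[of n]) (auto simp: cPhi_less)
  have "E (Ph n v) = csc gam (E (?S n v)) + Ph n (E v) + csc gam (?S n (E v))" by (rule e)
  also have "E (?S n v) = - csc gam (E (?S (n - 1) v)) + E (Ph (n - 1) v)"
    unfolding rec[of n] by (simp add: linop_add[OF E_linop] linop_diff[OF E_linop] linop_neg[OF E_linop] linop_scale[OF E_linop])
  also have "?S n (E v) = - csc gam (?S (n - 1) (E v)) + Ph (n - 1) (E v)" by (rule rec)
  also have "E (Ph (n - 1) v) = csc gam (E (?S (n - 1) v)) + Ph (n - 1) (E v) + csc gam (?S (n - 1) (E v))" by (rule e)
  also have "csc gam (- csc gam (E (?S (n - 1) v)) + (csc gam (E (?S (n - 1) v)) + Ph (n - 1) (E v) + csc gam (?S (n - 1) (E v))))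
      + Ph n (E v) + csc gam (- csc gam (?S (n - 1) (E v)) + Ph (n - 1) (E v))
      = Ph n (E v) + (csc gam (Ph (n - 1) (E v)) + csc gam (Ph (n - 1) (E v)))"
    by (simp add: scale_right_diff_distrib scale_right_distrib)
  also have "csc gam (Ph (n - 1) (E v)) + csc gam (Ph (n - 1) (E v)) = csc beta (Ph (n - 1) (E v))"
    by (rule csc_double[symmetric, of gam, folded beta_eq_gam])
  finally show ?thesis .
qed

lemma E_am: "E (am n v) = am n (E v) + csc beta (am (n - 1) (E v)) + csc (beta * kap (n - 1)) (E v)"
  unfolding am_def
  by (simp add: linop_diff[OF E_linop] linop_scale[OF E_linop] E_Ph scale_right_diff_distrib mps_const_mult)

text \<open>After multiplication by 2 + beta z the pairing is twice the sum in
  \<open>cw_delta\<close>, so its value is 2 (1 + gam z) = 2 + beta z times a delta. The factor 1/(2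
  + beta z) in Phi thus gives exactly the delta.\<close>

lemma pc_Ph: "pc j (Ph n v) + Ph n (pc j v) = (if n = - j then v else 0)"
proof -
  define s where "s n = (\<Sum>l = - \<bar>j\<bar> - \<bar>n\<bar>..\<bar>j\<bar> + \<bar>n\<bar>. cw j l * cPhi n (- l))" for n
  have s_eq: "s n = (\<Sum>l = - N..N. cw j l * cPhi n (- l))" if "N \<ge> \<bar>j\<bar> + \<bar>n\<bar>" for n N
    unfolding s_def by (rule sum.mono_neutral_left) (use that in \<open>auto simp: cw_less cPhi_less\<close>)
  have "s n - (if n = - j then 1 / 2 else 0) = 0"
  proof (rule qbeta_rec_zero[of "- j" "\<lambda>n. s n - (if n = - j then 1 / 2 else 0)"])
    fix n assume "n < - j"
    then have "cw j l * cPhi n (- l) = 0" for l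
      using cw_less[of j l] cPhi_less[of n "- l"] by (cases "l > j") auto
    then show "s n - (if n = - j then 1 / 2 else 0) = 0" using \<open>n < - j\<close> by (auto simp: s_def intro!: sum.neutral)
  next
    fix n
    define N where "N = \<bar>j\<bar> + \<bar>n\<bar> + 1"
    have "2 * s n + beta * s (n - 1) = (\<Sum>l = - N..N. cw j l * (2 * cPhi n (- l) + beta * cPhi (n - 1) (- l)))"
      by (subst (1 2) s_eq[of _ N]) (auto simp: N_def sum_distrib_left algebra_simps simp flip: sum.distrib)
    also have "\<dots> = (\<Sum>l = - N..N. cw j l * cw n (- l))" by (simp only: cPhi_rec)
    also have "\<dots> = (if n + j = 0 then 1 else 0) + (if n + j = 1 then gam else 0)"
      by (rule cw_delta) (auto simp: N_def)
    finally have "2 * s n + beta * s (n - 1) = (if n + j = 0 then 1 else 0) + (if n + j = 1 then gam else 0)" .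
    then show "2 * (s n - (if n = - j then 1 / 2 else 0)) + beta * (s (n - 1) - (if n - 1 = - j then 1 / 2 else 0)) = 0"
      by (auto simp: algebra_simps beta_eq_gam)
  qed
  then have s: "2 * s n = (if n = - j then 1 else 0)" by (auto split: if_splits)
  have "pc j (Ph n v) + Ph n (pc j v)
      = csc (\<Sum>l = -(\<bar>j\<bar> + \<bar>n\<bar>)..\<bar>j\<bar> + \<bar>n\<bar>. 2 * neg_one_pow l * (neg_one_pow l * cw j l * cPhi n (- l))) v"
    unfolding pc_def Ph_def by (rule clin_anticommute[of j _ n]) (auto simp: cw_less cPhi_less)
  also have "(\<Sum>l = -(\<bar>j\<bar> + \<bar>n\<bar>)..\<bar>j\<bar> + \<bar>n\<bar>. 2 * neg_one_pow l * (neg_one_pow l * cw j l * cPhi n (- l))) = 2 * s n"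
  proof -
    have e: "2 * neg_one_pow l * (neg_one_pow l * cw j l * cPhi n (- l)) = 2 * (cw j l * cPhi n (- l))" for l
    proof -
      have "2 * neg_one_pow l * (neg_one_pow l * cw j l * cPhi n (- l))
          = 2 * (neg_one_pow l * neg_one_pow l) * (cw j l * cPhi n (- l))" by (simp only: mult_ac)
      then show ?thesis by (simp only: neg_one_pow_mult mult_1_right)
    qed
    show ?thesis unfolding s_def sum_distrib_left by (rule sum.cong, simp, rule e)
  qed
  finally show ?thesis by (simp add: s)
qed

lemma pc_am: "pc j (am n v) = - am n (pc j v) - csc (2 * kap n) (pc j v) + (if n = - j then v else 0)"
proof -
  have "csc (2 * kap n) w = csc (kap n) w + csc (kap n) w" for w
    by (rule csc_double)
  then show ?thesis using pc_Ph[of j n v]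
    by (simp add: am_def linop_diff[OF pc_linop] linop_scale[OF pc_linop] algebra_simps)
qed

section \<open>The dual functionals and biorthogonality\<close>

definition ast :: "int \<Rightarrow> 'f \<Rightarrow> 'f" where "ast n v = E (pc (- n) v)"

lemma ast_linop: "linop (ast n)"
  unfolding ast_def by (rule linop_comp[OF E_linop pc_linop])

lemma ast_Fplus: "v \<in> Fplus \<Longrightarrow> ast n v \<in> Fplus"
  unfolding ast_def by (intro E_Fplus pc_Fplus)

text \<open>Two scalar terms arise from the constant subtracted in \<open>am\<close>: 2 kap m from
  the anticommutator and beta kap (m - 1) from moving E. By \<open>kap_rec\<close> they add up to 0
  unless m = 0.\<close>

lemma ast_am:
  "ast n (am m v) = - am m (ast n v) - csc beta (am (m - 1) (ast n v)) - (if m = 0 then ast n v else 0)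
    + (if m = n then E v else 0)"
proof -
  have k: "csc (beta * kap (m - 1)) w + csc (2 * kap m) w = (if m = 0 then w else 0)" for w
    using kap_rec[of m] by (simp flip: scale_left_distrib mps_const_add add: add.commute split: if_splits)
  have "ast n (am m v) = E (- am m (pc (- n) v) - csc (2 * kap m) (pc (- n) v) + (if m = n then v else 0))"
    unfolding ast_def pc_am by simp
  also have "\<dots> = - (am m (ast n v) + csc beta (am (m - 1) (ast n v)) + csc (beta * kap (m - 1)) (ast n v))
      - csc (2 * kap m) (ast n v) + (if m = n then E v else 0)"
    by (simp add: linop_add[OF E_linop] linop_diff[OF E_linop] linop_neg[OF E_linop] linop_scale[OF E_linop]
        linop_0[OF E_linop] E_am ast_def)
  also have "\<dots> = - am m (ast n v) - csc beta (am (m - 1) (ast n v))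
      - (csc (beta * kap (m - 1)) (ast n v) + csc (2 * kap m) (ast n v)) + (if m = n then E v else 0)"
    by simp
  finally show ?thesis unfolding k .
qed

text \<open>The largest part acts first on the vector, which mirrors the order in which
  \<open>kp\<close> applies its creation operators.\<close>

fun Df :: "nat list \<Rightarrow> 'f \<Rightarrow> scalars" where
  "Df [] v = bra v"
| "Df (n # ns) v = Df ns (ast (int n) v)"

lemma Df_add: "Df ns (u + v) = Df ns u + Df ns v"
  by (induction ns arbitrary: u v) (simp_all add: bra_add linop_add[OF ast_linop])
lemma Df_scale: "Df ns (scale c v) = c * Df ns v"
  by (induction ns arbitrary: v) (simp_all add: bra_scale linop_scale[OF ast_linop])
lemma Df_0: "Df ns 0 = 0" using Df_scale[of ns 0 0] by simp
lemma Df_neg: "Df ns (- v) = - Df ns v" using Df_scale[of ns "- 1" v] by simp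
lemma Df_diff: "Df ns (u - v) = Df ns u - Df ns v" using Df_add[of ns u "- v"] by (simp add: Df_neg)
text \<open>\<open>bra\<close> kills positive modes, negative modes have coefficient 0 by
  \<open>cPhi_neg\<close>, and \<open>phi 0\<close> contributes kap m on \<open>Fplus\<close>. This
  is precisely the constant subtracted in \<open>am\<close>.\<close>

lemma bra_am: assumes "v \<in> Fplus" "m \<ge> 0" shows "bra (am m v) = 0"
proof -
  obtain d where d: "d \<ge> 0" "v \<in> filt plus d" using FplusE[OF assms(1)] by metis
  have "bra (Ph m v) = (\<Sum>j = - d..max m 0. mps_const (cPhi m j) * bra (phi j v))"
    unfolding Ph_def by (subst clin_eq[OF vac_plus d(2), of m]) (auto simp: cPhi_less bra_sum bra_scale)
  also have "\<dots> = (\<Sum>j\<in>{0}. mps_const (cPhi m j) * bra (phi j v))"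
  proof (rule sum.mono_neutral_right)
    show "\<forall>j\<in>{- d..max m 0} - {0}. mps_const (cPhi m j) * bra (phi j v) = 0"
    proof
      fix j assume "j \<in> {- d..max m 0} - {0}"
      then have "j > 0 \<or> j < 0" by auto
      then show "mps_const (cPhi m j) * bra (phi j v) = 0" using assms(2) by (auto simp: bra_phi cPhi_neg)
    qed
  qed (use d in auto)
  finally show ?thesis by (simp add: am_def bra_diff bra_scale cPhi_0 bra_phi_0 assms(1))
qed

lemma strict_Cons: "n # ns \<in> strict_partitions \<longleftrightarrow> n > 0 \<and> (\<forall>x\<in>set ns. x < n) \<and> ns \<in> strict_partitions"
  by (auto simp: strict_partitions_def)

lemma strict_Nil: "[] \<in> strict_partitions" by (simp add: strict_partitions_def)

text \<open>Passing \<open>ast n\<close> replaces the index m by m and m - 1. Since m > n and n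
  exceeds every remaining part, m - 1 still does: strictness pays for the shift at every
  step.\<close>

lemma Df_am:
  assumes "ns \<in> strict_partitions" "v \<in> Fplus" "m > 0" "\<And>x. x \<in> set ns \<Longrightarrow> int x < m"
  shows "Df ns (am m v) = 0"
  using assms
proof (induction ns arbitrary: v m)
  case Nil
  then show ?case by (simp add: bra_am)
next
  case (Cons n ns)
  have F: "ast (int n) v \<in> Fplus" using Cons by (intro ast_Fplus)
  have "Df ns (am m (ast (int n) v)) = 0"
    by (rule Cons.IH) (use Cons.prems F in \<open>auto simp: strict_Cons\<close>)
  moreover have "Df ns (am (m - 1) (ast (int n) v)) = 0"
    by (rule Cons.IH) (use Cons.prems F in \<open>fastforce simp: strict_Cons\<close>)+
  ultimately show ?case using Cons.prems by (auto simp: ast_am Df_diff Df_neg Df_scale)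
qed

text \<open>Differs from \<open>ket_p\<close> by a factor \<open>Ei\<close> in front of the vacuum
  as well; \<open>Ei\<close> fixes \<open>plus\<close>, and the recursion becomes uniform.\<close>

fun kp :: "nat list \<Rightarrow> 'f" where
  "kp [] = plus"
| "kp (l # ls) = am (int l) (Ei (kp ls))"

lemma kp_Fplus: "kp ls \<in> Fplus"
  by (induction ls) (auto intro: Fplus_plus am_Fplus Ei_Fplus)

text \<open>Since pc(z) E = (1 + beta z) E pc(z), the value at index i is a multiple of the value at
  i - 1 as long as i \<le> J. Very low indices vanish by degree, so the induction climbs from
  there.\<close>

lemma pc_Ei_zero:
  assumes "\<And>j. j \<le> J \<Longrightarrow> pc j w = 0" "j \<le> J"
  shows "pc j (Ei w) = 0"
proof -
  obtain d where d: "d \<ge> 0" "Ei w \<in> filt ket d" using ex_filt by metis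
  have low: "pc i (Ei w) = 0" if "i < - d" for i
    by (rule filt_below_0[OF pc_filt[OF vac_ket d(2)]]) (use that in auto)
  have rec: "pc i (Ei w) = - csc beta (pc (i - 1) (Ei w))" if "i \<le> J" for i
  proof -
    have "0 = pc i (E (Ei w))" using assms(1)[OF that] by (simp add: E_Ei)
    also have "\<dots> = E (pc i (Ei w) + csc beta (pc (i - 1) (Ei w)))"
      unfolding pc_E by (simp add: linop_add[OF E_linop] linop_scale[OF E_linop])
    finally have "Ei 0 = pc i (Ei w) + csc beta (pc (i - 1) (Ei w))" by (metis Ei_E)
    then show ?thesis by (simp add: linop_0[OF Ei_linop] eq_neg_iff_add_eq_0)
  qed
  show ?thesis
  proof (cases "j < - d")
    case False
    then have "- d - 1 \<le> j" by simp
    then show ?thesis using assms(2)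
    proof (induction j rule: int_ge_induct)
      case base
      then show ?case by (simp add: low)
    next
      case (step i)
      then show ?case using rec[of "i + 1"] by simp
    qed
  qed (simp add: low)
qed

text \<open>A mode this low meets no contraction, because all parts are smaller than n. It passes
  every \<open>am\<close> and every \<open>Ei\<close> until it kills \<open>plus\<close>.\<close>

lemma pc_kp:
  assumes "ms \<in> strict_partitions" "n > 0" "\<And>x. x \<in> set ms \<Longrightarrow> int x < n" "j \<le> - n"
  shows "pc j (kp ms) = 0"
  using assms(1,3,4)
proof (induction ms arbitrary: j)
  case Nil
  have "pc j plus = 0"
    by (rule filt_below_0[OF pc_filt[OF vac_plus filt_vac[OF order_refl]]]) (use Nil assms(2) in auto)
  then show ?case by simp
next
  case (Cons l ls)
  have "pc i (kp ls) = 0" if "i \<le> - n" for i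
    using Cons that by (intro Cons.IH) (auto simp: strict_Cons)
  then have "pc i (Ei (kp ls)) = 0" if "i \<le> - n" for i using that by (rule pc_Ei_zero)
  then have "pc j (Ei (kp ls)) = 0" using Cons by simp
  moreover have "int l \<noteq> - j" using Cons.prems(2)[of l] Cons.prems(3) by auto
  ultimately show ?case using Cons by (simp add: pc_am linop_0[OF am_linop])
qed

text \<open>The first parts m of \<open>ms\<close> and n of \<open>ns\<close> are compared. If m >
  n, \<open>Df_am\<close> gives 0. If m \<le> n, \<open>ast n\<close> kills what stands behind
  \<open>am m\<close>, so only the contraction at m = n survives; there E cancels Ei, and the tails
  are compared.\<close>

lemma Df_kp:
  assumes "ns \<in> strict_partitions" "ms \<in> strict_partitions"
  shows "Df ns (kp ms) = (if ns = ms then 1 else 0)"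
  using assms
proof (induction ns arbitrary: ms)
  case Nil
  show ?case by (cases ms) (simp_all add: bra_plus bra_am Ei_Fplus kp_Fplus)
next
  case (Cons n ns)
  have n: "n > 0" "\<And>x. x \<in> set ns \<Longrightarrow> x < n" "ns \<in> strict_partitions" using Cons.prems by (auto simp: strict_Cons)
  show ?case
  proof (cases ms)
    case Nil
    have "pc (- int n) (kp []) = 0"
      by (rule pc_kp[of _ "int n"]) (use n strict_Nil in auto)
    then show ?thesis using Nil by (simp add: ast_def linop_0[OF E_linop] Df_0)
  next
    case (Cons m ms')
    have m: "m > 0" "\<And>x. x \<in> set ms' \<Longrightarrow> x < m" "ms' \<in> strict_partitions"
      using Cons.prems Cons by (auto simp: strict_Cons)
    let ?v = "Ei (kp ms')"
    show ?thesis
    proof (cases "m > n")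
      case True
      have "Df (n # ns) (am (int m) ?v) = 0"
        by (rule Df_am) (use Cons.prems True m n in \<open>auto intro: Ei_Fplus kp_Fplus dest: n(2)\<close>)
      then show ?thesis using True Cons by simp
    next
      case False
      have "pc i (kp ms') = 0" if "i \<le> - int n" for i
        by (rule pc_kp[of _ "int n"]) (use m n that False in force)+
      then have "pc (- int n) ?v = 0" by (rule pc_Ei_zero) auto
      then have "ast (int n) ?v = 0" by (simp add: ast_def linop_0[OF E_linop])
      then have "ast (int n) (am (int m) ?v) = (if m = n then kp ms' else 0)"
        using m by (simp add: ast_am linop_0[OF am_linop] E_Ei)
      then show ?thesis using Cons.IH[OF n(3) m(3)] Cons by (auto simp: Df_0)
    qed
  qed
qed

end

section \<open>The deformed fermions and the vectors of the statement in terms of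
  coefficients\<close>

lemma phi_bracket_apply: "phi_bracket n w = (case w of [j] \<Rightarrow> mps_const (cw n j) | _ \<Rightarrow> 0)"
proof -
  have w: "fps_X / (1 + fps_const (beta / 2) * fps_X) = wfps" by (simp add: wfps_def gam_def)
  have g: "[:beta / 2, 1:] = [:gam, 1:]" by (simp add: gam_def)
  show ?thesis
  proof (cases "n \<ge> 1")
    case True
    have e: "phi_bracket n w = (\<Sum>k\<in>{k. 1 \<le> k \<and> [int k] = w}. mps_const ((wfps ^ k) $ nat n))"
    proof -
      have fin: "finite {k. 1 \<le> k \<and> [int k] = w}"
        by (rule finite_subset[of _ "{nat (hd w)}"]) auto
      have "phi_bracket n w = (\<Sum>k\<in>{k. 1 \<le> k \<and> [int k] = w}. mps_const ((wfps ^ k) $ nat n) * fs_word [int k] w)"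
        unfolding phi_bracket_def w if_P[OF True]
        by (rule fs_lincomb_superset[OF fin]) (auto simp: fs_word_def)
      then show ?thesis by (simp add: fs_word_def)
    qed
    show ?thesis
    proof (cases "\<exists>j. w = [j]")
      case True
      then obtain j where j: "w = [j]" by blast
      show ?thesis
      proof (cases "j \<ge> 1")
        case True
        then have "{k. 1 \<le> k \<and> [int k] = w} = {nat j}" using j by auto
        then show ?thesis unfolding e using j True cw_nat[of n "nat j"] \<open>n \<ge> 1\<close> by simp
      next
        case False
        then have emp: "{k. 1 \<le> k \<and> [int k] = w} = {}" using j by auto
        have "cw n j = 0" using False \<open>n \<ge> 1\<close> by (intro cw_pos_nonpos) auto
        then show ?thesis unfolding e emp using j by simp
      qed
    next
      case False
      then have "{k. 1 \<le> k \<and> [int k] = w} = {}" by auto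
      then show ?thesis unfolding e using False by (auto split: list.splits)
    qed
  next
    case False
    have e: "phi_bracket n w = (\<Sum>k\<in>{k. [- int k] = w}. mps_const (coeff ([:gam, 1:] ^ k) (nat (- n))))"
    proof -
      have fin: "finite {k. [- int k] = w}"
        by (rule finite_subset[of _ "{nat (- hd w)}"]) auto
      have "phi_bracket n w = (\<Sum>k\<in>{k. [- int k] = w}. mps_const (coeff ([:gam, 1:] ^ k) (nat (- n))) * fs_word [- int k] w)"
        unfolding phi_bracket_def g if_not_P[OF False]
        by (rule fs_lincomb_superset[OF fin]) (auto simp: fs_word_def)
      then show ?thesis by (simp add: fs_word_def)
    qed
    show ?thesis
    proof (cases "\<exists>j. w = [j]")
      case True
      then obtain j where j: "w = [j]" by blast
      show ?thesis
      proof (cases "j \<le> 0")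
        case True
        then have "{k. [- int k] = w} = {nat (- j)}" using j by auto
        then show ?thesis unfolding e using j True cw_neg_nat[of "nat (- n)" "nat (- j)"] False by simp
      next
        case jp: False
        then have emp: "{k. [- int k] = w} = {}" using j by auto
        have "cw n j = 0" using jp False by (intro cw_less) auto
        then show ?thesis unfolding e emp using j by simp
      qed
    next
      case nj: False
      then have "{k. [- int k] = w} = {}" by auto
      then show ?thesis unfolding e using nj by (auto split: list.splits)
    qed
  qed
qed

lemma kap_int: "kap (int k) = 1 / 2 * (- beta / 2) ^ k"
  by (simp add: kap_def gam_def)

lemma Phi_bracket_apply: "Phi_bracket n w = (case w of [j] \<Rightarrow> mps_const (cPhi n j) | _ \<Rightarrow> 0)"
proof (cases "\<exists>j. w = [j]")
  case True
  then obtain j where j: "w = [j]" by blast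
  have "Phi_bracket n w = (\<Sum>k | k \<le> nat (n - j). mps_const (1 / 2 * (- beta / 2) ^ k) * phi_bracket (n - int k) w)"
    unfolding Phi_bracket_def
  proof (rule fs_lincomb_superset)
    fix k assume "k \<in> UNIV - {k. k \<le> nat (n - j)}"
    then have "cw (n - int k) j = 0" by (intro cw_less) auto
    then show "mps_const (1 / 2 * (- beta / 2) ^ k) * phi_bracket (n - int k) w = 0"
      by (simp add: phi_bracket_apply j)
  qed auto
  then show ?thesis unfolding j phi_bracket_apply cPhi_def kap_int mps_const_sum mps_const_mult by (simp only: list.case)
next
  case False
  then have "phi_bracket m w = 0" for m by (auto simp: phi_bracket_apply split: list.splits)
  then have "Phi_bracket n w = 0" unfolding Phi_bracket_def fs_lincomb_def by simp
  then show ?thesis using False by (auto split: list.splits)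
qed

context scalar_fermions begin

lemma fs_act_Phi_bracket: "fs_act scale phi (Phi_bracket n) v = Ph n v"
proof -
  obtain d where d: "d \<ge> 0" "v \<in> filt ket d" using ex_filt by metis
  have "fs_act scale phi (Phi_bracket n) v = (\<Sum>w\<in>(\<lambda>j. [j]) ` {- d..n}. scale (Phi_bracket n w) (foldr phi w v))"
    unfolding fs_act_def
  proof (rule Sum_any.expand_superset)
    show "{w. scale (Phi_bracket n w) (foldr phi w v) \<noteq> 0} \<subseteq> (\<lambda>j. [j]) ` {- d..n}"
    proof
      fix w assume "w \<in> {w. scale (Phi_bracket n w) (foldr phi w v) \<noteq> 0}"
      then have w: "scale (Phi_bracket n w) (foldr phi w v) \<noteq> 0" by simp
      then have "Phi_bracket n w \<noteq> 0" by auto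
      then obtain j where j: "w = [j]" "cPhi n j \<noteq> 0"
        by (auto simp: Phi_bracket_apply split: list.splits) (metis mps_const_0)
      moreover have "\<not> j < - d" using w j phi_vanish[OF vac_ket d(2), of j] by auto
      moreover have "\<not> j > n" using j cPhi_less by blast
      ultimately show "w \<in> (\<lambda>j. [j]) ` {- d..n}" by auto
    qed
  qed simp
  also have "\<dots> = (\<Sum>j = - d..n. csc (cPhi n j) (phi j v))"
    by (subst sum.reindex) (auto simp: inj_on_def Phi_bracket_apply)
  also have "\<dots> = Ph n v"
    unfolding Ph_def by (rule clin_eq[OF vac_ket d(2), of n, symmetric]) (auto simp: cPhi_less)
  finally show ?thesis .
qed

lemma ket_p_eq: "ket_p scale phi ket ls = kp ls"
proof (induction ls)
  case Nil
  show ?case by (simp add: plus_def)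
next
  case (Cons l ls)
  have "(if ls = [] then ket_p scale phi ket ls
     else op_exp scale (\<lambda>u. - fs_act scale phi theta u) (ket_p scale phi ket ls)) = Ei (kp ls)"
    using Cons by (auto simp: Ei_vac[OF vac_plus] simp flip: Ei_eq)
  then show ?case
    by (simp add: Let_def fs_act_Phi_bracket am_def kap_int)
qed

subsection \<open>Spanning\<close>

definition sword :: "nat list \<Rightarrow> 'f" where "sword a = foldr phi (map int a) plus"

text \<open>Straightening: a letter smaller than the head passes it with a sign and without
  contraction, equal positive letters give 0, and a letter 0 is absorbed by \<open>plus\<close>. The
  bound m on the letters keeps the head strictly largest in the recursive call.\<close>

lemma phi_sword:
  assumes "a \<in> strict_partitions" "b \<le> m" "\<And>x. x \<in> set a \<Longrightarrow> x \<le> m"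
  shows "phi (int b) (sword a) \<in> span {sword c | c. c \<in> strict_partitions \<and> sum_list c = b + sum_list a \<and> set c \<subseteq> {..m}}"
  using assms
proof (induction a arbitrary: m)
  case Nil
  show ?case
  proof (cases "b = 0")
    case True
    then have "phi (int b) (sword []) = sword []" by (simp add: sword_def phi_0_plus)
    then show ?thesis using True strict_Nil by (auto intro!: span_base)
  next
    case False
    then have "phi (int b) (sword []) = sword [b]" "[b] \<in> strict_partitions"
      by (simp_all add: sword_def strict_partitions_def)
    then show ?thesis using Nil by (auto intro!: span_base exI[of _ "[b]"])
  qed
next
  case (Cons l ls)
  have l: "l > 0" "\<And>x. x \<in> set ls \<Longrightarrow> x < l" "ls \<in> strict_partitions" "l \<le> m"
    using Cons.prems by (auto simp: strict_Cons)
  show ?case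
  proof (cases b l rule: linorder_cases)
    case greater
    have "phi (int b) (sword (l # ls)) = sword (b # l # ls)" by (simp add: sword_def)
    moreover have "b # l # ls \<in> strict_partitions"
      using greater Cons.prems(1) l by (auto simp: strict_Cons[of b] intro: less_trans)
    ultimately show ?thesis using Cons.prems by (auto intro!: span_base exI[of _ "b # l # ls"])
  next
    case equal
    then show ?thesis using l by (simp add: sword_def phi_square span_zero)
  next
    case less
    have "phi (int b) (sword (l # ls)) = - phi (int l) (phi (int b) (sword ls))"
      using phi_swap[of "int b" "int l" "sword ls"] less by (simp add: sword_def)
    moreover have "phi (int l) u \<in> span {sword c | c. c \<in> strict_partitions \<and> sum_list c = b + sum_list (l # ls) \<and> set c \<subseteq> {..m}}"
      if "u \<in> span {sword c | c. c \<in> strict_partitions \<and> sum_list c = b + sum_list ls \<and> set c \<subseteq> {..l - 1}}" for u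
      using that
    proof (induction rule: span_induct_alt)
      case base
      then show ?case by (simp add: phi_0 span_zero)
    next
      case (step c x y)
      then obtain e where e: "x = sword e" "e \<in> strict_partitions" "sum_list e = b + sum_list ls" "set e \<subseteq> {..l - 1}"
        by auto
      have s: "l # e \<in> strict_partitions" using e l by (auto simp: strict_Cons)
      have "phi (int l) x \<in> span {sword c | c. c \<in> strict_partitions \<and> sum_list c = b + sum_list (l # ls) \<and> set c \<subseteq> {..m}}"
      proof (rule span_base, rule CollectI, intro exI conjI)
        show "phi (int l) x = sword (l # e)" by (simp add: e sword_def)
        show "set (l # e) \<subseteq> {..m}" using e(4) l by fastforce
      qed (use e s in auto)
      then show ?case using step by (simp add: phi_add phi_scale span_add span_scale)
    qed
    moreover have "phi (int b) (sword ls) \<in> span {sword c | c. c \<in> strict_partitions \<and> sum_list c = b + sum_list ls \<and> set c \<subseteq> {..l - 1}}"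
      by (rule Cons.IH) (use l less in \<open>auto simp: less_Suc_eq_le[symmetric]\<close>)
    ultimately show ?thesis by (simp add: span_neg)
  qed
qed

lemma word_strict_span: "foldr phi (map int a) plus \<in> span {sword c | c. c \<in> strict_partitions \<and> sum_list c = sum_list a}"
proof (induction a)
  case Nil
  have "sword [] \<in> span {sword c | c. c \<in> strict_partitions \<and> sum_list c = sum_list []}"
    using strict_Nil by (intro span_base) auto
  then show ?case by (simp add: sword_def)
next
  case (Cons b a)
  have "phi (int b) u \<in> span {sword c | c. c \<in> strict_partitions \<and> sum_list c = b + sum_list a}"
    if "u \<in> span {sword c | c. c \<in> strict_partitions \<and> sum_list c = sum_list a}" for u
    using that
  proof (induction rule: span_induct_alt)
    case base
    then show ?case by (simp add: phi_0 span_zero)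
  next
    case (step c x y)
    then obtain e where e: "x = sword e" "e \<in> strict_partitions" "sum_list e = sum_list a" by auto
    have "phi (int b) x \<in> span {sword c | c. c \<in> strict_partitions \<and> sum_list c = b + sum_list e \<and> set c \<subseteq> {..Max (insert b (set e))}}"
      unfolding e(1) by (rule phi_sword) (use e in auto)
    then have "phi (int b) x \<in> span {sword c | c. c \<in> strict_partitions \<and> sum_list c = b + sum_list a}"
      by (rule span_mono[THEN subsetD, rotated]) (use e in auto)
    then show ?case using step by (simp add: phi_add phi_scale span_add span_scale)
  qed
  then show ?case using Cons by simp
qed

lemma Ei_leading:
  assumes "vac \<Omega>" "v \<in> filt \<Omega> d" shows "Ei v - v \<in> filt \<Omega> (d - 1)"
proof -
  have "Ei v = (\<Sum>k\<le>Suc (nat d). dbos (- tgam) k v)"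
    unfolding Ei_def by (rule bexp_eq[OF assms]) auto
  also have "\<dots> = v + (\<Sum>k\<le>nat d. dbos (- tgam) (Suc k) v)"
    by (subst sum.atMost_Suc_shift) (simp add: dbos_0)
  finally have "Ei v - v = (\<Sum>k\<le>nat d. dbos (- tgam) (Suc k) v)" by simp
  also have "\<dots> \<in> filt \<Omega> (d - 1)"
    by (rule filt_sum) (rule filt_mono[OF dbos_filt[OF assms]], simp)
  finally show ?thesis .
qed

lemma am_leading:
  assumes "vac \<Omega>" "v \<in> filt \<Omega> d" "l > 0"
  shows "am l v - csc (1 / 2) (phi l v) \<in> filt \<Omega> (d + l - 1)"
proof -
  have "Ph l v = (\<Sum>j = min (- d) l..l. csc (cPhi l j) (phi j v))"
    unfolding Ph_def by (rule clin_eq[OF assms(1,2), of l]) (auto simp: cPhi_less)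
  also have "{min (- d) l..l} = insert l {min (- d) l..l - 1}" by auto
  also have "(\<Sum>j\<in>insert l {min (- d) l..l - 1}. csc (cPhi l j) (phi j v))
      = csc (1 / 2) (phi l v) + (\<Sum>j = min (- d) l..l - 1. csc (cPhi l j) (phi j v))"
    by (subst sum.insert) (auto simp: cPhi_self)
  finally have "am l v - csc (1 / 2) (phi l v) = (\<Sum>j = min (- d) l..l - 1. csc (cPhi l j) (phi j v)) - csc (kap l) v"
    by (simp add: am_def)
  also have "\<dots> \<in> filt \<Omega> (d + l - 1)"
  proof (intro filt_diff filt_sum filt_scale)
    show "v \<in> filt \<Omega> (d + l - 1)" by (rule filt_mono[OF assms(2)]) (use assms in auto)
    fix j assume "j \<in> {min (- d) l..l - 1}"
    then show "phi j v \<in> filt \<Omega> (d + l - 1)" by (intro filt_mono[OF phi_filt[OF assms(1,2)]]) auto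
  qed
  finally show ?thesis .
qed

text \<open>\<open>Ei\<close> is the identity up to lower degree, and the top coefficient of
  \<open>am l\<close> is \<open>cPhi l l\<close>, which is 1/2. So each part contributes a factor
  1/2, and the leading coefficient is invertible.\<close>

lemma kp_leading:
  assumes "ls \<in> strict_partitions"
  shows "kp ls \<in> filt plus (int (sum_list ls)) \<and>
    (\<exists>c :: qbeta. c \<noteq> 0 \<and> kp ls - csc c (sword ls) \<in> filt plus (int (sum_list ls) - 1))"
  using assms
proof (induction ls)
  case Nil
  show ?case by (auto simp: sword_def filt_vac intro!: exI[of _ 1] filt_0)
next
  case (Cons l ls)
  let ?d = "int (sum_list ls)" and ?d' = "int (sum_list (l # ls))"
  have l: "l > 0" and ls: "ls \<in> strict_partitions" using Cons.prems by (auto simp: strict_Cons)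
  obtain c :: qbeta where c: "c \<noteq> 0" "kp ls - csc c (sword ls) \<in> filt plus (?d - 1)" and k: "kp ls \<in> filt plus ?d"
    using Cons.IH[OF ls] by blast
  let ?v = "Ei (kp ls)"
  have v: "?v \<in> filt plus ?d" by (rule Ei_filt[OF vac_plus k])
  have 1: "am (int l) ?v - csc (1 / 2) (phi (int l) ?v) \<in> filt plus (?d' - 1)"
    using am_leading[OF vac_plus v, of "int l"] l by (simp add: algebra_simps)
  have "?v - csc c (sword ls) \<in> filt plus (?d - 1)"
    using filt_add[OF Ei_leading[OF vac_plus k] c(2)] by simp
  then have "csc (1 / 2) (phi (int l) (?v - csc c (sword ls))) \<in> filt plus (?d - 1 + int l)"
    by (intro filt_scale phi_filt[OF vac_plus])
  moreover have "csc (1 / 2) (phi (int l) (?v - csc c (sword ls))) = csc (1 / 2) (phi (int l) ?v) - csc (1 / 2 * c) (sword (l # ls))"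
    by (simp only: phi_diff phi_scale scale_right_diff_distrib scale_scale mps_const_mult) (simp add: sword_def)
  ultimately have 2: "csc (1 / 2) (phi (int l) ?v) - csc (1 / 2 * c) (sword (l # ls)) \<in> filt plus (?d' - 1)"
    by (simp add: algebra_simps)
  have 3: "kp (l # ls) - csc (1 / 2 * c) (sword (l # ls)) \<in> filt plus (?d' - 1)"
    using filt_add[OF 1 2] by simp
  have "csc (1 / 2 * c) (sword (l # ls)) \<in> filt plus ?d'"
    unfolding sword_def by (intro filt_scale filt_word) simp
  then have "kp (l # ls) \<in> filt plus ?d'"
    using filt_add[OF filt_mono[OF 3, of ?d']] by fastforce
  then show ?case using 3 c(1) by (intro conjI exI[of _ "1 / 2 * c"]) auto
qed

text \<open>Triangularity in the degree: \<open>kp ls\<close> is a nonzero constant multiple of a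
  strict word up to lower degree, and strict words span by straightening.\<close>

lemma filt_plus_span: "v \<in> filt plus (int d - 1) \<Longrightarrow> v \<in> span (kp ` strict_partitions)"
proof (induction d arbitrary: v)
  case 0
  then have "v = 0" by (intro filt_below_0) auto
  then show ?case by (simp add: span_zero)
next
  case (Suc d)
  have s: "sword ls \<in> span (kp ` strict_partitions)" if ls: "ls \<in> strict_partitions" "sum_list ls \<le> d" for ls
  proof -
    obtain c :: qbeta where c: "c \<noteq> 0" "kp ls - csc c (sword ls) \<in> filt plus (int (sum_list ls) - 1)"
      using kp_leading[OF ls(1)] by blast
    have h: "kp ls - csc c (sword ls) \<in> span (kp ` strict_partitions)"
      by (rule Suc.IH[OF filt_mono[OF c(2)]]) (use ls in auto)
    have "kp ls \<in> span (kp ` strict_partitions)" using ls by (intro span_base) auto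
    from span_diff[OF this h] have "csc c (sword ls) \<in> span (kp ` strict_partitions)" by simp
    then have "csc (1 / c) (csc c (sword ls)) \<in> span (kp ` strict_partitions)"
      by (rule span_scale)
    then show ?thesis using c(1) by (simp flip: mps_const_mult)
  qed
  show ?case using Suc.prems
  proof (induction rule: filt_induct)
    case (word a)
    have "foldr phi (map int a) plus \<in> span {sword c | c. c \<in> strict_partitions \<and> sum_list c = sum_list a}"
      by (rule word_strict_span)
    also have "\<dots> \<subseteq> span (kp ` strict_partitions)"
      by (rule span_minimal) (use s word in auto)
    finally show ?case .
  qed (auto intro: span_add span_scale span_zero)
qed

text \<open>The vectors \<open>kp\<close> span, and biorthogonality forces the coefficients to be
  the values of \<open>Df\<close>. The finite set L is what later makes the Cauchy sum converge
  coefficientwise.\<close>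

lemma Fplus_expansion:
  assumes "v \<in> Fplus"
  obtains L where "finite L" "L \<subseteq> strict_partitions" "\<And>ls. ls \<in> strict_partitions - L \<Longrightarrow> Df ls v = 0"
    "v = (\<Sum>ls\<in>L. scale (Df ls v) (kp ls))"
proof -
  obtain d where d: "d \<ge> 0" "v \<in> filt plus d" using FplusE[OF assms] by metis
  then have "v \<in> filt plus (int (Suc (nat d)) - 1)" by simp
  then have "v \<in> span (kp ` strict_partitions)" by (rule filt_plus_span)
  then have "\<exists>L. finite L \<and> L \<subseteq> strict_partitions \<and> (\<forall>ls\<in>strict_partitions - L. Df ls v = 0) \<and>
    v = (\<Sum>ls\<in>L. scale (Df ls v) (kp ls))"
  proof (induction rule: span_induct_alt)
    case base
    then show ?case by (intro exI[of _ "{}"]) (simp add: Df_0)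
  next
    case (step c x y)
    then obtain m L where m: "x = kp m" "m \<in> strict_partitions" and L: "finite L" "L \<subseteq> strict_partitions"
      "\<forall>ls\<in>strict_partitions - L. Df ls y = 0" "y = (\<Sum>ls\<in>L. scale (Df ls y) (kp ls))" by blast
    have y: "y = (\<Sum>ls\<in>insert m L. scale (Df ls y) (kp ls))"
    proof -
      have "(\<Sum>ls\<in>L. scale (Df ls y) (kp ls)) = (\<Sum>ls\<in>insert m L. scale (Df ls y) (kp ls))"
        by (rule sum.mono_neutral_left) (use L m in auto)
      then show ?thesis using L(4) by simp
    qed
    have k: "Df ls x = (if ls = m then 1 else 0)" if "ls \<in> strict_partitions" for ls
      using Df_kp[OF that m(2)] m(1) by simp
    have "(\<Sum>ls\<in>insert m L. scale (Df ls (scale c x + y)) (kp ls))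
        = (\<Sum>ls\<in>insert m L. (if ls = m then scale c (kp m) else 0) + scale (Df ls y) (kp ls))"
    proof (rule sum.cong)
      fix ls assume "ls \<in> insert m L"
      then have "ls \<in> strict_partitions" using L m by auto
      then show "scale (Df ls (scale c x + y)) (kp ls) = (if ls = m then scale c (kp m) else 0) + scale (Df ls y) (kp ls)"
        by (simp add: Df_add Df_scale k scale_left_distrib)
    qed simp
    also have "\<dots> = scale c x + y"
      unfolding sum.distrib y[symmetric] using L(1) by (simp add: m(1))
    finally have ex: "scale c x + y = (\<Sum>ls\<in>insert m L. scale (Df ls (scale c x + y)) (kp ls))" ..
    show ?case
    proof (intro exI[of _ "insert m L"] conjI ballI)
      fix ls assume "ls \<in> strict_partitions - insert m L"
      then show "Df ls (scale c x + y) = 0" using L(3) by (simp add: Df_add Df_scale k)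
    qed (use L(1,2) m(2) in simp_all, rule ex)
  qed
  then show thesis using that by blast
qed

lemma Fplus_Df_eq_0: "v \<in> Fplus \<Longrightarrow> (\<And>ls. ls \<in> strict_partitions \<Longrightarrow> Df ls v = 0) \<Longrightarrow> v = 0"
proof -
  assume v: "v \<in> Fplus" and z: "\<And>ls. ls \<in> strict_partitions \<Longrightarrow> Df ls v = 0"
  obtain L where "L \<subseteq> strict_partitions" "v = (\<Sum>ls\<in>L. scale (Df ls v) (kp ls))"
    using Fplus_expansion[OF v] by metis
  moreover from this have "(\<Sum>ls\<in>L. scale (Df ls v) (kp ls)) = 0"
    by (intro sum.neutral) (auto simp: z)
  ultimately show "v = 0" by simp
qed

end

subsection \<open>Iterated Laurent series in one more variable\<close>

lemma il_eqI: "(\<And>e. il_coeff f e = il_coeff g e) \<Longrightarrow> f = g"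
  by transfer auto

lemma il_coeff_simps:
  "il_coeff 0 e = 0" "il_coeff 1 e = (if e = 0 then 1 else 0)"
  "il_coeff (f + g) e = il_coeff f e + il_coeff g e"
  "il_coeff (f - g) e = il_coeff f e - il_coeff g e"
  "il_coeff (- f) e = - il_coeff f e"
  "il_coeff (f * g) e = conv (il_coeff f) (il_coeff g) e"
  by (simp_all add: zero_ilaurent.rep_eq one_ilaurent.rep_eq plus_ilaurent.rep_eq minus_ilaurent.rep_eq
      uminus_ilaurent.rep_eq times_ilaurent.rep_eq)

lemma il_coeff_monom_times: "il_coeff (il_monom a c * f) e = c * il_coeff f (e - a)"
  for c :: "'a::comm_ring_1"
  unfolding il_coeff_simps
  by (subst conv_superset[where P = "{(a, e - a)}"]) (auto simp: il_coeff_il_monom split: if_splits)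

lemma il_monom_mult: "il_monom a c * il_monom b d = il_monom (a + b) (c * d)" for c :: "'a::comm_ring_1"
  by (rule il_eqI) (auto simp: il_coeff_monom_times il_coeff_il_monom algebra_simps)

lemma il_monom_0_1: "il_monom 0 (1 :: 'a::comm_ring_1) = 1"
  by (rule il_eqI) (simp add: il_coeff_il_monom il_coeff_simps)

lemma il_const_0 [simp]: "il_const 0 = 0"
  and il_const_1 [simp]: "il_const 1 = 1"
  and il_const_add: "il_const (a + b) = il_const a + il_const b"
  and il_const_minus: "il_const (- a) = - il_const a"
  for a b :: "'a::comm_ring_1"
  by (rule il_eqI, simp add: il_const_def il_coeff_il_monom il_coeff_simps)+

lemma il_const_mult: "il_const (a * b) = il_const a * il_const b" for a b :: "'a::comm_ring_1"
  by (simp add: il_const_def il_monom_mult)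

lemma il_const_power: "il_const (a ^ n) = il_const a ^ n" for a :: "'a::comm_ring_1"
  by (induction n) (simp_all add: il_const_mult)

lemma right_inverse_unique: assumes "a * b = 1" "a * c = (1 :: 'a::comm_ring_1)" shows "c = b"
proof -
  have "c = (a * b) * c" using assms by simp
  also have "\<dots> = (a * c) * b" by (simp only: mult_ac)
  finally show ?thesis using assms by simp
qed

lemma il_inverse_eq: "a * b = 1 \<Longrightarrow> inverse a = b" for a b :: "'a::comm_ring_1 ilaurent"
  unfolding inverse_ilaurent_def
  by (rule the_equality) (auto intro: right_inverse_unique)

lemma il_unit: "a dvd 1 \<Longrightarrow> a * inverse a = 1" for a :: "'a::comm_ring_1 ilaurent"
  by (auto simp: dvd_def il_inverse_eq[of a])

lemma mps_inverse_eq: "a * b = 1 \<Longrightarrow> inverse a = b" for a b :: "('v, 'a::comm_ring_1) mps"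
  unfolding inverse_mps_def
  by (rule the_equality) (auto intro: right_inverse_unique)

lemma dvd_1_mult: "a dvd 1 \<Longrightarrow> b dvd 1 \<Longrightarrow> a * b dvd (1 :: 'a::comm_ring_1)"
  using mult_dvd_mono[of a 1 b 1] by simp

definition tl_exp :: "(nat \<Rightarrow>\<^sub>0 int) \<Rightarrow> (nat \<Rightarrow>\<^sub>0 int)" where "tl_exp e = Poly_Mapping.map_key Suc e"

lemma lookup_tl_exp [simp]: "Poly_Mapping.lookup (tl_exp e) i = Poly_Mapping.lookup e (Suc i)"
  by (simp add: tl_exp_def map_key.rep_eq)

definition cons_exp :: "int \<Rightarrow> (nat \<Rightarrow>\<^sub>0 int) \<Rightarrow> (nat \<Rightarrow>\<^sub>0 int)" where
  "cons_exp n e = Abs_poly_mapping (\<lambda>i. case i of 0 \<Rightarrow> n | Suc j \<Rightarrow> Poly_Mapping.lookup e j)"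

lemma lookup_cons_exp: "Poly_Mapping.lookup (cons_exp n e) i = (case i of 0 \<Rightarrow> n | Suc j \<Rightarrow> Poly_Mapping.lookup e j)"
proof -
  have "{i. (case i of 0 \<Rightarrow> n | Suc j \<Rightarrow> Poly_Mapping.lookup e j) \<noteq> 0} \<subseteq> insert 0 (Suc ` Poly_Mapping.keys e)"
  proof
    fix i assume "i \<in> {i. (case i of 0 \<Rightarrow> n | Suc j \<Rightarrow> Poly_Mapping.lookup e j) \<noteq> 0}"
    then show "i \<in> insert 0 (Suc ` Poly_Mapping.keys e)" by (cases i) (auto simp: in_keys_iff)
  qed
  then have "finite {i. (case i of 0 \<Rightarrow> n | Suc j \<Rightarrow> Poly_Mapping.lookup e j) \<noteq> 0}"
    by (rule finite_subset) simp
  then show ?thesis by (simp add: cons_exp_def)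
qed

lemma tl_cons_exp [simp]: "tl_exp (cons_exp n e) = e"
  by (rule poly_mapping_eqI) (simp add: lookup_cons_exp)

lemma lookup_cons_exp_0 [simp]: "Poly_Mapping.lookup (cons_exp n e) 0 = n"
  by (simp add: lookup_cons_exp)

lemma cons_tl_exp: "cons_exp (Poly_Mapping.lookup e 0) (tl_exp e) = e"
  by (rule poly_mapping_eqI) (simp add: lookup_cons_exp split: nat.splits)

lemma exp_eq_iff: "e = f \<longleftrightarrow> Poly_Mapping.lookup e 0 = Poly_Mapping.lookup f 0 \<and> tl_exp e = tl_exp f"
  by (metis cons_tl_exp)

lemma tl_exp_add: "tl_exp (e + f) = tl_exp e + tl_exp f"
  by (rule poly_mapping_eqI) (simp add: lookup_add)

lemma tl_exp_diff: "tl_exp (e - f) = tl_exp e - tl_exp f"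
  by (rule poly_mapping_eqI) (simp add: lookup_minus)

lemma tl_exp_0 [simp]: "tl_exp 0 = 0"
  by (rule poly_mapping_eqI) simp

lemma tl_exp_single_0 [simp]: "tl_exp (Poly_Mapping.single 0 n) = 0"
  by (rule poly_mapping_eqI) (simp add: lookup_single)

lemma exp_leI:
  assumes "Poly_Mapping.lookup e 0 < Poly_Mapping.lookup f 0 \<or>
    (Poly_Mapping.lookup e 0 = Poly_Mapping.lookup f 0 \<and> tl_exp e \<le> tl_exp f)"
  shows "e \<le> f"
  using assms
proof
  assume "Poly_Mapping.lookup e 0 < Poly_Mapping.lookup f 0"
  then have "e < f" by (auto simp: less_poly_mapping.rep_eq less_fun_def)
  then show ?thesis by simp
next
  assume a: "Poly_Mapping.lookup e 0 = Poly_Mapping.lookup f 0 \<and> tl_exp e \<le> tl_exp f"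
  show ?thesis
  proof (cases "tl_exp e = tl_exp f")
    case True
    then show ?thesis using a exp_eq_iff[of e f] by simp
  next
    case False
    then have "tl_exp e < tl_exp f" using a le_neq_trans by blast
    then obtain k where "Poly_Mapping.lookup e (Suc k) < Poly_Mapping.lookup f (Suc k)"
      "\<And>k'. k' < k \<Longrightarrow> Poly_Mapping.lookup e (Suc k') = Poly_Mapping.lookup f (Suc k')"
      by (auto simp: less_poly_mapping.rep_eq less_fun_def)
    then have "e < f" using a
      by (auto simp: less_poly_mapping.rep_eq less_fun_def less_Suc_eq_0_disj intro!: exI[of _ "Suc k"])
    then show ?thesis by simp
  qed
qed

definition il_vars :: "nat \<Rightarrow> 'a::zero ilaurent \<Rightarrow> bool" where
  "il_vars r f \<longleftrightarrow> (\<forall>e. il_coeff f e \<noteq> 0 \<longrightarrow> Poly_Mapping.keys e \<subseteq> {..<r})"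

lemma il_support_coeff: "il_support {e. il_coeff f e \<noteq> 0}"
  using il_coeff[of f] by simp

lemma il_vars_mono: "il_vars r f \<Longrightarrow> r \<le> s \<Longrightarrow> il_vars s f"
  unfolding il_vars_def by fastforce

lemma ex_il_vars: "\<exists>r. il_vars r f"
  using il_support_coeff[of f] unfolding il_support_def il_vars_def by blast

lemma il_vars_0: "il_vars r 0" and il_vars_1: "il_vars r (1 :: 'a::comm_ring_1 ilaurent)"
  by (auto simp: il_vars_def il_coeff_simps)

lemma il_vars_const: "il_vars r (il_const c)"
  by (auto simp: il_vars_def il_const_def il_coeff_il_monom)

lemma il_vars_add: "il_vars r f \<Longrightarrow> il_vars r g \<Longrightarrow> il_vars r (f + g)" for f g :: "'a::comm_ring_1 ilaurent"
  unfolding il_vars_def il_coeff_simps by (metis add.right_neutral)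

lemma il_vars_mult: "il_vars r f \<Longrightarrow> il_vars r g \<Longrightarrow> il_vars r (f * g)" for f g :: "'a::comm_ring_1 ilaurent"
  unfolding il_vars_def il_coeff_simps
proof (intro allI impI)
  fix e assume fg: "\<forall>e. il_coeff f e \<noteq> 0 \<longrightarrow> Poly_Mapping.keys e \<subseteq> {..<r}"
    "\<forall>e. il_coeff g e \<noteq> 0 \<longrightarrow> Poly_Mapping.keys e \<subseteq> {..<r}" and "conv (il_coeff f) (il_coeff g) e \<noteq> 0"
  from this(3) obtain a b where ab: "a + b = e" "il_coeff f a \<noteq> 0" "il_coeff g b \<noteq> 0" by (rule conv_nonzeroD)
  have "Poly_Mapping.keys e \<subseteq> Poly_Mapping.keys a \<union> Poly_Mapping.keys b"
    using Poly_Mapping.keys_add[of a b] ab(1) by simp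
  with ab show "Poly_Mapping.keys e \<subseteq> {..<r}" using fg by blast
qed

lemma il_vars_power: "il_vars r f \<Longrightarrow> il_vars r (f ^ n)" for f :: "'a::comm_ring_1 ilaurent"
  by (induction n) (simp_all add: il_vars_1 il_vars_mult)

lemma il_vars_sum: "(\<And>a. a \<in> A \<Longrightarrow> il_vars r (f a)) \<Longrightarrow> il_vars r (sum f A)" for f :: "_ \<Rightarrow> 'a::comm_ring_1 ilaurent"
  by (induction A rule: infinite_finite_induct) (auto simp: il_vars_0 il_vars_add)

text \<open>The condition under which the s_n can be assembled into one iterated Laurent series in a
  new leading variable: exponents bounded below, and a number of variables bounded uniformly in
  n.\<close>

definition il_seq :: "(int \<Rightarrow> 'a::comm_ring_1 ilaurent) \<Rightarrow> bool" where
  "il_seq s \<longleftrightarrow> (\<exists>N. \<forall>n<N. s n = 0) \<and> (\<exists>r. \<forall>n. il_vars r (s n))"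

lemma il_seqI: "(\<And>n. n < N \<Longrightarrow> s n = 0) \<Longrightarrow> (\<And>n. il_vars r (s n)) \<Longrightarrow> il_seq s"
  unfolding il_seq_def by blast

lemma il_seq_add: "il_seq s \<Longrightarrow> il_seq t \<Longrightarrow> il_seq (\<lambda>n. s n + t n)"
proof -
  assume "il_seq s" "il_seq t"
  then obtain N r M q where "\<And>n. n < N \<Longrightarrow> s n = 0" "\<And>n. il_vars r (s n)" "\<And>n. n < M \<Longrightarrow> t n = 0" "\<And>n. il_vars q (t n)"
    unfolding il_seq_def by blast
  then show ?thesis
    by (intro il_seqI[of "min N M" _ "max r q"]) (auto intro!: il_vars_add il_vars_mono[of r "s _" "max r q"] il_vars_mono[of q "t _" "max r q"])
qed

lemma il_seq_mult: "il_seq s \<Longrightarrow> il_seq (\<lambda>n. f * s n)"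
proof -
  assume "il_seq s"
  then obtain N r where "\<And>n. n < N \<Longrightarrow> s n = 0" "\<And>n. il_vars r (s n)"
    unfolding il_seq_def by blast
  moreover obtain q where "il_vars q f" using ex_il_vars by blast
  ultimately show ?thesis
    by (intro il_seqI[of "N" _ "max r q"]) (auto intro!: il_vars_mult il_vars_mono[of r "s _" "max r q"] il_vars_mono[of q f "max r q"])
qed

lemma il_seq_shift: "il_seq s \<Longrightarrow> il_seq (\<lambda>n. s (n + k))"
proof -
  assume "il_seq s"
  then obtain N r where "\<And>n. n < N \<Longrightarrow> s n = 0" "\<And>n. il_vars r (s n)"
    unfolding il_seq_def by blast
  then show ?thesis by (intro il_seqI[of "N - k" _ r]) auto
qed

text \<open>\<open>il_glue s\<close> is $\sum_n u_0^n s_n(u_1, u_2, \dots)$.\<close>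

definition il_glue :: "(int \<Rightarrow> 'a::comm_ring_1 ilaurent) \<Rightarrow> 'a ilaurent" where
  "il_glue s = Abs_ilaurent (\<lambda>e. il_coeff (s (Poly_Mapping.lookup e 0)) (tl_exp e))"

lemma il_coeff_glue:
  assumes "il_seq s"
  shows "il_coeff (il_glue s) e = il_coeff (s (Poly_Mapping.lookup e 0)) (tl_exp e)"
proof -
  let ?S = "{e. il_coeff (s (Poly_Mapping.lookup e 0)) (tl_exp e) \<noteq> 0}"
  obtain N r where N: "\<And>n. n < N \<Longrightarrow> s n = 0" and r: "\<And>n. il_vars r (s n)"
    using assms unfolding il_seq_def by blast
  have "well_ordered_set ?S"
    unfolding well_ordered_set_iff
  proof (intro allI impI)
    fix A assume A: "A \<subseteq> ?S" "A \<noteq> {}"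
    define f where "f e = nat (Poly_Mapping.lookup e 0 - N)" for e :: "nat \<Rightarrow>\<^sub>0 int"
    have ge: "Poly_Mapping.lookup e 0 \<ge> N" if "e \<in> A" for e
    proof (rule ccontr)
      assume "\<not> ?thesis"
      then have "s (Poly_Mapping.lookup e 0) = 0" by (intro N) auto
      then show False using A that by (auto simp: il_coeff_simps)
    qed
    \<comment> \<open>A minimum is found lexicographically: the exponent of the leading variable is
      minimised first, which is possible as it is at least N, and then the tail within the
      well-ordered support of one s_n.\<close>
    obtain e0 where e0: "e0 \<in> A" "\<And>e. e \<in> A \<Longrightarrow> f e0 \<le> f e"
      using A(2) ex_has_least_nat[of "\<lambda>e. e \<in> A" _ f] by blast
    define n where "n = Poly_Mapping.lookup e0 0"
    let ?B = "tl_exp ` {e \<in> A. Poly_Mapping.lookup e 0 = n}"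
    have "?B \<subseteq> {e. il_coeff (s n) e \<noteq> 0}" "?B \<noteq> {}" using A e0 by (auto simp: n_def)
    moreover have "well_ordered_set {e. il_coeff (s n) e \<noteq> 0}"
      using il_support_coeff by (auto simp: il_support_def)
    ultimately obtain b where b: "b \<in> ?B" "\<forall>x\<in>?B. b \<le> x" unfolding well_ordered_set_iff by meson
    then obtain m where m: "m \<in> A" "Poly_Mapping.lookup m 0 = n" "b = tl_exp m" by auto
    have "m \<le> x" if x: "x \<in> A" for x
    proof (rule exp_leI)
      have "n \<le> Poly_Mapping.lookup x 0" using e0(2)[OF x] ge[OF x] ge[OF e0(1)] by (auto simp: f_def n_def)
      then show "Poly_Mapping.lookup m 0 < Poly_Mapping.lookup x 0 \<or>
          (Poly_Mapping.lookup m 0 = Poly_Mapping.lookup x 0 \<and> tl_exp m \<le> tl_exp x)"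
        using b m x by (cases "Poly_Mapping.lookup x 0 = n") auto
    qed
    then show "\<exists>m\<in>A. \<forall>x\<in>A. m \<le> x" using m(1) by blast
  qed
  moreover have "Poly_Mapping.keys e \<subseteq> {..<Suc r}" if "e \<in> ?S" for e
  proof
    fix i assume i: "i \<in> Poly_Mapping.keys e"
    have "Poly_Mapping.keys (tl_exp e) \<subseteq> {..<r}" using r that unfolding il_vars_def by auto
    then show "i \<in> {..<Suc r}" using i by (cases i) (auto simp: in_keys_iff subset_iff)
  qed
  ultimately have "il_support ?S" unfolding il_support_def by blast
  then show ?thesis by (simp add: il_glue_def Abs_ilaurent_inverse)
qed

lemma il_glue_add: "il_seq s \<Longrightarrow> il_seq t \<Longrightarrow> il_glue (\<lambda>n. s n + t n) = il_glue s + il_glue t"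
  by (rule il_eqI) (simp add: il_coeff_glue il_seq_add il_coeff_simps)

text \<open>The renaming of every variable to its successor. It frees the most significant variable,
  so inductions on the number of variables add the new one in front.\<close>

definition il_shift :: "'a::comm_ring_1 ilaurent \<Rightarrow> 'a ilaurent" where
  "il_shift f = il_glue (\<lambda>n. if n = 0 then f else 0)"

lemma il_seq_single: "il_seq (\<lambda>n. if n = 0 then f else 0)"
  using ex_il_vars[of f] il_vars_0 by (auto intro!: il_seqI[of 0])

lemma il_coeff_shift: "il_coeff (il_shift f) e = (if Poly_Mapping.lookup e 0 = 0 then il_coeff f (tl_exp e) else 0)"
  unfolding il_shift_def by (simp add: il_coeff_glue[OF il_seq_single] il_coeff_simps)

lemma il_shift_times_glue:
  assumes s: "il_seq s"
  shows "il_shift f * il_glue s = il_glue (\<lambda>n. f * s n)"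
proof (rule il_eqI)
  fix e :: "nat \<Rightarrow>\<^sub>0 int"
  let ?n = "Poly_Mapping.lookup e 0"
  let ?P = "{(a, b). a + b = tl_exp e \<and> il_coeff f a \<noteq> 0 \<and> il_coeff (s ?n) b \<noteq> 0}"
  let ?h = "\<lambda>(a, b). (cons_exp 0 a, cons_exp ?n b)"
  have fin: "finite ?P" by (rule il_support_pairs) (rule il_support_coeff)+
  have "cons_exp m a = cons_exp m b \<Longrightarrow> a = b" for m a b by (metis tl_cons_exp)
  then have inj: "inj_on ?h ?P" by (auto simp: inj_on_def)
  have "il_coeff (il_shift f * il_glue s) e = (\<Sum>(a, b)\<in>?h ` ?P. il_coeff (il_shift f) a * il_coeff (il_glue s) b)"
    unfolding il_coeff_simps
  proof (rule conv_superset)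
    show "finite (?h ` ?P)" using fin by simp
    show "?h ` ?P \<subseteq> {(a, b). a + b = e}"
      by (auto simp: exp_eq_iff[of _ e] lookup_add tl_exp_add)
    show "{(a, b). a + b = e \<and> il_coeff (il_shift f) a \<noteq> 0 \<and> il_coeff (il_glue s) b \<noteq> 0} \<subseteq> ?h ` ?P"
    proof
      fix x assume "x \<in> {(a, b). a + b = e \<and> il_coeff (il_shift f) a \<noteq> 0 \<and> il_coeff (il_glue s) b \<noteq> 0}"
      then obtain a b where x: "x = (a, b)" and ab: "a + b = e" "il_coeff (il_shift f) a \<noteq> 0" "il_coeff (il_glue s) b \<noteq> 0"
        by auto
      have a0: "Poly_Mapping.lookup a 0 = 0" "il_coeff f (tl_exp a) \<noteq> 0"
        using ab(2) by (auto simp: il_coeff_shift split: if_splits)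
      have b0: "Poly_Mapping.lookup b 0 = ?n" using arg_cong[OF ab(1), of "\<lambda>e. Poly_Mapping.lookup e 0"] a0 by (simp add: lookup_add)
      have "x = ?h (tl_exp a, tl_exp b)" using cons_tl_exp[of a] cons_tl_exp[of b] a0 b0 x by simp
      moreover have "(tl_exp a, tl_exp b) \<in> ?P"
        using ab(1,3) a0 b0 by (simp add: il_coeff_glue[OF s] flip: tl_exp_add)
      ultimately show "x \<in> ?h ` ?P" by (rule image_eqI)
    qed
  qed
  also have "\<dots> = (\<Sum>(a, b)\<in>?P. il_coeff f a * il_coeff (s ?n) b)"
    by (subst sum.reindex[OF inj]) (simp add: split_def il_coeff_shift il_coeff_glue[OF s])
  also have "\<dots> = il_coeff (il_glue (\<lambda>n. f * s n)) e"
    by (simp add: il_coeff_glue[OF il_seq_mult[OF s]] il_coeff_simps conv_def)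
  finally show "il_coeff (il_shift f * il_glue s) e = il_coeff (il_glue (\<lambda>n. f * s n)) e" .
qed

lemma il_shift_mult: "il_shift (f * g) = il_shift f * il_shift g"
proof -
  have "il_shift f * il_shift g = il_glue (\<lambda>n. f * (if n = 0 then g else 0))"
    unfolding il_shift_def[of g] by (rule il_shift_times_glue[OF il_seq_single])
  also have "(\<lambda>n. f * (if n = 0 then g else 0)) = (\<lambda>n :: int. if n = 0 then f * g else 0)" by auto
  finally show ?thesis by (simp add: il_shift_def)
qed

lemma il_shift_add: "il_shift (f + g) = il_shift f + il_shift g"
  by (rule il_eqI) (simp add: il_coeff_shift il_coeff_simps)

lemma il_shift_diff: "il_shift (f - g) = il_shift f - il_shift g"
  by (rule il_eqI) (simp add: il_coeff_shift il_coeff_simps)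

lemma il_shift_0 [simp]: "il_shift 0 = 0"
  by (rule il_eqI) (simp add: il_coeff_shift il_coeff_simps)

lemma il_shift_monom: "il_shift (il_monom e c) = il_monom (cons_exp 0 e) c"
  by (rule il_eqI) (auto simp: il_coeff_shift il_coeff_il_monom exp_eq_iff[of _ "cons_exp 0 e"])

lemma cons_exp_single: "cons_exp 0 (Poly_Mapping.single i n) = Poly_Mapping.single (Suc i) n"
  by (rule poly_mapping_eqI) (simp add: lookup_cons_exp lookup_single when_def split: nat.splits)

lemma cons_exp_0: "cons_exp 0 0 = 0"
  by (rule poly_mapping_eqI) (simp add: lookup_cons_exp split: nat.splits)

lemma il_shift_const [simp]: "il_shift (il_const c) = il_const c"
  by (simp add: il_const_def il_shift_monom cons_exp_0)

lemma il_shift_1 [simp]: "il_shift 1 = (1 :: 'a::comm_ring_1 ilaurent)"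
  using il_shift_const[of "1 :: 'a"] by simp

lemma il_shift_var: "il_shift (il_var i) = il_var (Suc i)"
  by (simp add: il_var_def il_shift_monom cons_exp_single)

lemma il_shift_sum: "il_shift (sum f A) = (\<Sum>a\<in>A. il_shift (f a))"
  by (induction A rule: infinite_finite_induct) (simp_all add: il_shift_add)

lemma il_shift_prod: "il_shift (prod f A) = (\<Prod>a\<in>A. il_shift (f a))"
  by (induction A rule: infinite_finite_induct) (simp_all add: il_shift_mult)

lemma il_shift_power: "il_shift (f ^ n) = il_shift f ^ n"
  by (induction n) (simp_all add: il_shift_mult)

lemma il_shift_unit: "f dvd 1 \<Longrightarrow> il_shift f dvd 1"
  by (metis dvd_def il_shift_mult il_shift_1)

lemma il_shift_inverse: "f dvd 1 \<Longrightarrow> il_shift (inverse f) = inverse (il_shift f)"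
  by (metis il_inverse_eq il_unit il_shift_mult il_shift_1)

definition il_ivar :: "nat \<Rightarrow> 'a::comm_ring_1 ilaurent" where
  "il_ivar i = il_monom (Poly_Mapping.single i (- 1)) 1"

lemma il_var_ivar: "il_var i * il_ivar i = (1 :: 'a::comm_ring_1 ilaurent)"
  by (simp add: il_var_def il_ivar_def il_monom_mult il_monom_0_1 flip: single_add)

lemma il_shift_ivar: "il_shift (il_ivar i) = il_ivar (Suc i)"
  by (simp add: il_ivar_def il_shift_monom cons_exp_single)

lemma il_monom_glue:
  assumes s: "il_seq s"
  shows "il_monom (Poly_Mapping.single 0 k) 1 * il_glue s = il_glue (\<lambda>n. s (n + (- k)))"
  using il_seq_shift[OF s, of "- k"]
  by (intro il_eqI) (simp add: il_coeff_monom_times il_coeff_glue s lookup_minus tl_exp_diff)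

lemma il_var_glue: "il_seq s \<Longrightarrow> il_var 0 * il_glue s = il_glue (\<lambda>n. s (n - 1))"
  and il_ivar_glue: "il_seq s \<Longrightarrow> il_ivar 0 * il_glue s = il_glue (\<lambda>n. s (n + 1))"
  using il_monom_glue[of s 1] il_monom_glue[of s "- 1"] by (simp_all add: il_var_def il_ivar_def)

text \<open>The geometric series in -c times the leading variable is legitimate even if c has poles
  in the other variables, since the leading exponent dominates the order.\<close>

lemma il_unit_geometric: "1 + il_shift c * il_var 0 dvd (1 :: 'a::comm_ring_1 ilaurent)"
proof -
  obtain r where r: "il_vars r c" using ex_il_vars by blast
  define s where "s n = (if n < 0 then 0 else (- c) ^ nat n)" for n
  have mc: "il_vars r (- c)" using r by (auto simp: il_vars_def il_coeff_simps)
  have s: "il_seq s"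
    by (rule il_seqI[of 0 _ r]) (auto simp: s_def il_vars_0 intro: il_vars_power mc)
  have s1: "il_seq (\<lambda>n. s (n - 1))" using il_seq_shift[OF s, of "- 1"] by simp
  have "(1 + il_shift c * il_var 0) * il_glue s = il_glue s + il_shift c * (il_var 0 * il_glue s)"
    by (simp add: algebra_simps)
  also have "\<dots> = il_glue s + il_glue (\<lambda>n. c * s (n - 1))"
    by (simp add: il_var_glue s il_shift_times_glue s1)
  also have "\<dots> = il_glue (\<lambda>n. s n + c * s (n - 1))"
    by (rule il_glue_add[symmetric, OF s il_seq_mult[OF s1]])
  also have "(\<lambda>n. s n + c * s (n - 1)) = (\<lambda>n. if n = 0 then 1 else 0)"
  proof
    fix n
    have "s (int (Suc m)) = - c * s (int m)" for m by (simp add: s_def nat_add_distrib)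
    moreover have "n < 0 \<or> n = 0 \<or> (\<exists>m. n = int (Suc m))" by presburger
    ultimately show "s n + c * s (n - 1) = (if n = 0 then 1 else 0)" by (auto simp: s_def)
  qed
  finally have "(1 + il_shift c * il_var 0) * il_glue s = 1" by (simp flip: il_shift_def)
  then show ?thesis by (metis dvd_def)
qed

text \<open>
  The sequence \<open>A\<close> of modes of a field is evaluated at $w(\overline{u_0}) = -1 / W_0$, where
  $W_0 = u_0^{-1} + \beta/2$.
\<close>

definition W0 :: "qbeta ilaurent" where "W0 = il_ivar 0 + il_const gam"

definition check_modes :: "(int \<Rightarrow> qbeta ilaurent) \<Rightarrow> int \<Rightarrow> qbeta ilaurent" where
  "check_modes A m = Sum_any (\<lambda>j. il_const (neg_one_pow j * cw m j) * A j)"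

definition il_eval :: "(int \<Rightarrow> qbeta ilaurent) \<Rightarrow> qbeta ilaurent" where
  "il_eval A = il_glue (check_modes A)"

lemma check_modes_eq:
  assumes "\<And>n. n < N \<Longrightarrow> A n = 0" "a \<le> N" "m \<le> b"
  shows "check_modes A m = (\<Sum>j = a..b. il_const (neg_one_pow j * cw m j) * A j)"
  unfolding check_modes_def
proof (rule Sum_any.expand_superset)
  have "j \<in> {a..b}" if "il_const (neg_one_pow j * cw m j) * A j \<noteq> 0" for j
  proof -
    have "\<not> j < N" using that assms(1) by auto
    moreover have "\<not> m < j" using that cw_less[of m j] by auto
    ultimately show ?thesis using assms(2,3) by auto
  qed
  then show "{j. il_const (neg_one_pow j * cw m j) * A j \<noteq> 0} \<subseteq> {a..b}" by auto
qed simp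

lemma il_seq_check:
  assumes "il_seq A" shows "il_seq (check_modes A)"
proof -
  obtain N r where N: "\<And>n. n < N \<Longrightarrow> A n = 0" and r: "\<And>n. il_vars r (A n)"
    using assms unfolding il_seq_def by blast
  have e: "check_modes A m = (\<Sum>j = N..m. il_const (neg_one_pow j * cw m j) * A j)" for m
    by (rule check_modes_eq) (use N in auto)
  show ?thesis
    by (rule il_seqI[of N _ r]) (auto simp: e intro!: il_vars_sum il_vars_mult il_vars_const r)
qed

lemma il_eval_add: "il_seq A \<Longrightarrow> il_seq B \<Longrightarrow> il_eval (\<lambda>n. A n + B n) = il_eval A + il_eval B"
proof -
  assume A: "il_seq A" and B: "il_seq B"
  obtain N M where N: "\<And>n. n < N \<Longrightarrow> A n = 0" and M: "\<And>n. n < M \<Longrightarrow> B n = 0"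
    using A B unfolding il_seq_def by blast
  have "check_modes (\<lambda>n. A n + B n) = (\<lambda>m. check_modes A m + check_modes B m)"
  proof
    fix m
    show "check_modes (\<lambda>n. A n + B n) m = check_modes A m + check_modes B m"
    by (subst (1 2 3) check_modes_eq[of "min N M" _ "min N M" _ m])
      (use N M in \<open>auto simp: distrib_left sum.distrib\<close>)
  qed
  then show ?thesis unfolding il_eval_def
    by (simp add: il_glue_add[OF il_seq_check[OF A] il_seq_check[OF B], symmetric])
qed

lemma il_eval_mult: "il_seq A \<Longrightarrow> il_eval (\<lambda>n. f * A n) = il_shift f * il_eval A"
proof -
  assume A: "il_seq A"
  obtain N where N: "\<And>n. n < N \<Longrightarrow> A n = 0" using A unfolding il_seq_def by blast
  have "check_modes (\<lambda>n. f * A n) = (\<lambda>m. f * check_modes A m)"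
  proof
    fix m
    show "check_modes (\<lambda>n. f * A n) m = f * check_modes A m"
    by (subst (1 2) check_modes_eq[of N _ N _ m])
      (use N in \<open>auto simp: sum_distrib_left mult_ac\<close>)
  qed
  then show ?thesis unfolding il_eval_def
    by (simp add: il_shift_times_glue[OF il_seq_check[OF A]])
qed

text \<open>Shifting the modes multiplies the field by its argument, which is
  -1/\<open>W0\<close>.\<close>

lemma il_eval_shift: "il_seq A \<Longrightarrow> W0 * il_eval (\<lambda>n. A (n - 1)) = - il_eval A"
proof -
  assume A: "il_seq A"
  obtain N where N: "\<And>n. n < N \<Longrightarrow> A n = 0" using A unfolding il_seq_def by blast
  let ?B = "\<lambda>n. A (n - 1)"
  have B: "il_seq ?B" using il_seq_shift[OF A, of "- 1"] by simp
  have cB: "check_modes ?B m = (\<Sum>j = N - 1..m. il_const (neg_one_pow (j + 1) * cw m (j + 1)) * A j)" for m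
  proof -
    have "check_modes ?B m = (\<Sum>j = N..m + 1. il_const (neg_one_pow j * cw m j) * A (j - 1))"
      by (rule check_modes_eq) (use N in auto)
    also have "\<dots> = (\<Sum>j = N - 1..m. il_const (neg_one_pow (j + 1) * cw m (j + 1)) * A j)"
      by (rule sum.reindex_bij_witness[of _ "\<lambda>j. j + 1" "\<lambda>j. j - 1"]) auto
    finally show ?thesis .
  qed
  have "check_modes ?B (m + 1) + il_const gam * check_modes ?B m = - check_modes A m" for m
  proof -
    have 1: "check_modes ?B m = (\<Sum>j = N - 1..m + 1. il_const (neg_one_pow (j + 1) * cw m (j + 1)) * A j)"
      unfolding cB by (rule sum.mono_neutral_left) (auto simp: cw_less)
    have 2: "check_modes A m = (\<Sum>j = N - 1..m + 1. il_const (neg_one_pow j * cw m j) * A j)"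
      by (rule check_modes_eq) (use N in auto)
    have k: "neg_one_pow (j + 1) * cw (m + 1) (j + 1) + gam * (neg_one_pow (j + 1) * cw m (j + 1)) = - (neg_one_pow j * cw m j)" for j
      using cw_rec[of m "j + 1"] by (simp add: neg_one_pow_def)
    show ?thesis
      unfolding cB[of "m + 1"] 1 2 sum_distrib_left sum.distrib[symmetric] sum_negf[symmetric]
      by (intro sum.cong refl)
        (simp only: mult.assoc[symmetric] il_const_mult[symmetric] distrib_right[symmetric] il_const_add[symmetric] k[unfolded mult.assoc[symmetric]] il_const_minus mult_minus_left)
  qed
  note m = this
  have cs: "il_seq (check_modes ?B)" by (rule il_seq_check[OF B])
  have "W0 * il_eval ?B = il_ivar 0 * il_glue (check_modes ?B) + il_shift (il_const gam) * il_glue (check_modes ?B)"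
    unfolding W0_def il_eval_def by (simp add: distrib_right)
  also have "\<dots> = il_glue (\<lambda>n. check_modes ?B (n + 1) + il_const gam * check_modes ?B n)"
    unfolding il_ivar_glue[OF cs] il_shift_times_glue[OF cs]
    by (rule il_glue_add[symmetric, OF il_seq_shift[OF cs] il_seq_mult[OF cs]])
  also have "\<dots> = il_glue (\<lambda>n. il_const (- 1) * check_modes A n)"
    unfolding m by (simp add: il_const_minus)
  also have "\<dots> = - il_eval A"
  proof -
    have sh1: "il_shift (il_const (- 1)) = (- 1 :: qbeta ilaurent)"
    by (subst il_shift_const) (simp add: il_const_minus)
    show ?thesis unfolding il_shift_times_glue[OF il_seq_check[OF A], symmetric] il_eval_def sh1 by simp
  qed
  finally show ?thesis .
qed

text \<open>The hypothesis says (1 - W w) A(w) = (1 + W w) B(w). At w = -1/\<open>W0\<close>, with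
  the other variables renamed, this becomes the claim after multiplication by \<open>W0\<close>.
  Exchange relations with M and with E are both of this shape.\<close>

lemma il_eval_reflect:
  assumes A: "il_seq A" and B: "il_seq B" and rel: "\<And>n. A n - W * A (n - 1) = B n + W * B (n - 1)"
  shows "(W0 + il_shift W) * il_eval A = (W0 - il_shift W) * il_eval B"
proof -
  let ?s = "\<lambda>A n. A (n - 1 :: int)"
  have sA: "il_seq (?s A)" "il_seq (?s B)" using il_seq_shift[OF A, of "- 1"] il_seq_shift[OF B, of "- 1"] by simp_all
  have rel': "A n + (- W) * ?s A n = B n + W * ?s B n" for n using rel[of n] by simp
  have "il_eval A + il_shift (- W) * il_eval (?s A) = il_eval (\<lambda>n. A n + (- W) * ?s A n)"
    by (simp only: il_eval_add[OF A il_seq_mult[OF sA(1)]] il_eval_mult[OF sA(1)])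
  also have "\<dots> = il_eval B + il_shift W * il_eval (?s B)"
    unfolding rel' by (simp only: il_eval_add[OF B il_seq_mult[OF sA(2)]] il_eval_mult[OF sA(2)])
  finally have 1: "il_eval A + il_shift (- W) * il_eval (?s A) = il_eval B + il_shift W * il_eval (?s B)" .
  have mW: "il_shift (- W) = - il_shift W" using il_shift_diff[of 0 W] by simp
  have "W0 * il_eval A - il_shift W * (W0 * il_eval (?s A)) = W0 * il_eval B + il_shift W * (W0 * il_eval (?s B))"
    using arg_cong[OF 1, of "\<lambda>x. W0 * x"] unfolding mW by (simp add: algebra_simps)
  then show ?thesis unfolding il_eval_shift[OF A] il_eval_shift[OF B] by (simp add: algebra_simps)
qed

lemma mps_coeff_0_mult: "mps_coeff (f * g) 0 = mps_coeff f 0 * mps_coeff g (0 :: 'v \<Rightarrow>\<^sub>0 nat)"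
proof -
  have z: "a = 0 \<and> b = 0" if "a + b = 0" for a b :: "'v \<Rightarrow>\<^sub>0 nat"
  proof -
    have "Poly_Mapping.lookup a x + Poly_Mapping.lookup b x = 0" for x
      using arg_cong[OF that, of "\<lambda>m. Poly_Mapping.lookup m x"] by (simp add: lookup_add)
    then show ?thesis by (auto intro!: poly_mapping_eqI)
  qed
  show ?thesis unfolding mps_coeff_simps
    by (subst conv_superset[where P = "{(0, 0)}"]) (auto dest: z)
qed

section \<open>Exponents and units for the generating series of GQ\<close>

definition lam_exp :: "nat list \<Rightarrow> (nat \<Rightarrow>\<^sub>0 int)" where
  "lam_exp ls = (\<Sum>i<length ls. Poly_Mapping.single i (- int (ls ! i)))"

lemma lookup_lam_exp: "Poly_Mapping.lookup (lam_exp ls) i = (if i < length ls then - int (ls ! i) else 0)"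
  by (simp add: lam_exp_def lookup_sum lookup_single when_def)

lemma lam_exp_Cons: "Poly_Mapping.lookup (lam_exp (n # ls)) 0 = - int n" "tl_exp (lam_exp (n # ls)) = lam_exp ls"
  by (simp add: lookup_lam_exp) (rule poly_mapping_eqI, simp add: lookup_lam_exp)

lemma il_const_beta: "il_const beta = il_const gam + il_const gam"
  by (simp only: beta_eq_gam mult_2 il_const_add)

lemma il_const_2: "il_const 2 = (2 :: 'a::comm_ring_1 ilaurent)"
  by (simp only: one_add_one[symmetric] il_const_add il_const_1)

lemma prod_list_upt: "(\<Prod>j\<leftarrow>[0..<r]. f j) = (\<Prod>j<r. f j)" for f :: "nat \<Rightarrow> 'a::comm_ring_1"
  by (induction r) (simp_all add: mult.commute)

lemma W0_minus: "W0 - il_const gam = il_ivar 0" by (simp add: W0_def)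

lemma W0_plus: "W0 + il_const gam = il_ivar 0 * (1 + il_const beta * il_var 0)"
proof -
  have "il_ivar 0 * (1 + il_const beta * il_var 0) = il_ivar 0 + il_const beta * (il_var 0 * il_ivar 0)"
    by (simp add: algebra_simps)
  then show ?thesis by (simp add: il_var_ivar W0_def il_const_beta)
qed

lemma il_ivar_unit: "il_ivar i dvd (1 :: 'a::comm_ring_1 ilaurent)"
  by (metis il_var_ivar dvd_def mult.commute)

lemma one_beta_unit: "1 + il_const beta * il_var i dvd (1 :: qbeta ilaurent)"
proof (induction i)
  case 0
  show ?case using il_unit_geometric[of "il_const beta"] by simp
next
  case (Suc i)
  then show ?case using il_shift_unit[OF Suc] by (simp add: il_shift_add il_shift_mult il_shift_var)
qed

lemma W0_plus_unit: "W0 + il_const gam dvd 1"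
  unfolding W0_plus by (rule dvd_1_mult[OF il_ivar_unit one_beta_unit])

lemma W0_shift_unit: "W0 + il_shift W dvd 1"
proof -
  have "il_ivar 0 * (1 + il_shift (il_const gam + W) * il_var 0)
      = il_ivar 0 + il_shift (il_const gam + W) * (il_var 0 * il_ivar 0)" by (simp add: algebra_simps)
  then have "W0 + il_shift W = il_ivar 0 * (1 + il_shift (il_const gam + W) * il_var 0)"
    by (simp add: il_var_ivar W0_def il_shift_add)
  then show ?thesis using dvd_1_mult[OF il_ivar_unit il_unit_geometric] by simp
qed

lemma il_seq_delta: "il_seq (\<lambda>n. if n = k then f else 0)"
  using ex_il_vars[of f] il_vars_0 by (auto intro!: il_seqI[of k])

lemma il_eval_delta: "il_eval (\<lambda>n. if n = - int l then f else 0) = (- W0) ^ l * il_shift f"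
proof (induction l)
  case 0
  have "check_modes (\<lambda>n. if n = 0 then f else 0) = (\<lambda>m. if m = 0 then f else 0)"
  proof
    fix m
    have "check_modes (\<lambda>n. if n = 0 then f else 0) m
        = (\<Sum>j = min 0 m..max 0 m. il_const (neg_one_pow j * cw m j) * (if j = 0 then f else 0))"
      by (rule check_modes_eq[of 0]) auto
    also have "\<dots> = (\<Sum>j = min 0 m..max 0 m. if j = 0 then il_const (neg_one_pow j * cw m j) * f else 0)"
      by (intro sum.cong) auto
    also have "\<dots> = (if m = 0 then f else 0)"
      by (subst sum.delta) (auto simp: cw_0 neg_one_pow_def)
    finally show "check_modes (\<lambda>n. if n = 0 then f else 0) m = (if m = 0 then f else 0)" .
  qed
  then show ?case by (simp add: il_eval_def il_shift_def)
next
  case (Suc l)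
  have "W0 * il_eval (\<lambda>n. if n - 1 = - int (Suc l) then f else 0) = - il_eval (\<lambda>n. if n = - int (Suc l) then f else 0)"
    by (rule il_eval_shift[OF il_seq_delta])
  moreover have "(\<lambda>n. if n - 1 = - int (Suc l) then f else 0) = (\<lambda>n. if n = - int l then f else 0)"
    by (auto simp: fun_eq_iff)
  ultimately have h: "W0 * ((- W0) ^ l * il_shift f) = - il_eval (\<lambda>n. if n = - int (Suc l) then f else 0)"
    using Suc by (simp only:)
  then have "il_eval (\<lambda>n. if n = - int (Suc l) then f else 0) = - (W0 * ((- W0) ^ l * il_shift f))"
    by (simp only: minus_minus)
  then show ?case by (simp add: mult.assoc)
qed

lemma il_seq_0: "il_seq (\<lambda>n. 0)" by (rule il_seqI[of 0 _ 0]) (auto simp: il_vars_0)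

lemma il_seq_sum: "(\<And>a. a \<in> I \<Longrightarrow> il_seq (A a)) \<Longrightarrow> il_seq (\<lambda>n. \<Sum>a\<in>I. A a n)"
  by (induction I rule: infinite_finite_induct) (auto simp: il_seq_0 il_seq_add)

lemma il_eval_0: "il_eval (\<lambda>n. 0) = 0"
  using il_eval_mult[OF il_seq_0, of 0] by simp

lemma il_eval_sum:
  "(\<And>a. a \<in> I \<Longrightarrow> il_seq (A a)) \<Longrightarrow> il_eval (\<lambda>n. \<Sum>a\<in>I. A a n) = (\<Sum>a\<in>I. il_eval (A a))"
  by (induction I rule: infinite_finite_induct) (auto simp: il_eval_0 il_eval_add il_seq_sum)

context scalar_fermions begin

subsection \<open>Laurent series valued functionals\<close>

text \<open>Values lie in series over Q(beta), while the scalars involve further variables; these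
  are set to 0, and linearity is meant in this sense. The uniform bound on the variables makes the
  values on all modes an \<open>il_seq\<close>.\<close>

definition fnl :: "('f \<Rightarrow> qbeta ilaurent) \<Rightarrow> bool" where
  "fnl \<omega> \<longleftrightarrow> (\<forall>u v. \<omega> (u + v) = \<omega> u + \<omega> v) \<and> (\<forall>s v. \<omega> (scale s v) = il_const (mps_coeff s 0) * \<omega> v) \<and>
    (\<exists>r. \<forall>v. il_vars r (\<omega> v))"

lemma fnl_add: "fnl \<omega> \<Longrightarrow> \<omega> (u + v) = \<omega> u + \<omega> v" by (simp add: fnl_def)
lemma fnl_scale: "fnl \<omega> \<Longrightarrow> \<omega> (scale s v) = il_const (mps_coeff s 0) * \<omega> v" by (simp add: fnl_def)
lemma fnl_csc: "fnl \<omega> \<Longrightarrow> \<omega> (csc c v) = il_const c * \<omega> v" by (simp add: fnl_scale mps_coeff_const)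
lemma fnl_0: "fnl \<omega> \<Longrightarrow> \<omega> 0 = 0" using fnl_scale[of \<omega> 0 0] by (simp add: mps_coeff_simps)
lemma fnl_sum: "fnl \<omega> \<Longrightarrow> \<omega> (sum f A) = (\<Sum>a\<in>A. \<omega> (f a))"
  by (induction A rule: infinite_finite_induct) (simp_all add: fnl_0 fnl_add)

lemma fnl_linop: "fnl \<omega> \<Longrightarrow> linop T \<Longrightarrow> fnl (\<lambda>v. \<omega> (T v))"
  unfolding fnl_def by (auto simp: linop_add linop_scale)

text \<open>The functional applied to M(W) v, a finite sum because M_l lowers the degree by
  l.\<close>

definition MZ :: "qbeta ilaurent \<Rightarrow> ('f \<Rightarrow> qbeta ilaurent) \<Rightarrow> 'f \<Rightarrow> qbeta ilaurent" where
  "MZ W \<omega> v = Sum_any (\<lambda>l. W ^ l * \<omega> (Mop l v))"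

lemma MZ_eq:
  assumes "fnl \<omega>" "vac \<Omega>" "v \<in> filt \<Omega> d" "d \<le> int N"
  shows "MZ W \<omega> v = (\<Sum>l\<le>N. W ^ l * \<omega> (Mop l v))"
  unfolding MZ_def
proof (rule Sum_any.expand_superset)
  have "l \<le> N" if "W ^ l * \<omega> (Mop l v) \<noteq> 0" for l
  proof (rule ccontr)
    assume "\<not> l \<le> N"
    then have "Mop l v = 0" using assms by (intro Mop_vanish[OF assms(2,3)]) auto
    with that show False by (simp add: fnl_0 assms)
  qed
  then show "{l. W ^ l * \<omega> (Mop l v) \<noteq> 0} \<subseteq> {..N}" by auto
qed simp

lemma fnl_MZ: assumes w: "fnl \<omega>" shows "fnl (MZ W \<omega>)"
  unfolding fnl_def
proof (intro conjI allI)
  fix u v :: 'f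
  obtain d e where d: "d \<ge> 0" "u \<in> filt ket d" "e \<ge> 0" "v \<in> filt ket e" using ex_filt by metis
  then have f: "u \<in> filt ket (d + e)" "v \<in> filt ket (d + e)" by (auto elim: filt_mono)
  note e = MZ_eq[OF w vac_ket _, of _ "d + e" "nat (d + e)"]
  show "MZ W \<omega> (u + v) = MZ W \<omega> u + MZ W \<omega> v"
    by (subst (1 2 3) e) (use f filt_add[OF f] in \<open>auto simp: linop_add[OF Mop_linop] fnl_add[OF w] distrib_left sum.distrib\<close>)
next
  fix s v
  obtain d where d: "d \<ge> 0" "v \<in> filt ket d" using ex_filt by metis
  note e = MZ_eq[OF w vac_ket _, of _ d "nat d"]
  show "MZ W \<omega> (scale s v) = il_const (mps_coeff s 0) * MZ W \<omega> v"
    by (subst (1 2) e) (use d filt_scale[OF d(2)] in \<open>auto simp: linop_scale[OF Mop_linop] fnl_scale[OF w] sum_distrib_left mult_ac\<close>)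
next
  obtain r where r: "\<And>v. il_vars r (\<omega> v)" using w unfolding fnl_def by blast
  obtain q where q: "il_vars q W" using ex_il_vars by blast
  have "il_vars (max r q) (MZ W \<omega> v)" for v
  proof -
    obtain d where d: "d \<ge> 0" "v \<in> filt ket d" using ex_filt by metis
    show ?thesis
      by (subst MZ_eq[OF w vac_ket d(2), of "nat d"])
        (use d in \<open>auto intro!: il_vars_sum il_vars_mult il_vars_power il_vars_mono[OF r] il_vars_mono[OF q]\<close>)
  qed
  then show "\<exists>r. \<forall>v. il_vars r (MZ W \<omega> v)" by blast
qed

text \<open>What remains of the dual functional once its annihilation fields have reached
  \<open>bra\<close>: each field has become a factor M(W_i), and the factors e^theta have
  stayed.\<close>

fun Zf :: "qbeta ilaurent list \<Rightarrow> 'f \<Rightarrow> qbeta ilaurent" where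
  "Zf [] v = il_const (mps_coeff (bra v) 0)"
| "Zf (W # Ws) v = MZ W (Zf Ws) (E v)"

lemma fnl_Zf: "fnl (Zf Ws)"
proof (induction Ws)
  case Nil
  show ?case
    by (auto simp: fnl_def bra_add bra_scale mps_coeff_simps(3) mps_coeff_0_mult il_const_add il_const_mult intro: il_vars_const)
next
  case (Cons W Ws)
  have "Zf (W # Ws) = (\<lambda>v. MZ W (Zf Ws) (E v))" by (rule ext) simp
  then show ?case using fnl_linop[OF fnl_MZ[OF Cons] E_linop] by simp
qed

lemma il_seq_phi:
  assumes w: "fnl \<omega>" shows "il_seq (\<lambda>n. \<omega> (phi n v))"
proof -
  obtain d where d: "d \<ge> 0" "v \<in> filt ket d" using ex_filt by metis
  obtain r where r: "\<And>v. il_vars r (\<omega> v)" using w unfolding fnl_def by blast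
  show ?thesis
    by (rule il_seqI[of "- d" _ r]) (auto simp: phi_vanish[OF vac_ket d(2)] fnl_0[OF w] r)
qed

lemma MZ_phi:
  assumes w: "fnl \<omega>"
  shows "MZ W \<omega> (phi n v) - W * MZ W \<omega> (phi (n - 1) v) = MZ W (\<lambda>u. \<omega> (phi n u)) v + W * MZ W (\<lambda>u. \<omega> (phi (n - 1) u)) v"
proof -
  obtain d where d: "d \<ge> 0" "v \<in> filt ket d" using ex_filt by metis
  define N where "N = nat (d + \<bar>n\<bar> + 1)"
  have N: "d \<le> int N" "d + n \<le> int N" "d + (n - 1) \<le> int N" using d by (auto simp: N_def)
  have N': "d \<le> int (Suc N)" "d + n \<le> int (Suc N)" using N by auto
  have wp: "fnl (\<lambda>u. \<omega> (phi m u))" for m by (rule fnl_linop[OF w phi_linear])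
  have "MZ W \<omega> (phi n v) = (\<Sum>l\<le>Suc N. W ^ l * \<omega> (Mop l (phi n v)))"
    by (rule MZ_eq[OF w vac_ket phi_filt[OF vac_ket d(2)] N'(2)])
  also have "\<dots> = \<omega> (phi n v) + (\<Sum>l\<le>N. W ^ Suc l * \<omega> (Mop (Suc l) (phi n v)))"
    by (subst sum.atMost_Suc_shift) simp
  also have "\<dots> = W * (\<Sum>l\<le>N. W ^ l * \<omega> (Mop l (phi (n - 1) v)))
      + (\<omega> (phi n v) + (\<Sum>l\<le>N. W ^ Suc l * \<omega> (phi n (Mop (Suc l) v))))
      + W * (\<Sum>l\<le>N. W ^ l * \<omega> (phi (n - 1) (Mop l v)))"
    unfolding Mop_phi_Suc by (simp add: fnl_add[OF w] algebra_simps sum.distrib sum_distrib_left del: Mop.simps(2))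
  also have "(\<Sum>l\<le>N. W ^ l * \<omega> (Mop l (phi (n - 1) v))) = MZ W \<omega> (phi (n - 1) v)"
    by (rule MZ_eq[OF w vac_ket phi_filt[OF vac_ket d(2)] N(3), symmetric])
  also have "(\<Sum>l\<le>N. W ^ l * \<omega> (phi (n - 1) (Mop l v))) = MZ W (\<lambda>u. \<omega> (phi (n - 1) u)) v"
    by (rule MZ_eq[OF wp vac_ket d(2) N(1), symmetric])
  also have "\<omega> (phi n v) + (\<Sum>l\<le>N. W ^ Suc l * \<omega> (phi n (Mop (Suc l) v))) = (\<Sum>l\<le>Suc N. W ^ l * \<omega> (phi n (Mop l v)))"
    by (subst sum.atMost_Suc_shift) simp
  also have "\<dots> = MZ W (\<lambda>u. \<omega> (phi n u)) v"
    by (rule MZ_eq[OF wp vac_ket d(2) N'(1), symmetric])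
  finally show ?thesis by simp
qed

text \<open>Moving the field at w = -1/\<open>W0\<close> to the left through M(W) multiplies it by
  (\<open>W0\<close> - W)/(\<open>W0\<close> + W).\<close>

lemma il_eval_MZ:
  assumes w: "fnl \<omega>" and d: "vac \<Omega>" "v \<in> filt \<Omega> d" "d \<le> int N"
  shows "(W0 + il_shift W) * il_eval (\<lambda>n. MZ W \<omega> (phi n v))
    = (W0 - il_shift W) * (\<Sum>l\<le>N. il_shift W ^ l * il_eval (\<lambda>n. \<omega> (phi n (Mop l v))))"
proof -
  have wp: "fnl (\<lambda>u. \<omega> (phi m u))" for m by (rule fnl_linop[OF w phi_linear])
  let ?B = "\<lambda>n. MZ W (\<lambda>u. \<omega> (phi n u)) v"
  have B: "?B n = (\<Sum>l\<le>N. W ^ l * \<omega> (phi n (Mop l v)))" for n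
    by (rule MZ_eq[OF wp d])
  have s: "il_seq (\<lambda>n. W ^ l * \<omega> (phi n (Mop l v)))" for l
    by (rule il_seq_mult[OF il_seq_phi[OF w]])
  have sB: "il_seq ?B" unfolding B by (rule il_seq_sum[OF s])
  have "(W0 + il_shift W) * il_eval (\<lambda>n. MZ W \<omega> (phi n v)) = (W0 - il_shift W) * il_eval ?B"
    by (rule il_eval_reflect[OF il_seq_phi[OF fnl_MZ[OF w]] sB MZ_phi[OF w]])
  also have "il_eval ?B = (\<Sum>l\<le>N. il_shift W ^ l * il_eval (\<lambda>n. \<omega> (phi n (Mop l v))))"
    unfolding B by (subst il_eval_sum[OF s]) (simp add: il_eval_mult[OF il_seq_phi[OF w]] il_shift_power)
  finally show ?thesis .
qed

text \<open>The same reflection with gam in place of W. Since \<open>W0\<close> - gam = 1/u and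
  \<open>W0\<close> + gam = (1 + beta u)/u for the leading variable u, the factor is 1/(1 + beta
  u).\<close>

lemma il_eval_E:
  assumes w: "fnl \<omega>"
  shows "(W0 + il_const gam) * il_eval (\<lambda>n. \<omega> (E (phi n v))) = (W0 - il_const gam) * il_eval (\<lambda>n. \<omega> (phi n (E v)))"
proof -
  have wE: "fnl (\<lambda>u. \<omega> (E u))" by (rule fnl_linop[OF w E_linop])
  have "(W0 + il_shift (il_const gam)) * il_eval (\<lambda>n. \<omega> (E (phi n v))) = (W0 - il_shift (il_const gam)) * il_eval (\<lambda>n. \<omega> (phi n (E v)))"
  proof (rule il_eval_reflect[OF il_seq_phi[OF wE] il_seq_phi[OF w]])
    fix n
    show "\<omega> (E (phi n v)) - il_const gam * \<omega> (E (phi (n - 1) v)) = \<omega> (phi n (E v)) + il_const gam * \<omega> (phi (n - 1) (E v))"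
      by (subst E_phi[of n v]) (simp add: fnl_add[OF w] fnl_csc[OF w])
  qed
  then show ?thesis by simp
qed

lemma fnl_shift: "fnl \<omega> \<Longrightarrow> fnl (\<lambda>v. il_shift (\<omega> v))"
proof -
  assume w: "fnl \<omega>"
  then obtain r where r: "\<And>v. il_vars r (\<omega> v)" unfolding fnl_def by blast
  have "il_vars (Suc r) (il_shift (\<omega> v))" for v
    unfolding il_vars_def
  proof (intro allI impI)
    fix e assume "il_coeff (il_shift (\<omega> v)) e \<noteq> 0"
    then have "Poly_Mapping.lookup e 0 = 0" "Poly_Mapping.keys (tl_exp e) \<subseteq> {..<r}"
      using r[of v] by (auto simp: il_coeff_shift il_vars_def split: if_splits)
    then show "Poly_Mapping.keys e \<subseteq> {..<Suc r}"
      by (auto simp: in_keys_iff subset_iff) (metis less_Suc_eq_0_disj lessI not0_implies_Suc)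
  qed
  then show ?thesis using w unfolding fnl_def
    by (auto simp: il_shift_add il_shift_mult)
qed

definition ZT :: "qbeta ilaurent list \<Rightarrow> 'f \<Rightarrow> qbeta ilaurent" where
  "ZT Ws = MZ W0 (\<lambda>v. il_shift (Zf Ws v))"

text \<open>The field travels left through every pair of M(W) and e^theta, and \<open>bra\<close>
  turns it into M(\<open>W0\<close>). As M commutes with all these operators, M(\<open>W0\<close>)
  can then be placed next to v. Denominators are kept on the left, so no inverses enter the
  induction.\<close>

lemma il_eval_Zf:
  assumes "v \<in> Fplus"
  shows "(\<Prod>W\<leftarrow>Ws. (W0 + il_shift W) * (W0 + il_const gam)) * il_eval (\<lambda>m. Zf Ws (phi m v))
    = (\<Prod>W\<leftarrow>Ws. (W0 - il_shift W) * (W0 - il_const gam)) * ZT Ws v"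
  using assms
proof (induction Ws arbitrary: v)
  case Nil
  obtain d where d: "d \<ge> 0" "v \<in> filt plus d" using FplusE[OF Nil] by metis
  define N where "N = nat d"
  let ?a = "\<lambda>l. il_const (mps_coeff (bra (Mop l v)) 0)"
  have "il_const (mps_coeff (bra (phi m v)) 0) = (\<Sum>l\<le>N. if m = - int l then il_const ((-1) ^ l) * ?a l else 0)" for m
  proof (cases "m \<le> 0 \<and> - int N \<le> m")
    case True
    define l where "l = nat (- m)"
    have m: "m = - int l" "l \<le> N" using True by (auto simp: l_def)
    have "bra (phi m v) = mps_const ((-1) ^ l) * bra (Mop l v)"
      unfolding m(1) using bra_phi_Mop[OF Nil, of l] by (simp add: mps_const_power mps_const_minus)
    moreover have "(\<Sum>l\<le>N. if m = - int l then il_const ((-1) ^ l) * ?a l else 0) = (\<Sum>l'\<le>N. if l' = l then il_const ((-1) ^ l) * ?a l else 0)"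
      by (rule sum.cong) (auto simp: m)
    ultimately show ?thesis using m(2) by (simp add: mps_coeff_const_times il_const_mult)
  next
    case False
    have "bra (phi m v) = 0"
    proof (cases "m > 0")
      case True
      then show ?thesis by (rule bra_phi)
    next
      case f2: False
      then have "m < - d" using False d(1) by (auto simp: N_def)
      then show ?thesis using phi_vanish[OF vac_plus d(2)] by (simp add: bra_0)
    qed
    moreover have "(\<Sum>l\<le>N. if m = - int l then il_const ((-1) ^ l) * ?a l else 0) = 0"
      using False by (intro sum.neutral) auto
    ultimately show ?thesis by (simp add: mps_coeff_simps)
  qed
  then have "il_eval (\<lambda>m. Zf [] (phi m v)) = (\<Sum>l\<le>N. il_eval (\<lambda>m. if m = - int l then il_const ((-1) ^ l) * ?a l else 0))"
    by (simp add: il_eval_sum il_seq_delta)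
  also have "\<dots> = (\<Sum>l\<le>N. W0 ^ l * il_shift (?a l))"
  proof (rule sum.cong)
    fix l
    \<comment> \<open>The sign in \<open>bra_phi_Mop\<close> cancels the sign of the argument
      -1/\<open>W0\<close>.\<close>
    have "il_const ((-1) ^ l) = (- 1 :: qbeta ilaurent) ^ l" by (simp add: il_const_power il_const_minus)
    then have "(- W0) ^ l * il_const ((-1) ^ l) = W0 ^ l" by (simp flip: power_mult_distrib)
    then show "il_eval (\<lambda>m. if m = - int l then il_const ((-1) ^ l) * ?a l else 0) = W0 ^ l * il_shift (?a l)"
      by (simp only: il_eval_delta il_shift_mult il_shift_const mult.assoc[symmetric])
  qed simp
  also have "\<dots> = ZT [] v"
    unfolding ZT_def using MZ_eq[OF fnl_shift[OF fnl_Zf] vac_plus d(2), of N "W0" "[]"] d(1)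
    by (simp add: N_def)
  finally show ?case by simp
next
  case (Cons W Ws)
  let ?D = "\<Prod>W\<leftarrow>Ws. (W0 + il_shift W) * (W0 + il_const gam)"
  let ?N = "\<Prod>W\<leftarrow>Ws. (W0 - il_shift W) * (W0 - il_const gam)"
  obtain d where d: "d \<ge> 0" "v \<in> filt plus d" using FplusE[OF Cons.prems] by metis
  define N where "N = nat d"
  have N: "d \<le> int N" by (simp add: N_def)
  have Ev: "E v \<in> filt plus d" by (rule E_filt[OF vac_plus d(2)])
  have F: "Mop l (E v) \<in> Fplus" for l by (intro Mop_Fplus E_Fplus Cons.prems)
  let ?A = "il_eval (\<lambda>m. Zf (W # Ws) (phi m v))"
  let ?B = "il_eval (\<lambda>m. MZ W (Zf Ws) (phi m (E v)))"
  have 1: "(W0 + il_const gam) * ?A = (W0 - il_const gam) * ?B"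
    using il_eval_E[OF fnl_MZ[OF fnl_Zf]] by simp
  have 2: "(W0 + il_shift W) * ?B = (W0 - il_shift W) * (\<Sum>l\<le>N. il_shift W ^ l * il_eval (\<lambda>n. Zf Ws (phi n (Mop l (E v)))))"
    by (rule il_eval_MZ[OF fnl_Zf vac_plus Ev N])
  have w: "fnl (\<lambda>v. il_shift (Zf Ws v))" by (rule fnl_shift[OF fnl_Zf])
  have 3: "(\<Sum>l\<le>N. il_shift W ^ l * ZT Ws (Mop l (E v))) = ZT (W # Ws) v"
  proof -
    have "(\<Sum>l\<le>N. il_shift W ^ l * ZT Ws (Mop l (E v)))
        = (\<Sum>l\<le>N. \<Sum>k\<le>N. il_shift W ^ l * (W0 ^ k * il_shift (Zf Ws (Mop k (Mop l (E v))))))"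
      unfolding ZT_def
      by (intro sum.cong refl, subst MZ_eq[OF w vac_plus Mop_filt[OF vac_plus Ev], of _ N])
        (use N in \<open>auto simp: sum_distrib_left\<close>)
    also have "\<dots> = (\<Sum>k\<le>N. W0 ^ k * il_shift (\<Sum>l\<le>N. W ^ l * Zf Ws (Mop l (E (Mop k v)))))"
      by (subst sum.swap) (simp add: il_shift_sum il_shift_mult il_shift_power sum_distrib_left mult_ac Mop_E Mop_commute)
    also have "\<dots> = (\<Sum>k\<le>N. W0 ^ k * il_shift (Zf (W # Ws) (Mop k v)))"
    proof (intro sum.cong refl)
      fix k
      have "Zf (W # Ws) (Mop k v) = (\<Sum>l\<le>N. W ^ l * Zf Ws (Mop l (E (Mop k v))))"
        unfolding Zf.simps by (rule MZ_eq[OF fnl_Zf vac_plus E_filt[OF vac_plus Mop_filt[OF vac_plus d(2)]]]) (use N in auto)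
      then show "W0 ^ k * il_shift (\<Sum>l\<le>N. W ^ l * Zf Ws (Mop l (E (Mop k v)))) = W0 ^ k * il_shift (Zf (W # Ws) (Mop k v))"
        by simp
    qed
    also have "\<dots> = ZT (W # Ws) v"
      unfolding ZT_def by (rule MZ_eq[OF fnl_shift[OF fnl_Zf] vac_plus d(2) N, symmetric])
    finally show ?thesis .
  qed
  have "?D * (\<Sum>l\<le>N. il_shift W ^ l * il_eval (\<lambda>n. Zf Ws (phi n (Mop l (E v)))))
      = (\<Sum>l\<le>N. il_shift W ^ l * (?D * il_eval (\<lambda>n. Zf Ws (phi n (Mop l (E v))))))"
    by (simp add: sum_distrib_left mult_ac)
  also have "\<dots> = ?N * ZT (W # Ws) v"
    unfolding Cons.IH[OF F] 3[symmetric] by (simp add: sum_distrib_left mult_ac)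
  finally have 4: "?D * (\<Sum>l\<le>N. il_shift W ^ l * il_eval (\<lambda>n. Zf Ws (phi n (Mop l (E v))))) = ?N * ZT (W # Ws) v" .
  have "(\<Prod>W\<leftarrow>W # Ws. (W0 + il_shift W) * (W0 + il_const gam)) * ?A = ?D * (W0 + il_shift W) * ((W0 + il_const gam) * ?A)"
    by (simp add: mult_ac)
  also have "\<dots> = (W0 - il_const gam) * (?D * ((W0 + il_shift W) * ?B))" unfolding 1 by (simp only: mult_ac)
  also have "\<dots> = (W0 - il_const gam) * (W0 - il_shift W) * (?D * (\<Sum>l\<le>N. il_shift W ^ l * il_eval (\<lambda>n. Zf Ws (phi n (Mop l (E v))))))"
    unfolding 2 by (simp only: mult_ac)
  also have "\<dots> = (\<Prod>W\<leftarrow>W # Ws. (W0 - il_shift W) * (W0 - il_const gam)) * ZT (W # Ws) v"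
    unfolding 4 by (simp add: mult_ac)
  finally show ?case .
qed

lemma Zf_shift: "il_shift (Zf Ws v) = Zf (map il_shift Ws) v"
proof (induction Ws arbitrary: v)
  case (Cons W Ws)
  obtain d where d: "d \<ge> 0" "E v \<in> filt ket d" using ex_filt by metis
  have N: "d \<le> int (nat d)" by simp
  show ?case
    by (simp add: MZ_eq[OF fnl_Zf vac_ket d(2) N] il_shift_sum il_shift_mult il_shift_power Cons)
qed simp

lemma ZT_E: "ZT Ws (E v) = Zf (W0 # map il_shift Ws) v"
  by (simp add: ZT_def Zf_shift)

lemma check_modes_Zf: "check_modes (\<lambda>n. Zf Ws (E (phi n v))) m = Zf Ws (ast (- m) v)"
proof -
  obtain d where d: "d \<ge> 0" "v \<in> filt ket d" using ex_filt by metis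
  have w: "fnl (\<lambda>v. Zf Ws (E v))" by (rule fnl_linop[OF fnl_Zf E_linop])
  have "check_modes (\<lambda>n. Zf Ws (E (phi n v))) m = (\<Sum>j = - d..m. il_const (neg_one_pow j * cw m j) * Zf Ws (E (phi j v)))"
    by (rule check_modes_eq[of "- d"]) (auto simp: phi_vanish[OF vac_ket d(2)] fnl_0[OF w])
  moreover have "pc m v = (\<Sum>j = - d..m. csc (neg_one_pow j * cw m j) (phi j v))"
    unfolding pc_def by (rule clin_eq[OF vac_ket d(2), of m]) (auto simp: cw_less)
  ultimately show ?thesis by (simp add: ast_def fnl_sum[OF w] fnl_csc[OF w])
qed

end

section \<open>The rational prefactor of the generating series\<close>

definition Wl :: "nat \<Rightarrow> qbeta ilaurent list" where
  "Wl r = map (\<lambda>i. il_ivar i + il_const gam) [0..<r]"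

lemma Wl_Suc: "Wl (Suc r) = W0 # map il_shift (Wl r)"
proof -
  have "[0..<Suc r] = 0 # map Suc [0..<r]" by (simp add: upt_conv_Cons map_Suc_upt del: upt_Suc)
  then show ?thesis by (simp add: Wl_def W0_def il_shift_add il_shift_ivar o_def del: upt_Suc)
qed

text \<open>The quotient of \<open>fgl_minus\<close> by \<open>fgl_plus\<close> at u_j, u_i. For i <
  j the denominator is a unit of the iterated series ring.\<close>

definition pair_factor :: "nat \<Rightarrow> nat \<Rightarrow> qbeta ilaurent" where
  "pair_factor i j = (il_var j - il_var i) * inverse (1 + il_const beta * il_var i)
    * inverse (il_var j + il_var i + il_const beta * il_var j * il_var i)"

definition Cil :: "nat \<Rightarrow> qbeta ilaurent" where
  "Cil r = (\<Prod>i<r. inverse (1 + il_const beta * il_var i)) * (\<Prod>(i, j) | i < j \<and> j < r. pair_factor i j)"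

lemma W0_plus_var: "W0 + il_ivar j + il_const gam = il_ivar 0 * il_ivar j * (il_var j + il_var 0 + il_const beta * il_var j * il_var 0)"
proof -
  have "il_ivar 0 * il_ivar j * (il_var j + il_var 0 + il_const beta * il_var j * il_var 0)
      = il_ivar 0 * (il_var j * il_ivar j) + il_ivar j * (il_var 0 * il_ivar 0) + il_const beta * (il_var j * il_ivar j) * (il_var 0 * il_ivar 0)"
    by (simp add: algebra_simps)
  then show ?thesis by (simp add: il_var_ivar W0_def il_const_beta)
qed

lemma fgl_unit_0: "il_var (Suc j) + il_var 0 + il_const beta * il_var (Suc j) * il_var 0 dvd (1 :: qbeta ilaurent)"
proof -
  let ?x = "il_var (Suc j) + il_var 0 + il_const beta * il_var (Suc j) * il_var 0 :: qbeta ilaurent"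
  have "W0 + il_shift (il_ivar j + il_const gam) dvd 1" by (rule W0_shift_unit)
  moreover have "W0 + il_shift (il_ivar j + il_const gam) = W0 + il_ivar (Suc j) + il_const gam"
    by (simp add: il_shift_add il_shift_ivar add.assoc)
  ultimately have "il_ivar 0 * il_ivar (Suc j) * ?x dvd 1"
    unfolding W0_plus_var[symmetric] by simp
  then show ?thesis by (metis dvd_mult_right)
qed

lemma fgl_unit: "i < j \<Longrightarrow> il_var j + il_var i + il_const beta * il_var j * il_var i dvd (1 :: qbeta ilaurent)"
proof (induction i arbitrary: j)
  case 0
  then show ?case using fgl_unit_0[of "j - 1"] by simp
next
  case (Suc i)
  then obtain j' where j: "j = Suc j'" "i < j'" by (cases j) auto
  show ?case using il_shift_unit[OF Suc.IH[OF j(2)]] by (simp add: j(1) il_shift_add il_shift_mult il_shift_var)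
qed

lemma pair_factor_shift: "i < j \<Longrightarrow> il_shift (pair_factor i j) = pair_factor (Suc i) (Suc j)"
  by (simp add: pair_factor_def il_shift_mult il_shift_diff il_shift_add il_shift_var il_shift_inverse one_beta_unit fgl_unit)

text \<open>With W = 1/u_j + gam, the reflection factor of M(W) is (u_j - u_0)/(u_j \<oplus> u_0),
  and that of e^theta is 1/(1 + beta u_0). Their product is the pair factor of GQ.\<close>

lemma pair_factor_0:
  "(W0 + il_shift (il_ivar j + il_const gam)) * (W0 + il_const gam) * pair_factor 0 (Suc j)
    = (W0 - il_shift (il_ivar j + il_const gam)) * (W0 - il_const gam)"
proof -
  let ?b = "1 + il_const beta * il_var 0 :: qbeta ilaurent"
  let ?x = "il_var (Suc j) + il_var 0 + il_const beta * il_var (Suc j) * il_var 0 :: qbeta ilaurent"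
  have b: "?b * inverse ?b = 1" by (rule il_unit[OF one_beta_unit])
  have x: "?x * inverse ?x = 1" by (rule il_unit[OF fgl_unit_0])
  have 1: "W0 + il_shift (il_ivar j + il_const gam) = il_ivar 0 * il_ivar (Suc j) * ?x"
    unfolding W0_plus_var[symmetric] by (simp add: il_shift_add il_shift_ivar add.assoc)
  have 2: "W0 - il_shift (il_ivar j + il_const gam) = il_ivar 0 * il_ivar (Suc j) * (il_var (Suc j) - il_var 0)"
  proof -
    have "il_ivar 0 * il_ivar (Suc j) * (il_var (Suc j) - il_var 0 :: qbeta ilaurent)
        = il_ivar 0 * (il_var (Suc j) * il_ivar (Suc j)) - il_ivar (Suc j) * (il_var 0 * il_ivar 0)"
      by (simp add: algebra_simps)
    then show ?thesis by (simp add: il_var_ivar W0_def il_shift_add il_shift_ivar)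
  qed
  have "(W0 + il_shift (il_ivar j + il_const gam)) * (W0 + il_const gam) * pair_factor 0 (Suc j)
      = il_ivar 0 * il_ivar (Suc j) * il_ivar 0 * (il_var (Suc j) - il_var 0) * (?b * inverse ?b) * (?x * inverse ?x)"
    unfolding 1 W0_plus pair_factor_def by (simp only: mult_ac)
  then show ?thesis unfolding b x 2 W0_minus by (simp add: mult_ac)
qed

lemma Cil_Suc: "Cil (Suc r) = il_shift (Cil r) * inverse (1 + il_const beta * il_var 0) * (\<Prod>j<r. pair_factor 0 (Suc j))"
proof -
  have p: "(\<Prod>(i, j) | i < j \<and> j < Suc r. pair_factor i j)
      = (\<Prod>j<r. pair_factor 0 (Suc j)) * (\<Prod>(i, j) | i < j \<and> j < r. pair_factor (Suc i) (Suc j))"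
  proof -
    have fin: "finite {(i, j). i < j \<and> j < q}" for q :: nat
      by (rule finite_subset[of _ "{..<q} \<times> {..<q}"]) auto
    have "{(i, j). i < j \<and> j < Suc r} = (\<lambda>j. (0, Suc j)) ` {..<r} \<union> (\<lambda>(i, j). (Suc i, Suc j)) ` {(i, j). i < j \<and> j < r}"
      (is "?L = ?R1 \<union> ?R2")
    proof (intro equalityI subsetI)
      fix x assume x: "x \<in> ?L"
      then obtain i j where ij: "x = (i, Suc j)" "i < Suc j" "j < r" by (cases x, cases "snd x") auto
      show "x \<in> ?R1 \<union> ?R2"
      proof (cases i)
        case 0
        then show ?thesis using ij by auto
      next
        case (Suc i')
        then have "x = (\<lambda>(i, j). (Suc i, Suc j)) (i', j)" "(i', j) \<in> {(i, j). i < j \<and> j < r}" using ij by auto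
        then show ?thesis by blast
      qed
    qed auto
    moreover have "?R1 \<inter> ?R2 = {}" by auto
    ultimately have "(\<Prod>(i, j) | i < j \<and> j < Suc r. pair_factor i j) = (\<Prod>(i, j)\<in>?R1. pair_factor i j) * (\<Prod>(i, j)\<in>?R2. pair_factor i j)"
      using fin[of r] by (simp add: prod.union_disjoint)
    also have "(\<Prod>(i, j)\<in>?R1. pair_factor i j) = (\<Prod>j<r. pair_factor 0 (Suc j))"
      by (subst prod.reindex) (auto simp: inj_on_def)
    also have "(\<Prod>(i, j)\<in>?R2. pair_factor i j) = (\<Prod>(i, j) | i < j \<and> j < r. pair_factor (Suc i) (Suc j))"
      by (subst prod.reindex) (auto simp: inj_on_def split_def)
    finally show ?thesis .
  qed
  have s: "il_shift (\<Prod>(i, j) | i < j \<and> j < r. pair_factor i j) = (\<Prod>(i, j) | i < j \<and> j < r. pair_factor (Suc i) (Suc j))"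
    unfolding il_shift_prod by (rule prod.cong) (auto simp: pair_factor_shift)
  have q: "(\<Prod>i<Suc r. inverse (1 + il_const beta * il_var i))
      = inverse (1 + il_const beta * il_var 0) * il_shift (\<Prod>i<r. inverse (1 + il_const beta * il_var i))"
    by (simp add: prod.lessThan_Suc_shift il_shift_prod il_shift_inverse one_beta_unit il_shift_add il_shift_mult il_shift_var del: prod.lessThan_Suc)
  show ?thesis unfolding Cil_def p q il_shift_mult s by (simp only: mult_ac)
qed

lemma prod_list_unit: "(\<And>x. x \<in> set xs \<Longrightarrow> f x dvd 1) \<Longrightarrow> (\<Prod>x\<leftarrow>xs. f x) dvd (1 :: 'a::comm_ring_1)"
  by (induction xs) (auto intro!: dvd_1_mult)

lemma unit_cancel: "a dvd 1 \<Longrightarrow> a * b = a * c \<Longrightarrow> b = (c :: 'a::comm_ring_1)"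
proof -
  assume "a dvd 1" and e: "a * b = a * c"
  then obtain d where d: "1 = a * d" by (auto simp: dvd_def)
  have "d * (a * b) = d * (a * c)" unfolding e ..
  then show "b = c" using d by (simp add: mult.assoc[symmetric] mult.commute[of d])
qed

context scalar_fermions begin

text \<open>Applying \<open>ast n\<close> extracts the coefficient of u_0^(-n) from the field
  preceded by e^theta. Moving the field to \<open>bra\<close> collects one pair factor for each of
  the remaining variables, and \<open>Cil\<close> is the product of everything collected.\<close>

lemma Df_eq_il_coeff:
  assumes "v \<in> Fplus"
  shows "il_coeff (Cil (length ls) * Zf (Wl (length ls)) v) (lam_exp ls) = mps_coeff (Df ls v) 0"
  using assms
proof (induction ls arbitrary: v)
  case Nil
  have "{(i, j). i < j \<and> j < (0::nat)} = {}" by auto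
  then show ?case by (simp add: Cil_def Wl_def lam_exp_def il_const_def il_coeff_il_monom)
next
  case (Cons n ls)
  let ?r = "length ls"
  let ?s = "\<lambda>m. Zf (Wl ?r) (ast (- m) v)"
  let ?Y = "il_eval (\<lambda>n. Zf (Wl ?r) (E (phi n v)))"
  let ?b = "1 + il_const beta * il_var 0 :: qbeta ilaurent"
  have w: "fnl (\<lambda>v. Zf (Wl ?r) (E v))" by (rule fnl_linop[OF fnl_Zf E_linop])
  have seq: "il_seq ?s"
    using il_seq_check[OF il_seq_phi[OF w, of v]] by (simp add: check_modes_Zf[abs_def])
  have Y: "?Y = il_glue ?s" by (simp add: il_eval_def check_modes_Zf[abs_def])
  let ?R = "\<Prod>W\<leftarrow>Wl ?r. (W0 + il_shift W) * (W0 + il_const gam)"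
  let ?Y' = "il_eval (\<lambda>m. Zf (Wl ?r) (phi m (E v)))"
  have R: "?R dvd 1" by (intro prod_list_unit dvd_1_mult W0_shift_unit W0_plus_unit)
  have "?R * (\<Prod>j<?r. pair_factor 0 (Suc j)) = (\<Prod>W\<leftarrow>Wl ?r. (W0 - il_shift W) * (W0 - il_const gam))"
    unfolding Wl_def map_map o_def by (simp add: prod_list_upt pair_factor_0 del: il_shift_const flip: prod.distrib)
  then have "?R * ((\<Prod>j<?r. pair_factor 0 (Suc j)) * ZT (Wl ?r) (E v)) = ?R * ?Y'"
    using il_eval_Zf[OF E_Fplus[OF Cons.prems], of "Wl ?r"] by (simp add: mult.assoc[symmetric])
  then have 1: "(\<Prod>j<?r. pair_factor 0 (Suc j)) * ZT (Wl ?r) (E v) = ?Y'" by (rule unit_cancel[OF R])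
  \<comment> \<open>The e^theta belonging to the new field itself supplies the single factor 1/(1 +
    beta u_0) of GQ.\<close>
  have "il_ivar 0 * (?b * ?Y) = il_ivar 0 * ?Y'"
    using il_eval_E[OF fnl_Zf, of "Wl ?r" v] unfolding W0_plus W0_minus by (simp add: mult_ac)
  then have 2: "?b * ?Y = ?Y'" by (rule unit_cancel[OF il_ivar_unit])
  have "Cil (Suc ?r) * Zf (Wl (Suc ?r)) v
      = il_shift (Cil ?r) * inverse ?b * ((\<Prod>j<?r. pair_factor 0 (Suc j)) * ZT (Wl ?r) (E v))"
    unfolding Cil_Suc Wl_Suc ZT_E[symmetric] by (simp only: mult_ac)
  also have "\<dots> = il_shift (Cil ?r) * (?b * inverse ?b) * ?Y"
    unfolding 1 2[symmetric] by (simp only: mult_ac)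
  also have "\<dots> = il_glue (\<lambda>m. Cil ?r * ?s m)"
    unfolding il_unit[OF one_beta_unit] Y by (simp add: il_shift_times_glue[OF seq])
  finally have "il_coeff (Cil (length (n # ls)) * Zf (Wl (length (n # ls))) v) (lam_exp (n # ls))
      = il_coeff (Cil ?r * ?s (- int n)) (lam_exp ls)"
    by (simp add: il_coeff_glue[OF il_seq_mult[OF seq]] lam_exp_Cons)
  also have "\<dots> = mps_coeff (Df (n # ls) v) 0"
    using Cons.IH[OF ast_Fplus[OF Cons.prems, of "int n"]] by simp
  finally show ?case .
qed

text \<open>X(w) is moved to the left: M(W) contributes (1 + wW)/(1 - wW), e^theta contributes the
  same with gam for W, and \<open>bra\<close> absorbs X(w). Only nonnegative powers of w arise, so
  negative modes are annihilated.\<close>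

lemma Zf_X:
  assumes "v \<in> Fplus"
  shows "Zf Ws (X n v) = (if n < 0 then 0 else (\<Prod>W\<leftarrow>Ws. gser W * gser (il_const gam)) $ nat n) * Zf Ws v"
  using assms
proof (induction Ws arbitrary: n v)
  case Nil
  then show ?case by (auto simp: bra_X mps_coeff_simps)
next
  case (Cons W Ws)
  define F where "F = (\<Prod>W\<leftarrow>Ws. gser W * gser (il_const gam))"
  define G where "G = F * gser W"
  \<comment> \<open>Coefficients with integer index, 0 for negative ones: the convolution in
    \<open>T_mult\<close> then holds with any upper bound at least m.\<close>
  define T where "T H m = (if m < 0 then 0 else H $ nat m)" for H :: "qbeta ilaurent fps" and m
  have T_mult: "T (H * K) m = (\<Sum>j\<le>N. K $ j * T H (m - int j))" if "m \<le> int N" for H K m N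
  proof (cases "m < 0")
    case False
    have "T (H * K) m = (\<Sum>j\<le>nat m. K $ j * H $ (nat m - j))"
      using False by (simp add: T_def mult.commute[of H] fps_mult_nth atMost_atLeast0)
    also have "\<dots> = (\<Sum>j\<le>nat m. K $ j * T H (m - int j))"
      by (rule sum.cong) (use False in \<open>auto simp: T_def nat_diff_distrib\<close>)
    also have "\<dots> = (\<Sum>j\<le>N. K $ j * T H (m - int j))"
      by (rule sum.mono_neutral_left) (use False that in \<open>auto simp: T_def\<close>)
    finally show ?thesis .
  qed (auto simp: T_def intro!: sum.neutral)
  have IH: "Zf Ws (X m u) = T F m * Zf Ws u" if "u \<in> Fplus" for m u
    using Cons.IH[OF that] by (simp add: F_def T_def)
  have step: "MZ W (Zf Ws) (X m u) = T G m * MZ W (Zf Ws) u" if u: "u \<in> Fplus" for m u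
  proof -
    obtain d where d: "d \<ge> 0" "u \<in> filt plus d" using FplusE[OF u] by metis
    define L where "L = nat (d + \<bar>m\<bar>)"
    have L: "d + m \<le> int L" "m \<le> int L" "d \<le> int L" using d by (auto simp: L_def)
    have h: "gser W $ j = W ^ j * il_const (mps_coeff (hcoeff j) 0)" for j
    proof -
      have "mps_coeff (hcoeff j) 0 = (if j = 0 then 1 else 2)"
        by (simp add: hcoeff_def mps_coeff_simps mps_coeff_const flip: mps_const_numeral)
      then show ?thesis by (simp add: gser_def il_const_2 mult.commute)
    qed
    have "MZ W (Zf Ws) (X m u) = (\<Sum>l\<le>L. W ^ l * Zf Ws (Mop l (X m u)))"
      by (rule MZ_eq[OF fnl_Zf vac_plus X_filt[OF vac_plus d(2)] L(1)])
    also have "\<dots> = (\<Sum>l\<le>L. \<Sum>j\<le>l. gser W $ j * T F (m - int j) * (W ^ (l - j) * Zf Ws (Mop (l - j) u)))"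
    proof (intro sum.cong refl)
      fix l
      have "W ^ l * Zf Ws (Mop l (X m u)) = (\<Sum>j\<le>l. W ^ l * (il_const (mps_coeff (hcoeff j) 0) * (T F (m - int j) * Zf Ws (Mop (l - j) u))))"
        unfolding Mop_X by (simp add: fnl_sum[OF fnl_Zf] fnl_scale[OF fnl_Zf] IH Mop_Fplus u sum_distrib_left)
      also have "\<dots> = (\<Sum>j\<le>l. gser W $ j * T F (m - int j) * (W ^ (l - j) * Zf Ws (Mop (l - j) u)))"
      proof (intro sum.cong refl)
        fix j assume "j \<in> {..l}"
        then have "W ^ l = W ^ j * W ^ (l - j)" by (simp flip: power_add)
        then show "W ^ l * (il_const (mps_coeff (hcoeff j) 0) * (T F (m - int j) * Zf Ws (Mop (l - j) u)))
          = gser W $ j * T F (m - int j) * (W ^ (l - j) * Zf Ws (Mop (l - j) u))"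
          unfolding h by (simp only: mult_ac)
      qed
      finally show "W ^ l * Zf Ws (Mop l (X m u)) = (\<Sum>j\<le>l. gser W $ j * T F (m - int j) * (W ^ (l - j) * Zf Ws (Mop (l - j) u)))" .
    qed
    also have "\<dots> = (\<Sum>j\<le>L. \<Sum>i\<le>L - j. gser W $ j * T F (m - int j) * (W ^ i * Zf Ws (Mop i u)))"
      unfolding sum_triangle by simp
    also have "\<dots> = (\<Sum>j\<le>L. gser W $ j * T F (m - int j) * MZ W (Zf Ws) u)"
    proof (intro sum.cong refl)
      fix j assume j: "j \<in> {..L}"
      show "(\<Sum>i\<le>L - j. gser W $ j * T F (m - int j) * (W ^ i * Zf Ws (Mop i u))) = gser W $ j * T F (m - int j) * MZ W (Zf Ws) u"
      proof (cases "m - int j < 0")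
        case False
        have "MZ W (Zf Ws) u = (\<Sum>i\<le>L - j. W ^ i * Zf Ws (Mop i u))"
          by (rule MZ_eq[OF fnl_Zf vac_plus d(2)]) (use L j False in \<open>auto simp: of_nat_diff\<close>)
        then show ?thesis by (simp add: sum_distrib_left)
      qed (simp add: T_def)
    qed
    also have "\<dots> = T G m * MZ W (Zf Ws) u"
      unfolding G_def T_mult[OF L(2)] by (simp add: sum_distrib_right)
    finally show ?thesis .
  qed
  obtain d where d: "d \<ge> 0" "v \<in> filt plus d" using FplusE[OF Cons.prems] by metis
  define L where "L = nat (d + \<bar>n\<bar>)"
  have L: "n + d \<le> int L" "n \<le> int L" using d by (auto simp: L_def)
  have g: "il_const (mps_coeff (gser (mps_const gam) $ k :: scalars) 0) = gser (il_const gam) $ k" for k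
  proof -
    have e: "(gser (mps_const gam) $ k :: scalars) = mps_const (gser gam $ k)"
      by (simp add: gser_def mps_const_mult mps_const_power)
    show ?thesis unfolding e mps_coeff_const by (simp add: gser_def il_const_mult il_const_power il_const_2)
  qed
  have "Zf (W # Ws) (X n v) = MZ W (Zf Ws) (\<Sum>k\<le>L. scale (gser (mps_const gam) $ k) (X (n - int k) (E v)))"
    unfolding Zf.simps E_def by (subst bexp_X[OF odd_tgam(1) is_exp_tgam(1) vac_plus d(2) L(1)]) simp
  also have "\<dots> = (\<Sum>k\<le>L. gser (il_const gam) $ k * (T G (n - int k) * MZ W (Zf Ws) (E v)))"
    by (simp add: fnl_sum[OF fnl_MZ[OF fnl_Zf]] fnl_scale[OF fnl_MZ[OF fnl_Zf]] step E_Fplus Cons.prems g)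
  also have "\<dots> = T (G * gser (il_const gam)) n * Zf (W # Ws) v"
    unfolding T_mult[OF L(2)] by (simp add: sum_distrib_right mult.assoc)
  also have "G * gser (il_const gam) = (\<Prod>W\<leftarrow>W # Ws. gser W * gser (il_const gam))"
    by (simp add: G_def F_def mult_ac)
  finally show ?case by (simp only: T_def)
qed

end

subsection \<open>Power series in many variables\<close>

lemma conv_monomial:
  fixes m :: "'v \<Rightarrow>\<^sub>0 nat"
  shows "conv f g m = (\<Sum>(a, b) | a + b = m. f a * g b)"
proof (rule conv_superset)
  show "finite {(a, b). a + b = m}" using finite_monomial_pairs[of m "\<lambda>_ _. True"] by simp
qed auto

lemma keys_add_nat: "Poly_Mapping.keys (a + b) = Poly_Mapping.keys a \<union> Poly_Mapping.keys (b :: 'v \<Rightarrow>\<^sub>0 nat)"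
  by (auto simp: in_keys_iff lookup_add)

text \<open>Variables outside A are set to 0. This is a ring homomorphism, and the coefficient at a
  monomial depends only on the restriction to its variables; infinite products are handled through
  finite ones in this way.\<close>

definition mps_res :: "'v set \<Rightarrow> ('v, 'a::comm_ring_1) mps \<Rightarrow> ('v, 'a) mps" where
  "mps_res A f = Abs_mps (\<lambda>m. if Poly_Mapping.keys m \<subseteq> A then mps_coeff f m else 0)"

lemma mps_coeff_res: "mps_coeff (mps_res A f) m = (if Poly_Mapping.keys m \<subseteq> A then mps_coeff f m else 0)"
  by (simp add: mps_res_def Abs_mps_inverse)

lemma mps_res_mult: "mps_res A (f * g) = mps_res A f * mps_res A g"
proof (rule mps_eqI)
  fix m
  show "mps_coeff (mps_res A (f * g)) m = mps_coeff (mps_res A f * mps_res A g) m"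
  proof (cases "Poly_Mapping.keys m \<subseteq> A")
    case True
    then show ?thesis
      unfolding mps_coeff_res mps_coeff_simps conv_monomial
      by (auto simp: mps_coeff_res keys_add_nat intro!: sum.cong)
  next
    case False
    have "(\<Sum>(a, b) | a + b = m. mps_coeff (mps_res A f) a * mps_coeff (mps_res A g) b) = 0"
      by (rule sum.neutral) (use False in \<open>auto simp: mps_coeff_res keys_add_nat\<close>)
    then show ?thesis using False by (simp add: mps_coeff_res mps_coeff_simps conv_monomial)
  qed
qed

lemma mps_res_simps:
  "mps_res A 0 = 0" "mps_res A 1 = 1" "mps_res A (f + g) = mps_res A f + mps_res A g"
  "mps_res A (mps_const c) = mps_const c"
  by (rule mps_eqI; auto simp: mps_coeff_res mps_coeff_simps mps_coeff_const)+

lemma mps_res_sum: "mps_res A (sum f I) = (\<Sum>i\<in>I. mps_res A (f i))"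
  by (induction I rule: infinite_finite_induct) (simp_all add: mps_res_simps)

lemma mps_res_prod: "mps_res A (prod f I) = (\<Prod>i\<in>I. mps_res A (f i))"
  by (induction I rule: infinite_finite_induct) (simp_all add: mps_res_simps mps_res_mult)

lemma mps_has_prodI:
  fixes f :: "'i \<Rightarrow> ('v, 'a::comm_ring_1) mps"
  assumes "\<And>m. \<exists>J. finite J \<and> J \<subseteq> I \<and> (\<forall>i\<in>I - J. mps_res (Poly_Mapping.keys m) (f i) = 1) \<and>
    mps_coeff p m = mps_coeff (\<Prod>i\<in>J. f i) m"
  shows "mps_has_prod f I p"
  unfolding mps_has_prod_def
proof
  fix m
  obtain J where J: "finite J" "J \<subseteq> I" "\<And>i. i \<in> I - J \<Longrightarrow> mps_res (Poly_Mapping.keys m) (f i) = 1"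
    "mps_coeff p m = mps_coeff (\<Prod>i\<in>J. f i) m" using assms[of m] by blast
  show "\<forall>\<^sub>F K in finite_subsets_at_top I. mps_coeff (\<Prod>i\<in>K. f i) m = mps_coeff p m"
    unfolding eventually_finite_subsets_at_top
  proof (intro exI[of _ J] conjI allI impI)
    fix K assume K: "finite K \<and> J \<subseteq> K \<and> K \<subseteq> I"
    have c: "mps_coeff g m = mps_coeff (mps_res (Poly_Mapping.keys m) g) m" for g :: "('v, 'a) mps"
      by (simp add: mps_coeff_res)
    have "mps_res (Poly_Mapping.keys m) (\<Prod>i\<in>K. f i) = mps_res (Poly_Mapping.keys m) (\<Prod>i\<in>J. f i)"
      unfolding mps_res_prod by (rule prod.mono_neutral_right) (use K J(3) in auto)
    then show "mps_coeff (\<Prod>i\<in>K. f i) m = mps_coeff p m" unfolding J(4) c[of "prod f _"] by simp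
  qed (use J in auto)
qed

lemma mps_infprod_eq: "mps_has_prod f I p \<Longrightarrow> mps_infprod f I = p"
  unfolding mps_infprod_def by (rule the_equality) (auto intro: mps_has_prod_unique)

definition mps_ins :: "'v \<Rightarrow> 'a::comm_ring_1 fps \<Rightarrow> ('v, 'a) mps" where
  "mps_ins v f = Abs_mps (\<lambda>m. if Poly_Mapping.keys m \<subseteq> {v} then f $ Poly_Mapping.lookup m v else 0)"

lemma mps_coeff_ins: "mps_coeff (mps_ins v f) m = (if Poly_Mapping.keys m \<subseteq> {v} then f $ Poly_Mapping.lookup m v else 0)"
  by (simp add: mps_ins_def Abs_mps_inverse)

lemma keys_subset_single: "Poly_Mapping.keys m \<subseteq> {v} \<Longrightarrow> m = Poly_Mapping.single v (Poly_Mapping.lookup m v)"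
  by (rule poly_mapping_eqI) (auto simp: lookup_single when_def in_keys_iff subset_iff)

lemma mps_ins_mult: "mps_ins v (f * g) = mps_ins v f * mps_ins v g"
proof (rule mps_eqI)
  fix m
  show "mps_coeff (mps_ins v (f * g)) m = mps_coeff (mps_ins v f * mps_ins v g) m"
  proof (cases "Poly_Mapping.keys m \<subseteq> {v}")
    case True
    define n where "n = Poly_Mapping.lookup m v"
    have m: "m = Poly_Mapping.single v n" using keys_subset_single[OF True] by (simp add: n_def)
    have k: "Poly_Mapping.keys a \<subseteq> {v} \<and> Poly_Mapping.keys b \<subseteq> {v}" if "a + b = m" for a b
      using True that keys_add_nat[of a b] by auto
    have "mps_coeff (mps_ins v f * mps_ins v g) m = (\<Sum>(a, b) | a + b = m. f $ Poly_Mapping.lookup a v * g $ Poly_Mapping.lookup b v)"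
      unfolding mps_coeff_simps conv_monomial by (rule sum.cong) (simp_all add: mps_coeff_ins k split: prod.splits)
    also have "\<dots> = (\<Sum>i=0..n. f $ i * g $ (n - i))"
    proof (rule sum.reindex_bij_witness[of _ "\<lambda>i. (Poly_Mapping.single v i, Poly_Mapping.single v (n - i))" "\<lambda>(a, b). Poly_Mapping.lookup a v"])
      fix ab assume "ab \<in> {(a, b). a + b = m}"
      then obtain a b where ab: "ab = (a, b)" "a + b = m" by auto
      have s: "Poly_Mapping.lookup a v + Poly_Mapping.lookup b v = n" using ab(2) by (auto simp: n_def lookup_add)
      note ka = keys_subset_single[OF conjunct1[OF k[OF ab(2)]]] and kb = keys_subset_single[OF conjunct2[OF k[OF ab(2)]]]
      have n: "n - Poly_Mapping.lookup a v = Poly_Mapping.lookup b v" using s by simp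
      show "(case ab of (a, b) \<Rightarrow> Poly_Mapping.lookup a v) \<in> {0..n}"
        "(Poly_Mapping.single v (case ab of (a, b) \<Rightarrow> Poly_Mapping.lookup a v), Poly_Mapping.single v (n - (case ab of (a, b) \<Rightarrow> Poly_Mapping.lookup a v))) = ab"
        "f $ (case ab of (a, b) \<Rightarrow> Poly_Mapping.lookup a v) * g $ (n - (case ab of (a, b) \<Rightarrow> Poly_Mapping.lookup a v))
          = (case ab of (a, b) \<Rightarrow> f $ Poly_Mapping.lookup a v * g $ Poly_Mapping.lookup b v)"
        unfolding ab(1) prod.case n ka[symmetric] kb[symmetric] using s by simp_all
    qed (auto simp: m single_add[symmetric])
    finally show ?thesis using True by (simp add: mps_coeff_ins fps_mult_nth n_def)
  next
    case False
    then have "mps_coeff (mps_ins v f * mps_ins v g) m = 0"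
      unfolding mps_coeff_simps conv_monomial
      by (intro sum.neutral) (auto simp: mps_coeff_ins keys_add_nat)
    then show ?thesis using False by (simp add: mps_coeff_ins)
  qed
qed

lemma mps_ins_simps:
  fixes v :: 'v and f g :: "'a::comm_ring_1 fps" and c :: 'a
  shows
  "mps_ins v (f + g) = mps_ins v f + mps_ins v g" "mps_ins v (f - g) = mps_ins v f - mps_ins v g"
  "mps_ins v (fps_const c) = mps_const c" "mps_ins v 1 = (1 :: ('v, 'a) mps)" "mps_ins v fps_X = (mps_var v :: ('v, 'a) mps)"
proof -
  have c: "mps_ins v (fps_const c) = mps_const c" for c :: 'a
    by (rule mps_eqI) (auto simp: mps_coeff_ins mps_coeff_const dest: keys_subset_single)
  then show "mps_ins v (fps_const c) = mps_const c" .
  show "mps_ins v 1 = (1 :: ('v, 'a) mps)" using c[of 1] by (simp add: mps_const_1)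
  show "mps_ins v fps_X = (mps_var v :: ('v, 'a) mps)"
    by (rule mps_eqI) (auto simp: mps_coeff_ins mps_var.rep_eq fps_X_def dest: keys_subset_single)
qed (rule mps_eqI, simp add: mps_coeff_ins mps_coeff_simps)+

lemma mps_ins_prod: "mps_ins v (prod f A) = (\<Prod>a\<in>A. mps_ins v (f a))"
  by (induction A rule: infinite_finite_induct) (simp_all add: mps_ins_simps mps_ins_mult)

text \<open>The factors involve distinct variables, so a monomial splits between them in one way
  only and no convolution is left.\<close>

lemma mps_coeff_prod_ins:
  assumes "finite A"
  shows "mps_coeff (\<Prod>j\<in>A. mps_ins j (g j)) m = (if Poly_Mapping.keys m \<subseteq> A then \<Prod>j\<in>A. g j $ Poly_Mapping.lookup m j else 0)"
  using assms
proof (induction A arbitrary: m rule: finite_induct)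
  case empty
  then show ?case by (auto simp: mps_coeff_simps)
next
  case (insert a A)
  let ?n = "Poly_Mapping.lookup m a"
  let ?s = "Poly_Mapping.single a ?n"
  let ?p = "\<Prod>j\<in>A. mps_ins j (g j)"
  have sm: "?s + (m - ?s) = m" by (rule poly_mapping_eqI) (simp add: lookup_add lookup_minus lookup_single when_def)
  have lk: "Poly_Mapping.lookup (m - ?s) x = (if x = a then 0 else Poly_Mapping.lookup m x)" for x
    by (simp add: lookup_minus lookup_single when_def)
  have "mps_coeff (\<Prod>j\<in>insert a A. mps_ins j (g j)) m = mps_coeff (mps_ins a (g a) * ?p) m"
    using insert by simp
  also have "\<dots> = (\<Sum>(x, y)\<in>{(?s, m - ?s)}. mps_coeff (mps_ins a (g a)) x * mps_coeff ?p y)"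
    unfolding mps_coeff_simps
  proof (rule conv_superset)
    show "{(x, y). x + y = m \<and> mps_coeff (mps_ins a (g a)) x \<noteq> 0 \<and> mps_coeff ?p y \<noteq> 0} \<subseteq> {(?s, m - ?s)}"
    proof clarify
      fix x y assume m: "m = x + y" and x: "mps_coeff (mps_ins a (g a)) x \<noteq> 0" and y: "mps_coeff ?p y \<noteq> 0"
      have "Poly_Mapping.keys x \<subseteq> {a}" using x by (auto simp: mps_coeff_ins split: if_splits)
      then have xs: "x = Poly_Mapping.single a (Poly_Mapping.lookup x a)" by (rule keys_subset_single)
      have "Poly_Mapping.keys y \<subseteq> A" using y insert.IH[of y] by (auto split: if_splits)
      then have "Poly_Mapping.lookup y a = 0" using insert(2) by (auto simp: in_keys_iff)
      then have "x = Poly_Mapping.single a (Poly_Mapping.lookup (x + y) a)" using xs by (simp add: lookup_add)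
      then show "x = Poly_Mapping.single a (Poly_Mapping.lookup (x + y) a) \<and> y = x + y - Poly_Mapping.single a (Poly_Mapping.lookup (x + y) a)"
        by (metis add_diff_cancel_left')
    qed
  qed (use sm in auto)
  also have "\<dots> = g a $ ?n * (if Poly_Mapping.keys (m - ?s) \<subseteq> A then \<Prod>j\<in>A. g j $ Poly_Mapping.lookup (m - ?s) j else 0)"
    unfolding insert.IH[symmetric] by (simp add: mps_coeff_ins)
  also have "Poly_Mapping.keys (m - ?s) \<subseteq> A \<longleftrightarrow> Poly_Mapping.keys m \<subseteq> insert a A"
    by (auto simp: in_keys_iff lk subset_iff)
  also have "(\<Prod>j\<in>A. g j $ Poly_Mapping.lookup (m - ?s) j) = (\<Prod>j\<in>A. g j $ Poly_Mapping.lookup m j)"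
    by (rule prod.cong) (use insert(2) in \<open>auto simp: lk\<close>)
  finally show ?case using insert by simp
qed

lemma mps_res_ins: "f $ 0 = 1 \<Longrightarrow> v \<notin> A \<Longrightarrow> mps_res A (mps_ins v f) = 1"
proof (rule mps_eqI)
  fix m :: "'b \<Rightarrow>\<^sub>0 nat" assume f: "f $ 0 = 1" "v \<notin> A"
  have "m = 0" if "Poly_Mapping.keys m \<subseteq> A" "Poly_Mapping.keys m \<subseteq> {v}"
    using that f(2) by (subst keys_eq_empty[symmetric]) blast
  then show "mps_coeff (mps_res A (mps_ins v f)) m = mps_coeff 1 m"
    using f by (auto simp: mps_coeff_res mps_coeff_ins mps_coeff_simps)
qed

subsection \<open>The change of variable\<close>

definition ring_emb :: "(qbeta \<Rightarrow> 'a::comm_ring_1) \<Rightarrow> bool" where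
  "ring_emb h \<longleftrightarrow> h 0 = 0 \<and> h 1 = 1 \<and> (\<forall>a b. h (a + b) = h a + h b) \<and> (\<forall>a b. h (a * b) = h a * h b)"

lemma ring_embD: "ring_emb h \<Longrightarrow> h 0 = 0" "ring_emb h \<Longrightarrow> h 1 = 1"
  "ring_emb h \<Longrightarrow> h (a + b) = h a + h b" "ring_emb h \<Longrightarrow> h (a * b) = h a * h b"
  by (auto simp: ring_emb_def)

lemma ring_emb_sum: "ring_emb h \<Longrightarrow> h (\<Sum>a\<in>A. f a) = (\<Sum>a\<in>A. h (f a))"
  by (induction A rule: infinite_finite_induct) (auto simp: ring_embD)

lemma ring_emb_const: "ring_emb il_const" "ring_emb mps_const"
  by (simp_all add: ring_emb_def il_const_add il_const_mult mps_const_add mps_const_mult)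

text \<open>\<open>wsubst h f\<close> is $f(w(x))$, where \<open>h\<close> embeds $\mathbb{Q}(\beta)$ in the ring of coefficients.\<close>

definition wsubst :: "(qbeta \<Rightarrow> 'a::comm_ring_1) \<Rightarrow> 'a fps \<Rightarrow> 'a fps" where
  "wsubst h f = Abs_fps (\<lambda>q. \<Sum>n\<le>q. h ((wfps ^ n) $ q) * f $ n)"

lemma wfps_power_less: "q < n \<Longrightarrow> (wfps ^ n) $ q = 0"
  using cw_less[of "int q" "int n"] by (simp add: cw_nat)

lemma wsubst_nth:
  assumes "ring_emb h" "q \<le> N"
  shows "wsubst h f $ q = (\<Sum>n\<le>N. h ((wfps ^ n) $ q) * f $ n)"
  unfolding wsubst_def fps_nth_Abs_fps
  by (rule sum.mono_neutral_left) (use assms in \<open>auto simp: wfps_power_less ring_embD\<close>)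

lemma wsubst_mult:
  assumes h: "ring_emb h"
  shows "wsubst h (f * g) = wsubst h f * wsubst h g"
proof (rule fps_ext)
  fix q
  have "(wsubst h f * wsubst h g) $ q = (\<Sum>p=0..q. (\<Sum>i\<le>q. h ((wfps ^ i) $ p) * f $ i) * (\<Sum>j\<le>q. h ((wfps ^ j) $ (q - p)) * g $ j))"
    unfolding fps_mult_nth by (rule sum.cong, rule refl, rule arg_cong2[of _ _ _ _ "(*)"]) (auto intro: wsubst_nth[OF h])
  also have "\<dots> = (\<Sum>p=0..q. \<Sum>i\<le>q. \<Sum>j\<le>q. h ((wfps ^ i) $ p * (wfps ^ j) $ (q - p)) * (f $ i * g $ j))"
    by (simp add: sum_product ring_embD[OF h] mult_ac)
  also have "\<dots> = (\<Sum>i\<le>q. \<Sum>j\<le>q. \<Sum>p=0..q. h ((wfps ^ i) $ p * (wfps ^ j) $ (q - p)) * (f $ i * g $ j))"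
    by (rule trans[OF sum.swap]) (intro sum.cong refl sum.swap)
  also have "\<dots> = (\<Sum>i\<le>q. \<Sum>j\<le>q. h ((wfps ^ (i + j)) $ q) * (f $ i * g $ j))"
    by (simp add: sum_distrib_right[symmetric] ring_emb_sum[OF h, symmetric] fps_mult_nth[symmetric] power_add)
  also have "\<dots> = (\<Sum>i\<le>q. \<Sum>j\<le>q - i. h ((wfps ^ (i + j)) $ q) * (f $ i * g $ (i + j - i)))"
  proof (rule sum.cong[OF refl])
    fix i assume "i \<in> {..q}"
    have z: "h ((wfps ^ (i + j)) $ q) = 0" if "\<not> j \<le> q - i" for j
      using that by (simp add: wfps_power_less ring_embD(1)[OF h])
    show "(\<Sum>j\<le>q. h ((wfps ^ (i + j)) $ q) * (f $ i * g $ j)) = (\<Sum>j\<le>q - i. h ((wfps ^ (i + j)) $ q) * (f $ i * g $ (i + j - i)))"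
      unfolding add_diff_cancel_left' by (rule sum.mono_neutral_right) (auto simp: z)
  qed
  also have "\<dots> = (\<Sum>n\<le>q. \<Sum>i\<le>n. h ((wfps ^ n) $ q) * (f $ i * g $ (n - i)))"
    by (rule sum_triangle[symmetric])
  also have "\<dots> = wsubst h (f * g) $ q"
    by (simp add: wsubst_def fps_mult_nth sum_distrib_left atMost_atLeast0)
  finally show "wsubst h (f * g) $ q = (wsubst h f * wsubst h g) $ q" ..
qed

lemma wsubst_const_times: "wsubst h (fps_const c * f) = fps_const c * wsubst h f"
  by (rule fps_ext) (simp add: wsubst_def sum_distrib_left mult_ac)

lemma wsubst_add: "wsubst h (f + g) = wsubst h f + wsubst h g"
  by (rule fps_ext) (simp add: wsubst_def distrib_left sum.distrib)

lemma wsubst_1: "ring_emb h \<Longrightarrow> wsubst h 1 = 1"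
proof (rule fps_ext)
  fix q assume h: "ring_emb h"
  have "wsubst h 1 $ q = (\<Sum>n\<in>{0}. h ((wfps ^ n) $ q) * 1 $ n)"
    unfolding wsubst_def fps_nth_Abs_fps by (rule sum.mono_neutral_right) auto
  then show "wsubst h 1 $ q = 1 $ q" using h by (simp add: ring_embD)
qed

lemma wsubst_prod: "ring_emb h \<Longrightarrow> wsubst h (prod f A) = (\<Prod>a\<in>A. wsubst h (f a))"
  by (induction A rule: infinite_finite_induct) (simp_all add: wsubst_1 wsubst_mult)

lemma wsubst_X:
  assumes h: "ring_emb h"
  shows "(1 + fps_const (h gam) * fps_X) * wsubst h fps_X = fps_X"
proof (rule fps_ext)
  fix q
  have w: "wsubst h fps_X $ n = h (wfps $ n)" for n
  proof -
    have "wsubst h fps_X $ n = (\<Sum>i\<le>n + 1. h ((wfps ^ i) $ n) * fps_X $ i)" by (rule wsubst_nth[OF h]) simp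
    also have "\<dots> = (\<Sum>i\<in>{1}. h ((wfps ^ i) $ n) * fps_X $ i)"
      by (rule sum.mono_neutral_right) (auto simp: fps_X_def)
    finally show ?thesis by simp
  qed
  have "(wfps + fps_const gam * (fps_X * wfps)) $ q = fps_X $ q"
    using wfps_times by (simp add: algebra_simps)
  then have "h ((wfps + fps_const gam * (fps_X * wfps)) $ q) = h (fps_X $ q)" by simp
  moreover have "((1 + fps_const (h gam) * fps_X) * wsubst h fps_X) $ q
      = wsubst h fps_X $ q + h gam * (fps_X * wsubst h fps_X) $ q"
    by (simp add: algebra_simps)
  ultimately show "((1 + fps_const (h gam) * fps_X) * wsubst h fps_X) $ q = fps_X $ q"
    by (cases q) (auto simp: w ring_embD[OF h] split: if_splits)
qed

text \<open>(1 + s w)/(1 - s w) at w = x/(1 + gam x), with both sides of the fraction multiplied by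
  1 + gam x.\<close>

lemma wsubst_gser:
  assumes h: "ring_emb h"
  shows "wsubst h (gser s) * (1 + fps_const (h gam - s) * fps_X) = 1 + fps_const (h gam + s) * fps_X"
proof -
  let ?u = "1 + fps_const (h gam) * fps_X"
  have l: "?u * wsubst h (1 + fps_const c * fps_X) = 1 + fps_const (h gam + c) * fps_X" for c
  proof -
    have "?u * wsubst h (1 + fps_const c * fps_X) = ?u + fps_const c * (?u * wsubst h fps_X)"
      unfolding wsubst_add wsubst_1[OF h] wsubst_const_times by (simp add: algebra_simps)
    then show ?thesis unfolding wsubst_X[OF h] by (simp add: algebra_simps flip: fps_const_add)
  qed
  have "wsubst h (gser s) * (?u * wsubst h (1 + fps_const (- s) * fps_X)) = ?u * wsubst h (gser s * (1 + fps_const (- s) * fps_X))"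
    unfolding wsubst_mult[OF h] by (simp only: mult_ac)
  also have "gser s * (1 + fps_const (- s) * fps_X) = 1 + fps_const s * fps_X"
    using gser_times[of s] by (simp flip: fps_const_neg)
  finally show ?thesis unfolding l by simp
qed

subsection \<open>Coefficients of $GQ_\lambda$\<close>

text \<open>The expansion in x of (u_i \<oplus> x)/(u_i \<ominus> x), after division of numerator
  and denominator by u_i.\<close>

definition Tser :: "nat \<Rightarrow> qbeta ilaurent fps" where
  "Tser i = (1 + fps_const (il_const beta + il_ivar i) * fps_X) * (1 + fps_const (il_const beta) * fps_X) * geo (il_ivar i)"

lemma Tser_0: "Tser i $ 0 = 1"
  by (simp add: Tser_def geo_def fps_mult_nth)

text \<open>The two factors come from M and from e^theta. In the variable x the first becomes (1 +
  (beta + 1/u_i) x)/(1 - x/u_i) and the second 1 + beta x.\<close>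

lemma Tser_wsubst: "wsubst il_const (gser (il_ivar i + il_const gam) * gser (il_const gam)) = Tser i"
proof -
  have 1: "wsubst il_const (gser (il_ivar i + il_const gam)) * (1 - fps_const (il_ivar i) * fps_X)
      = 1 + fps_const (il_const beta + il_ivar i) * fps_X"
    using wsubst_gser[OF ring_emb_const(1), of "il_ivar i + il_const gam"]
    by (simp add: il_const_beta algebra_simps flip: fps_const_neg)
  have 2: "wsubst il_const (gser (il_const gam)) = 1 + fps_const (il_const beta) * fps_X"
    using wsubst_gser[OF ring_emb_const(1), of "il_const gam"] by (simp add: il_const_beta)
  have "wsubst il_const (gser (il_ivar i + il_const gam))
      = wsubst il_const (gser (il_ivar i + il_const gam)) * (geo (il_ivar i) * (1 - fps_const (il_ivar i) * fps_X))"
    unfolding geo_times by simp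
  also have "\<dots> = (1 + fps_const (il_const beta + il_ivar i) * fps_X) * geo (il_ivar i)"
    unfolding 1[symmetric] by (simp only: mult_ac)
  finally show ?thesis unfolding wsubst_mult[OF ring_emb_const(1)] 2 Tser_def by (simp only: mult_ac)
qed

lemma mps_const_inverse:
  "a dvd 1 \<Longrightarrow> inverse (mps_const a) = (mps_const (inverse a) :: ('v, 'b::comm_ring_1 ilaurent) mps)"
  by (rule mps_inverse_eq) (simp add: il_unit flip: mps_const_mult)

lemma fgl_quotient:
  "fgl_plus (mps_const (il_const beta)) (mps_const (il_var i)) (mps_var j)
    / fgl_minus (mps_const (il_const beta)) (mps_const (il_var i)) (mps_var j) = mps_ins j (Tser i)"
proof -
  let ?b = "il_const beta" and ?u = "il_var i :: qbeta ilaurent" and ?v = "il_ivar i :: qbeta ilaurent"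
  have plus: "fgl_plus (mps_const ?b) (mps_const ?u) (mps_var j) = mps_ins j (fps_const ?u + fps_X + fps_const ?b * fps_const ?u * fps_X)"
    unfolding fgl_plus_def by (simp only: mps_ins_simps mps_ins_mult)
  have b: "(1 + fps_const ?b * fps_X) * geo (- ?b) = 1"
    using geo_times[of "- ?b"] by (simp add: mult.commute flip: fps_const_neg)
  have invb: "inverse (1 + mps_const ?b * mps_var j) = mps_ins j (geo (- ?b))"
    by (rule mps_inverse_eq, rule arg_cong[OF b, of "mps_ins j", unfolded mps_ins_simps mps_ins_mult])
  have minus: "fgl_minus (mps_const ?b) (mps_const ?u) (mps_var j) = mps_ins j ((fps_const ?u - fps_X) * geo (- ?b))"
    unfolding fgl_minus_def divide_mps_def invb by (simp only: mps_ins_simps mps_ins_mult)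
  have uv: "fps_const ?u * fps_const ?v = 1" by (simp add: il_var_ivar)
  have expand: "(u + x + b * u * x) * ((1 + b * x) * (v * g)) = (u * v + v * x + b * (u * v) * x) * (1 + b * x) * g"
    for u v x b g :: "qbeta ilaurent fps" by (simp add: algebra_simps)
  have "(fps_const ?u - fps_X) * (fps_const ?v * geo ?v) = (fps_const ?u * fps_const ?v) * geo ?v - fps_const ?v * fps_X * geo ?v"
    by (simp add: left_diff_distrib mult.assoc mult.left_commute[of fps_X] del: fps_const_mult)
  also have "\<dots> = geo ?v * (1 - fps_const ?v * fps_X)" unfolding uv by (simp add: algebra_simps)
  finally have g: "(fps_const ?u - fps_X) * (fps_const ?v * geo ?v) = 1" unfolding geo_times .
  have "(fps_const ?u - fps_X) * geo (- ?b) * ((1 + fps_const ?b * fps_X) * (fps_const ?v * geo ?v))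
      = ((fps_const ?u - fps_X) * (fps_const ?v * geo ?v)) * ((1 + fps_const ?b * fps_X) * geo (- ?b))" by (simp only: mult_ac)
  also have "\<dots> = 1" unfolding g b by simp
  finally have "inverse (fgl_minus (mps_const ?b) (mps_const ?u) (mps_var j))
      = mps_ins j ((1 + fps_const ?b * fps_X) * (fps_const ?v * geo ?v))"
    unfolding minus by (intro mps_inverse_eq) (simp add: mps_ins_simps flip: mps_ins_mult)
  then have "fgl_plus (mps_const ?b) (mps_const ?u) (mps_var j) / fgl_minus (mps_const ?b) (mps_const ?u) (mps_var j)
      = mps_ins j ((fps_const ?u + fps_X + fps_const ?b * fps_const ?u * fps_X) * ((1 + fps_const ?b * fps_X) * (fps_const ?v * geo ?v)))"
    unfolding plus divide_mps_def by (simp only: mps_ins_mult)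
  also have "(fps_const ?u + fps_X + fps_const ?b * fps_const ?u * fps_X) * ((1 + fps_const ?b * fps_X) * (fps_const ?v * geo ?v))
      = (fps_const ?u * fps_const ?v + fps_const ?v * fps_X + fps_const ?b * (fps_const ?u * fps_const ?v) * fps_X) * (1 + fps_const ?b * fps_X) * geo ?v"
    by (rule expand)
  also have "\<dots> = Tser i" unfolding uv Tser_def by (simp add: algebra_simps flip: fps_const_add)
  finally show ?thesis .
qed

text \<open>Every factor has constant term 1 in its variable x_j, so only the variables of the
  monomial contribute to its coefficient.\<close>

lemma mps_coeff_GQ_gen:
  "mps_coeff (GQ_gen r) m = Cil r * (\<Prod>j\<in>Poly_Mapping.keys m. (\<Prod>i<r. Tser i) $ Poly_Mapping.lookup m j)"
proof -
  let ?b = "mps_const (il_const beta) :: (nat, qbeta ilaurent) mps" and ?U = "\<lambda>i. mps_const (il_var i) :: (nat, qbeta ilaurent) mps"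
  have c1: "1 / (1 + ?b * ?U i) = mps_const (inverse (1 + il_const beta * il_var i))" for i
  proof -
    have "1 + ?b * ?U i = mps_const (1 + il_const beta * il_var i)" by (simp add: mps_const_add mps_const_mult)
    then show ?thesis unfolding divide_mps_def by (simp add: mps_const_inverse one_beta_unit)
  qed
  have c2: "fgl_minus ?b (?U j) (?U i) / fgl_plus ?b (?U j) (?U i) = mps_const (pair_factor i j)" if "i < j" for i j
  proof -
    have "fgl_plus ?b (?U j) (?U i) = mps_const (il_var j + il_var i + il_const beta * il_var j * il_var i)"
      by (simp add: fgl_plus_def mps_const_add mps_const_mult)
    moreover have "fgl_minus ?b (?U j) (?U i) = mps_const ((il_var j - il_var i) * inverse (1 + il_const beta * il_var i))"
      using c1[of i] by (simp add: fgl_minus_def divide_mps_def mps_const_mult mps_const_diff)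
    ultimately show ?thesis unfolding divide_mps_def pair_factor_def
      by (simp add: mps_const_inverse fgl_unit that mps_const_mult)
  qed
  define p where "p = (Abs_mps (\<lambda>m. \<Prod>j\<in>Poly_Mapping.keys m. (\<Prod>i<r. Tser i) $ Poly_Mapping.lookup m j) :: (nat, qbeta ilaurent) mps)"
  have pc: "mps_coeff p m = (\<Prod>j\<in>Poly_Mapping.keys m. (\<Prod>i<r. Tser i) $ Poly_Mapping.lookup m j)" for m
    by (simp add: p_def Abs_mps_inverse)
  have "mps_has_prod (\<lambda>(i, j). fgl_plus ?b (?U i) (mps_var j) / fgl_minus ?b (?U i) (mps_var j)) ({..<r} \<times> UNIV) p"
    unfolding fgl_quotient
  proof (rule mps_has_prodI, intro exI conjI ballI)
    fix m :: "nat \<Rightarrow>\<^sub>0 nat"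
    let ?K = "Poly_Mapping.keys m"
    show "finite ({..<r} \<times> ?K)" "{..<r} \<times> ?K \<subseteq> {..<r} \<times> UNIV" by auto
    fix x assume "x \<in> {..<r} \<times> UNIV - {..<r} \<times> ?K"
    then show "mps_res ?K (case x of (i, j) \<Rightarrow> mps_ins j (Tser i)) = 1"
      by (auto intro!: mps_res_ins Tser_0)
  next
    fix m :: "nat \<Rightarrow>\<^sub>0 nat"
    let ?K = "Poly_Mapping.keys m"
    have "(\<Prod>x\<in>{..<r} \<times> ?K. case x of (i, j) \<Rightarrow> mps_ins j (Tser i)) = (\<Prod>j\<in>?K. mps_ins j (\<Prod>i<r. Tser i))"
      by (simp add: prod.cartesian_product[symmetric] mps_ins_prod) (rule prod.swap)
    then show "mps_coeff p m = mps_coeff (\<Prod>x\<in>{..<r} \<times> ?K. case x of (i, j) \<Rightarrow> mps_ins j (Tser i)) m"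
      by (simp add: mps_coeff_prod_ins pc)
  qed
  then have ip: "mps_infprod (\<lambda>(i, j). fgl_plus ?b (?U i) (mps_var j) / fgl_minus ?b (?U i) (mps_var j)) ({..<r} \<times> UNIV) = p"
    by (rule mps_infprod_eq)
  have "(\<Prod>(i, j) | i < j \<and> j < r. fgl_minus ?b (?U j) (?U i) / fgl_plus ?b (?U j) (?U i)) = (\<Prod>(i, j) | i < j \<and> j < r. mps_const (pair_factor i j))"
    by (rule prod.cong) (auto simp: c2)
  then have "GQ_gen r = mps_const (Cil r) * p"
    unfolding GQ_gen_def Let_def ip c1 Cil_def mps_const_mult mps_const_prod by (simp add: split_def mult_ac)
  then show ?thesis by (simp add: mps_coeff_const_times pc)
qed

lemma mps_coeff_GQ:
  "mps_coeff (GQ ls) m = il_coeff (Cil (length ls)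
    * (\<Prod>j\<in>Poly_Mapping.keys m. (\<Prod>i<length ls. Tser i) $ Poly_Mapping.lookup m j)) (lam_exp ls)"
  by (simp add: GQ_def mps_map.rep_eq mps_coeff_GQ_gen lam_exp_def)

subsection \<open>The Cauchy kernel\<close>

definition xpart :: "(nat + nat \<Rightarrow>\<^sub>0 nat) \<Rightarrow> (nat \<Rightarrow>\<^sub>0 nat)" where "xpart M = Poly_Mapping.map_key Inl M"
definition ypart :: "(nat + nat \<Rightarrow>\<^sub>0 nat) \<Rightarrow> (nat \<Rightarrow>\<^sub>0 nat)" where "ypart M = Poly_Mapping.map_key Inr M"
definition xy :: "(nat \<Rightarrow>\<^sub>0 nat) \<Rightarrow> (nat \<Rightarrow>\<^sub>0 nat) \<Rightarrow> (nat + nat \<Rightarrow>\<^sub>0 nat)" where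
  "xy n m = Abs_poly_mapping (case_sum (Poly_Mapping.lookup n) (Poly_Mapping.lookup m))"

lemma lookup_xpart [simp]: "Poly_Mapping.lookup (xpart M) i = Poly_Mapping.lookup M (Inl i)"
  and lookup_ypart [simp]: "Poly_Mapping.lookup (ypart M) i = Poly_Mapping.lookup M (Inr i)"
  by (simp_all add: xpart_def ypart_def map_key.rep_eq)

lemma lookup_xy: "Poly_Mapping.lookup (xy n m) = case_sum (Poly_Mapping.lookup n) (Poly_Mapping.lookup m)"
proof -
  have "{x. case_sum (Poly_Mapping.lookup n) (Poly_Mapping.lookup m) x \<noteq> 0} \<subseteq> Inl ` Poly_Mapping.keys n \<union> Inr ` Poly_Mapping.keys m"
    by (force simp: in_keys_iff split: sum.splits)
  then have "finite {x. case_sum (Poly_Mapping.lookup n) (Poly_Mapping.lookup m) x \<noteq> 0}"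
    by (rule finite_subset) simp
  then show ?thesis by (simp add: xy_def)
qed

lemma xpart_xy [simp]: "xpart (xy n m) = n" and ypart_xy [simp]: "ypart (xy n m) = m"
  by (rule poly_mapping_eqI, simp add: lookup_xy)+

lemma xy_parts [simp]: "xy (xpart M) (ypart M) = M"
  by (rule poly_mapping_eqI) (simp add: lookup_xy split: sum.splits)

lemma xy_add: "xy n m + xy n' m' = xy (n + n') (m + m')"
  by (rule poly_mapping_eqI) (simp add: lookup_xy lookup_add split: sum.splits)

lemma parts_add: "xpart (M + N) = xpart M + xpart N" "ypart (M + N) = ypart M + ypart N"
  by (rule poly_mapping_eqI, simp add: lookup_add)+

text \<open>Series in x over series in y, read as series in both. The kernel can thus be built one x
  at a time, its coefficients being scalars of the Fock space.\<close>

definition mps_join :: "(nat, (nat, 'a::comm_ring_1) mps) mps \<Rightarrow> (nat + nat, 'a) mps" where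
  "mps_join f = Abs_mps (\<lambda>M. mps_coeff (mps_coeff f (xpart M)) (ypart M))"

lemma mps_coeff_join: "mps_coeff (mps_join f) M = mps_coeff (mps_coeff f (xpart M)) (ypart M)"
  by (simp add: mps_join_def Abs_mps_inverse)

lemma mps_join_mult: "mps_join (f * g) = mps_join f * mps_join g"
proof (rule mps_eqI)
  fix M
  have fin: "finite {(a, b). a + b = (m :: 'v \<Rightarrow>\<^sub>0 nat)}" for m
    using finite_monomial_pairs[of m "\<lambda>_ _. True"] by simp
  have "mps_coeff (mps_join (f * g)) M = (\<Sum>nn | fst nn + snd nn = xpart M. \<Sum>mm | fst mm + snd mm = ypart M.
      mps_coeff (mps_coeff f (fst nn)) (fst mm) * mps_coeff (mps_coeff g (snd nn)) (snd mm))"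
    unfolding mps_coeff_join mps_coeff_simps conv_monomial mps_coeff_sum by (simp add: split_def mps_coeff_simps conv_monomial)
  also have "\<dots> = (\<Sum>(nn, mm)\<in>{nn. fst nn + snd nn = xpart M} \<times> {mm. fst mm + snd mm = ypart M}.
      mps_coeff (mps_coeff f (fst nn)) (fst mm) * mps_coeff (mps_coeff g (snd nn)) (snd mm))"
    by (rule sum.cartesian_product)
  also have "\<dots> = (\<Sum>(A, B) | A + B = M. mps_coeff (mps_join f) A * mps_coeff (mps_join g) B)"
    by (rule sum.reindex_bij_witness[of _ "\<lambda>(A, B). ((xpart A, xpart B), (ypart A, ypart B))"
        "\<lambda>((n, n'), (m, m')). (xy n m, xy n' m')"])
      (auto simp: mps_coeff_join xy_add parts_add)
  also have "\<dots> = mps_coeff (mps_join f * mps_join g) M"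
    by (simp add: mps_coeff_simps conv_monomial)
  finally show "mps_coeff (mps_join (f * g)) M = mps_coeff (mps_join f * mps_join g) M" .
qed

lemma parts_0 [simp]: "xpart 0 = 0" "ypart 0 = 0"
  by (rule poly_mapping_eqI, simp)+

lemma parts_eq_0: "xpart M = 0 \<Longrightarrow> ypart M = 0 \<Longrightarrow> M = 0"
  using xy_parts[of M] xy_parts[of 0] by simp

lemma mps_join_simps:
  "mps_join 1 = 1" "mps_join (f + g) = mps_join f + mps_join g" "mps_join (f - g) = mps_join f - mps_join g"
  "mps_join (mps_const (mps_const c)) = mps_const c" "mps_join (mps_const (mps_var j)) = mps_var (Inr j)"
  "mps_join (mps_var i) = mps_var (Inl i)"
proof -
  have s: "M = Poly_Mapping.single (Inr j) 1 \<longleftrightarrow> xpart M = 0 \<and> ypart M = Poly_Mapping.single j 1" for M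
  proof
    assume "M = Poly_Mapping.single (Inr j) 1"
    then show "xpart M = 0 \<and> ypart M = Poly_Mapping.single j 1"
      by (auto intro!: poly_mapping_eqI simp: lookup_single when_def)
  next
    assume "xpart M = 0 \<and> ypart M = Poly_Mapping.single j 1"
    then have "M = xy 0 (Poly_Mapping.single j 1)" by (metis xy_parts)
    then show "M = Poly_Mapping.single (Inr j) 1"
      by (auto intro!: poly_mapping_eqI simp: lookup_single when_def lookup_xy split: sum.splits)
  qed
  have t: "M = Poly_Mapping.single (Inl i) 1 \<longleftrightarrow> ypart M = 0 \<and> xpart M = Poly_Mapping.single i 1" for M
  proof
    assume "M = Poly_Mapping.single (Inl i) 1"
    then show "ypart M = 0 \<and> xpart M = Poly_Mapping.single i 1"
      by (auto intro!: poly_mapping_eqI simp: lookup_single when_def)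
  next
    assume "ypart M = 0 \<and> xpart M = Poly_Mapping.single i 1"
    then have "M = xy (Poly_Mapping.single i 1) 0" by (metis xy_parts)
    then show "M = Poly_Mapping.single (Inl i) 1"
      by (auto intro!: poly_mapping_eqI simp: lookup_single when_def lookup_xy split: sum.splits)
  qed
  show "mps_join 1 = 1" "mps_join (f + g) = mps_join f + mps_join g" "mps_join (f - g) = mps_join f - mps_join g"
    "mps_join (mps_const (mps_const c)) = mps_const c"
    by (rule mps_eqI; auto simp: mps_coeff_join mps_coeff_simps mps_coeff_const dest: parts_eq_0)+
  show "mps_join (mps_const (mps_var j)) = mps_var (Inr j)" "mps_join (mps_var i) = mps_var (Inl i)"
    by (rule mps_eqI; simp only: mps_coeff_join mps_coeff_simps mps_coeff_const mps_var.rep_eq s t; auto simp: mps_coeff_simps mps_var.rep_eq)+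
qed

lemma mps_join_prod: "mps_join (prod f A) = (\<Prod>a\<in>A. mps_join (f a))"
  by (induction A rule: infinite_finite_induct) (simp_all add: mps_join_simps mps_join_mult)

text \<open>One factor of the Cauchy kernel as a series in x_i, namely (1 + (beta + y_j) x)/((1 -
  y_j x)(1 + beta x)).\<close>

definition kser :: "nat \<Rightarrow> scalars fps" where
  "kser j = (1 + fps_const (mps_const beta + mps_var j) * fps_X) * geo (mps_var j) * geo (- mps_const beta)"

lemma kser_0: "kser j $ 0 = 1" by (simp add: kser_def geo_def fps_mult_nth)

lemma mps_const_beta: "mps_const beta = (mps_const gam + mps_const gam :: ('v, qbeta) mps)"
  by (simp only: beta_eq_gam mult_2 mps_const_add)

lemma kser_wsubst: "wsubst mps_const (gser (mps_const gam + mps_var j) * gser (- mps_const gam)) = kser j"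
proof -
  let ?y = "mps_var j :: scalars" and ?g = "mps_const gam :: scalars" and ?b = "mps_const beta :: scalars"
  have 1: "wsubst mps_const (gser (?g + ?y)) * (1 - fps_const ?y * fps_X) = 1 + fps_const (?b + ?y) * fps_X"
    using wsubst_gser[OF ring_emb_const(2), of "?g + ?y"]
    by (simp add: mps_const_beta algebra_simps flip: fps_const_neg)
  have 2: "wsubst mps_const (gser (- ?g)) * (1 - fps_const (- ?b) * fps_X) = 1"
    using wsubst_gser[OF ring_emb_const(2), of "- ?g"] by (simp add: mps_const_beta flip: fps_const_neg)
  have "wsubst mps_const (gser (?g + ?y) * gser (- ?g))
      = wsubst mps_const (gser (?g + ?y)) * wsubst mps_const (gser (- ?g))
        * (geo ?y * (1 - fps_const ?y * fps_X)) * (geo (- ?b) * (1 - fps_const (- ?b) * fps_X))"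
    unfolding geo_times wsubst_mult[OF ring_emb_const(2)] by simp
  also have "\<dots> = (wsubst mps_const (gser (?g + ?y)) * (1 - fps_const ?y * fps_X)) * geo ?y
      * (wsubst mps_const (gser (- ?g)) * (1 - fps_const (- ?b) * fps_X)) * geo (- ?b)" by (simp only: mult_ac)
  finally show ?thesis unfolding 1 2 kser_def by simp
qed

lemma kernel_factor:
  "(1 - fgl_neg (mps_const beta) (mps_var (Inl i)) * mps_var (Inr j)) / (1 - mps_var (Inl i) * mps_var (Inr j))
    = mps_join (mps_ins i (kser j))"
proof -
  let ?y = "mps_var j :: scalars" and ?b = "mps_const beta :: scalars"
  let ?x = "mps_var (Inl i) :: (nat + nat, qbeta) mps" and ?z = "mps_var (Inr j) :: (nat + nat, qbeta) mps" and ?B = "mps_const beta :: (nat + nat, qbeta) mps"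
  let ?J = "\<lambda>f. mps_join (mps_ins i f)"
  have J: "?J (f * g) = ?J f * ?J g" "?J (f + g) = ?J f + ?J g" "?J (f - g) = ?J f - ?J g" "?J 1 = 1" "?J fps_X = ?x"
    "?J (fps_const ?y) = ?z" "?J (fps_const ?b) = ?B" for f g
    by (simp_all add: mps_ins_mult mps_join_mult mps_ins_simps mps_join_simps)
  have b: "(1 + fps_const ?b * fps_X) * geo (- ?b) = 1"
    using geo_times[of "- ?b"] by (simp add: mult.commute flip: fps_const_neg)
  have bj: "(1 + ?B * ?x) * ?J (geo (- ?b)) = 1"
    unfolding J(5,7)[symmetric] J(4)[symmetric] J(1,2)[symmetric] b ..
  have ib: "inverse (1 + ?B * ?x) = ?J (geo (- ?b))" by (rule mps_inverse_eq[OF bj])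
  have y: "(1 - fps_X * fps_const ?y) * geo ?y = 1" using geo_times[of ?y] by (simp add: mult.commute)
  have iy: "inverse (1 - ?x * ?z) = ?J (geo ?y)"
    by (rule mps_inverse_eq) (unfold J(5,6)[symmetric] J(4)[symmetric] J(1,3)[symmetric] y, rule refl)
  have "1 - fgl_neg ?B ?x * ?z = 1 + ?x * ?J (geo (- ?b)) * ?z"
    unfolding fgl_neg_def divide_mps_def ib by simp
  also have "\<dots> = (1 + ?B * ?x) * ?J (geo (- ?b)) + ?x * ?J (geo (- ?b)) * ?z" unfolding bj ..
  also have "\<dots> = (1 + (?B + ?z) * ?x) * ?J (geo (- ?b))" by (simp add: algebra_simps)
  finally have "(1 - fgl_neg ?B ?x * ?z) / (1 - ?x * ?z) = (1 + (?B + ?z) * ?x) * ?J (geo (- ?b)) * ?J (geo ?y)"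
    unfolding divide_mps_def iy by simp
  also have "\<dots> = ?J (kser j)"
    unfolding kser_def fps_const_add[symmetric] J by (simp only: mult_ac)
  finally show ?thesis .
qed

definition fps_res :: "nat set \<Rightarrow> scalars fps \<Rightarrow> scalars fps" where
  "fps_res A f = Abs_fps (\<lambda>n. mps_res A (f $ n))"

lemma fps_res_nth [simp]: "fps_res A f $ n = mps_res A (f $ n)" by (simp add: fps_res_def)

lemma fps_res_mult: "fps_res A (f * g) = fps_res A f * fps_res A g"
  by (rule fps_ext) (simp add: fps_mult_nth mps_res_sum mps_res_mult)

lemma mps_res_var: "mps_res A (mps_var j) = (if j \<in> A then mps_var j else 0)"
  by (rule mps_eqI) (auto simp: mps_coeff_res mps_var.rep_eq mps_coeff_simps)

lemma mps_res_power: "mps_res A (f ^ n) = mps_res A f ^ n"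
  by (induction n) (simp_all add: mps_res_simps mps_res_mult)

lemma mps_res_of_nat: "mps_res A (of_nat n) = of_nat n"
  by (induction n) (simp_all add: mps_res_simps)

lemma fps_res_kser: "j \<notin> A \<Longrightarrow> fps_res A (kser j) = 1"
proof -
  assume j: "j \<notin> A"
  let ?b = "mps_const beta :: scalars"
  have n: "mps_res A (- x) = - mps_res A x" for x :: scalars
    by (rule mps_eqI) (simp add: mps_coeff_res mps_coeff_simps)
  have g: "fps_res A (geo (mps_var j)) = 1"
    by (rule fps_ext) (auto simp: geo_def mps_res_power mps_res_var j power_0_left)
  have l: "fps_res A (1 + fps_const (?b + mps_var j) * fps_X) = 1 + fps_const ?b * fps_X"
    by (rule fps_ext) (auto simp: mps_res_simps mps_res_var j fps_X_def)
  have h: "fps_res A (geo (- ?b)) = geo (- ?b)"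
    by (rule fps_ext) (simp add: geo_def mps_res_power n mps_res_simps)
  have "(1 + fps_const ?b * fps_X) * geo (- ?b) = 1"
    using geo_times[of "- ?b"] by (simp add: mult.commute flip: fps_const_neg)
  then show ?thesis unfolding kser_def fps_res_mult g l h by simp
qed

text \<open>Here f stands for the infinite product over j of \<open>kser j\<close>; it is specified
  only through its restrictions to finitely many y, which determine all coefficients.\<close>

lemma kernel_has_prod:
  assumes f: "\<And>A. finite A \<Longrightarrow> fps_res A f = fps_res A (\<Prod>j\<in>A. kser j)"
  shows "mps_coeff cauchy_kernel M
    = mps_coeff (\<Prod>i\<in>Poly_Mapping.keys (xpart M). f $ Poly_Mapping.lookup (xpart M) i) (ypart M)"
proof -
  define P where "P = (Abs_mps (\<lambda>n. \<Prod>i\<in>Poly_Mapping.keys n. f $ Poly_Mapping.lookup n i) :: (nat, scalars) mps)"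
  have Pc: "mps_coeff P n = (\<Prod>i\<in>Poly_Mapping.keys n. f $ Poly_Mapping.lookup n i)" for n
    by (simp add: P_def Abs_mps_inverse)
  have kx: "i \<in> Poly_Mapping.keys (xpart M) \<longleftrightarrow> Inl i \<in> Poly_Mapping.keys M"
    and ky: "i \<in> Poly_Mapping.keys (ypart M) \<longleftrightarrow> Inr i \<in> Poly_Mapping.keys M" for i M
    by (simp_all add: in_keys_iff)
  have "mps_has_prod (\<lambda>(i, j). mps_join (mps_ins i (kser j))) UNIV (mps_join P)"
  proof (rule mps_has_prodI, intro exI conjI ballI)
    fix M
    let ?I = "Poly_Mapping.keys (xpart M)" and ?A = "Poly_Mapping.keys (ypart M)"
    show "finite (?I \<times> ?A)" "?I \<times> ?A \<subseteq> UNIV" by auto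
    \<comment> \<open>A factor outside the rectangle lacks x_i or y_j among the variables of M, and
      setting either of them to 0 turns the factor into 1.\<close>
    fix x assume x: "x \<in> UNIV - ?I \<times> ?A"
    obtain i j where ij: "x = (i, j)" by force
    have xpart_0: "xpart N = 0" if "Poly_Mapping.keys (xpart N) \<subseteq> {i}" "Poly_Mapping.lookup N (Inl i) = 0" for N
      using keys_subset_single[OF that(1)] that(2) by simp
    have "mps_coeff (mps_res (Poly_Mapping.keys M) (mps_join (mps_ins i (kser j)))) N = mps_coeff 1 N" for N
    proof (cases "Poly_Mapping.keys N \<subseteq> Poly_Mapping.keys M")
      case True
      show ?thesis
      proof (cases "i \<in> ?I")
        case False
        then have i0: "Poly_Mapping.lookup (xpart N) i = 0" using True kx by (auto simp: in_keys_iff subset_iff)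
        then have "Poly_Mapping.keys (xpart N) \<subseteq> {i} \<longleftrightarrow> xpart N = 0"
          using keys_subset_single[of "xpart N" i] by auto
        then show ?thesis using True i0
          by (auto simp: mps_coeff_res mps_coeff_join mps_coeff_ins kser_0 mps_coeff_simps dest: parts_eq_0)
      next
        case ii: True
        then have "j \<notin> ?A" using x ij by auto
        then have "mps_res ?A (kser j $ n) = (1 :: scalars fps) $ n" for n
          using fps_res_kser[of j ?A] by (metis fps_res_nth)
        moreover have "Poly_Mapping.keys (ypart N) \<subseteq> ?A" using True ky by blast
        ultimately have "mps_coeff (kser j $ n) (ypart N) = mps_coeff ((1 :: scalars fps) $ n) (ypart N)" for n
          by (metis mps_coeff_res)
        then show ?thesis using True
          by (cases "ypart N = 0") (auto simp: mps_coeff_res mps_coeff_join mps_coeff_ins mps_coeff_simps dest: parts_eq_0 xpart_0)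
      qed
    next
      case False
      then show ?thesis by (auto simp: mps_coeff_res mps_coeff_simps)
    qed
    then show "mps_res (Poly_Mapping.keys M) (case x of (i, j) \<Rightarrow> mps_join (mps_ins i (kser j))) = 1"
      by (simp add: ij mps_eqI)
  next
    fix M
    let ?I = "Poly_Mapping.keys (xpart M)" and ?A = "Poly_Mapping.keys (ypart M)"
    have c: "mps_coeff g (ypart M) = mps_coeff (mps_res ?A g) (ypart M)" for g :: scalars
      by (simp add: mps_coeff_res)
    have "(\<Prod>x\<in>?I \<times> ?A. case x of (i, j) \<Rightarrow> mps_join (mps_ins i (kser j))) = mps_join (\<Prod>i\<in>?I. mps_ins i (\<Prod>j\<in>?A. kser j))"
      by (simp add: prod.cartesian_product[symmetric] mps_ins_prod mps_join_prod)
    then have "mps_coeff (\<Prod>x\<in>?I \<times> ?A. case x of (i, j) \<Rightarrow> mps_join (mps_ins i (kser j))) M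
        = mps_coeff (\<Prod>i\<in>?I. (\<Prod>j\<in>?A. kser j) $ Poly_Mapping.lookup (xpart M) i) (ypart M)"
      by (simp add: mps_coeff_join mps_coeff_prod_ins)
    also have "\<dots> = mps_coeff (\<Prod>i\<in>?I. f $ Poly_Mapping.lookup (xpart M) i) (ypart M)"
    proof -
      have e: "mps_res ?A (f $ n) = mps_res ?A ((\<Prod>j\<in>?A. kser j) $ n)" for n
        using arg_cong[OF f[OF finite_keys], of "\<lambda>z. z $ n" "ypart M"] by simp
      have "mps_res ?A (\<Prod>i\<in>?I. (\<Prod>j\<in>?A. kser j) $ Poly_Mapping.lookup (xpart M) i)
          = mps_res ?A (\<Prod>i\<in>?I. f $ Poly_Mapping.lookup (xpart M) i)"
        unfolding mps_res_prod e ..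
      then show ?thesis by (metis c)
    qed
    finally show "mps_coeff (mps_join P) M = mps_coeff (\<Prod>x\<in>?I \<times> ?A. case x of (i, j) \<Rightarrow> mps_join (mps_ins i (kser j))) M"
      by (simp add: mps_coeff_join Pc)
  qed
  then have k: "cauchy_kernel = mps_join P"
    unfolding cauchy_kernel_def Let_def kernel_factor by (rule mps_infprod_eq)
  show ?thesis unfolding k mps_coeff_join Pc ..
qed

subsection \<open>The Hamiltonian\<close>

lemma cw_binomial: "cw (int (Suc k)) (int (Suc n)) = of_nat (k choose n) * (- gam) ^ (k - n)"
proof (induction k arbitrary: n)
  case 0
  then show ?case using cw_self[of 1] cw_less[of 1 "int (Suc n)"] by (cases n) auto
next
  case (Suc k)
  have r: "cw (int (Suc (Suc k))) (int (Suc n)) = cw (int (Suc k)) (int n) - gam * cw (int (Suc k)) (int (Suc n))"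
    using cw_rec[of "int (Suc k)" "int (Suc n)"] by (simp add: algebra_simps)
  show ?case
  proof (cases n)
    case 0
    then show ?thesis unfolding r using Suc.IH[of 0] by (simp add: cw_0)
  next
    case (Suc l)
    show ?thesis
    proof (cases "l < k")
      case True
      then have "k - l = Suc (k - Suc l)" by simp
      then show ?thesis unfolding r unfolding Suc Suc.IH by (simp only: binomial_Suc_Suc of_nat_add diff_Suc_Suc) (simp add: algebra_simps)
    next
      case False
      then show ?thesis unfolding r unfolding Suc Suc.IH by (cases "l = k") (simp_all add: binomial_eq_0)
    qed
  qed
qed

text \<open>With z = 1/X the two inverse bases are -w(-z) and -w(z). The two powers differ by X ->
  -X up to the sign in their arguments, so for odd k they have opposite coefficients and the
  division by 2 leaves one of them.\<close>

lemma b_round_series_nth: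
  assumes "odd k" shows "fls_nth (b_round_series (- int n)) k = (-1) ^ Suc n * cw k (int n)"
proof -
  define wm where "wm = - (wfps oo (- fps_X))"
  have w: "(wfps oo (- fps_X)) * (1 - fps_const gam * fps_X) = - fps_X"
    using arg_cong[OF wfps_times, of "\<lambda>f. f oo (- fps_X)"]
    by (simp add: fps_compose_mult_distrib fps_compose_add_distrib)
  have "wm * (1 - fps_const gam * fps_X) = fps_X"
    unfolding wm_def by (simp only: mult_minus_left w minus_minus)
  from arg_cong[OF this, of fps_to_fls]
  have "fps_to_fls wm * (1 - fls_const gam * fls_X) = fls_X"
    by (simp add: fls_times_fps_to_fls)
  moreover have XX: "(fls_X_inv :: qbeta fls) * fls_X = 1" by (simp add: fls_X_inv_times_conv_shift)
  ultimately have "fps_to_fls wm * (fls_X_inv - fls_const gam) * fls_X = 1 * fls_X"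
    by (simp only: mult.assoc left_diff_distrib XX mult_1_left)
  then have "(fls_X_inv - fls_const gam) * fps_to_fls wm = 1" by (metis mult_right_cancel fls_X_nonzero mult.commute)
  then have i1: "inverse (fls_X_inv - fls_const gam) = fps_to_fls wm" by (rule inverse_unique)
  have "(- fls_X_inv - fls_const gam) * (- wser) = 1" using wser_times by (simp add: algebra_simps)
  then have i2: "inverse (- fls_X_inv - fls_const gam) = - wser" by (rule inverse_unique)
  have half: "f / 2 = fls_const (1 / 2) * f" for f :: "qbeta fls"
  proof -
    have "fls_const (1 / 2) * f * 2 = f * fls_const (1 / 2 * 2)"
      by (simp only: fls_const_mult_const[symmetric] mult_ac fls_const_numeral[symmetric])
    then show ?thesis by (simp add: divide_eq_eq)
  qed
  have cm: "(wfps ^ n oo (- fps_X)) $ nat k = (-1) ^ nat k * (wfps ^ n) $ nat k"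
    by (simp add: fps_compose_uminus')
  have "(fls_X_inv - fls_const gam) powi (- int n) = fps_to_fls (wm ^ n)"
    by (simp add: power_int_minus i1 fps_to_fls_power flip: power_inverse)
  moreover have "(- fls_X_inv - fls_const gam) powi (- int n) = (- 1) ^ n * wser ^ n"
    by (simp add: power_int_minus i2 power_minus[of wser] flip: power_inverse)
  moreover have "wm ^ n = (- 1) ^ n * (wfps ^ n oo (- fps_X))"
    unfolding wm_def by (simp add: power_minus[of "wfps oo _"] fps_compose_power)
  moreover have "((- 1) ^ n * f) $ m = (- 1) ^ n * f $ m" for f :: "qbeta fps" and m
    by (cases "even n") simp_all
  moreover have "fls_nth ((- 1) ^ n * f) m = (- 1) ^ n * fls_nth f m" for f :: "qbeta fls" and m
    by (cases "even n") simp_all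
  moreover have "fls_nth (wser ^ n) k = cw k (int n)" by (simp add: cw_def)
  ultimately have "fls_nth (b_round_series (- int n)) k
      = 1 / 2 * ((- 1) ^ n * (if k < 0 then 0 else (-1) ^ nat k * (wfps ^ n) $ nat k) - (- 1) ^ n * cw k (int n))"
    unfolding b_round_series_def gam_def[symmetric] half by (simp add: cm)
  also have "(if k < 0 then 0 else (-1) ^ nat k * (wfps ^ n) $ nat k) = - cw k (int n)"
    using assms by (simp add: cw_nat even_nat_iff)
  finally show ?thesis by (simp add: algebra_simps)
qed

lemma b_bracket_apply:
  "b_bracket (int n) w = (case w of [p, q] \<Rightarrow> if odd (p + q) then
    mps_const ((-1) ^ Suc n * cw (- (p + q)) (int n) * (1 / 4 * neg_one_pow q)) else 0 | _ \<Rightarrow> 0)"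
proof -
  have r: "b_round (- int n) w = (case w of [p, q] \<Rightarrow> if odd (p + q) then
      mps_const ((-1) ^ Suc n * cw (p + q) (int n) * (1 / 4 * neg_one_pow q)) else 0 | _ \<Rightarrow> 0)" for w
  proof (cases "\<exists>p q. w = [p, q]")
    case True
    then obtain p q where w: "w = [p, q]" by blast
    have J: "{k. odd k \<and> p + q = - k} = (if odd (p + q) then {- (p + q)} else {})"
    proof -
      have "(odd k \<and> p + q = - k) = (k = - (p + q) \<and> odd (p + q))" for k
        by (metis even_minus minus_minus)
      then show ?thesis by simp
    qed
    have "b_round (- int n) w = (\<Sum>k\<in>{k. odd k \<and> p + q = - k}.
        mps_const (fls_nth (b_round_series (- int n)) (- k)) * b_op k w)"
      unfolding b_round_def
    proof (rule fs_lincomb_superset)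
      show "finite {k. odd k \<and> p + q = - k}" unfolding J by simp
    qed (auto simp: b_op_apply w)
    also have "\<dots> = (if odd (p + q) then mps_const (fls_nth (b_round_series (- int n)) (p + q)) * b_op (- (p + q)) w else 0)"
      unfolding J by (simp add: add.commute[of q p])
    finally show ?thesis
      by (simp add: w b_op_apply b_round_series_nth del: power_Suc flip: mps_const_mult)
  next
    case False
    have "b_round (- int n) w = (\<Sum>k\<in>{}. mps_const (fls_nth (b_round_series (- int n)) (- k)) * b_op k w)"
      unfolding b_round_def by (rule fs_lincomb_superset) (use False in \<open>auto simp: b_op_apply split: list.splits\<close>)
    then show ?thesis using False by (auto split: list.splits)
  qed
  \<comment> \<open>The anti-involution takes the coefficient at [-q, -p] and multiplies it by
    (-1)^(p+q), which turns the sign (-1)^p into (-1)^q.\<close>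
  have s: "neg_one_pow (a + b) * mps_const ((-1) ^ Suc n * cw (- b - a) (int n) * neg_one_pow a / 4)
      = (mps_const ((-1) ^ Suc n * cw (- a - b) (int n) * neg_one_pow b / 4) :: scalars)" for a b
  proof -
    have ab: "- b - a = - a - b" by simp
    show ?thesis unfolding ab mps_const_neg_one_pow[symmetric] mps_const_mult[symmetric]
      by (simp add: neg_one_pow_def)
  qed
  show ?thesis
    unfolding b_bracket_def fs_star_def r by (auto simp: s simp del: power_Suc split: list.splits)
qed

lemma mps_coeff_var_power: "n > 0 \<Longrightarrow> j \<notin> Poly_Mapping.keys m \<Longrightarrow> mps_coeff (mps_var j ^ n :: scalars) m = 0"
proof -
  assume n: "n > 0" and j: "j \<notin> Poly_Mapping.keys m"
  have "mps_coeff (mps_var j ^ n :: scalars) m = mps_coeff (mps_res (Poly_Mapping.keys m) (mps_var j ^ n :: scalars)) m"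
    by (simp add: mps_coeff_res)
  then show ?thesis using n j by (simp add: mps_res_power mps_res_var mps_coeff_simps power_0_left)
qed

lemma power_sum_coeff:
  assumes n: "n > 0" and A: "finite A" "Poly_Mapping.keys m \<subseteq> A"
  shows "mps_coeff (power_sum n) m = mps_coeff (\<Sum>j\<in>A. mps_var j ^ n) m"
proof -
  define s where "s = (Abs_mps (\<lambda>m. mps_coeff (\<Sum>j\<in>Poly_Mapping.keys m. mps_var j ^ n) m) :: scalars)"
  have eq: "mps_coeff (\<Sum>j\<in>J. mps_var j ^ n :: scalars) m = mps_coeff s m"
    if "finite J" "Poly_Mapping.keys m \<subseteq> J" for J m
    unfolding s_def Abs_mps_inverse[OF UNIV_I] mps_coeff_sum
    by (rule sum.mono_neutral_right) (use that n in \<open>auto intro: mps_coeff_var_power\<close>)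
  have "mps_has_sum (\<lambda>i. mps_var i ^ n) UNIV s"
    unfolding mps_has_sum_def eventually_finite_subsets_at_top
    using eq by (auto intro!: exI[of _ "Poly_Mapping.keys m" for m])
  then have "power_sum n = s"
    unfolding power_sum_def mps_infsum_def by (intro the_equality) (auto intro: mps_has_sum_unique)
  then show ?thesis using eq[OF A] by simp
qed

lemma mps_res_power_sum:
  assumes "n > 0" "finite A"
  shows "mps_res A (power_sum n) = (\<Sum>j\<in>A. mps_var j ^ n)"
proof -
  have "mps_res A (\<Sum>j\<in>A. mps_var j ^ n) = (\<Sum>j\<in>A. mps_var j ^ n :: scalars)"
    by (simp add: mps_res_sum mps_res_power mps_res_var)
  moreover have "mps_res A (power_sum n) = mps_res A (\<Sum>j\<in>A. mps_var j ^ n)"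
    by (rule mps_eqI) (simp add: mps_coeff_res power_sum_coeff[OF assms])
  ultimately show ?thesis by simp
qed

text \<open>Entry k is the total coefficient of b_k in the Hamiltonian. The operator
  \<open>b_bracket n\<close> contains b_k only for k \<ge> n, so the sum is finite although all n
  contribute.\<close>

definition tH :: "scalars fps" where
  "tH = Abs_fps (\<lambda>k. if odd k then \<Sum>n=1..k. 2 * power_sum n * mps_const (1 / of_nat n)
    * mps_const ((-1) ^ Suc n * cw (int k) (int n)) else 0)"

lemma odd_tH: "odd_fps tH" by (simp add: odd_fps_def tH_def)

lemma H_bracket_eq_quad: "H_bracket = quad tH"
proof
  fix w
  show "H_bracket w = quad tH w"
  proof (cases "\<exists>p q. w = [p, q]")
    case True
    then obtain p q where w: "w = [p, q]" by blast
    define k where "k = nat (- (p + q))"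
    have z: "cw (- p - q) (int n) = 0" if "\<not> n \<le> k" for n using that by (intro cw_less) (simp add: k_def)
    have "H_bracket w = (\<Sum>n=1..k. 2 * power_sum n * mps_const (1 / of_nat n) * b_bracket (int n) w)"
      unfolding H_bracket_def by (rule fs_lincomb_superset) (auto simp: w b_bracket_apply z)
    also have "\<dots> = quad tH w"
    proof (cases "p + q < 0")
      case True
      then have k: "- (p + q) = int k" by (simp add: k_def)
      have o: "odd (p + q) \<longleftrightarrow> odd k" by (metis k even_minus even_of_nat)
      show ?thesis
      proof (cases "odd k")
        case ok: True
        then have opq: "odd (p + q)" using o by simp
        have b: "b_bracket (int n) [p, q] = mps_const ((-1) ^ Suc n * cw (int k) (int n)) * mps_const (1 / 4 * neg_one_pow q)" for n
          unfolding b_bracket_apply list.case if_P[OF opq] k mps_const_mult ..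
        show ?thesis
          unfolding w quad_simp k_def[symmetric] if_P[OF True] tH_def fps_nth_Abs_fps if_P[OF ok] b sum_distrib_right
          by (simp only: mult.assoc)
      next
        case ek: False
        then have epq: "\<not> odd (p + q)" using o by simp
        have b: "b_bracket (int n) [p, q] = 0" for n
          unfolding b_bracket_apply list.case if_not_P[OF epq] ..
        show ?thesis unfolding w b quad_simp k_def[symmetric] using ek by (simp add: tH_def)
      qed
    next
      case False
      then have "k = 0" by (simp add: k_def)
      then show ?thesis using False by (simp add: w quad_simp)
    qed
    finally show ?thesis .
  next
    case False
    have "H_bracket w = (\<Sum>n\<in>{}. 2 * power_sum n * mps_const (1 / of_nat n) * b_bracket (int n) w)"
      unfolding H_bracket_def by (rule fs_lincomb_superset) (use False in \<open>auto simp: b_bracket_apply split: list.splits\<close>)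
    then show ?thesis using False quad_nonzeroD[of tH w] by auto
  qed
qed

text \<open>The absorption identity (1/n) C(k-1, n-1) = (1/k) C(k, n). For odd k all signs cancel,
  for even n as well as for odd n.\<close>

lemma binomial_term:
  assumes "1 \<le> n" "n \<le> k" "odd k"
  shows "1 / of_nat n * ((-1) ^ Suc n * cw (int k) (int n)) = 1 / of_nat k * (of_nat (k choose n) * gam ^ (k - n))"
proof -
  obtain k' n' where kn: "k = Suc k'" "n = Suc n'" using assms by (metis Suc_le_D One_nat_def le_trans)
  have e: "even (k' - n') \<longleftrightarrow> even n'" using assms kn by (simp add: even_diff_nat)
  have "(- 1) ^ n' * (- gam) ^ (k' - n') = (gam ^ (k' - n') :: qbeta)"
    using e by (cases "even n'") (simp_all add: power_minus_odd)
  then have c: "(-1) ^ Suc n * cw (int k) (int n) = of_nat (k' choose n') * gam ^ (k - n)"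
    unfolding kn cw_binomial by (simp add: mult_ac)
  have "of_nat (Suc k') * of_nat (k' choose n') = (of_nat (Suc n') * of_nat (Suc k' choose Suc n') :: qbeta)"
    by (metis Suc_times_binomial_eq of_nat_mult mult.commute)
  then have "1 / of_nat n * of_nat (k' choose n') = (1 / of_nat k * of_nat (k choose n) :: qbeta)"
    unfolding kn by (simp add: field_simps del: of_nat_Suc binomial_Suc_Suc)
  then show ?thesis unfolding c mult.assoc[symmetric] by (rule arg_cong)
qed

text \<open>The terms with n \<ge> 1 of the binomial theorem add up to (2/k) ((gam + y_j)^k -
  gam^k). The absent term n = 0 is what the summand with argument -gam accounts for.\<close>

lemma fps_res_tH:
  assumes A: "finite A"
  shows "fps_res A tH = (\<Sum>j\<in>A. tser (mps_const gam + mps_var j) + tser (- mps_const gam))"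
proof (rule fps_ext)
  fix k
  let ?g = "mps_const gam :: scalars"
  show "fps_res A tH $ k = (\<Sum>j\<in>A. tser (?g + mps_var j) + tser (- ?g)) $ k"
  proof (cases "odd k")
    case True
    have "fps_res A tH $ k = (\<Sum>n=1..k. 2 * (\<Sum>j\<in>A. mps_var j ^ n) * mps_const (1 / of_nat n * ((-1) ^ Suc n * cw (int k) (int n))))"
    proof -
      have t: "mps_res A (2 * power_sum n * mps_const a * mps_const b) = 2 * (\<Sum>j\<in>A. mps_var j ^ n) * mps_const (a * b)"
        if "1 \<le> n" for n a b
        using that mps_res_simps(4)[of A "2 :: qbeta"]
        by (simp add: mps_res_mult mps_res_simps(4) mps_res_power_sum[OF _ A] mps_const_mult mult.assoc)
      show ?thesis
        unfolding fps_res_nth tH_def fps_nth_Abs_fps if_P[OF True] mps_res_sum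
        by (rule sum.cong) (simp_all only: t atLeastAtMost_iff)
    qed
    also have "\<dots> = (\<Sum>n=1..k. 2 * (\<Sum>j\<in>A. mps_var j ^ n) * mps_const (1 / of_nat k * (of_nat (k choose n) * gam ^ (k - n))))"
      by (rule sum.cong) (use True binomial_term in \<open>auto simp del: power_Suc\<close>)
    also have "\<dots> = (\<Sum>j\<in>A. \<Sum>n=1..k. 2 * mps_const (1 / of_nat k) * (of_nat (k choose n) * mps_var j ^ n * ?g ^ (k - n)))"
    proof -
      have c: "mps_const (1 / of_nat k * (of_nat i * gam ^ l)) = (mps_const (1 / of_nat k) * (of_nat i * ?g ^ l))" for i l
        by (simp only: mps_const_mult mps_const_of_nat mps_const_power)
      show ?thesis unfolding c sum_distrib_left sum_distrib_right
        by (rule trans[OF sum.swap]) (simp only: mult_ac)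
    qed
    also have "\<dots> = (\<Sum>j\<in>A. 2 * mps_const (1 / of_nat k) * ((?g + mps_var j) ^ k - ?g ^ k))"
    proof (rule sum.cong[OF refl])
      fix j
      have "(mps_var j + ?g) ^ k = (\<Sum>n\<le>k. of_nat (k choose n) * mps_var j ^ n * ?g ^ (k - n))" by (rule binomial_ring)
      also have "\<dots> = ?g ^ k + (\<Sum>n=1..k. of_nat (k choose n) * mps_var j ^ n * ?g ^ (k - n))"
        by (simp add: atMost_atLeast0 sum.atLeast_Suc_atMost)
      finally show "(\<Sum>n=1..k. 2 * mps_const (1 / of_nat k) * (of_nat (k choose n) * mps_var j ^ n * ?g ^ (k - n)))
          = 2 * mps_const (1 / of_nat k) * ((?g + mps_var j) ^ k - ?g ^ k)"
        by (simp add: add.commute sum_distrib_left)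
    qed
    also have "\<dots> = (\<Sum>j\<in>A. tser (?g + mps_var j) + tser (- ?g)) $ k"
      unfolding tser_minus using True by (simp add: tser_def fps_sum_nth right_diff_distrib)
    finally show ?thesis .
  next
    case False
    then show ?thesis by (simp add: tH_def tser_def fps_sum_nth mps_res_simps)
  qed
qed

definition fH :: "scalars fps" where "fH = efps tH"

lemma is_exp_fH: "is_exp tH fH"
  unfolding fH_def by (rule is_exp_efps) (simp add: tH_def)

text \<open>Restriction commutes with the derivative and with products, so it preserves the
  differential equation of the exponential, and uniqueness applies.\<close>

lemma fps_res_fH:
  assumes A: "finite A"
  shows "fps_res A fH = (\<Prod>j\<in>A. gser (mps_const gam + mps_var j) * gser (- mps_const gam))"
proof -
  have d: "fps_deriv (fps_res A f) = fps_res A (fps_deriv f)" for f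
    by (rule fps_ext) (simp add: mps_res_mult mps_res_simps mps_res_of_nat del: of_nat_Suc)
  have "is_exp (fps_res A tH) (fps_res A fH)"
    using is_exp_fH unfolding is_exp_def d by (simp add: fps_res_mult mps_res_simps)
  moreover have "is_exp (fps_res A tH) (\<Prod>j\<in>A. gser (mps_const gam + mps_var j) * gser (- mps_const gam))"
    unfolding fps_res_tH[OF A] by (intro is_exp_sum[OF A] is_exp_add is_exp_tser)
  ultimately show ?thesis by (rule is_exp_unique)
qed

definition fhat :: "scalars fps" where "fhat = wsubst mps_const fH"

lemma fps_res_wsubst: "fps_res A (wsubst mps_const f) = wsubst mps_const (fps_res A f)"
  by (rule fps_ext) (simp add: wsubst_def mps_res_sum mps_res_mult mps_res_simps)

lemma fps_res_fhat: "finite A \<Longrightarrow> fps_res A fhat = (\<Prod>j\<in>A. kser j)"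
  unfolding fhat_def fps_res_wsubst fps_res_fH wsubst_prod[OF ring_emb_const(2)] kser_wsubst ..

lemma cauchy_kernel_coeff:
  "mps_coeff cauchy_kernel M
    = mps_coeff (\<Prod>i\<in>Poly_Mapping.keys (xpart M). fhat $ Poly_Mapping.lookup (xpart M) i) (ypart M)"
proof (rule kernel_has_prod)
  fix A :: "nat set" assume A: "finite A"
  have "fps_res A fhat = fps_res A (fps_res A fhat)" by (rule fps_ext) (auto intro!: mps_eqI simp: mps_coeff_res)
  then show "fps_res A fhat = fps_res A (\<Prod>j\<in>A. kser j)" unfolding fps_res_fhat[OF A] .
qed

context scalar_fermions begin

subsection \<open>Vectors with coefficients in $\mathbb{Q}(\beta)$\<close>

text \<open>The $\mathbb{Q}(\beta)$-form of the Fock space: \<open>X n\<close> vanishes on it for negative \<open>n\<close>, because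
  this can be tested on the constant coefficients of the functionals \<open>Df\<close>.\<close>

inductive_set KX :: "'f set" where
  plus: "plus \<in> KX"
| X: "v \<in> KX \<Longrightarrow> X n v \<in> KX"
| add: "u \<in> KX \<Longrightarrow> v \<in> KX \<Longrightarrow> u + v \<in> KX"
| csc: "v \<in> KX \<Longrightarrow> csc c v \<in> KX"

lemma KX_Fplus: "v \<in> KX \<Longrightarrow> v \<in> Fplus"
  by (induction rule: KX.induct) (auto intro: Fplus_plus X_Fplus Fplus_add Fplus_scale)

lemma KX_0: "0 \<in> KX" using KX.csc[OF KX.plus, of 0] by simp

lemma KX_sum: "(\<And>a. a \<in> A \<Longrightarrow> f a \<in> KX) \<Longrightarrow> sum f A \<in> KX"
  by (induction A rule: infinite_finite_induct) (auto intro: KX_0 KX.add)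

lemma KX_scale: "v \<in> KX \<Longrightarrow> s \<in> range mps_const \<Longrightarrow> scale s v \<in> KX"
  by (auto intro: KX.csc)

lemma KX_diff: "u \<in> KX \<Longrightarrow> v \<in> KX \<Longrightarrow> u - v \<in> KX"
  using KX.add[of u "csc (- 1) v"] KX.csc[of v "- 1"] by (simp add: mps_const_minus)

lemma KX_bos:
  assumes t: "odd_fps t" "\<And>k. t $ k \<in> range mps_const" and v: "v \<in> KX"
  shows "bos t v \<in> KX"
  using v
proof induction
  case plus
  show ?case by (simp add: bos_vac[OF vac_plus] KX_0)
next
  case (X v n)
  obtain d where d: "d \<ge> 0" "v \<in> filt plus d" using FplusE[OF KX_Fplus[OF X.hyps]] by metis
  have "n + d \<le> int (nat (n + d))" by simp
  then show ?case
    by (subst bos_X[OF t(1) vac_plus d(2)], assumption) (intro KX.add KX.X X.IH KX_sum KX_scale X.hyps t(2))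
qed (auto simp: linop_add[OF bos_linop] linop_scale[OF bos_linop] intro: KX.add KX.csc)

lemma const_range: "0 \<in> range (mps_const :: qbeta \<Rightarrow> scalars)" "1 \<in> range (mps_const :: qbeta \<Rightarrow> scalars)"
  "2 \<in> range (mps_const :: qbeta \<Rightarrow> scalars)" "(- 1) ^ k \<in> range (mps_const :: qbeta \<Rightarrow> scalars)"
  by (auto intro: range_eqI[of _ _ 0] range_eqI[of _ _ 1] range_eqI[of _ _ 2] range_eqI[of _ _ "(- 1) ^ k"]
      simp: mps_const_power mps_const_minus)

lemma KX_bj: "v \<in> KX \<Longrightarrow> bj j v \<in> KX"
  unfolding bj_def by (rule KX_bos[OF odd_bj]) (auto simp: fps_X_power_nth const_range)

lemma KX_Mop: "v \<in> KX \<Longrightarrow> Mop k v \<in> KX"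
proof (induction k rule: less_induct)
  case (less k)
  then show ?case
    by (cases k) (auto simp: ocoeff_def const_range intro!: KX.csc KX_sum KX_scale KX_bj)
qed

lemma KX_phi: assumes "v \<in> KX" shows "phi n v \<in> KX"
proof -
  obtain d where d: "d \<ge> 0" "v \<in> filt plus d" using FplusE[OF KX_Fplus[OF assms]] by metis
  then have "d \<le> int (nat d)" by simp
  then show ?thesis
    by (subst phi_eq_X[OF vac_plus d(2)], assumption) (intro KX_sum KX_scale KX.X KX_Mop assms const_range)
qed

lemma KX_bexp:
  assumes t: "odd_fps t" "\<And>k. t $ k \<in> range mps_const" and v: "v \<in> KX"
  shows "bexp t v \<in> KX"
proof -
  obtain d where d: "d \<ge> 0" "v \<in> filt plus d" using FplusE[OF KX_Fplus[OF v]] by metis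
  then have e: "bexp t v = (\<Sum>k\<le>nat d. dbos t k v)" by (intro bexp_eq[OF vac_plus d(2)]) simp
  have "(bos t ^^ k) v \<in> KX" for k by (induction k) (auto simp: v intro: KX_bos[OF t])
  then show ?thesis unfolding e dbos_def by (intro KX_sum KX.csc)
qed

lemma tgam_const: "tgam $ k \<in> range mps_const" "(- tgam) $ k \<in> range mps_const"
proof -
  have "tgam $ k = mps_const (if odd k then 2 * (1 / of_nat k) * gam ^ k else 0)"
    by (simp add: tgam_def tser_def mps_const_mult mps_const_power del: times_divide_eq_right)
  then show "tgam $ k \<in> range mps_const" "(- tgam) $ k \<in> range mps_const"
    by (auto simp flip: mps_const_minus)
qed

lemma KX_E: "v \<in> KX \<Longrightarrow> E v \<in> KX" and KX_Ei: "v \<in> KX \<Longrightarrow> Ei v \<in> KX"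
  unfolding E_def Ei_def by (auto intro: KX_bexp odd_tgam tgam_const)

lemma KX_clin:
  assumes "v \<in> KX" "\<And>j. j > n \<Longrightarrow> c j = 0" shows "clin c v \<in> KX"
proof -
  obtain d where d: "d \<ge> 0" "v \<in> filt plus d" using FplusE[OF KX_Fplus[OF assms(1)]] by metis
  show ?thesis
    by (subst clin_eq[OF vac_plus d(2) assms(2) order_refl order_refl], assumption)
      (intro KX_sum KX.csc KX_phi assms(1))
qed

lemma KX_ast: "v \<in> KX \<Longrightarrow> ast n v \<in> KX"
  unfolding ast_def pc_def by (intro KX_E KX_clin[where n = "- n"]) (auto simp: cw_less)

lemma KX_kp: "kp ls \<in> KX"
proof (induction ls)
  case (Cons l ls)
  then show ?case
    by (auto simp: am_def Ph_def cPhi_less intro!: KX_diff KX.csc KX_Ei KX_clin[where n = "int l"])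
qed (simp add: KX.plus)

lemma bra_KX: "v \<in> KX \<Longrightarrow> bra v \<in> range mps_const"
proof (induction rule: KX.induct)
  case plus
  show ?case by (simp add: bra_plus const_range)
next
  case (X v n)
  then show ?case by (simp add: bra_X KX_Fplus const_range)
next
  case (add u v)
  then show ?case by (auto simp: bra_add simp flip: mps_const_add)
next
  case (csc v c)
  then show ?case by (auto simp: bra_scale simp flip: mps_const_mult)
qed

text \<open>On the Q(beta)-form all values of the dual functionals are constants. The constant
  coefficient computed by \<open>Df_eq_il_coeff\<close> therefore gives the full value.\<close>

lemma Df_KX: assumes "v \<in> KX" shows "Df ls v = mps_const (mps_coeff (Df ls v) 0)"
proof -
  have "Df ls v \<in> range mps_const" if "v \<in> KX" for v
    using that by (induction ls arbitrary: v) (auto intro: bra_KX KX_ast)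
  from this[OF assms] show ?thesis by (auto simp: mps_coeff_const)
qed

lemma KX_eqI:
  assumes "u \<in> KX" "v \<in> KX" "\<And>ls. ls \<in> strict_partitions \<Longrightarrow> mps_coeff (Df ls u) 0 = mps_coeff (Df ls v) 0"
  shows "u = v"
proof -
  have "u - v = 0"
  proof (rule Fplus_Df_eq_0)
    show "u - v \<in> Fplus" by (intro Fplus_diff KX_Fplus assms)
    fix ls assume "ls \<in> strict_partitions"
    then show "Df ls (u - v) = 0"
      unfolding Df_diff by (subst Df_KX[OF assms(1)], subst Df_KX[OF assms(2)]) (simp add: assms(3))
  qed
  then show ?thesis by simp
qed

lemma X_neg: assumes "v \<in> KX" "n < 0" shows "X n v = 0"
proof (rule KX_eqI)
  fix ls
  show "mps_coeff (Df ls (X n v)) 0 = mps_coeff (Df ls 0) 0"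
    using Df_eq_il_coeff[OF X_Fplus[OF KX_Fplus[OF assms(1)]], of ls n] assms
    by (simp add: Zf_X KX_Fplus Df_0 mps_coeff_simps zero_ilaurent.rep_eq)
qed (intro KX.X KX_0 assms)+

section \<open>Modes in the variable x and the words they generate\<close>

definition Xh :: "nat \<Rightarrow> 'f \<Rightarrow> 'f" where
  "Xh q v = (\<Sum>n\<le>q. csc ((wfps ^ n) $ q) (X (int n) v))"

lemma Xh_linop: "linop (Xh q)"
  unfolding Xh_def[abs_def] by (intro linop_sums linop_scl X_linop)

lemma Xh_KX: "v \<in> KX \<Longrightarrow> Xh q v \<in> KX"
  unfolding Xh_def by (intro KX_sum KX.csc KX.X)

definition xh :: "nat list \<Rightarrow> 'f" where "xh qs = foldr Xh qs plus"

lemma xh_simps: "xh [] = plus" "xh (q # qs) = Xh q (xh qs)"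
  by (simp_all add: xh_def)

lemma xh_KX: "xh qs \<in> KX"
  by (induction qs) (simp_all add: xh_simps KX.plus Xh_KX)

inductive_set KW :: "'f set" where
  xh: "xh qs \<in> KW"
| add: "u \<in> KW \<Longrightarrow> v \<in> KW \<Longrightarrow> u + v \<in> KW"
| csc: "v \<in> KW \<Longrightarrow> csc c v \<in> KW"

lemma KW_KX: "v \<in> KW \<Longrightarrow> v \<in> KX"
  by (induction rule: KW.induct) (auto intro: xh_KX KX.add KX.csc)

lemma KW_0: "0 \<in> KW" using KW.csc[OF KW.xh, of 0] by simp

lemma KW_sum: "(\<And>a. a \<in> A \<Longrightarrow> f a \<in> KW) \<Longrightarrow> sum f A \<in> KW"
  by (induction A rule: infinite_finite_induct) (auto intro: KW_0 KW.add)

lemma KW_diff: "u \<in> KW \<Longrightarrow> v \<in> KW \<Longrightarrow> u - v \<in> KW"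
  using KW.add[of u "csc (- 1) v"] KW.csc[of v "- 1"] by (simp add: mps_const_minus)

lemma KW_Xh: "v \<in> KW \<Longrightarrow> Xh q v \<in> KW"
proof (induction rule: KW.induct)
  case (xh qs)
  show ?case using KW.xh[of "q # qs"] by (simp add: xh_simps)
qed (auto simp: linop_add[OF Xh_linop] linop_scale[OF Xh_linop] intro: KW.add KW.csc)

text \<open>The series w^q begins with x^q with coefficient 1, so the change from \<open>X\<close>
  to \<open>Xh\<close> is unitriangular and can be solved recursively for \<open>X\<close>.\<close>

lemma KW_X: assumes v: "v \<in> KW" shows "X (int q) v \<in> KW"
proof (induction q rule: less_induct)
  case (less q)
  have "(wfps ^ q) $ q = 1" using cw_self[of "int q"] by (simp add: cw_nat)
  then have "X (int q) v = Xh q v - (\<Sum>n<q. csc ((wfps ^ n) $ q) (X (int n) v))"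
    by (simp add: Xh_def lessThan_Suc_atMost[symmetric])
  then show ?case using less by (auto intro: KW_diff KW_Xh v KW_sum KW.csc)
qed

lemma KX_KW: "v \<in> KX \<Longrightarrow> v \<in> KW"
proof (induction rule: KX.induct)
  case plus
  show ?case using KW.xh[of "[]"] by (simp add: xh_simps)
next
  case (X v n)
  then show ?case using KW_X[of v "nat n"] by (cases "n \<ge> 0") (auto simp: X_neg KW_0)
qed (auto intro: KW.add KW.csc)

lemma Zf_plus: "Zf Ws plus = 1"
proof (induction Ws)
  case Nil
  show ?case by (simp add: bra_plus mps_coeff_simps)
next
  case (Cons W Ws)
  then show ?case
    by (simp add: E_vac[OF vac_plus] MZ_eq[OF fnl_Zf vac_plus filt_vac, of 0 0])
qed

lemma Zf_Xh:
  assumes "v \<in> Fplus"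
  shows "Zf Ws (Xh q v) = wsubst il_const (\<Prod>W\<leftarrow>Ws. gser W * gser (il_const gam)) $ q * Zf Ws v"
  unfolding Xh_def wsubst_def fnl_sum[OF fnl_Zf] fnl_csc[OF fnl_Zf] Zf_X[OF assms]
  by (simp add: sum_distrib_right mult.assoc)

lemma Zf_xh: "Zf (Wl r) (xh qs) = (\<Prod>q\<leftarrow>qs. (\<Prod>i<r. Tser i) $ q)"
proof -
  have "wsubst il_const (\<Prod>W\<leftarrow>Wl r. gser W * gser (il_const gam)) = (\<Prod>i<r. Tser i)"
    unfolding Wl_def by (simp add: prod_list_upt wsubst_prod ring_emb_const Tser_wsubst comp_def)
  then show ?thesis
    by (induction qs) (simp_all add: xh_simps Zf_plus Zf_Xh KX_Fplus[OF xh_KX])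
qed

end

text \<open>A list of exponents stands for a monomial in x. Entries 0, trailing ones included,
  contribute the factor f(0) = 1.\<close>

lemma prod_list_nth_keys:
  fixes f :: "'a::comm_ring_1 fps"
  assumes "f $ 0 = 1"
  shows "(\<Prod>q\<leftarrow>qs. f $ q) = (\<Prod>i\<in>Poly_Mapping.keys (Poly_Mapping.nth qs). f $ Poly_Mapping.lookup (Poly_Mapping.nth qs) i)"
proof -
  have "(\<Prod>q\<leftarrow>qs. f $ q) = (\<Prod>i<length qs. f $ Poly_Mapping.lookup (Poly_Mapping.nth qs) i)"
    unfolding prod_list_upt[symmetric] by (rule arg_cong[of _ _ prod_list], rule nth_equalityI) (simp_all add: nth_default_nth)
  also have "\<dots> = (\<Prod>i\<in>Poly_Mapping.keys (Poly_Mapping.nth qs). f $ Poly_Mapping.lookup (Poly_Mapping.nth qs) i)"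
    by (rule prod.mono_neutral_right) (auto simp: in_keys_iff assms nth_default_def simp del: keys_nth split: if_splits)
  finally show ?thesis .
qed

lemma ex_nth: "\<exists>qs. m = Poly_Mapping.nth qs" for m :: "nat \<Rightarrow>\<^sub>0 nat"
proof -
  obtain N where N: "\<And>i. i \<in> Poly_Mapping.keys m \<Longrightarrow> i < N"
    using finite_nat_set_iff_bounded[of "Poly_Mapping.keys m"] by auto
  have "m = Poly_Mapping.nth (map (Poly_Mapping.lookup m) [0..<N])"
    by (rule poly_mapping_eqI) (use N in \<open>auto simp: nth_default_def in_keys_iff\<close>)
  then show ?thesis ..
qed

context scalar_fermions begin

lemma Df_xh: "Df ls (xh qs) = mps_const (mps_coeff (GQ ls) (Poly_Mapping.nth qs))"
proof -
  have "(\<Prod>i<length ls. Tser i) $ 0 = 1" by (induction ls rule: rev_induct) (simp_all add: Tser_0)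
  then have "mps_coeff (Df ls (xh qs)) 0 = mps_coeff (GQ ls) (Poly_Mapping.nth qs)"
    unfolding mps_coeff_GQ Df_eq_il_coeff[OF KX_Fplus[OF xh_KX], symmetric] Zf_xh by (simp only: prod_list_nth_keys)
  then show ?thesis by (subst Df_KX[OF xh_KX]) (rule arg_cong)
qed

section \<open>The functional on the side of the Hamiltonian\<close>

definition ell :: "'f \<Rightarrow> scalars" where "ell v = bra (bexp tH v)"

lemma ell_add: "ell (u + v) = ell u + ell v"
  and ell_scale: "ell (scale c v) = c * ell v"
  by (simp_all add: ell_def linop_add[OF bexp_linop] linop_scale[OF bexp_linop] bra_add bra_scale)

lemma ell_0: "ell 0 = 0" using ell_scale[of 0 0] by simp

lemma ell_sum: "ell (sum f A) = (\<Sum>a\<in>A. ell (f a))"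
  by (induction A rule: infinite_finite_induct) (simp_all add: ell_0 ell_add)

lemma ell_plus: "ell plus = 1"
  by (simp add: ell_def bexp_vac[OF vac_plus] bra_plus)

text \<open>Conjugation by the exponential multiplies X(w) by \<open>fH\<close>, and
  \<open>bra\<close> absorbs the X(w) that remains.\<close>

lemma ell_X: assumes "v \<in> Fplus" shows "ell (X (int n) v) = fH $ n * ell v"
proof -
  obtain d where d: "d \<ge> 0" "v \<in> filt plus d" using FplusE[OF assms] by metis
  define N where "N = nat (int n + d)"
  have "ell (X (int n) v) = (\<Sum>k\<le>N. fH $ k * (if k = n then ell v else 0))"
    unfolding ell_def
    by (subst bexp_X[OF odd_tH is_exp_fH vac_plus d(2), of _ N])
      (auto simp: N_def bra_sum bra_scale bra_X bexp_Fplus assms intro!: sum.cong)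
  also have "\<dots> = fH $ n * ell v" using d(1) by (simp add: N_def if_distrib[of "(*) _"] sum.delta' cong: if_cong)
  finally show ?thesis .
qed

lemma ell_Xh: "v \<in> Fplus \<Longrightarrow> ell (Xh q v) = fhat $ q * ell v"
  by (simp add: Xh_def fhat_def wsubst_def ell_sum ell_scale ell_X sum_distrib_right mult.assoc)

lemma ell_xh: "ell (xh qs) = (\<Prod>q\<leftarrow>qs. fhat $ q)"
  by (induction qs) (simp_all add: xh_simps ell_plus ell_Xh KX_Fplus[OF xh_KX])

end

subsection \<open>Symmetric functions\<close>

definition tdeg :: "('v \<Rightarrow>\<^sub>0 nat) \<Rightarrow> nat" where
  "tdeg m = (\<Sum>i\<in>Poly_Mapping.keys m. Poly_Mapping.lookup m i)"

lemma tdeg_superset: "finite A \<Longrightarrow> Poly_Mapping.keys m \<subseteq> A \<Longrightarrow> tdeg m = (\<Sum>i\<in>A. Poly_Mapping.lookup m i)"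
  unfolding tdeg_def by (rule sum.mono_neutral_left) (auto simp: in_keys_iff)

lemma tdeg_add: "tdeg (a + b) = tdeg a + tdeg b"
  using tdeg_superset[of "Poly_Mapping.keys a \<union> Poly_Mapping.keys b" a]
    tdeg_superset[of "Poly_Mapping.keys a \<union> Poly_Mapping.keys b" b]
    tdeg_superset[of "Poly_Mapping.keys a \<union> Poly_Mapping.keys b" "a + b"]
  by (simp add: keys_add_nat lookup_add sum.distrib)

lemma tdeg_0: "tdeg 0 = 0" by (simp add: tdeg_def)

lemma mps_coeff_rename_bij:
  "bij \<pi> \<Longrightarrow> mps_coeff (mps_rename \<pi> f) m = mps_coeff f (Poly_Mapping.map_key \<pi> m)"
  by (simp add: mps_rename.rep_eq bij_is_surj)

lemma mps_rename_mult:
  fixes f g :: "('v, 'a::comm_ring_1) mps"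
  assumes \<pi>: "bij (\<pi> :: 'v \<Rightarrow> 'v)"
  shows "mps_rename \<pi> (f * g) = mps_rename \<pi> f * mps_rename \<pi> g"
proof (rule mps_eqI)
  fix m
  have inj: "inj \<pi>" "inj (inv \<pi>)" using \<pi> by (simp_all add: bij_is_inj bij_imp_bij_inv)
  have k: "Poly_Mapping.map_key \<pi> (Poly_Mapping.map_key (inv \<pi>) x) = x"
    "Poly_Mapping.map_key (inv \<pi>) (Poly_Mapping.map_key \<pi> x) = x" for x :: "'v \<Rightarrow>\<^sub>0 nat"
    using \<pi> inj by (simp_all add: poly_mapping_eq_iff map_key.rep_eq fun_eq_iff bij_is_surj surj_f_inv_f)
  have "(\<Sum>(a, b) | a + b = Poly_Mapping.map_key \<pi> m. mps_coeff f a * mps_coeff g b)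
      = (\<Sum>(a, b) | a + b = m. mps_coeff f (Poly_Mapping.map_key \<pi> a) * mps_coeff g (Poly_Mapping.map_key \<pi> b))"
    by (rule sum.reindex_bij_witness[of _ "\<lambda>(a, b). (Poly_Mapping.map_key \<pi> a, Poly_Mapping.map_key \<pi> b)"
          "\<lambda>(a, b). (Poly_Mapping.map_key (inv \<pi>) a, Poly_Mapping.map_key (inv \<pi>) b)"])
      (auto simp: k map_key_plus[OF inj(1), symmetric] map_key_plus[OF inj(2), symmetric])
  then show "mps_coeff (mps_rename \<pi> (f * g)) m = mps_coeff (mps_rename \<pi> f * mps_rename \<pi> g) m"
    by (simp add: mps_coeff_rename_bij[OF \<pi>] mps_coeff_simps conv_monomial)
qed

lemma mps_rename_simps:
  fixes f g :: "('v, 'a::comm_ring_1) mps"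
  assumes \<pi>: "bij (\<pi> :: 'v \<Rightarrow> 'v)"
  shows "mps_rename \<pi> (f + g) = mps_rename \<pi> f + mps_rename \<pi> g"
    "mps_rename \<pi> (mps_const c) = (mps_const c :: ('v, 'a) mps)"
    "mps_rename \<pi> (mps_var v) = (mps_var (\<pi> v) :: ('v, 'a) mps)"
proof -
  have inj: "inj \<pi>" using \<pi> by (rule bij_is_inj)
  have z: "Poly_Mapping.map_key \<pi> m = 0 \<longleftrightarrow> m = 0" for m :: "'v \<Rightarrow>\<^sub>0 nat"
    using inj \<pi> by (auto simp: poly_mapping_eq_iff map_key.rep_eq fun_eq_iff bij_iff; metis)
  have s: "Poly_Mapping.map_key \<pi> m = Poly_Mapping.single v 1 \<longleftrightarrow> m = Poly_Mapping.single (\<pi> v) 1" for m :: "'v \<Rightarrow>\<^sub>0 nat"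
  proof
    assume "Poly_Mapping.map_key \<pi> m = Poly_Mapping.single v 1"
    then have "Poly_Mapping.lookup m (\<pi> x) = Poly_Mapping.lookup (Poly_Mapping.single v 1) x" for x
      by (metis inj map_key.rep_eq comp_apply)
    then have "Poly_Mapping.lookup m (\<pi> x) = Poly_Mapping.lookup (Poly_Mapping.single (\<pi> v) 1) (\<pi> x)" for x
      using inj by (simp add: lookup_single when_def inj_eq)
    then have "Poly_Mapping.lookup m y = Poly_Mapping.lookup (Poly_Mapping.single (\<pi> v) 1) y" for y
      by (metis surjD[OF bij_is_surj[OF \<pi>], of y])
    then show "m = Poly_Mapping.single (\<pi> v) 1" by (rule poly_mapping_eqI)
  qed (simp add: inj)
  show "mps_rename \<pi> (f + g) = mps_rename \<pi> f + mps_rename \<pi> g"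
    "mps_rename \<pi> (mps_const c) = (mps_const c :: ('v, 'a) mps)"
    "mps_rename \<pi> (mps_var v) = (mps_var (\<pi> v) :: ('v, 'a) mps)"
    by (rule mps_eqI; simp only: mps_coeff_rename_bij[OF \<pi>] mps_coeff_simps mps_coeff_const mps_var.rep_eq z s)+
qed

lemma symmetric_functionsD:
  assumes "f \<in> symmetric_functions"
  shows "bij \<pi> \<Longrightarrow> mps_rename \<pi> f = f" and "\<exists>d. \<forall>m. mps_coeff f m \<noteq> 0 \<longrightarrow> tdeg m \<le> d"
  using assms unfolding symmetric_functions_def tdeg_def by blast+

lemma symmetric_functionsI:
  "(\<And>\<pi>. bij \<pi> \<Longrightarrow> mps_rename \<pi> f = f) \<Longrightarrow> (\<And>m. mps_coeff f m \<noteq> 0 \<Longrightarrow> tdeg m \<le> d) \<Longrightarrow> f \<in> symmetric_functions"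
  unfolding symmetric_functions_def tdeg_def by blast

lemma symmetric_functions_const: "mps_const c \<in> symmetric_functions" for c :: "'a::comm_ring_1"
  by (rule symmetric_functionsI[where d = 0]) (auto simp: mps_rename_simps mps_coeff_const tdeg_0 split: if_splits)

lemma symmetric_functions_add:
  fixes f g :: "(nat, 'a::comm_ring_1) mps"
  assumes "f \<in> symmetric_functions" "g \<in> symmetric_functions" shows "f + g \<in> symmetric_functions"
proof -
  obtain d e where "\<And>m. mps_coeff f m \<noteq> 0 \<Longrightarrow> tdeg m \<le> d" "\<And>m. mps_coeff g m \<noteq> 0 \<Longrightarrow> tdeg m \<le> e"
    using symmetric_functionsD(2)[OF assms(1)] symmetric_functionsD(2)[OF assms(2)] by blast
  then have "mps_coeff (f + g) m \<noteq> 0 \<Longrightarrow> tdeg m \<le> max d e" for m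
    by (metis add_0 le_max_iff_disj mps_coeff_simps(3))
  moreover have "mps_rename \<pi> (f + g) = f + g" if "bij \<pi>" for \<pi>
    by (simp only: mps_rename_simps(1)[OF that] symmetric_functionsD(1)[OF assms(1) that] symmetric_functionsD(1)[OF assms(2) that])
  ultimately show ?thesis by (intro symmetric_functionsI)
qed

lemma symmetric_functions_mult:
  fixes f g :: "(nat, 'a::comm_ring_1) mps"
  assumes "f \<in> symmetric_functions" "g \<in> symmetric_functions" shows "f * g \<in> symmetric_functions"
proof -
  obtain d e where de: "\<And>m. mps_coeff f m \<noteq> 0 \<Longrightarrow> tdeg m \<le> d" "\<And>m. mps_coeff g m \<noteq> 0 \<Longrightarrow> tdeg m \<le> e"
    using symmetric_functionsD(2)[OF assms(1)] symmetric_functionsD(2)[OF assms(2)] by blast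
  have "tdeg m \<le> d + e" if nz: "mps_coeff (f * g) m \<noteq> 0" for m
  proof -
    obtain a b where "a + b = m" "mps_coeff f a \<noteq> 0" "mps_coeff g b \<noteq> 0"
      using nz unfolding mps_coeff_simps by (rule conv_nonzeroD)
    then show ?thesis using de(1)[of a] de(2)[of b] tdeg_add[of a b] by simp
  qed
  moreover have "mps_rename \<pi> (f * g) = f * g" if "bij \<pi>" for \<pi>
    by (simp only: mps_rename_mult[OF that] symmetric_functionsD(1)[OF assms(1) that] symmetric_functionsD(1)[OF assms(2) that])
  ultimately show ?thesis by (intro symmetric_functionsI)
qed

text \<open>A bound instead of homogeneity, because beta carries no degree here. It supplies the
  bounded degree that membership in \<open>symmetric_functions\<close> demands.\<close>

definition homog_bound :: "scalars fps \<Rightarrow> bool" where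
  "homog_bound f \<longleftrightarrow> (\<forall>q m. mps_coeff (f $ q) m \<noteq> 0 \<longrightarrow> tdeg m \<le> q)"

lemma homog_boundD: "homog_bound f \<Longrightarrow> mps_coeff (f $ q) m \<noteq> 0 \<Longrightarrow> tdeg m \<le> q"
  by (simp add: homog_bound_def)

lemma homog_bound_mult:
  assumes "homog_bound f" "homog_bound g" shows "homog_bound (f * g)"
  unfolding homog_bound_def
proof (intro allI impI)
  fix q m assume "mps_coeff ((f * g) $ q) m \<noteq> 0"
  then have "(\<Sum>i=0..q. mps_coeff (f $ i * g $ (q - i)) m) \<noteq> 0" by (simp add: fps_mult_nth mps_coeff_sum)
  then obtain i where i: "i \<le> q" "mps_coeff (f $ i * g $ (q - i)) m \<noteq> 0"
    by (metis (mono_tags, lifting) atLeastAtMost_iff sum.not_neutral_contains_not_neutral)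
  then obtain a b where "a + b = m" "mps_coeff (f $ i) a \<noteq> 0" "mps_coeff (g $ (q - i)) b \<noteq> 0"
    unfolding mps_coeff_simps by (elim conv_nonzeroD)
  then show "tdeg m \<le> q"
    using homog_boundD[OF assms(1), of i a] homog_boundD[OF assms(2), of "q - i" b] tdeg_add[of a b] i(1) by simp
qed

lemma homog_bound_1: "homog_bound 1"
  by (auto simp: homog_bound_def mps_coeff_simps tdeg_0)

lemma homog_bound_prod: "(\<And>a. a \<in> A \<Longrightarrow> homog_bound (f a)) \<Longrightarrow> homog_bound (\<Prod>a\<in>A. f a)"
  by (induction A rule: infinite_finite_induct) (auto intro: homog_bound_1 homog_bound_mult)

lemma homog_bound_geo:
  assumes "\<And>m. mps_coeff s m \<noteq> 0 \<Longrightarrow> tdeg m \<le> 1" shows "homog_bound (geo s)"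
proof -
  have "mps_coeff (s ^ q) m \<noteq> 0 \<Longrightarrow> tdeg m \<le> q" for q m
  proof (induction q arbitrary: m)
    case 0
    then show ?case by (auto simp: mps_coeff_simps tdeg_0 split: if_splits)
  next
    case (Suc q)
    then have "mps_coeff (s * s ^ q) m \<noteq> 0" by simp
    then obtain a b where "a + b = m" "mps_coeff s a \<noteq> 0" "mps_coeff (s ^ q) b \<noteq> 0"
      unfolding mps_coeff_simps by (rule conv_nonzeroD)
    then show ?case using Suc.IH[of b] assms[of a] tdeg_add[of a b] by simp
  qed
  then show ?thesis by (simp add: homog_bound_def geo_def)
qed

lemma homog_bound_kser: "homog_bound (kser j)"
proof -
  have v: "mps_coeff (mps_const c + mps_var j :: scalars) m \<noteq> 0 \<Longrightarrow> tdeg m \<le> 1"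
    "mps_coeff (mps_const c :: scalars) m \<noteq> 0 \<Longrightarrow> tdeg m \<le> 1" for c m
    by (auto simp: mps_coeff_simps mps_coeff_const mps_var.rep_eq tdeg_0 tdeg_def split: if_splits)
  have "homog_bound (1 + fps_const (mps_const beta + mps_var j) * fps_X)"
    unfolding homog_bound_def
  proof (intro allI impI)
    fix q m
    assume a: "mps_coeff ((1 + fps_const (mps_const beta + mps_var j) * fps_X) $ q) m \<noteq> 0"
    show "tdeg m \<le> q"
    proof (cases q)
      case 0
      then show ?thesis using a by (auto simp: mps_coeff_simps tdeg_0 split: if_splits)
    next
      case (Suc p)
      then show ?thesis using a v(1)[of beta m] by (cases p) (auto simp: mps_coeff_simps fps_X_def)
    qed
  qed
  moreover have "homog_bound (geo (mps_var j))" by (rule homog_bound_geo) (use v(1)[of 0] in simp)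
  moreover have "homog_bound (geo (- mps_const beta))"
    by (rule homog_bound_geo) (use v(2)[of "- beta"] in \<open>simp add: mps_const_minus\<close>)
  ultimately show ?thesis unfolding kser_def by (intro homog_bound_mult)
qed

lemma fhat_coeff:
  assumes "finite A" "Poly_Mapping.keys m \<subseteq> A"
  shows "mps_coeff (fhat $ q) m = mps_coeff ((\<Prod>j\<in>A. kser j) $ q) m"
proof -
  have "mps_coeff (fhat $ q) m = mps_coeff (fps_res A fhat $ q) m" using assms(2) by (simp add: mps_coeff_res)
  then show ?thesis unfolding fps_res_fhat[OF assms(1)] .
qed

lemma fhat_0: "fhat $ 0 = 1"
proof (rule mps_eqI)
  fix m
  have "(\<Prod>j\<in>A. kser j) $ 0 = 1" if "finite A" for A
    using that by (induction A rule: finite_induct) (simp_all add: kser_0)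
  then show "mps_coeff (fhat $ 0) m = mps_coeff 1 m"
    by (simp add: fhat_coeff[OF finite_keys[of m] order_refl])
qed

text \<open>A coefficient is computed in the finite product of the \<open>kser j\<close> over the
  variables of its monomial, and a permutation of variables only relabels the factors.\<close>

lemma fhat_symmetric: "fhat $ q \<in> symmetric_functions"
proof (rule symmetric_functionsI)
  fix m assume "mps_coeff (fhat $ q) m \<noteq> 0"
  then show "tdeg m \<le> q"
    unfolding fhat_coeff[OF finite_keys order_refl] by (rule homog_boundD[OF homog_bound_prod[OF homog_bound_kser]])
next
  fix \<pi> :: "nat \<Rightarrow> nat" assume \<pi>: "bij \<pi>"
  define R where "R f = Abs_fps (\<lambda>n. mps_rename \<pi> (f $ n))" for f :: "scalars fps"
  have R_sum: "mps_rename \<pi> (sum f A) = (\<Sum>a\<in>A. mps_rename \<pi> (f a))" for f :: "nat \<Rightarrow> scalars" and A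
    using mps_rename_simps(2)[OF \<pi>, of 0]
    by (induction A rule: infinite_finite_induct) (simp_all add: mps_rename_simps[OF \<pi>])
  have R_mult: "R (f * g) = R f * R g" for f g
    by (rule fps_ext) (simp add: R_def fps_mult_nth R_sum mps_rename_mult[OF \<pi>])
  have R_one: "mps_rename \<pi> 1 = (1 :: scalars)" "mps_rename \<pi> 0 = (0 :: scalars)"
    using mps_rename_simps(2)[OF \<pi>, of 1] mps_rename_simps(2)[OF \<pi>, of 0] by simp_all
  have R_power: "mps_rename \<pi> (s ^ k) = mps_rename \<pi> s ^ k" for s :: scalars and k
    by (induction k) (simp_all add: R_one mps_rename_mult[OF \<pi>])
  have R_geo: "R (geo s) = geo (mps_rename \<pi> s)" for s by (rule fps_ext) (simp add: R_def geo_def R_power)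
  have R_lin: "R (1 + fps_const s * fps_X) = 1 + fps_const (mps_rename \<pi> s) * fps_X" for s
    by (rule fps_ext) (auto simp: R_def fps_X_def R_one mps_rename_simps[OF \<pi>])
  have R_kser: "R (kser j) = kser (\<pi> j)" for j
    unfolding kser_def R_mult R_geo R_lin
    by (simp add: mps_rename_simps[OF \<pi>] flip: mps_const_minus)
  have R_1: "R 1 = 1" by (rule fps_ext) (simp add: R_def R_one)
  have R_prod: "R (\<Prod>j\<in>B. kser j) = (\<Prod>j\<in>B. kser (\<pi> j))" for B
    by (induction B rule: infinite_finite_induct) (simp_all add: R_1 R_mult R_kser)
  show "mps_rename \<pi> (fhat $ q) = fhat $ q"
  proof (rule mps_eqI)
    fix m :: "nat \<Rightarrow>\<^sub>0 nat"
    let ?B = "Poly_Mapping.keys (Poly_Mapping.map_key \<pi> m)"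
    have inj: "inj \<pi>" using \<pi> by (rule bij_is_inj)
    have B: "\<pi> ` ?B = Poly_Mapping.keys m" by (simp only: keys_map_key[OF inj] surj_image_vimage_eq[OF bij_is_surj[OF \<pi>]])
    have "mps_coeff (mps_rename \<pi> (fhat $ q)) m = mps_coeff ((\<Prod>j\<in>?B. kser j) $ q) (Poly_Mapping.map_key \<pi> m)"
      unfolding mps_coeff_rename_bij[OF \<pi>] by (rule fhat_coeff) simp_all
    also have "\<dots> = mps_coeff (R (\<Prod>j\<in>?B. kser j) $ q) m" by (simp add: R_def mps_coeff_rename_bij[OF \<pi>])
    also have "R (\<Prod>j\<in>?B. kser j) = (\<Prod>j\<in>Poly_Mapping.keys m. kser j)"
      unfolding R_prod B[symmetric] by (rule prod.reindex_cong[symmetric, of \<pi>]) (auto intro: inj_on_subset[OF inj])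
    also have "mps_coeff (\<dots> $ q) m = mps_coeff (fhat $ q) m" by (rule fhat_coeff[symmetric]) simp_all
    finally show "mps_coeff (mps_rename \<pi> (fhat $ q)) m = mps_coeff (fhat $ q) m" .
  qed
qed

lemma mps_coeff_rename_xy:
  "mps_coeff (mps_rename Inl F * mps_rename Inr G) M = mps_coeff F (xpart M) * mps_coeff (G :: (nat, 'a::comm_ring_1) mps) (ypart M)"
proof -
  have l: "mps_coeff (mps_rename Inl F) A = (if ypart A = 0 then mps_coeff F (xpart A) else 0)" for A :: "nat + nat \<Rightarrow>\<^sub>0 nat"
  proof -
    have "Poly_Mapping.keys A \<subseteq> range Inl \<longleftrightarrow> (\<forall>i. Inr i \<notin> Poly_Mapping.keys A)"
      by (auto simp: subset_iff) (metis sum.exhaust rangeI)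
    also have "\<dots> \<longleftrightarrow> ypart A = 0" by (auto simp: in_keys_iff poly_mapping_eq_iff fun_eq_iff)
    finally show ?thesis by (simp add: mps_rename.rep_eq xpart_def)
  qed
  have r: "mps_coeff (mps_rename Inr G) A = (if xpart A = 0 then mps_coeff G (ypart A) else 0)" for A :: "nat + nat \<Rightarrow>\<^sub>0 nat"
  proof -
    have "Poly_Mapping.keys A \<subseteq> range Inr \<longleftrightarrow> (\<forall>i. Inl i \<notin> Poly_Mapping.keys A)"
      by (auto simp: subset_iff) (metis sum.exhaust rangeI)
    also have "\<dots> \<longleftrightarrow> xpart A = 0" by (auto simp: in_keys_iff poly_mapping_eq_iff fun_eq_iff)
    finally show ?thesis by (simp add: mps_rename.rep_eq ypart_def)
  qed
  have "mps_coeff (mps_rename Inl F * mps_rename Inr G) M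
      = (\<Sum>(A, B)\<in>{(xy (xpart M) 0, xy 0 (ypart M))}. mps_coeff (mps_rename Inl F) A * mps_coeff (mps_rename Inr G) B)"
    unfolding mps_coeff_simps
  proof (rule conv_superset)
    show "{(xy (xpart M) 0, xy 0 (ypart M))} \<subseteq> {(A, B). A + B = M}" by (simp add: xy_add)
    show "{(A, B). A + B = M \<and> mps_coeff (mps_rename Inl F) A \<noteq> 0 \<and> mps_coeff (mps_rename Inr G) B \<noteq> 0}
        \<subseteq> {(xy (xpart M) 0, xy 0 (ypart M))}"
    proof clarify
      fix A B :: "nat + nat \<Rightarrow>\<^sub>0 nat"
      assume "mps_coeff (mps_rename Inl F) A \<noteq> 0" "mps_coeff (mps_rename Inr G) B \<noteq> 0"
      then have "ypart A = 0" "xpart B = 0" by (auto simp: l r split: if_splits)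
      then show "A = xy (xpart (A + B)) 0 \<and> B = xy 0 (ypart (A + B))"
        using xy_parts[of A] xy_parts[of B] by (simp add: parts_add)
    qed
  qed simp
  then show ?thesis by (simp add: l r)
qed

subsection \<open>The Cauchy identity\<close>

context scalar_fermions begin

lemma ell_symmetric: "v \<in> KX \<Longrightarrow> ell v \<in> symmetric_functions"
proof -
  have xh: "ell (xh qs) \<in> symmetric_functions" for qs
    unfolding ell_xh using symmetric_functions_const[of 1]
    by (induction qs) (auto intro: symmetric_functions_mult fhat_symmetric)
  have "v \<in> KW \<Longrightarrow> ell v \<in> symmetric_functions"
    by (induction rule: KW.induct)
      (auto simp: xh ell_add ell_scale intro: symmetric_functions_add symmetric_functions_mult symmetric_functions_const)
  then show "v \<in> KX \<Longrightarrow> ell v \<in> symmetric_functions" using KX_KW by blast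
qed

text \<open>The linear functional on \<open>Fplus\<close> that takes the value h ls at
  \<open>kp ls\<close>. It turns a family of candidate dual functions into one functional,
  comparable with \<open>ell\<close>.\<close>

definition psi :: "(nat list \<Rightarrow> scalars) \<Rightarrow> 'f \<Rightarrow> scalars" where
  "psi h v = (\<Sum>ls | ls \<in> strict_partitions \<and> Df ls v \<noteq> 0. Df ls v * h ls)"

lemma psi_eq:
  assumes "finite L" "L \<subseteq> strict_partitions" "\<And>ls. ls \<in> strict_partitions - L \<Longrightarrow> Df ls v = 0"
  shows "psi h v = (\<Sum>ls\<in>L. Df ls v * h ls)"
  unfolding psi_def by (rule sum.mono_neutral_left) (use assms in auto)

lemma psi_add: assumes "u \<in> Fplus" "v \<in> Fplus" shows "psi h (u + v) = psi h u + psi h v"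
proof -
  obtain L where L: "finite L" "L \<subseteq> strict_partitions" "\<And>ls. ls \<in> strict_partitions - L \<Longrightarrow> Df ls u = 0"
    using Fplus_expansion[OF assms(1)] by metis
  obtain M where M: "finite M" "M \<subseteq> strict_partitions" "\<And>ls. ls \<in> strict_partitions - M \<Longrightarrow> Df ls v = 0"
    using Fplus_expansion[OF assms(2)] by metis
  have "finite (L \<union> M)" "L \<union> M \<subseteq> strict_partitions" using L M by auto
  note e = psi_eq[OF this]
  have "psi h u = (\<Sum>ls\<in>L \<union> M. Df ls u * h ls)" "psi h v = (\<Sum>ls\<in>L \<union> M. Df ls v * h ls)"
    "psi h (u + v) = (\<Sum>ls\<in>L \<union> M. Df ls (u + v) * h ls)"
    by (rule e; use L M in \<open>auto simp: Df_add\<close>)+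
  then show ?thesis by (simp add: Df_add distrib_right sum.distrib)
qed

lemma psi_scale: assumes "v \<in> Fplus" shows "psi h (scale c v) = c * psi h v"
proof -
  obtain L where L: "finite L" "L \<subseteq> strict_partitions" "\<And>ls. ls \<in> strict_partitions - L \<Longrightarrow> Df ls v = 0"
    using Fplus_expansion[OF assms] by metis
  have "psi h v = (\<Sum>ls\<in>L. Df ls v * h ls)" "psi h (scale c v) = (\<Sum>ls\<in>L. Df ls (scale c v) * h ls)"
    by (rule psi_eq[OF L(1,2)]; use L(3) in \<open>auto simp: Df_scale\<close>)+
  then show ?thesis by (simp add: Df_scale sum_distrib_left mult.assoc)
qed

lemma psi_kp: assumes "ls \<in> strict_partitions" shows "psi h (kp ls) = h ls"
  by (subst psi_eq[of "{ls}"]) (use assms in \<open>auto simp: Df_kp\<close>)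

lemma psi_ell: assumes "v \<in> Fplus" shows "psi (\<lambda>ls. ell (kp ls)) v = ell v"
proof -
  obtain L where L: "finite L" "L \<subseteq> strict_partitions" "\<And>ls. ls \<in> strict_partitions - L \<Longrightarrow> Df ls v = 0"
    "v = (\<Sum>ls\<in>L. scale (Df ls v) (kp ls))"
    using Fplus_expansion[OF assms] by metis
  have "ell v = ell (\<Sum>ls\<in>L. scale (Df ls v) (kp ls))" using L(4) by simp
  also have "\<dots> = psi (\<lambda>ls. ell (kp ls)) v"
    by (subst psi_eq[OF L(1,2)]) (simp_all add: L(3) ell_sum ell_scale)
  finally show ?thesis ..
qed

text \<open>The coefficient at the monomial of qs on the left is the sum of
  \<open>Df ls (xh qs)\<close> times h ls, by \<open>Df_xh\<close>, and the kernel has the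
  coefficient \<open>ell (xh qs)\<close>. Only finitely many ls contribute, so convergence is
  automatic.\<close>

lemma cauchy_sum_iff:
  "mps_has_sum (\<lambda>ls. mps_rename Inl (GQ ls) * mps_rename Inr (h ls)) strict_partitions cauchy_kernel
    \<longleftrightarrow> (\<forall>qs. psi h (xh qs) = ell (xh qs))"
proof -
  have ker: "mps_coeff cauchy_kernel M = mps_coeff (ell (xh qs)) (ypart M)" if "xpart M = Poly_Mapping.nth qs" for M qs
    unfolding cauchy_kernel_coeff that ell_xh prod_list_nth_keys[of fhat, OF fhat_0] ..
  have ev: "(\<forall>\<^sub>F J in finite_subsets_at_top strict_partitions.
      mps_coeff (\<Sum>ls\<in>J. mps_rename Inl (GQ ls) * mps_rename Inr (h ls)) M = x)
      \<longleftrightarrow> mps_coeff (psi h (xh qs)) (ypart M) = x" if M: "xpart M = Poly_Mapping.nth qs" for M qs x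
  proof -
    obtain L where L: "finite L" "L \<subseteq> strict_partitions" "\<And>ls. ls \<in> strict_partitions - L \<Longrightarrow> Df ls (xh qs) = 0"
      using Fplus_expansion[OF KX_Fplus[OF xh_KX]] by metis
    have "\<forall>\<^sub>F J in finite_subsets_at_top strict_partitions.
        mps_coeff (\<Sum>ls\<in>J. mps_rename Inl (GQ ls) * mps_rename Inr (h ls)) M = mps_coeff (psi h (xh qs)) (ypart M)"
      unfolding eventually_finite_subsets_at_top
    proof (intro exI[of _ L] conjI allI impI)
      fix J assume J: "finite J \<and> L \<subseteq> J \<and> J \<subseteq> strict_partitions"
      have "psi h (xh qs) = (\<Sum>ls\<in>J. Df ls (xh qs) * h ls)" by (rule psi_eq) (use J L(3) in auto)
      then show "mps_coeff (\<Sum>ls\<in>J. mps_rename Inl (GQ ls) * mps_rename Inr (h ls)) M = mps_coeff (psi h (xh qs)) (ypart M)"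
        by (simp add: mps_coeff_sum mps_coeff_rename_xy M Df_xh mps_coeff_const_times)
    qed (use L in auto)
    note this' = this
    show ?thesis
    proof
      assume "\<forall>\<^sub>F J in finite_subsets_at_top strict_partitions.
        mps_coeff (\<Sum>ls\<in>J. mps_rename Inl (GQ ls) * mps_rename Inr (h ls)) M = x"
      with this' have "\<forall>\<^sub>F J in finite_subsets_at_top (strict_partitions :: nat list set). mps_coeff (psi h (xh qs)) (ypart M) = x"
        by eventually_elim simp
      then show "mps_coeff (psi h (xh qs)) (ypart M) = x" by simp
    qed (use this' in simp)
  qed
  show ?thesis
  proof
    assume s: "mps_has_sum (\<lambda>ls. mps_rename Inl (GQ ls) * mps_rename Inr (h ls)) strict_partitions cauchy_kernel"
    show "\<forall>qs. psi h (xh qs) = ell (xh qs)"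
    proof (intro allI mps_eqI)
      fix qs m
      have x: "xpart (xy (Poly_Mapping.nth qs) m) = Poly_Mapping.nth qs" by simp
      show "mps_coeff (psi h (xh qs)) m = mps_coeff (ell (xh qs)) m"
        using iffD1[OF ev[OF x] spec[OF s[unfolded mps_has_sum_def]]] unfolding ker[OF x] ypart_xy .
    qed
  next
    assume p: "\<forall>qs. psi h (xh qs) = ell (xh qs)"
    show "mps_has_sum (\<lambda>ls. mps_rename Inl (GQ ls) * mps_rename Inr (h ls)) strict_partitions cauchy_kernel"
      unfolding mps_has_sum_def
    proof
      fix M
      obtain qs where "xpart M = Poly_Mapping.nth qs" using ex_nth by blast
      then show "\<forall>\<^sub>F J in finite_subsets_at_top strict_partitions.
        mps_coeff (\<Sum>ls\<in>J. mps_rename Inl (GQ ls) * mps_rename Inr (h ls)) M = mps_coeff cauchy_kernel M"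
        using ev ker p by simp
    qed
  qed
qed

text \<open>Existence is the expansion in the basis, \<open>psi_ell\<close>. Uniqueness holds
  because the words \<open>xh qs\<close> determine a functional on their Q(beta)-span, which
  contains every \<open>kp ls\<close>.\<close>

lemma gp_eq:
  assumes "ls \<in> strict_partitions"
  shows "gp ls = ell (kp ls)"
proof -
  define g where "g = restrict (\<lambda>ls. ell (kp ls)) strict_partitions"
  have "psi g v = psi (\<lambda>ls. ell (kp ls)) v" for v
    unfolding psi_def by (rule sum.cong) (auto simp: g_def)
  then have "\<forall>qs. psi g (xh qs) = ell (xh qs)" by (simp add: psi_ell KX_Fplus[OF xh_KX])
  moreover have "g \<in> strict_partitions \<rightarrow>\<^sub>E symmetric_functions"
    unfolding g_def by (auto intro: ell_symmetric KX_kp)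
  ultimately have fam: "gp_family g"
    unfolding gp_family_def cauchy_sum_iff by blast
  have "h = g" if h: "gp_family h" for h
  proof -
    have "psi h (xh qs) = ell (xh qs)" for qs using h unfolding gp_family_def cauchy_sum_iff by blast
    note word = this
    have "psi h v = ell v" if "v \<in> KW" for v
      using that by (induction rule: KW.induct)
        (auto simp: word psi_add psi_scale ell_add ell_scale KX_Fplus KW_KX)
    \<comment> \<open>\<open>psi h\<close> and \<open>ell\<close> agree on the words, hence on
      \<open>KW\<close>; \<open>KX_KW\<close> places \<open>kp ls\<close> there.\<close>
    then have "h ls = ell (kp ls)" if "ls \<in> strict_partitions" for ls
      using psi_kp[OF that, of h] KX_KW[OF KX_kp] by metis
    then show "h = g"
      using h unfolding gp_family_def g_def by (intro ext) (auto simp: PiE_def extensional_def)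
  qed
  then have gp: "gp = g" unfolding gp_def using fam by (intro the_equality)
  show ?thesis unfolding gp using assms by (simp add: g_def)
qed

end

theorem theorem6p4:
  fixes scale :: "scalars \<Rightarrow> 'f::ab_group_add \<Rightarrow> 'f"
    and phi :: "int \<Rightarrow> 'f \<Rightarrow> 'f" and ket :: 'f and bra :: "'f \<Rightarrow> scalars"
    and lam :: "nat list"
  assumes "neutral_fermions scale phi ket bra"
    and "lam \<in> strict_partitions"
  shows "gp lam = bra (op_exp scale (fs_act scale phi H_bracket) (ket_p scale phi ket lam))"
proof -
  interpret neutral_fermions scale phi ket bra by (rule assms(1))
  interpret scalar_fermions scale phi ket bra ..
  show ?thesis
    using gp_eq[OF assms(2)] by (simp add: ell_def bexp_def bos_def H_bracket_eq_quad ket_p_eq)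
qed

end
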